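(* Consider LinUCB run for $T$ rounds on the unit ball $\mathcal{B}^d$ ($d\ge 2$) with exploration parameter $\beta=\beta(T,d)$, under the sub-Gaussian noise assumption described in the context. Fix any matrix $\boldsymbol U\in\mathbb R^{d\times(d-1)}$ with orthonormal columns orthogonal to $\boldsymbol\theta^{\star}$ (equivalently, $\boldsymbol Q=(\boldsymbol\theta^{\star},\boldsymbol U)$ satisfies $\boldsymbol Q^{\top}\boldsymbol Q=\boldsymbol I_d$). If $\beta\gg d^2(\sigma\sqrt{d+\log\log T}+1)$ and $\beta=O(\mathrm{poly}\log T)$, then the terminal LinUCB estimator $\widehat{\boldsymbol\theta}_T$ satisfies $$\left(\frac{2\beta^{2}T}{d+1}\right)^{1/4}\boldsymbol U^{\top}\left(\widehat{\boldsymbol\theta}_{T}-\boldsymbol\theta^{\star}\right)\ \xrightarrow{d}\ \mathcal N(0,\sigma^2\boldsymbol I_{d-1})\qquad\text{as }T\to\infty.$$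
   Context: Setting. Let $d\ge 2$, let $T$ be the horizon, and let $\boldsymbol\theta^\star\in\mathbb R^d$ with $\|\boldsymbol\theta^\star\|_2=1$. In each round $t=1,\dots,T$ the learner picks an action $\boldsymbol a_t$ in the unit ball $\mathcal B^d=\{\boldsymbol x\in\mathbb R^d:\|\boldsymbol x\|_2\le 1\}$ (every vector of the ball is available in every round) and observes $r_t=\langle\boldsymbol a_t,\boldsymbol\theta^\star\rangle+\epsilon_t$. With $\mathcal F_t=\sigma(\boldsymbol a_1,r_1,\dots,\boldsymbol a_t,r_t)$, the noise satisfies $\mathbb E[\epsilon_t\mid\mathcal F_{t-1}]=0$, $\mathrm{Var}[\epsilon_t\mid\mathcal F_{t-1}]=\sigma^2$, and $\mathbb E[\exp(\lambda\epsilon_t)\mid\mathcal F_{t-1}]\le\exp(\sigma^2\lambda^2/2)$ for all $\lambda\in\mathbb R$ and $t\ge1$, where $\sigma>0$. LinUCB with deterministic exploration parameter $\beta>0$: $\boldsymbol\Lambda_0=\boldsymbol I_d$, $\boldsymbol\Lambda_t=\boldsymbol I_d+\sum_{s=1}^t\boldsymbol a_s\boldsymbol a_s^\top$, ridge estimator $\overline{\boldsymbol\theta}_t=\boldsymbol\Lambda_t^{-1}\sum_{s=1}^t\boldsymbol a_s r_s$, projected estimator $\widehat{\boldsymbol\theta}_t=\overline{\boldsymbol\theta}_t/\|\overline{\boldsymbol\theta}_t\|_2$ (an arbitrary unit vector if $\overline{\boldsymbol\theta}_t=0$, e.g. at $t=0$), and $$\boldsymbol a_t\in\arg\max_{\boldsymbol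 a\in\mathcal B^d}\Big\{\langle\boldsymbol a,\widehat{\boldsymbol\theta}_{t-1}\rangle+\beta\sqrt{\boldsymbol a^\top\boldsymbol\Lambda_{t-1}^{-1}\boldsymbol a}\Big\}.$$ Asymptotics: $T\to\infty$ with $d,\sigma,\boldsymbol\theta^\star$ fixed; for each horizon $T$ the algorithm is run anew with parameter $\beta=\beta(T,d)$. $f(T)\gg g(T)$ means $f(T)/g(T)\to\infty$ as $T\to\infty$; $\beta=O(\mathrm{poly}\log T)$ means $\beta\le C(\log T)^k$ for some constants $C,k$ not depending on $T$. *)

theory Defs
  imports "HOL-Probability.Probability"
begin

section \<open>LinUCB on the unit ball\<close>

definition outer_square :: "real ^ 'n \<Rightarrow> real ^ 'n ^ 'n" where
  "outer_square x = (\<chi> i j. x $ i * x $ j)"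

definition design_matrix :: "(nat \<Rightarrow> real ^ 'n::finite) \<Rightarrow> nat \<Rightarrow> real ^ 'n ^ 'n" where
  "design_matrix a t = mat 1 + (\<Sum>s=1..t. outer_square (a s))"

definition ridge_estimator ::
  "(nat \<Rightarrow> real ^ 'n::finite) \<Rightarrow> (nat \<Rightarrow> real) \<Rightarrow> nat \<Rightarrow> real ^ 'n" where
  "ridge_estimator a r t = matrix_inv (design_matrix a t) *v (\<Sum>s=1..t. r s *\<^sub>R a s)"

text \<open>A relation, because the unit vector is arbitrary when the ridge estimator vanishes.\<close>

definition is_unit_projection :: "real ^ 'n::finite \<Rightarrow> real ^ 'n \<Rightarrow> bool" where
  "is_unit_projection x u \<longleftrightarrow> norm u = 1 \<and> (x \<noteq> 0 \<longrightarrow> u = (1 / norm x) *\<^sub>R x)"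

definition ucb_index ::
  "real \<Rightarrow> real ^ 'n ^ 'n \<Rightarrow> real ^ 'n::finite \<Rightarrow> real ^ 'n \<Rightarrow> real" where
  "ucb_index \<beta> \<Lambda> u x = x \<bullet> u + \<beta> * sqrt (x \<bullet> (matrix_inv \<Lambda> *v x))"

definition history ::
  "'w measure \<Rightarrow> (nat \<Rightarrow> 'w \<Rightarrow> real ^ 'n::finite) \<Rightarrow> (nat \<Rightarrow> 'w \<Rightarrow> real) \<Rightarrow> nat \<Rightarrow> 'w measure" where
  "history M a r t = sigma (space M)
     (\<Union>s\<in>{1..t}. {a s -` A \<inter> space M | A. A \<in> sets borel} \<union> {r s -` B \<inter> space M | B. B \<in> sets borel})"

text \<open>
  The information available just before the noise of round \<open>t\<close> is revealed: the history of the
  first \<open>t - 1\<close> rounds together with the action of round \<open>t\<close>. The maximiser of the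
  index need not be unique and the estimator is arbitrary where the ridge estimator vanishes, so
  the action may depend on auxiliary randomness; it must not anticipate the noise of its own
  round. If the action is a measurable function of the past, this is just
  \<open>history M a r (t - 1)\<close>.
\<close>

definition pre_noise ::
  "'w measure \<Rightarrow> (nat \<Rightarrow> 'w \<Rightarrow> real ^ 'n::finite) \<Rightarrow> (nat \<Rightarrow> 'w \<Rightarrow> real) \<Rightarrow> nat \<Rightarrow> 'w measure" where
  "pre_noise M a r t = sigma (space M)
     (sets (history M a r (t - 1)) \<union> {a t -` A \<inter> space M | A. A \<in> sets borel})"

definition cond_variance :: "'w measure \<Rightarrow> 'w measure \<Rightarrow> ('w \<Rightarrow> real) \<Rightarrow> 'w \<Rightarrow> real" where
  "cond_variance M F X = real_cond_exp M F (\<lambda>\<omega>. (X \<omega> - real_cond_exp M F X \<omega>)\<^sup>2)"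

text \<open>
  \<open>integrable_exp_noise\<close> is part of the sub-Gaussian condition: it is what a finite
  bound on the conditional moment generating function means, and it has to be stated because
  \<^const>\<open>real_cond_exp\<close> is total. It makes \<open>\<epsilon> t\<close> square integrable.
\<close>

locale linucb_run = prob_space M
  for M :: "'w measure"
    and \<theta> :: "real ^ 'n::finite"
    and \<sigma> \<beta> :: real
    and T :: nat
    and a :: "nat \<Rightarrow> 'w \<Rightarrow> real ^ 'n"
    and r \<epsilon> :: "nat \<Rightarrow> 'w \<Rightarrow> real"
    and \<theta>hat :: "nat \<Rightarrow> 'w \<Rightarrow> real ^ 'n" +
  assumes action_measurable: "\<And>t. t \<in> {1..T} \<Longrightarrow> a t \<in> borel_measurable M"
    and noise_measurable: "\<And>t. t \<in> {1..T} \<Longrightarrow> \<epsilon> t \<in> borel_measurable M"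
    and estimator_measurable: "\<And>t. t \<in> {0..T} \<Longrightarrow> \<theta>hat t \<in> borel_measurable M"
    and reward: "\<And>t \<omega>. t \<in> {1..T} \<Longrightarrow> \<omega> \<in> space M \<Longrightarrow> r t \<omega> = a t \<omega> \<bullet> \<theta> + \<epsilon> t \<omega>"
    and integrable_exp_noise: "\<And>t l. t \<in> {1..T} \<Longrightarrow> integrable M (\<lambda>\<omega>. exp (l * \<epsilon> t \<omega>))"
    and noise_mean: "\<And>t. t \<in> {1..T} \<Longrightarrow>
      AE \<omega> in M. real_cond_exp M (pre_noise M a r t) (\<epsilon> t) \<omega> = 0"
    and noise_variance: "\<And>t. t \<in> {1..T} \<Longrightarrow>
      AE \<omega> in M. cond_variance M (pre_noise M a r t) (\<epsilon> t) \<omega> = \<sigma>\<^sup>2"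
    and noise_subgaussian: "\<And>t l. t \<in> {1..T} \<Longrightarrow>
      AE \<omega> in M. real_cond_exp M (pre_noise M a r t) (\<lambda>\<omega>. exp (l * \<epsilon> t \<omega>)) \<omega>
        \<le> exp (\<sigma>\<^sup>2 * l\<^sup>2 / 2)"
    and estimator: "\<And>t \<omega>. t \<in> {0..T} \<Longrightarrow> \<omega> \<in> space M \<Longrightarrow>
      is_unit_projection (ridge_estimator (\<lambda>s. a s \<omega>) (\<lambda>s. r s \<omega>) t) (\<theta>hat t \<omega>)"
    and action: "\<And>t \<omega>. t \<in> {1..T} \<Longrightarrow> \<omega> \<in> space M \<Longrightarrow>
      is_arg_max (ucb_index \<beta> (design_matrix (\<lambda>s. a s \<omega>) (t - 1)) (\<theta>hat (t - 1) \<omega>))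
        (\<lambda>x. x \<in> cball 0 1) (a t \<omega>)"


section \<open>Convergence in distribution of random vectors\<close>

definition multivariate_normal :: "real ^ 'm::finite \<Rightarrow> real ^ 'm ^ 'm \<Rightarrow> (real ^ 'm) measure" where
  "multivariate_normal \<mu> \<Sigma> = density lborel
     (\<lambda>x. ennreal (exp (- ((x - \<mu>) \<bullet> (matrix_inv \<Sigma> *v (x - \<mu>))) / 2)
       / sqrt ((2 * pi) ^ CARD('m) * det \<Sigma>)))"

text \<open>The library's \<^const>\<open>weak_conv_m\<close> is restricted to measures on the real line.\<close>

definition weakly_converges ::
  "(nat \<Rightarrow> 'a::topological_space measure) \<Rightarrow> 'a measure \<Rightarrow> bool" where
  "weakly_converges \<mu> \<nu> \<longleftrightarrow>
     (\<forall>f :: 'a \<Rightarrow> real. continuous_on UNIV f \<and> bounded (range f) \<longrightarrow>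
        (\<lambda>n. \<integral>x. f x \<partial>\<mu> n) \<longlonglongrightarrow> (\<integral>x. f x \<partial>\<nu>))"

text \<open>The random vectors may live on different probability spaces.\<close>

definition converges_in_distribution ::
  "(nat \<Rightarrow> 'w measure) \<Rightarrow> (nat \<Rightarrow> 'w \<Rightarrow> 'a::topological_space) \<Rightarrow> 'a measure \<Rightarrow> bool" where
  "converges_in_distribution M X \<nu> \<longleftrightarrow> weakly_converges (\<lambda>n. distr (M n) borel (X n)) \<nu>"

end

theory Submission
  imports Defs "HOL-Real_Asymp.Real_Asymp"
begin

text \<open>
  Let \<open>V\<close> be the design matrix after \<open>t\<close> rounds. In the frame of \<open>\<theta>\<close> a run is governed by the
  \<open>\<theta>\<close>-entry \<open>p\<close> of \<open>V\<close>, the trace \<open>X\<close> of the complementary block and the geometric mean \<open>g\<close> of the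
  eigenvalues of its Schur complement. Optimality of the action bounds the growth of \<open>X\<close> from above,
  the determinant grows at a known rate, and the arithmetic-geometric mean inequality \<open>N g \<le> X\<close> with
  \<open>N = d - 1\<close> closes the loop: \<open>g\<close> obeys a discrete version of \<open>(g^2)' = 2 \<beta>^2 / (d + 1)\<close>, and
  near equality in the mean inequality makes the Schur complement close to
  \<open>L = sqrt (2 \<beta>^2 T / (d + 1))\<close> times the identity.
  This requires only an iterated logarithm bound on the noise, which stopped exponential
  supermartingales and peeling provide. Then \<open>sqrt L\<close> times an orthogonal coordinate of the
  estimator is asymptotically a martingale transform divided by \<open>sqrt L\<close>, with quadratic variation
  tending to a constant; its characteristic function converges to that of the Gaussian, and Gaussian
  smoothing turns convergence of characteristic functions into weak convergence.
\<close>

section \<open>Symmetric matrices\<close>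

text \<open>Where the rate comes from: stationarity of the action gives
  \<open>\<beta> = l * \<mu> * w\<close> with \<open>l \<le> g\<close>. Late in the run
  \<open>\<mu>\<close> is near 1, so \<open>w\<close> is at least about \<open>\<beta> / g\<close>.
  A round adds about \<open>w^2\<close> to \<open>ln (det V)\<close> and, as \<open>p\<close> is
  near \<open>t\<close>, about \<open>1 / t\<close> to \<open>ln p\<close>. Hence
  \<open>N * g * g'\<close> is at least about \<open>\<beta>^2 - g^2 / t\<close>, and a linear
  \<open>g^2\<close> balances this with slope \<open>2 * \<beta>^2 / (N + 2)\<close>, where
  \<open>N + 2 = d + 1\<close>. The obstacle is a circle: the bound on exploration needs an accurate
  estimator, accuracy needs a well-conditioned design matrix, and conditioning results from the
  exploration bounds of earlier rounds. An invariant with crude constants is therefore carried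
  through the run by induction. It starts in a phase of length about \<open>\<beta>^2\<close>, where
  the bonus dominates the index whatever the estimator is. The sharp constants are derived only
  afterwards. This analysis concerns one outcome with controlled noise, and its constants are
  uniform over outcomes; the noise level has to be small against \<open>\<beta>^2\<close>.\<close>

lemma selfadjoint_max_eigenvector:
  fixes f :: "'a::euclidean_space \<Rightarrow> 'a"
  assumes lin: "linear f" and sa: "\<And>x y. f x \<bullet> y = x \<bullet> f y"
    and S: "subspace S" "f ` S \<subseteq> S" "S \<noteq> {0}"
  shows "\<exists>v\<in>S. norm v = 1 \<and> (\<exists>c. f v = c *\<^sub>R v)"
proof -
  let ?K = "sphere 0 1 \<inter> S"
  obtain z where z: "z \<in> S" "z \<noteq> 0" using S(3) subspace_0[OF S(1)] by blast
  have "(1 / norm z) *\<^sub>R z \<in> ?K" using z S(1) by (simp add: subspace_scale)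
  then have ne: "?K \<noteq> {}" by blast
  have comp: "compact ?K" by (intro compact_Int_closed closed_subspace S) simp
  have cont: "continuous_on ?K (\<lambda>x. x \<bullet> f x)"
    by (intro continuous_intros linear_continuous_on linear_conv_bounded_linear[THEN iffD1] lin)
  obtain v where v: "v \<in> ?K" and max: "\<And>x. x \<in> ?K ==> x \<bullet> f x \<le> v \<bullet> f v"
    using continuous_attains_sup[OF comp ne cont] by blast
  define c where "c = v \<bullet> f v"
  have vS: "v \<in> S" and v1: "v \<bullet> v = 1" using v by (auto simp: norm_eq_1)
  have le: "x \<bullet> f x \<le> c * (x \<bullet> x)" if "x \<in> S" for x
  proof (cases "x = 0")
    case False
    have "(1 / norm x) *\<^sub>R x \<in> ?K" using False that S(1) by (simp add: subspace_scale)
    from max[OF this] have "(1 / norm x)^2 * (x \<bullet> f x) \<le> c"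
      by (simp add: linear_cmul[OF lin] c_def power2_eq_square)
    moreover have "0 < x \<bullet> x" using False by simp
    ultimately show ?thesis using False
      by (simp add: field_simps power2_norm_eq_inner)
  qed (simp add: linear_0[OF lin])
  have orth: "x \<bullet> f v = 0" if x: "x \<in> S" "x \<bullet> v = 0" for x
  proof (rule ccontr)
    assume ne0: "x \<bullet> f v \<noteq> 0"
    define q where "q = x \<bullet> f v"
    define k where "k = c * (x \<bullet> x) - x \<bullet> f x"
    have k0: "k \<ge> 0" using le[OF x(1)] by (simp add: k_def)
    \<comment> \<open>The stationary choice would be \<open>q / k\<close>. The added 1 keeps the
      denominator positive when \<open>k = 0\<close> and leaves the second-order loss at no more
      than half of the first-order gain.\<close>
    define t where "t = q / (k + 1)"
    have "v + t *\<^sub>R x \<in> S" using vS x S(1) by (simp add: subspace_add subspace_scale)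
    from le[OF this] have "c + 2 * t * q + t^2 * (x \<bullet> f x) \<le> c * (1 + t^2 * (x \<bullet> x))"
      using x(2) v1 sa[of v x]
      by (simp add: linear_add[OF lin] linear_cmul[OF lin] inner_add inner_commute
          c_def q_def power2_eq_square algebra_simps)
    then have "2 * t * q \<le> t^2 * k" by (simp add: k_def algebra_simps)
    moreover have "2 * t * q = 2 * q^2 / (k + 1)" by (simp add: t_def power2_eq_square)
    moreover have "t^2 * k \<le> q^2 / (k + 1)"
    proof -
      have "t^2 * k = (q^2 / (k + 1)) * (k / (k + 1))"
        by (simp add: t_def power2_eq_square)
      also have "\<dots> \<le> (q^2 / (k + 1)) * 1"
        using k0 by (intro mult_left_mono) auto
      finally show ?thesis by simp
    qed
    ultimately have "q^2 / (k + 1) \<le> 0" by (simp add: field_simps)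
    moreover have "q^2 / (k + 1) > 0" using ne0 k0 by (simp add: q_def)
    ultimately show False by simp
  qed
  have "f v = c *\<^sub>R v"
  proof -
    let ?r = "f v - c *\<^sub>R v"
    have rS: "?r \<in> S" using S vS by (auto intro!: subspace_diff subspace_scale)
    have rv: "?r \<bullet> v = 0" using v1 by (simp add: inner_diff_left c_def inner_commute[of "f v"])
    have "?r \<bullet> ?r = 0"
      using orth[OF rS rv] rv by (simp add: inner_diff_right)
    then show ?thesis by simp
  qed
  then show ?thesis using v by auto
qed

text \<open>Induction on the dimension: the part of \<open>S\<close> orthogonal to an eigenvector is
  again invariant because \<open>f\<close> is selfadjoint.\<close>

lemma selfadjoint_eigenbasis:
  fixes f :: "'a::euclidean_space \<Rightarrow> 'a"
  assumes lin: "linear f" and sa: "\<And>x y. f x \<bullet> y = x \<bullet> f y"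
    and "subspace S" "f ` S \<subseteq> S"
  shows "\<exists>B\<subseteq>S. pairwise orthogonal B \<and> (\<forall>v\<in>B. norm v = 1 \<and> (\<exists>c. f v = c *\<^sub>R v)) \<and> span B = S"
  using assms(3,4)
proof (induction "dim S" arbitrary: S rule: less_induct)
  case less
  show ?case
  proof (cases "S = {0}")
    case True
    then show ?thesis by (intro exI[of _ "{}"]) auto
  next
    case False
    obtain v c where v: "v \<in> S" "norm v = 1" "f v = c *\<^sub>R v"
      using selfadjoint_max_eigenvector[OF lin sa less.prems False] by blast
    define S' where "S' = {x \<in> S. v \<bullet> x = 0}"
    have S'sub: "subspace S'"
      using less.prems(1) unfolding S'_def subspace_def by (auto simp: inner_add)
    have "v \<notin> S'" using v(2) by (auto simp: S'_def)
    then have "S' \<noteq> S" using v(1) by blast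
    then have S'S: "S' \<subset> S" by (auto simp: S'_def)
    have "dim S' < dim S"
      using S'S S'sub less.prems(1)
      by (simp add: dim_psubset span_eq_iff[THEN iffD2])
    moreover have "f ` S' \<subseteq> S'"
      using less.prems(2) v(3) by (auto simp: S'_def sa[symmetric])
    ultimately obtain B where B: "B \<subseteq> S'" "pairwise orthogonal B"
       "\<forall>v\<in>B. norm v = 1 \<and> (\<exists>c. f v = c *\<^sub>R v)" "span B = S'"
      using less.hyps S'sub by metis
    have "span (insert v B) = S"
    proof
      show "span (insert v B) \<subseteq> S"
        using v(1) B(1) S'S less.prems(1) by (intro span_minimal) auto
      show "S \<subseteq> span (insert v B)"
      proof
        fix x assume x: "x \<in> S"
        have "x - (v \<bullet> x) *\<^sub>R v \<in> S'"
          using x v less.prems(1)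
          by (auto simp: S'_def inner_diff_right norm_eq_1 intro!: subspace_diff subspace_scale)
        then have "x - (v \<bullet> x) *\<^sub>R v \<in> span (insert v B)"
          using B(4) span_mono[of B "insert v B"] by auto
        moreover have "(v \<bullet> x) *\<^sub>R v \<in> span (insert v B)"
          by (simp add: span_base span_scale)
        ultimately show "x \<in> span (insert v B)"
          by (metis diff_add_cancel span_add)
      qed
    qed
    moreover have "pairwise orthogonal (insert v B)"
      using B by (auto simp: pairwise_insert S'_def orthogonal_def inner_commute)
    ultimately show ?thesis
      using B v S'S by (intro exI[of _ "insert v B"]) auto
  qed
qed

lemma symmetric_inner: "transpose M = M ==> (M *v x) \<bullet> y = x \<bullet> (M *v y)"
  for M :: "real^'n^'n"
  by (metis dot_lmul_matrix transpose_matrix_vector)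

text \<open>All spectral data stand under one existential so that determinant, trace and both
  quadratic forms refer to the same eigenvalues \<open>l\<close> and the same frame
  \<open>h\<close>.\<close>

lemma symmetric_spectral:
  fixes M :: "real^'n^'n"
  assumes sym: "transpose M = M"
  shows "\<exists>(h :: 'n \<Rightarrow> real^'n) l. (\<forall>i j. h i \<bullet> h j = (if i = j then 1 else 0))
    \<and> (\<forall>i. M *v h i = l i *\<^sub>R h i)
    \<and> det M = (\<Prod>i\<in>UNIV. l i) \<and> trace M = (\<Sum>i\<in>UNIV. l i)
    \<and> (\<forall>z. z \<bullet> (M *v z) = (\<Sum>i\<in>UNIV. l i * (h i \<bullet> z)^2))
    \<and> (\<forall>z. z \<bullet> z = (\<Sum>i\<in>UNIV. (h i \<bullet> z)\<^sup>2))"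
proof -
  obtain B where B: "pairwise orthogonal B"
       "\<forall>v\<in>B. norm v = 1 \<and> (\<exists>c. M *v v = c *\<^sub>R v)" "span B = (UNIV :: (real^'n) set)"
    using selfadjoint_eigenbasis[of "(*v) M" UNIV] symmetric_inner[OF sym]
    by (auto simp: matrix_vector_mul_linear)
  have ind: "independent B"
    using B by (intro pairwise_orthogonal_independent) (auto simp: )
  have card: "card B = CARD('n)"
    by (metis B(3) DIM_cart DIM_real dim_UNIV dim_span ind dim_eq_card_independent mult.right_neutral)
  then obtain h where h: "bij_betw h (UNIV :: 'n set) B"
    using finite_same_card_bij[of "UNIV :: 'n set" B] independent_imp_finite[OF ind] by auto
  have hB: "h i \<in> B" for i using h by (auto simp: bij_betw_def)
  have hh: "h i \<bullet> h j = (if i = j then 1 else 0)" for i j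
  proof (cases "i = j")
    case False
    then have "h i \<noteq> h j" using h by (auto simp: bij_betw_def inj_on_def)
    then show ?thesis using B(1) hB False by (auto simp: pairwise_def orthogonal_def)
  qed (use B(2) hB in \<open>auto simp: norm_eq_1\<close>)
  have "\<forall>i. \<exists>c. M *v h i = c *\<^sub>R h i" using B(2) hB by blast
  then obtain l where l: "\<And>i. M *v h i = l i *\<^sub>R h i" unfolding choice_iff by blast
  define P where "P = (\<chi> i j. h j $ i)"
  have PP: "transpose P ** P = mat 1"
    using hh by (simp add: P_def matrix_matrix_mult_def transpose_def mat_def vec_eq_iff inner_vec_def)
  then have PP': "P ** transpose P = mat 1"
    by (simp add: matrix_left_right_inverse)
  define L :: "real^'n^'n" where "L = (\<chi> i j. if i = j then l i else 0)"
  have Ph: "P *v axis j 1 = h j" for j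
    by (simp add: P_def matrix_vector_mult_basis column_def vec_eq_iff)
  have MP: "M ** P = P ** L"
  proof -
    have "(M ** P) $ i $ j = (P ** L) $ i $ j" for i j
    proof -
      have "(M ** P) $ i $ j = (M *v h j) $ i"
        by (simp add: matrix_matrix_mult_def P_def matrix_vector_mult_def)
      also have "\<dots> = (P ** L) $ i $ j"
        by (simp add: l matrix_matrix_mult_def P_def L_def if_distrib cong: if_cong)
      finally show ?thesis .
    qed
    then show ?thesis by (simp add: vec_eq_iff)
  qed
  have M: "M = P ** L ** transpose P"
    by (metis MP PP' matrix_mul_assoc matrix_mul_rid)
  have detL: "det L = prod l UNIV"
    by (subst det_diagonal) (auto simp: L_def)
  have "det M = det (transpose P ** P) * det L"
    unfolding M by (simp add: det_mul)
  then have d: "det M = prod l UNIV" using PP detL by simp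
  have "trace M = trace (transpose P ** (P ** L))"
    unfolding M by (rule trace_mul_sym)
  also have "\<dots> = trace L" by (simp add: matrix_mul_assoc PP)
  finally have t: "trace M = sum l UNIV" by (simp add: trace_def L_def)
  have hz: "(transpose P *v z) $ i = h i \<bullet> z" for z i
    by (simp add: matrix_vector_mult_def transpose_def P_def inner_vec_def)
  have q: "z \<bullet> (M *v z) = (\<Sum>i\<in>UNIV. l i * (h i \<bullet> z)^2)" for z
  proof -
    have "z \<bullet> (M *v z) = (transpose P *v z) \<bullet> (L *v (transpose P *v z))"
      unfolding M by (metis dot_lmul_matrix matrix_vector_mul_assoc transpose_matrix_vector)
    also have "\<dots> = (\<Sum>i\<in>UNIV. l i * (h i \<bullet> z)^2)"
    proof -
      have Ly: "(L *v y) $ i = l i * y $ i" for y i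
        by (simp add: L_def matrix_vector_mult_def if_distrib[of "\<lambda>x. x * _"] cong: if_cong)
      then show ?thesis
        unfolding inner_vec_def[of "transpose P *v z"] Ly hz by (simp add: power2_eq_square mult_ac)
    qed
    finally show ?thesis .
  qed
  have n: "z \<bullet> z = (\<Sum>i\<in>UNIV. (h i \<bullet> z)\<^sup>2)" for z
  proof -
    have "z \<bullet> z = z \<bullet> ((P ** transpose P) *v z)" by (simp add: PP')
    also have "\<dots> = (transpose P *v z) \<bullet> (transpose P *v z)"
      by (metis dot_lmul_matrix matrix_vector_mul_assoc transpose_matrix_vector)
    also have "\<dots> = (\<Sum>i\<in>UNIV. (h i \<bullet> z)\<^sup>2)"
      unfolding inner_vec_def[of "transpose P *v z" "transpose P *v z"] hz by (simp add: power2_eq_square)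
    finally show ?thesis .
  qed
  show ?thesis using hh l d t q n by (intro exI[of _ h] exI[of _ l]) blast
qed

text \<open>The rank-one perturbation of the identity reduces to one modified column after a rotation.\<close>

definition outer :: "real^'n \<Rightarrow> real^'n \<Rightarrow> real^'n^'n" where
  "outer u v = (\<chi> i j. u $ i * v $ j)"

lemma outer_mult_vec: "outer u v *v z = (v \<bullet> z) *\<^sub>R u"
  by (simp add: outer_def matrix_vector_mult_def vec_eq_iff inner_vec_def sum_distrib_left mult_ac)

lemma det_add_outer:
  fixes u v :: "real^'n"
  shows "det (mat 1 + outer u v) = 1 + u \<bullet> v"
proof (cases "v = 0")
  case True
  then have "outer u v = 0" by (simp add: outer_def vec_eq_iff)
  then show ?thesis using True by simp
next
  case False
  fix k :: 'n
  obtain Q :: "real^'n^'n" where Q: "orthogonal_matrix Q" "Q *v axis k 1 = (1 / norm v) *\<^sub>R v"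
    using orthogonal_matrix_exists_basis[of "(1 / norm v) *\<^sub>R v" k] False by auto
  have QQ: "transpose Q ** Q = mat 1" using Q(1) by (simp add: orthogonal_matrix)
  let ?x = "axis k 1 + norm v *\<^sub>R (transpose Q *v u)"
  have tv: "transpose Q *v v = norm v *\<^sub>R axis k 1"
  proof -
    have "v = norm v *\<^sub>R (Q *v axis k 1)" using Q(2) False by simp
    then have "transpose Q *v v = norm v *\<^sub>R (transpose Q *v (Q *v axis k 1))"
      by (metis matrix_vector_mult_scaleR)
    then show ?thesis by (simp add: matrix_vector_mul_assoc QQ)
  qed
  have "transpose Q ** (mat 1 + outer u v) ** Q
      = (\<chi> i j. if j = k then (mat 1 *v ?x) $ i else (mat 1 :: real^'n^'n) $ i $ j)" (is "?L = ?R")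
  proof -
    have col: "?L *v z = z + ((transpose Q *v v) \<bullet> z) *\<^sub>R (transpose Q *v u)" for z
    proof -
      have "?L *v z = transpose Q *v (Q *v z + (v \<bullet> (Q *v z)) *\<^sub>R u)"
        by (simp add: matrix_vector_mult_add_rdistrib outer_mult_vec flip: matrix_vector_mul_assoc)
      also have "\<dots> = z + (v \<bullet> (Q *v z)) *\<^sub>R (transpose Q *v u)"
        by (simp only: matrix_vector_right_distrib matrix_vector_mult_scaleR matrix_vector_mul_assoc QQ
            matrix_vector_mul_lid)
      also have "v \<bullet> (Q *v z) = (transpose Q *v v) \<bullet> z"
        by (simp add: dot_lmul_matrix)
      finally show ?thesis .
    qed
    have "?L $ i $ j = ?R $ i $ j" for i j
    proof -
      have "?L $ i $ j = (?L *v axis j 1) $ i"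
        by (simp add: matrix_vector_mult_basis column_def)
      also have "\<dots> = ?R $ i $ j"
        unfolding col tv matrix_vector_mul_lid
        by (simp add: inner_axis' mat_def) (auto simp: axis_def)
      finally show ?thesis .
    qed
    then show ?thesis by (simp add: vec_eq_iff)
  qed
  then have "det ?L = ?x $ k" by (simp only: cramer_lemma) simp
  moreover have "det ?L = det (transpose Q ** Q) * det (mat 1 + outer u v)"
    by (simp add: det_mul)
  moreover have "norm v * (transpose Q *v u) $ k = u \<bullet> v"
  proof -
    have "(transpose Q *v u) $ k = (transpose Q *v u) \<bullet> axis k 1" by (simp add: inner_axis)
    also have "\<dots> = u \<bullet> (Q *v axis k 1)" by (simp add: dot_lmul_matrix)
    finally show ?thesis using False by (simp add: Q(2))
  qed
  ultimately show ?thesis using QQ by simp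
qed

section \<open>Determinant, trace and the spread of a spectrum\<close>

lemma arith_geom_prod:
  fixes l :: "'n::finite \<Rightarrow> real"
  assumes "\<And>i. l i \<ge> 0"
  shows "(\<Prod>i\<in>UNIV. l i) \<le> ((\<Sum>i\<in>UNIV. l i) / CARD('n)) ^ CARD('n)"
proof (cases "\<exists>i. l i = 0")
  case True
  then have "(\<Prod>i\<in>UNIV. l i) = 0" by (intro prod_zero) auto
  moreover have "0 \<le> ((\<Sum>i\<in>UNIV. l i) / CARD('n)) ^ CARD('n)"
    using assms by (intro zero_le_power divide_nonneg_nonneg sum_nonneg) auto
  ultimately show ?thesis by (rule ord_eq_le_trans)
next
  case False
  let ?n = "real CARD('n)"
  define m where "m = (\<Sum>i\<in>UNIV. l i) / ?n"
  have pos: "l i > 0" for i using False assms[of i] by (auto simp: less_le)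
  have m: "m > 0" unfolding m_def by (intro divide_pos_pos sum_pos pos) auto
  \<comment> \<open>The tangent bound of the logarithm is taken at the ratios to the mean, where its
    right-hand sides sum to zero.\<close>
  have "(\<Sum>i\<in>UNIV. ln (l i / m)) \<le> (\<Sum>i\<in>UNIV. l i / m - 1)"
    using pos m by (intro sum_mono ln_le_minus_one) auto
  also have "\<dots> = 0"
  proof -
    have "(\<Sum>i\<in>UNIV. l i) = m * ?n" by (simp add: m_def)
    then show ?thesis using m by (simp add: sum_subtractf flip: sum_divide_distrib)
  qed
  finally have "ln (\<Prod>i\<in>UNIV. l i / m) \<le> 0"
    using m by (subst ln_prod) (simp_all add: less_imp_neq[OF pos, symmetric] pos)
  then have "(\<Prod>i\<in>UNIV. l i / m) \<le> 1"
    using pos m by (subst (asm) ln_le_zero_iff) (auto intro!: prod_pos)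
  then show ?thesis using m by (simp add: prod_dividef field_simps flip: m_def)
qed

lemma psd_det_le:
  fixes M :: "real^'n^'n"
  assumes "transpose M = M" "\<And>z. 0 \<le> z \<bullet> (M *v z)"
  shows "det M \<le> (trace M / CARD('n)) ^ CARD('n)"
proof -
  obtain h :: "'n \<Rightarrow> real^'n" and l where sp: "(\<forall>i j. h i \<bullet> h j = (if i = j then 1 else 0))
    \<and> (\<forall>i. M *v h i = l i *\<^sub>R h i)
    \<and> det M = (\<Prod>i\<in>UNIV. l i) \<and> trace M = (\<Sum>i\<in>UNIV. l i)
    \<and> (\<forall>z. z \<bullet> (M *v z) = (\<Sum>i\<in>UNIV. l i * (h i \<bullet> z)^2))
    \<and> (\<forall>z. z \<bullet> z = (\<Sum>i\<in>UNIV. (h i \<bullet> z)\<^sup>2))"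
    using symmetric_spectral[OF assms(1)] by (elim exE)
  note s = sp[THEN conjunct1, rule_format] sp[THEN conjunct2, THEN conjunct1, rule_format]
    sp[THEN conjunct2, THEN conjunct2, THEN conjunct1]
    sp[THEN conjunct2, THEN conjunct2, THEN conjunct2, THEN conjunct1]
    sp[THEN conjunct2, THEN conjunct2, THEN conjunct2, THEN conjunct2, THEN conjunct1, rule_format]
    sp[THEN conjunct2, THEN conjunct2, THEN conjunct2, THEN conjunct2, THEN conjunct2, rule_format]
  have "l i \<ge> 0" for i using assms(2)[of "h i"] s(1)[of i i] by (simp add: s(2))
  then show ?thesis unfolding s by (rule arith_geom_prod)
qed

lemma psd_det_ge:
  fixes M :: "real^'n^'n"
  assumes "transpose M = M" "\<And>z. k * (z \<bullet> z) \<le> z \<bullet> (M *v z)" "0 \<le> k"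
  shows "k ^ CARD('n) \<le> det M"
proof -
  obtain h :: "'n \<Rightarrow> real^'n" and l where sp: "(\<forall>i j. h i \<bullet> h j = (if i = j then 1 else 0))
    \<and> (\<forall>i. M *v h i = l i *\<^sub>R h i)
    \<and> det M = (\<Prod>i\<in>UNIV. l i) \<and> trace M = (\<Sum>i\<in>UNIV. l i)
    \<and> (\<forall>z. z \<bullet> (M *v z) = (\<Sum>i\<in>UNIV. l i * (h i \<bullet> z)^2))
    \<and> (\<forall>z. z \<bullet> z = (\<Sum>i\<in>UNIV. (h i \<bullet> z)\<^sup>2))"
    using symmetric_spectral[OF assms(1)] by (elim exE)
  note s = sp[THEN conjunct1, rule_format] sp[THEN conjunct2, THEN conjunct1, rule_format]
    sp[THEN conjunct2, THEN conjunct2, THEN conjunct1]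
    sp[THEN conjunct2, THEN conjunct2, THEN conjunct2, THEN conjunct1]
    sp[THEN conjunct2, THEN conjunct2, THEN conjunct2, THEN conjunct2, THEN conjunct1, rule_format]
    sp[THEN conjunct2, THEN conjunct2, THEN conjunct2, THEN conjunct2, THEN conjunct2, rule_format]
  have "k \<le> l i" for i using assms(2)[of "h i"] s(1)[of i i] by (simp add: s(2))
  then have "(\<Prod>i\<in>(UNIV::'n set). k) \<le> det M" unfolding s using assms(3) by (intro prod_mono) auto
  then show ?thesis by simp
qed

text \<open>Since \<open>ln y \<le> 2 * (sqrt y - 1)\<close>, the gap \<open>y - 1 - ln y\<close> is
  at least \<open>(sqrt y - 1)^2\<close>. The factor 3 bounds \<open>sqrt y + 1\<close>, which is
  where \<open>\<eta> \<le> 1\<close> enters.\<close>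

lemma near_one_if_log_gap_small:
  fixes y \<eta> :: real
  assumes "y > 0" "y - 1 - ln y \<le> \<eta>" "\<eta> \<le> 1"
  shows "\<bar>y - 1\<bar> \<le> 3 * sqrt \<eta>"
proof -
  have "ln y = 2 * ln (sqrt y)" using assms(1) by (simp add: ln_sqrt)
  also have "\<dots> \<le> 2 * (sqrt y - 1)" using assms(1) ln_le_minus_one[of "sqrt y"] by simp
  finally have "(sqrt y - 1)^2 \<le> \<eta>"
    using assms by (simp add: power2_eq_square algebra_simps)
  then have r: "\<bar>sqrt y - 1\<bar> \<le> sqrt \<eta>" by (simp add: real_le_rsqrt flip: real_sqrt_abs)
  have "0 \<le> \<eta>" using \<open>(sqrt y - 1)^2 \<le> \<eta>\<close> by (meson order_trans zero_le_power2)
  then have s1: "sqrt \<eta> \<le> 1" using assms(3) by simp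
  have "\<bar>y - 1\<bar> = \<bar>sqrt y - 1\<bar> * \<bar>sqrt y + 1\<bar>"
  proof -
    have "y - 1 = (sqrt y - 1) * (sqrt y + 1)" using assms(1) by (simp add: algebra_simps)
    then show ?thesis by (metis abs_mult)
  qed
  also have "\<dots> \<le> sqrt \<eta> * 3"
  proof (rule mult_mono)
    show "\<bar>sqrt y + 1\<bar> \<le> 3" using r s1 real_sqrt_ge_zero[of y] assms(1) by linarith
  qed (use r \<open>0 \<le> \<eta>\<close> in auto)
  finally show ?thesis by simp
qed

text \<open>The defect in the arithmetic-geometric mean inequality controls the spread of the spectrum.\<close>

lemma psd_spectrum_near:
  fixes M :: "real^'n^'n" and g \<eta> :: real
  assumes sym: "transpose M = M" and psd: "\<And>z. 0 \<le> z \<bullet> (M *v z)" and g: "g > 0"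
    and det: "det M = g ^ CARD('n)" and tr: "trace M \<le> CARD('n) * g + \<eta> * g" and \<eta>: "\<eta> \<le> 1"
  shows "\<bar>z \<bullet> (M *v z) - g * (z \<bullet> z)\<bar> \<le> 3 * sqrt \<eta> * g * (z \<bullet> z)"
proof -
  obtain h :: "'n \<Rightarrow> real^'n" and l where sp: "(\<forall>i j. h i \<bullet> h j = (if i = j then 1 else 0))
    \<and> (\<forall>i. M *v h i = l i *\<^sub>R h i)
    \<and> det M = (\<Prod>i\<in>UNIV. l i) \<and> trace M = (\<Sum>i\<in>UNIV. l i)
    \<and> (\<forall>z. z \<bullet> (M *v z) = (\<Sum>i\<in>UNIV. l i * (h i \<bullet> z)^2))
    \<and> (\<forall>z. z \<bullet> z = (\<Sum>i\<in>UNIV. (h i \<bullet> z)\<^sup>2))"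
    using symmetric_spectral[OF sym] by (elim exE)
  note s = sp[THEN conjunct1, rule_format] sp[THEN conjunct2, THEN conjunct1, rule_format]
    sp[THEN conjunct2, THEN conjunct2, THEN conjunct1]
    sp[THEN conjunct2, THEN conjunct2, THEN conjunct2, THEN conjunct1]
    sp[THEN conjunct2, THEN conjunct2, THEN conjunct2, THEN conjunct2, THEN conjunct1, rule_format]
    sp[THEN conjunct2, THEN conjunct2, THEN conjunct2, THEN conjunct2, THEN conjunct2, rule_format]
  have "l i \<ge> 0" for i using psd[of "h i"] s(1)[of i i] by (simp add: s(2))
  moreover have "l i \<noteq> 0" for i
  proof
    assume "l i = 0"
    then have "det M = 0" unfolding s(3) by (intro prod_zero) auto
    then show False using det g by simp
  qed
  ultimately have lpos: "l i > 0" for i by (simp add: less_le)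
  \<comment> \<open>The \<open>\<psi> i\<close> are nonnegative, and because the ratios
    \<open>l i / g\<close> have product 1 they sum to \<open>trace M / g\<close> minus the
    dimension. So each of them is at most \<open>\<eta>\<close>.\<close>
  define \<psi> where "\<psi> i = l i / g - 1 - ln (l i / g)" for i
  have \<psi>0: "\<psi> i \<ge> 0" for i
    using ln_le_minus_one[of "l i / g"] lpos[of i] g by (simp add: \<psi>_def)
  have lnp: "ln (\<Prod>i\<in>UNIV. l i / g) = (\<Sum>i\<in>UNIV. ln (l i / g))"
    using lpos g by (intro ln_prod) (simp_all add: less_imp_neq[OF lpos, symmetric])
  have "(\<Sum>i\<in>UNIV. \<psi> i) = trace M / g - CARD('n) - ln (\<Prod>i\<in>UNIV. l i / g)"
    unfolding lnp by (simp add: \<psi>_def sum_subtractf s(4) flip: sum_divide_distrib)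
  also have "(\<Prod>i\<in>UNIV. l i / g) = 1"
    using g det by (simp add: prod_dividef s(3)[symmetric])
  also have "trace M / g - CARD('n) - ln 1 \<le> \<eta>" using tr g by (simp add: field_simps)
  finally have "(\<Sum>i\<in>UNIV. \<psi> i) \<le> \<eta>" .
  moreover have "\<psi> i \<le> (\<Sum>i\<in>UNIV. \<psi> i)" for i
    by (intro member_le_sum) (auto simp: \<psi>0)
  ultimately have "\<psi> i \<le> \<eta>" for i by (rule order_trans[rotated])
  then have near: "\<bar>l i / g - 1\<bar> \<le> 3 * sqrt \<eta>" for i
    using lpos[of i] g \<eta> by (intro near_one_if_log_gap_small) (auto simp: \<psi>_def)
  have "z \<bullet> (M *v z) - g * (z \<bullet> z) = (\<Sum>i\<in>UNIV. (l i - g) * (h i \<bullet> z)^2)"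
    unfolding s(5,6) by (simp add: sum_distrib_left left_diff_distrib sum_subtractf)
  also have "\<bar>\<dots>\<bar> \<le> (\<Sum>i\<in>UNIV. (3 * sqrt \<eta> * g) * (h i \<bullet> z)^2)"
  proof (rule order_trans[OF sum_abs], rule sum_mono)
    fix i
    have "\<bar>l i - g\<bar> = \<bar>l i / g - 1\<bar> * g"
    proof -
      have "l i - g = (l i / g - 1) * g" using g by (simp add: left_diff_distrib)
      then show ?thesis using g by (metis abs_mult abs_of_pos)
    qed
    also have "\<dots> \<le> 3 * sqrt \<eta> * g" using near g by (intro mult_right_mono) auto
    finally show "\<bar>(l i - g) * (h i \<bullet> z)^2\<bar> \<le> (3 * sqrt \<eta> * g) * (h i \<bullet> z)^2"
      by (simp add: abs_mult mult_right_mono)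
  qed
  finally show ?thesis by (simp add: s(6) sum_distrib_left)
qed

section \<open>Rank-one updates\<close>

lemma matrix_mult_outer: "V ** outer u v = outer (V *v u) v"
  by (simp add: outer_def matrix_matrix_mult_def matrix_vector_mult_def vec_eq_iff sum_distrib_left mult_ac)

lemma outer_mult_matrix: "outer u v ** V = outer u (transpose V *v v)"
  by (simp add: outer_def matrix_matrix_mult_def matrix_vector_mult_def transpose_def vec_eq_iff
      sum_distrib_left mult_ac)

lemma trace_outer: "trace (outer u v) = u \<bullet> v"
  by (simp add: trace_def outer_def inner_vec_def)

lemma transpose_outer: "transpose (outer u v) = outer v u"
  by (simp add: transpose_def outer_def mult.commute)

lemma outer_square_eq_outer: "outer_square x = outer x x"
  by (simp add: outer_def outer_square_def)

lemma transpose_add: "transpose (A + B) = transpose A + transpose (B :: real^'n^'m)"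
  by (simp add: transpose_def vec_eq_iff)

lemma matrix_inv_mult:
  fixes V :: "real^'n^'n"
  assumes "det V \<noteq> 0"
  shows "V ** matrix_inv V = mat 1" "matrix_inv V ** V = mat 1"
proof -
  have "invertible V" using assms by (simp add: invertible_det_nz)
  then have "\<exists>A'. V ** A' = mat 1 \<and> A' ** V = mat 1" by (simp add: invertible_def)
  from someI_ex[OF this] show "V ** matrix_inv V = mat 1" "matrix_inv V ** V = mat 1"
    unfolding matrix_inv_def by auto
qed

text \<open>Factoring out \<open>V\<close> leaves a rank-one perturbation of the identity. For the
  played action this makes the determinant grow by the factor \<open>1 + w^2\<close> per
  round.\<close>

lemma det_rank_one_update:
  fixes V :: "real^'n^'n"
  assumes "det V \<noteq> 0"
  shows "det (V + outer a a) = det V * (1 + a \<bullet> (matrix_inv V *v a))"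
proof -
  have "V ** (mat 1 + outer (matrix_inv V *v a) a) = V + outer a a"
    by (simp add: matrix_add_ldistrib matrix_mult_outer matrix_vector_mul_assoc matrix_inv_mult[OF assms])
  then have "det (V + outer a a) = det V * det (mat 1 + outer (matrix_inv V *v a) a)"
    by (metis det_mul)
  then show ?thesis by (simp add: det_add_outer inner_commute)
qed

section \<open>The design matrix in the frame of the parameter\<close>

definition par :: "real^'n^'n \<Rightarrow> real^'n \<Rightarrow> real" where
  "par V \<theta> = \<theta> \<bullet> (V *v \<theta>)"

definition perp :: "real^'n^'n \<Rightarrow> real^'n \<Rightarrow> real" where
  "perp V \<theta> = trace V - par V \<theta>"

text \<open>For a unit vector \<open>\<theta>\<close> this is the off-diagonal block of
  \<open>V\<close> in an orthonormal frame starting with \<open>\<theta>\<close>, kept as a vector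
  of the full space.\<close>

definition cross :: "real^'n^'n \<Rightarrow> real^'n \<Rightarrow> real^'n" where
  "cross V \<theta> = V *v \<theta> - par V \<theta> *\<^sub>R \<theta>"

text \<open>
  The determinant of the Schur complement of the \<open>\<theta>\<close>-entry is \<open>det V / par V \<theta>\<close>, so this is the
  geometric mean of its eigenvalues.
\<close>

definition gm :: "real^'n^'n \<Rightarrow> real^'n \<Rightarrow> real" where
  "gm V \<theta> = (det V / par V \<theta>) powr (1 / (real CARD('n) - 1))"

lemma matrix_add_rdistrib: "(A + B) ** C = A ** C + B ** (C :: real^'n^'m)"
  by (simp add: matrix_matrix_mult_def vec_eq_iff distrib_right sum.distrib)

locale pd_matrix =
  fixes V :: "real^'n^'n" and \<theta> :: "real^'n"
  assumes sym: "transpose V = V" and pd: "\<And>z. z \<bullet> z \<le> z \<bullet> (V *v z)"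
    and unit: "norm \<theta> = 1" and dim: "CARD('n) \<ge> 2"
begin

abbreviation "p \<equiv> par V \<theta>"
abbreviation "X \<equiv> perp V \<theta>"
abbreviation "b \<equiv> cross V \<theta>"
abbreviation "g \<equiv> gm V \<theta>"

lemma N_ge: "(real CARD('n) - 1) \<ge> 1" using dim by simp

lemma unit': "\<theta> \<bullet> \<theta> = 1" using unit by (simp add: norm_eq_1)

lemma p_ge: "p \<ge> 1" using pd[of \<theta>] unit' by (simp add: par_def)

lemma p_pos: "p > 0" using p_ge by simp

lemma det_ge: "det V \<ge> 1"
  using psd_det_ge[OF sym, of 1] pd by simp

lemma det_nz: "det V \<noteq> 0" using det_ge by simp

lemma g_pos: "g > 0"
  using det_ge p_ge by (simp add: gm_def)

lemma g_power: "g ^ (CARD('n) - 1) = det V / p"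
proof -
  have "g ^ (CARD('n) - 1) = g powr (real CARD('n) - 1)"
    using g_pos dim by (simp add: powr_realpow[symmetric] of_nat_diff)
  also have "\<dots> = det V / p"
    using N_ge det_ge p_ge by (simp add: gm_def powr_powr)
  finally show ?thesis .
qed

lemma g_power_card: "g ^ CARD('n) = g * det V / p"
  using g_power dim by (cases "CARD('n)") auto

text \<open>The congruence built from it sends \<open>\<theta>\<close> to \<open>sqrt s\<close>
  times itself and a vector orthogonal to \<open>\<theta>\<close> to a representative that is
  \<open>V\<close>-orthogonal to \<open>\<theta>\<close>. The result is block diagonal, with
  \<open>\<theta>\<close>-entry \<open>p * s\<close> and the Schur complement of \<open>p\<close> as
  the other block. In this way the Schur complement is studied inside a matrix of full size instead
  of a type of one dimension less.\<close>

definition "shear s = - (1 / p) *\<^sub>R b + (sqrt s - 1) *\<^sub>R \<theta>"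

definition "sheared s = (mat 1 + outer (shear s) \<theta>) ** V ** (mat 1 + outer \<theta> (shear s))"

lemma cross_theta: "b \<bullet> \<theta> = 0" "\<theta> \<bullet> b = 0"
  by (simp_all add: cross_def par_def unit' inner_diff_left inner_diff_right inner_commute)

lemma V_theta: "V *v \<theta> = b + p *\<^sub>R \<theta>" by (simp add: cross_def)

lemma sheared_sym: "transpose (sheared s) = sheared s"
  by (simp add: sheared_def matrix_transpose_mul sym transpose_add transpose_outer matrix_mul_assoc)

lemma sheared_quad: "z \<bullet> (sheared s *v z) =
    (z + (shear s \<bullet> z) *\<^sub>R \<theta>) \<bullet> (V *v (z + (shear s \<bullet> z) *\<^sub>R \<theta>))"
proof -
  have "sheared s *v z = (mat 1 + outer (shear s) \<theta>) *v (V *v (z + (shear s \<bullet> z) *\<^sub>R \<theta>))"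
    by (simp add: sheared_def matrix_vector_mult_add_rdistrib outer_mult_vec flip: matrix_vector_mul_assoc)
  then show ?thesis
    by (simp add: matrix_vector_mult_add_rdistrib outer_mult_vec inner_add_left inner_add_right inner_commute)
qed

lemma sheared_det: "s \<ge> 0 ==> det (sheared s) = s * det V"
  unfolding sheared_def det_mul det_add_outer
  by (simp add: shear_def inner_add_left inner_add_right inner_diff_left inner_diff_right cross_theta unit')

lemma sheared_trace: "s \<ge> 0 ==> trace (sheared s) = X + p * s - (b \<bullet> b) / p"
proof -
  assume s: "s \<ge> 0"
  let ?h = "shear s"
  have "sheared s = V + outer ?h (V *v \<theta>) + outer (V *v \<theta> + p *\<^sub>R ?h) ?h"
    unfolding sheared_def
    by (simp add: matrix_add_rdistrib matrix_add_ldistrib matrix_mult_outer outer_mult_matrix sym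
        matrix_vector_mult_add_rdistrib outer_mult_vec par_def inner_commute)
  then have "trace (sheared s) = trace V + 2 * (?h \<bullet> (V *v \<theta>)) + p * (?h \<bullet> ?h)"
    by (simp add: trace_add trace_outer inner_add_left inner_add_right inner_commute[of "V *v \<theta>"])
  also have "?h \<bullet> (V *v \<theta>) = - (b \<bullet> b) / p + (sqrt s - 1) * p"
    by (simp add: V_theta shear_def inner_add_left inner_add_right inner_diff_left inner_diff_right cross_theta unit')
  also have "?h \<bullet> ?h = (b \<bullet> b) / p^2 + (sqrt s - 1)^2"
    by (simp add: shear_def inner_add_left inner_add_right inner_diff_left inner_diff_right
        cross_theta unit' power2_eq_square)
  also have "trace V + 2 * (- (b \<bullet> b) / p + (sqrt s - 1) * p) + p * ((b \<bullet> b) / p^2 + (sqrt s - 1)^2)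
      = X + p * s - (b \<bullet> b) / p"
    using p_pos s by (simp add: perp_def field_simps power2_eq_square)
  finally show ?thesis .
qed

lemma sheared_psd: "0 \<le> z \<bullet> (sheared s *v z)"
  unfolding sheared_quad by (meson inner_ge_zero order_trans pd)

text \<open>At \<open>s = g / p\<close> the \<open>\<theta>\<close>-entry of the sheared matrix is
  \<open>g\<close>, the geometric mean of the other block, so the arithmetic-geometric mean
  inequality in full dimension amounts to the one for the Schur complement. The trace falls short of
  \<open>X + g\<close> by \<open>(b \<bullet> b) / p\<close>; the defect in the mean inequality
  therefore also controls the off-diagonal block.\<close>

lemma cross_le: "(b \<bullet> b) / p \<le> X - (real CARD('n) - 1) * g"
proof -
  let ?s = "g / p"
  have s: "?s \<ge> 0" using g_pos p_pos by simp
  have "det (sheared ?s) \<le> (trace (sheared ?s) / CARD('n)) ^ CARD('n)"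
    by (rule psd_det_le[OF sheared_sym sheared_psd])
  then have le: "g ^ CARD('n) \<le> ((X + g - (b \<bullet> b) / p) / CARD('n)) ^ CARD('n)"
    using p_pos g_power_card by (simp add: sheared_det[OF s] sheared_trace[OF s])
  have "0 \<le> trace (sheared ?s)"
  proof -
    have "sheared ?s $ i $ i \<ge> 0" for i
      using sheared_psd[of "axis i 1" ?s] by (simp add: matrix_vector_mult_basis column_def inner_axis')
    then show ?thesis unfolding trace_def by (intro sum_nonneg) auto
  qed
  then have "0 \<le> (X + g - (b \<bullet> b) / p) / CARD('n)"
    using p_pos by (simp add: sheared_trace[OF s])
  with le g_pos have "g \<le> (X + g - (b \<bullet> b) / p) / CARD('n)"
    using dim by (subst (asm) power_mono_iff) auto
  then show ?thesis using dim by (simp add: field_simps)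
qed

lemma N_g_le: "(real CARD('n) - 1) * g \<le> X"
proof -
  have "0 \<le> (b \<bullet> b) / p" using p_pos by simp
  then show ?thesis using cross_le by linarith
qed

text \<open>The representative \<open>z1 - m *\<^sub>R \<theta>\<close> is no shorter than
  \<open>z1\<close>, so the lower bound \<open>l\<close> on \<open>V\<close> passes to the Schur
  complement. With \<open>s = l / p\<close> the \<open>\<theta>\<close>-entry is \<open>l\<close> as
  well, and the whole sheared matrix dominates \<open>l\<close> times the identity; comparing
  determinants gives the claim.\<close>

lemma le_g:
  assumes "\<And>z. l * (z \<bullet> z) \<le> z \<bullet> (V *v z)" "l > 0"
  shows "l \<le> g"
proof -
  let ?s = "l / p"
  have s: "?s \<ge> 0" using assms(2) p_pos by simp
  have q: "l * (z \<bullet> z) \<le> z \<bullet> (sheared ?s *v z)" for z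
  proof -
    define z1 where "z1 = z - (z \<bullet> \<theta>) *\<^sub>R \<theta>"
    define z0 where "z0 = z \<bullet> \<theta>"
    have z: "z = z1 + z0 *\<^sub>R \<theta>" and z1: "z1 \<bullet> \<theta> = 0" "\<theta> \<bullet> z1 = 0"
      by (auto simp: z1_def z0_def inner_diff_left inner_diff_right unit' inner_commute)
    define m where "m = (b \<bullet> z1) / p"
    have e: "z + (shear ?s \<bullet> z) *\<^sub>R \<theta> = (z1 - m *\<^sub>R \<theta>) + (sqrt ?s * z0) *\<^sub>R \<theta>"
      unfolding z by (simp add: shear_def inner_add_left inner_add_right cross_theta z1 unit' m_def algebra_simps)
    have Vo: "(z1 - m *\<^sub>R \<theta>) \<bullet> (V *v \<theta>) = 0"
      using p_pos by (simp add: V_theta inner_diff_left inner_diff_right inner_add_left inner_add_right z1 unit' cross_theta m_def inner_commute)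
    then have Vo': "\<theta> \<bullet> (V *v (z1 - m *\<^sub>R \<theta>)) = 0"
      by (metis inner_commute symmetric_inner sym)
    have "z \<bullet> (sheared ?s *v z) = (z1 - m *\<^sub>R \<theta>) \<bullet> (V *v (z1 - m *\<^sub>R \<theta>)) + (sqrt ?s * z0)^2 * p"
      unfolding sheared_quad e matrix_vector_right_distrib matrix_vector_mult_scaleR inner_add_left inner_add_right
      using Vo Vo' by (simp add: par_def power2_eq_square)
    moreover have "(sqrt ?s * z0)^2 * p = l * z0^2"
      using s p_pos by (simp add: power_mult_distrib)
    moreover have "l * (z1 \<bullet> z1) \<le> l * ((z1 - m *\<^sub>R \<theta>) \<bullet> (z1 - m *\<^sub>R \<theta>))"
      using assms(2) by (simp add: inner_diff_left inner_diff_right z1 unit')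
    moreover have "z \<bullet> z = z1 \<bullet> z1 + z0^2"
      unfolding z by (simp add: inner_add_left inner_add_right z1 unit' power2_eq_square)
    ultimately show ?thesis using assms(1)[of "z1 - m *\<^sub>R \<theta>"] by (simp add: distrib_left)
  qed
  have "l ^ CARD('n) \<le> l / p * det V"
    using psd_det_ge[OF sheared_sym q] assms(2) by (simp add: sheared_det[OF s])
  moreover have "l ^ CARD('n) = l * l ^ (CARD('n) - 1)" using dim by (cases "CARD('n)") auto
  ultimately have "l ^ (CARD('n) - 1) \<le> g ^ (CARD('n) - 1)"
    unfolding g_power using assms(2) p_pos by (simp add: field_simps)
  then show ?thesis using g_pos dim assms(2) by (subst (asm) power_mono_iff) auto
qed

text \<open>The sheared matrix at \<open>s = g / p\<close> has geometric mean \<open>g\<close> and a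
  trace within \<open>\<eta> * g\<close> of its minimum, so its spectrum is near \<open>g\<close>.
  On vectors orthogonal to \<open>\<theta>\<close> its form is that of \<open>V\<close> minus
  \<open>(b \<bullet> z1)^2 / p\<close>.\<close>

lemma near_isotropic:
  assumes \<eta>: "X - (real CARD('n) - 1) * g \<le> \<eta> * g" "\<eta> \<le> 1" and z1: "z1 \<bullet> \<theta> = 0"
  shows "\<bar>z1 \<bullet> (V *v z1) - (b \<bullet> z1)^2 / p - g * (z1 \<bullet> z1)\<bar> \<le> 3 * sqrt \<eta> * g * (z1 \<bullet> z1)"
proof -
  let ?s = "g / p"
  have s: "?s \<ge> 0" using g_pos p_pos by simp
  have "\<bar>z1 \<bullet> (sheared ?s *v z1) - g * (z1 \<bullet> z1)\<bar> \<le> 3 * sqrt \<eta> * g * (z1 \<bullet> z1)"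
  proof (rule psd_spectrum_near[OF sheared_sym sheared_psd g_pos _ _ \<eta>(2)])
    show "det (sheared ?s) = g ^ CARD('n)" by (simp add: sheared_det[OF s] g_power_card)
    have "0 \<le> (b \<bullet> b) / p" using p_pos by simp
    moreover have "trace (sheared ?s) = X + g - (b \<bullet> b) / p"
      using p_pos by (simp add: sheared_trace[OF s])
    ultimately show "trace (sheared ?s) \<le> real CARD('n) * g + \<eta> * g"
      using \<eta>(1) unfolding left_diff_distrib by linarith
  qed
  moreover have "z1 \<bullet> (sheared ?s *v z1) = z1 \<bullet> (V *v z1) - (b \<bullet> z1)^2 / p"
  proof -
    define m where "m = - (b \<bullet> z1) / p"
    have e: "shear ?s \<bullet> z1 = m"
      using z1 by (simp add: shear_def inner_add_left inner_diff_left m_def inner_commute[of \<theta>])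
    have "(V *v z1) \<bullet> \<theta> = z1 \<bullet> b"
      using z1 by (subst symmetric_inner[OF sym]) (simp add: V_theta inner_add_right)
    then have Vz: "\<theta> \<bullet> (V *v z1) = b \<bullet> z1" by (simp add: inner_commute)
    have pV: "\<theta> \<bullet> (V *v \<theta>) = p" by (simp add: par_def)
    have zV: "z1 \<bullet> (V *v \<theta>) = b \<bullet> z1"
      using z1 by (simp add: V_theta inner_add_right inner_commute)
    have "z1 \<bullet> (sheared ?s *v z1) = z1 \<bullet> (V *v z1) + 2 * m * (b \<bullet> z1) + m * m * p"
      unfolding sheared_quad e matrix_vector_right_distrib matrix_vector_mult_scaleR inner_add_left
        inner_add_right inner_scaleR_left inner_scaleR_right Vz zV pV
      by (simp add: algebra_simps)
    also have "\<dots> = z1 \<bullet> (V *v z1) - (b \<bullet> z1)^2 / p"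
      using p_pos by (simp add: m_def power2_eq_square)
    finally show ?thesis .
  qed
  ultimately show ?thesis by simp
qed

lemma cross_inner_le:
  assumes "X - (real CARD('n) - 1) * g \<le> \<eta> * g"
  shows "(b \<bullet> z)^2 / p \<le> \<eta> * g * (z \<bullet> z)"
proof -
  have "(b \<bullet> z)^2 / p \<le> (b \<bullet> b) * (z \<bullet> z) / p"
    using Cauchy_Schwarz_ineq[of b z] p_pos by (intro divide_right_mono) auto
  also have "\<dots> = ((b \<bullet> b) / p) * (z \<bullet> z)" by simp
  also have "\<dots> \<le> \<eta> * g * (z \<bullet> z)" using cross_le assms by (intro mult_right_mono) auto
  finally show ?thesis .
qed

lemma quad_ge:
  assumes \<eta>: "X - (real CARD('n) - 1) * g \<le> \<eta> * g" "\<eta> \<le> 1"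
  shows "(1 - 4 * sqrt \<eta>) * (p * (z \<bullet> \<theta>)^2 + g * (z \<bullet> z - (z \<bullet> \<theta>)^2)) \<le> z \<bullet> (V *v z)"
proof -
  have "0 \<le> \<eta> * g" using N_g_le \<eta>(1) by linarith
  then have \<eta>0: "\<eta> \<ge> 0" using g_pos by (simp add: zero_le_mult_iff)
  define a where "a = sqrt \<eta>"
  have a: "a \<ge> 0" "\<eta> = a * a" using \<eta>0 by (auto simp: a_def)
  define z0 where "z0 = z \<bullet> \<theta>"
  define z1 where "z1 = z - z0 *\<^sub>R \<theta>"
  have z: "z = z1 + z0 *\<^sub>R \<theta>" and z1: "z1 \<bullet> \<theta> = 0" "\<theta> \<bullet> z1 = 0"
    by (auto simp: z1_def z0_def inner_diff_left inner_diff_right unit' inner_commute)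
  define m where "m = b \<bullet> z1"
  have zz: "z \<bullet> z - z0^2 = z1 \<bullet> z1"
    unfolding z by (simp add: inner_add_left inner_add_right z1 unit' power2_eq_square)
  have "(V *v z1) \<bullet> \<theta> = m"
    using z1 by (subst symmetric_inner[OF sym]) (simp add: V_theta inner_add_right m_def inner_commute)
  then have q: "z \<bullet> (V *v z) = z1 \<bullet> (V *v z1) + 2 * z0 * m + p * z0^2"
    unfolding z by (simp add: matrix_vector_right_distrib matrix_vector_mult_scaleR inner_add_left inner_add_right
          V_theta unit' cross_theta z1 inner_commute m_def[symmetric] power2_eq_square algebra_simps)
      (simp add: m_def inner_commute)
  have q1: "z1 \<bullet> (V *v z1) \<ge> m^2 / p + (1 - 3 * a) * g * (z1 \<bullet> z1)"
    using near_isotropic[OF \<eta> z1(1)] by (simp add: m_def a_def algebra_simps abs_if split: if_splits)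
  have m: "m^2 / p \<le> a * (a * (g * (z1 \<bullet> z1)))"
    using cross_inner_le[OF \<eta>(1), of z1] by (simp add: m_def a mult_ac)
  show ?thesis
  proof (cases "a = 0")
    case True
    then have "m^2 / p \<le> 0" using m by simp
    then have "m = 0" using p_pos by (simp add: field_simps)
    then show ?thesis using q q1 True unfolding a_def[symmetric] z0_def[symmetric] zz by simp
  next
    case False
    then have a0: "a > 0" using a by simp
    \<comment> \<open>A completed square with weight \<open>a = sqrt \<eta>\<close> absorbs the
      cross term \<open>2 * z0 * m\<close>. It costs one more multiple of \<open>a\<close> in the
      orthogonal block, which explains 4 in place of 3 in the factor; the division by
      \<open>a\<close> is why \<open>a = 0\<close> is a separate case.\<close>
    have "(sqrt a * sqrt p * z0 + m / (sqrt a * sqrt p))^2 = a * p * z0^2 + 2 * z0 * m + m^2 / (a * p)"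
      using a0 p_pos by (simp add: power2_sum power_mult_distrib power_divide)
    then have "0 \<le> a * p * z0^2 + 2 * z0 * m + m^2 / (a * p)" by (metis zero_le_power2)
    moreover have "m^2 / (a * p) \<le> a * (g * (z1 \<bullet> z1))"
    proof -
      have "m^2 / (a * p) = (m^2 / p) / a" by simp
      also have "\<dots> \<le> a * (a * (g * (z1 \<bullet> z1))) / a" using m a0 by (intro divide_right_mono) auto
      finally show ?thesis using a0 by simp
    qed
    moreover have "m^2 / p \<ge> 0" using p_pos by simp
    moreover have "0 \<le> a * (p * z0^2)" using a p_pos by simp
    ultimately show ?thesis using q q1 unfolding a_def[symmetric] z0_def[symmetric] zz
      by (simp add: algebra_simps)
  qed
qed

lemma quad_perp_le:
  assumes \<eta>: "X - (real CARD('n) - 1) * g \<le> \<eta> * g" "\<eta> \<le> 1" and z1: "z1 \<bullet> \<theta> = 0"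
  shows "z1 \<bullet> (V *v z1) \<le> (1 + 4 * sqrt \<eta>) * g * (z1 \<bullet> z1)"
proof -
  have "0 \<le> \<eta> * g" using N_g_le \<eta>(1) by linarith
  then have \<eta>0: "\<eta> \<ge> 0" using g_pos by (simp add: zero_le_mult_iff)
  have "\<eta> = sqrt \<eta> * sqrt \<eta>" using \<eta>0 by simp
  also have "\<dots> \<le> sqrt \<eta> * 1" using \<eta>0 \<eta>(2) by (intro mult_left_mono) auto
  finally have "\<eta> * (g * (z1 \<bullet> z1)) \<le> sqrt \<eta> * (g * (z1 \<bullet> z1))"
    using g_pos by (intro mult_right_mono) auto
  with near_isotropic[OF assms] cross_inner_le[OF \<eta>(1), of z1] show ?thesis
    by (simp add: algebra_simps abs_if split: if_splits)
qed

lemma det_le_quad: "det V \<le> p * (X / (real CARD('n) - 1)) ^ (CARD('n) - 1)"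
proof -
  have "g \<le> X / (real CARD('n) - 1)" using N_g_le N_ge by (simp add: field_simps)
  then have "g ^ (CARD('n) - 1) \<le> (X / (real CARD('n) - 1)) ^ (CARD('n) - 1)"
    using g_pos by (intro power_mono) auto
  then show ?thesis unfolding g_power using p_pos by (simp add: field_simps)
qed

lemma inverse_par_ge: "\<theta> \<bullet> (matrix_inv V *v \<theta>) \<ge> 1 / p"
proof -
  let ?v = "matrix_inv V *v \<theta>"
  have Vv: "V *v ?v = \<theta>" using det_nz by (simp add: matrix_vector_mul_assoc matrix_inv_mult)
  define k where "k = 1 / p"
  have "0 \<le> (?v - k *\<^sub>R \<theta>) \<bullet> (V *v (?v - k *\<^sub>R \<theta>))" by (meson inner_ge_zero order_trans pd)
  also have "\<dots> = ?v \<bullet> \<theta> - 2 * k + k^2 * p"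
  proof -
    have "?v \<bullet> (V *v \<theta>) = 1" using Vv symmetric_inner[OF sym, of ?v \<theta>] unit' by (simp add: inner_commute)
    then show ?thesis
      by (simp add: matrix_vector_mult_diff_distrib matrix_vector_mult_scaleR Vv inner_diff_left inner_diff_right
          unit' par_def power2_eq_square algebra_simps)
  qed
  also have "k^2 * p = k" using p_pos by (simp add: k_def power2_eq_square)
  finally show ?thesis by (simp add: k_def inner_commute)
qed

end

section \<open>One round of LinUCB\<close>

context pd_matrix
begin

abbreviation "W \<equiv> matrix_inv V"

definition "wn z = sqrt (z \<bullet> (W *v z))"

lemma V_W: "V *v (W *v z) = z" and W_V: "W *v (V *v z) = z"
  using det_nz by (simp_all add: matrix_vector_mul_assoc matrix_inv_mult)

lemma V_inner: "(V *v x) \<bullet> y = x \<bullet> (V *v y)" by (rule symmetric_inner[OF sym])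

lemma W_inner: "(W *v x) \<bullet> y = x \<bullet> (W *v y)"
  by (metis V_W V_inner)

lemma W_quad: "z \<bullet> (W *v z) = (W *v z) \<bullet> (V *v (W *v z))"
  by (simp add: V_W inner_commute)

lemma V_nonneg: "0 \<le> z \<bullet> (V *v z)" by (meson inner_ge_zero order_trans pd)

lemma W_nonneg: "0 \<le> z \<bullet> (W *v z)" by (simp only: W_quad V_nonneg)

lemma wn_sq: "(wn z)^2 = z \<bullet> (W *v z)" by (simp add: wn_def W_nonneg)

lemma wn_nonneg: "0 \<le> wn z" by (simp add: wn_def W_nonneg)

lemma wn_pos: "z \<noteq> 0 ==> 0 < wn z"
proof -
  assume "z \<noteq> 0"
  then have "W *v z \<noteq> 0" using V_W[of z] by auto
  then have "0 < (W *v z) \<bullet> (W *v z)" by simp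
  also have "\<dots> \<le> z \<bullet> (W *v z)" unfolding W_quad by (rule pd)
  finally show ?thesis by (simp add: wn_def)
qed

text \<open>Cauchy-Schwarz for the dual norms of \<open>V\<close> and its inverse, read off from
  nonnegativity of the \<open>V\<close>-form at the balanced difference
  \<open>k *\<^sub>R (W *v x) - y\<close>.\<close>

lemma pairing_le:
  assumes "y \<bullet> (V *v y) \<le> r^2" "0 \<le> r"
  shows "x \<bullet> y \<le> wn x * r"
proof (cases "x = 0")
  case False
  define k where "k = r / wn x"
  have w: "wn x > 0" using False by (rule wn_pos)
  have "0 \<le> (k *\<^sub>R (W *v x) - y) \<bullet> (V *v (k *\<^sub>R (W *v x) - y))" by (rule V_nonneg)
  also have "\<dots> = k^2 * (wn x)^2 - 2 * k * (x \<bullet> y) + y \<bullet> (V *v y)"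
  proof -
    have e1: "(W *v x) \<bullet> (V *v y) = x \<bullet> y" by (simp add: W_inner W_V)
    have e2: "y \<bullet> (V *v (W *v x)) = x \<bullet> y" by (simp add: V_W inner_commute)
    have e3: "(W *v x) \<bullet> (V *v (W *v x)) = (wn x)^2" by (simp add: wn_sq flip: W_quad)
    show ?thesis
      unfolding matrix_vector_mult_diff_distrib matrix_vector_mult_scaleR inner_diff_left inner_diff_right
        inner_scaleR_left inner_scaleR_right e1 e2 e3
      by (simp add: power2_eq_square algebra_simps)
  qed
  also have "k^2 * (wn x)^2 = r^2" using w by (simp add: k_def power_divide)
  finally have "2 * k * (x \<bullet> y) \<le> 2 * r^2" using assms(1) by simp
  then have "r * (x \<bullet> y) \<le> r * (wn x * r)"
    using w by (simp add: k_def field_simps power2_eq_square)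
  then show ?thesis
  proof (cases "r = 0")
    case True
    then have "y \<bullet> y \<le> 0" using assms(1) pd[of y] by simp
    then have "y = 0" by (metis inner_eq_zero_iff inner_ge_zero order_antisym)
    then show ?thesis using True by simp
  qed (use assms(2) in auto)
qed (use assms wn_nonneg in simp)

text \<open>Inversion reverses the order of positive definite forms. At \<open>z = W *v v\<close>
  the hypothesis bounds \<open>k * ?Q\<close> by \<open>v \<bullet> z\<close>, while Cauchy-Schwarz
  over the two blocks gives \<open>(v \<bullet> z)^2 \<le> ?R * ?Q\<close>; dividing by
  \<open>v \<bullet> z\<close> finishes.\<close>

lemma wn_dual_le:
  assumes Q: "\<And>z. k * (p * (z \<bullet> \<theta>)^2 + g * (z \<bullet> z - (z \<bullet> \<theta>)^2)) \<le> z \<bullet> (V *v z)" and k: "k > 0"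
  shows "k * (wn v)^2 \<le> (v \<bullet> \<theta>)^2 / p + (v \<bullet> v - (v \<bullet> \<theta>)^2) / g"
proof -
  define z where "z = W *v v"
  define c where "c = v \<bullet> \<theta>"
  define z0 where "z0 = z \<bullet> \<theta>"
  define x where "x = v - c *\<^sub>R \<theta>"
  define z1 where "z1 = z - z0 *\<^sub>R \<theta>"
  have xx: "v \<bullet> v - c^2 = x \<bullet> x" and zz: "z \<bullet> z - z0^2 = z1 \<bullet> z1" and vz: "v \<bullet> z = c * z0 + x \<bullet> z1"
    by (simp_all add: x_def z1_def c_def z0_def inner_diff_left inner_diff_right unit' inner_commute
        power2_eq_square algebra_simps)
  let ?R = "c^2 / p + (x \<bullet> x) / g" and ?Q = "p * z0^2 + g * (z1 \<bullet> z1)"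
  have s: "(wn v)^2 = v \<bullet> z" by (simp add: wn_sq z_def)
  have kQ: "k * ?Q \<le> v \<bullet> z"
    using Q[of z] unfolding z0_def[symmetric] zz by (simp add: z_def V_W inner_commute)
  have R0: "?R \<ge> 0" using p_pos g_pos by simp
  have "(v \<bullet> z)^2 \<le> ?R * ?Q"
  proof -
    define X' where "X' = (x \<bullet> x)" define Z' where "Z' = (z1 \<bullet> z1)"
    have cs: "(x \<bullet> z1)^2 \<le> X' * Z'" unfolding X'_def Z'_def by (rule Cauchy_Schwarz_ineq)
    have "2 * (c * z0 * (x \<bullet> z1)) \<le> (g * c^2 * Z' / p + p * z0^2 * X' / g)"
    proof -
      have "(c * z0 * (x \<bullet> z1))^2 \<le> (c^2 * z0^2) * (X' * Z')"
        using cs by (simp add: power_mult_distrib mult_left_mono)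
      also have "\<dots> = (g * c^2 * Z' / p) * (p * z0^2 * X' / g)"
        using p_pos g_pos by (simp add: mult_ac)
      also have "\<dots> \<le> ((g * c^2 * Z' / p + p * z0^2 * X' / g) / 2)^2"
      proof -
        have "4 * (s * t) \<le> (s + t)^2" for s t :: real
          using zero_le_power2[of "s - t"] by (simp add: power2_eq_square algebra_simps)
        then have "s * t \<le> ((s + t) / 2)^2" for s t :: real
          by (simp add: power_divide mult.commute)
        then show ?thesis .
      qed
      finally have "\<bar>c * z0 * (x \<bullet> z1)\<bar> \<le> \<bar>(g * c^2 * Z' / p + p * z0^2 * X' / g) / 2\<bar>"
        by (simp only: abs_le_square_iff)
      moreover have "0 \<le> (g * c^2 * Z' / p + p * z0^2 * X' / g) / 2"
        using p_pos g_pos by (simp add: X'_def Z'_def)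
      moreover have "2 * A \<le> B" if "\<bar>A\<bar> \<le> \<bar>B / 2\<bar>" "0 \<le> B / 2" for A B :: real using that by linarith
      ultimately show ?thesis by blast
    qed
    moreover have "?R * ?Q = (c * z0)^2 + X' * Z' + (g * c^2 * Z' / p + p * z0^2 * X' / g)"
      using p_pos g_pos by (simp add: X'_def Z'_def field_simps power2_eq_square)
    ultimately show ?thesis unfolding vz using cs by (simp add: power2_sum)
  qed
  then have "k * (v \<bullet> z)^2 \<le> ?R * (k * ?Q)" using k by (simp add: mult_left_mono)
  also have "\<dots> \<le> ?R * (v \<bullet> z)" using kQ R0 by (rule mult_left_mono)
  finally have *: "(v \<bullet> z) * (k * (v \<bullet> z)) \<le> (v \<bullet> z) * ?R" by (simp add: power2_eq_square mult_ac)
  have "v \<bullet> z \<ge> 0" using s by (metis zero_le_power2)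
  then have "k * (v \<bullet> z) \<le> ?R" using * R0 by (cases "v \<bullet> z = 0") auto
  then show ?thesis unfolding s c_def[symmetric] xx .
qed

text \<open>The frame lemmas hold for every unit vector, so \<open>v\<close> takes the place of
  \<open>\<theta>\<close>: the inverse form at \<open>v\<close> is at least
  \<open>1 / par V v\<close>, and \<open>par V v\<close> is at most the trace.\<close>

lemma wn_ge: "norm v = 1 ==> 1 \<le> (wn v)^2 * trace V"
proof -
  assume v: "norm v = 1"
  interpret v: pd_matrix V v by unfold_locales (use sym pd v dim in auto)
  have "1 / par V v \<le> (wn v)^2" using v.inverse_par_ge by (simp add: wn_sq)
  moreover have "par V v \<le> trace V" using v.N_g_le v.g_pos v.N_ge
    by (smt (verit) mult_nonneg_nonneg perp_def)
  ultimately show ?thesis using v.p_pos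
    by (smt (verit, best) divide_le_eq mult_left_mono zero_le_power2)
qed

end

section \<open>The optimal action as a trust region problem\<close>

locale ucb_step = pd_matrix V \<theta> for V :: "real^'n^'n" and \<theta> :: "real^'n" +
  fixes u a :: "real^'n" and \<beta> :: real
  assumes u: "norm u = 1" and \<beta>: "\<beta> > 0"
    and opt: "is_arg_max (ucb_index \<beta> V u) (\<lambda>x. x \<in> cball 0 1) a"
begin

abbreviation "w \<equiv> wn a"
definition "\<mu> = a \<bullet> u + \<beta> * w"
text \<open>The Lagrange multiplier: with \<open>y = (\<beta> / w) *\<^sub>R (W *v a)\<close>, lemma
  \<open>maximiser\<close> says that \<open>V *v y = l *\<^sub>R (u + y)\<close>, and
  \<open>l_quad_le\<close> is the matching second-order condition.\<close>

definition "l = \<beta> / (\<mu> * w)"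
abbreviation "c \<equiv> a \<bullet> \<theta>"
definition "y = a \<bullet> a - c^2"

lemma u': "u \<bullet> u = 1" using u by (simp add: norm_eq_1)

lemma index: "ucb_index \<beta> V u x = x \<bullet> u + \<beta> * wn x" by (simp add: ucb_index_def wn_def)

lemma opt_le: "norm x \<le> 1 ==> x \<bullet> u + \<beta> * wn x \<le> \<mu>"
  using opt by (auto simp: is_arg_max_def index \<mu>_def not_less[symmetric])

lemma norm_a_le: "norm a \<le> 1" using opt by (auto simp: is_arg_max_def)

lemma mu_ge: "\<mu> \<ge> 1 + \<beta> * wn u" using opt_le[of u] u u' by simp

lemma mu_ge_1: "\<mu> \<ge> 1" using mu_ge wn_nonneg[of u] \<beta> by (smt (verit) mult_nonneg_nonneg)

lemma w_pos: "w > 0"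
proof (rule wn_pos, rule notI)
  assume "a = 0"
  then have "\<mu> = 0" unfolding \<mu>_def by (simp add: wn_def)
  then show False using mu_ge_1 by simp
qed

lemma l_pos: "l > 0" using w_pos mu_ge_1 \<beta> by (simp add: l_def)

text \<open>The index of a unit vector is the support function, in its direction, of the ellipsoid
  of radius \<open>\<beta>\<close> around \<open>u\<close>. As no index exceeds
  \<open>\<mu>\<close>, the ellipsoid lies in the ball of radius \<open>\<mu>\<close>.\<close>

lemma confidence_norm_le: "y' \<bullet> (V *v y') \<le> \<beta>^2 ==> norm (u + y') \<le> \<mu>"
proof (cases "u + y' = 0")
  case True
  then show ?thesis using mu_ge_1 by simp
next
  case False
  assume y': "y' \<bullet> (V *v y') \<le> \<beta>^2"
  define x where "x = (1 / norm (u + y')) *\<^sub>R (u + y')"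
  have nx: "norm x = 1" using False by (simp add: x_def)
  have "norm (u + y') = x \<bullet> (u + y')"
    using False by (simp add: x_def power2_norm_eq_inner[symmetric] power2_eq_square)
  also have "\<dots> \<le> x \<bullet> u + wn x * \<beta>"
    using pairing_le[OF y', of x] \<beta> by (simp add: inner_add_right)
  also have "\<dots> \<le> \<mu>" using opt_le[of x] nx by (simp add: mult.commute)
  finally show ?thesis .
qed

text \<open>An equality case of Cauchy-Schwarz: \<open>u + ?y\<close> has norm at most
  \<open>\<mu>\<close>, yet its inner product with \<open>a\<close>, a vector of norm at most 1,
  equals \<open>\<mu>\<close>.\<close>

lemma maximiser: "u + (\<beta> / w) *\<^sub>R (W *v a) = \<mu> *\<^sub>R a" and norm_a: "norm a = 1"
proof -
  let ?y = "(\<beta> / w) *\<^sub>R (W *v a)"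
  have "?y \<bullet> (V *v ?y) = (\<beta> / w)^2 * w^2"
    unfolding wn_sq by (simp add: matrix_vector_mult_scaleR V_W inner_commute power2_eq_square)
  then have "?y \<bullet> (V *v ?y) \<le> \<beta>^2" using w_pos by (simp add: power_divide)
  then have 1: "norm (u + ?y) \<le> \<mu>" by (rule confidence_norm_le)
  have 2: "a \<bullet> (u + ?y) = \<mu>"
    using w_pos wn_sq[of a] by (simp add: inner_add_right \<mu>_def power2_eq_square field_simps)
  have 3: "a \<bullet> a \<le> 1" using norm_a_le by (simp add: norm_le_square)
  have "(norm (u + ?y - \<mu> *\<^sub>R a))^2 = (norm (u + ?y))^2 - 2 * \<mu> * (a \<bullet> (u + ?y)) + \<mu>^2 * (a \<bullet> a)"
    unfolding power2_norm_eq_inner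
    by (simp only: inner_diff_left inner_diff_right inner_scaleR_left inner_scaleR_right
        inner_commute[of "u + ?y" a] power2_eq_square) (simp add: algebra_simps)
  also have "\<dots> \<le> \<mu>^2 - 2 * \<mu> * \<mu> + \<mu>^2 * 1"
    unfolding 2 using 1 3 mu_ge_1 by (intro add_mono diff_mono power_mono mult_left_mono) auto
  finally have "(norm (u + ?y - \<mu> *\<^sub>R a))^2 \<le> 0" by (simp add: power2_eq_square)
  then show eq: "u + ?y = \<mu> *\<^sub>R a" by simp
  have "a \<bullet> a = 1" using 2 mu_ge_1 unfolding eq by simp
  then show "norm a = 1" by (simp add: norm_eq_1)
qed

lemma a': "a \<bullet> a = 1" using norm_a by (simp add: norm_eq_1)

text \<open>
  \<open>u + y\<close> is the longest vector of the confidence ellipsoid around \<open>u\<close>, a trust region problem: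
  comparing \<open>y\<close> with its reflections inside the ellipsoid gives the second-order condition.
\<close>

lemma l_quad_le: "l * (z \<bullet> z) \<le> z \<bullet> (V *v z)"
proof -
  have main: "l * (z \<bullet> z) \<le> z \<bullet> (V *v z)" if za: "z \<bullet> a \<noteq> 0" for z
  proof -
    define y where "y = (\<beta> / w) *\<^sub>R (W *v a)"
    have Vy: "V *v y = (\<beta> / w) *\<^sub>R a" by (simp add: y_def matrix_vector_mult_scaleR V_W)
    have yVy: "y \<bullet> (V *v y) = \<beta>^2"
    proof -
      have "y \<bullet> (V *v y) = (\<beta> / w)^2 * w^2"
        unfolding wn_sq Vy by (simp add: y_def inner_commute power2_eq_square)
      then show ?thesis using w_pos by (simp add: power_divide)
    qed
    have z0: "z \<noteq> 0" using za by auto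
    define q where "q = z \<bullet> (V *v z)"
    have q: "q > 0" using z0 pd[of z] by (simp add: q_def less_le_trans[OF _ pd])
    \<comment> \<open>The nonzero parameter at which the line from \<open>y\<close> in direction
      \<open>z\<close> meets the ellipsoid a second time.\<close>
    define t where "t = - 2 * (\<beta> / w) * (z \<bullet> a) / q"
    have t0: "t \<noteq> 0" using za q \<beta> w_pos by (simp add: t_def)
    have "(y + t *\<^sub>R z) \<bullet> (V *v (y + t *\<^sub>R z)) = \<beta>^2 + 2 * t * (\<beta> / w) * (z \<bullet> a) + t^2 * q"
    proof -
      have "y \<bullet> (V *v z) = (\<beta> / w) * (z \<bullet> a)"
        using V_inner[of y z] by (simp add: Vy inner_commute)
      moreover have "z \<bullet> (V *v y) = (\<beta> / w) * (z \<bullet> a)" by (simp add: Vy)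
      ultimately show ?thesis
        unfolding matrix_vector_right_distrib matrix_vector_mult_scaleR inner_add_left inner_add_right
          inner_scaleR_left inner_scaleR_right yVy q_def
        by (simp add: power2_eq_square algebra_simps)
    qed
    also have "t^2 * q = - 2 * t * (\<beta> / w) * (z \<bullet> a)"
      using q by (simp add: t_def power2_eq_square mult_ac)
    finally have "norm (u + (y + t *\<^sub>R z)) \<le> \<mu>" by (intro confidence_norm_le) simp
    then have "norm (\<mu> *\<^sub>R a + t *\<^sub>R z) \<le> \<mu>"
      by (simp only: y_def add.assoc[symmetric] maximiser)
    then have "(norm (\<mu> *\<^sub>R a + t *\<^sub>R z))^2 \<le> \<mu>^2" by (rule power_mono) simp
    moreover have "(norm (\<mu> *\<^sub>R a + t *\<^sub>R z))^2 = \<mu>^2 + (2 * \<mu> * t * (z \<bullet> a) + t^2 * (z \<bullet> z))"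
      unfolding power2_norm_eq_inner
      by (simp add: inner_add_left inner_add_right a' inner_commute[of a z] power2_eq_square algebra_simps)
    ultimately have "2 * \<mu> * t * (z \<bullet> a) + t^2 * (z \<bullet> z) \<le> 0" by simp
    moreover have "2 * \<mu> * t * (z \<bullet> a) = - t\<^sup>2 * (\<mu> * w / \<beta> * q)"
      using q \<beta> w_pos by (simp add: t_def power2_eq_square)
    ultimately have "t^2 * (z \<bullet> z) \<le> t^2 * (\<mu> * w / \<beta> * q)" by simp
    moreover have "t^2 > 0" using t0 by simp
    ultimately have "z \<bullet> z \<le> \<mu> * w / \<beta> * q" by (simp only: mult_le_cancel_left_pos)
    then show ?thesis using \<beta> w_pos mu_ge_1 unfolding l_def q_def[symmetric] by (simp add: field_simps)
  qed
  show ?thesis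
  proof (cases "z \<bullet> a = 0")
    case True
    \<comment> \<open>For \<open>z\<close> orthogonal to \<open>a\<close> the line is tangent and
      there is no second intersection; the inequality is the limit of those for
      \<open>z + e *\<^sub>R a\<close>.\<close>
    define f where "f e = (z + e *\<^sub>R a) \<bullet> (V *v (z + e *\<^sub>R a)) - l * ((z + e *\<^sub>R a) \<bullet> (z + e *\<^sub>R a))" for e
    have "(f \<longlongrightarrow> f 0) (at_right 0)"
      unfolding f_def by (intro tendsto_intros bounded_linear.tendsto[OF matrix_vector_mul_bounded_linear])
    moreover have "eventually (\<lambda>e. f e \<ge> 0) (at_right 0)"
    proof -
      have "f e \<ge> 0" if "e > 0" for e
        using main[of "z + e *\<^sub>R a"] True that a' by (simp add: f_def inner_add_left)
      then show ?thesis by (auto simp: eventually_at_right_less eventually_at_filter)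
    qed
    ultimately have "f 0 \<ge> 0" by (intro tendsto_lowerbound) auto
    then show ?thesis by (simp add: f_def)
  qed (rule main)
qed

lemma l_le_g: "l \<le> g" by (rule le_g[OF l_quad_le l_pos])

lemma l_le_p: "l \<le> p" using l_quad_le[of \<theta>] by (simp add: par_def unit')

lemma quad_bound_w: "(\<And>z. k * (z \<bullet> z) \<le> z \<bullet> (V *v z)) ==> k * w^2 \<le> 1"
proof -
  assume k: "\<And>z. k * (z \<bullet> z) \<le> z \<bullet> (V *v z)"
  define z where "z = W *v a"
  have w2: "w^2 = a \<bullet> z" by (simp add: wn_sq z_def)
  have kz: "k * (z \<bullet> z) \<le> w^2" using k[of z] by (simp add: z_def V_W wn_sq inner_commute)
  show ?thesis
  proof (cases "k > 0")
    case True
    have "(w^2)^2 \<le> z \<bullet> z" unfolding w2 using Cauchy_Schwarz_ineq[of a z] a' by simp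
    then have "k * (w^2)^2 \<le> k * (z \<bullet> z)" using True by simp
    then have "w^2 * (k * w^2) \<le> w^2 * 1" using kz by (simp add: power2_eq_square mult_ac)
    moreover have "w^2 > 0" using w_pos by simp
    ultimately show ?thesis by (simp only: mult_le_cancel_left_pos)
  next
    case False
    then have "k * w^2 \<le> 0" by (simp add: mult_nonpos_nonneg)
    then show ?thesis by simp
  qed
qed

lemma w_le_1: "w^2 \<le> 1" using quad_bound_w[of 1] pd by simp

lemma mu_le: "\<mu> \<le> 1 + \<beta> * w"
  using norm_cauchy_schwarz[of a u] u norm_a by (simp add: \<mu>_def)

lemma l_w_eq: "l * w^2 = \<beta> * w / \<mu>"
  using w_pos by (simp add: l_def power2_eq_square)

lemma l_w_ge: "1 - 1 / \<mu> \<le> l * w^2"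
proof -
  have "\<mu> \<le> 1 + \<beta> * w" by (rule mu_le)
  then have "1 \<le> (1 + \<beta> * w) / \<mu>" using mu_ge_1 by simp
  then show ?thesis unfolding l_w_eq by (simp add: add_divide_distrib)
qed

lemma y_nonneg: "0 \<le> y" and y_le: "y \<le> 1" and c_sq: "c^2 = 1 - y"
proof -
  have "c^2 \<le> 1" using Cauchy_Schwarz_ineq[of a \<theta>] a' unit' by (simp add: power2_eq_square)
  then show "0 \<le> y" "y \<le> 1" "c^2 = 1 - y" by (simp_all add: y_def a')
qed

text \<open>Optimality against the reflection of \<open>a\<close> in the axis \<open>\<theta>\<close> controls the cross term.\<close>

lemma exploration_le:
  defines "s \<equiv> (a - c *\<^sub>R \<theta>) \<bullet> u"
  shows "\<mu> * y \<le> (\<beta> / w) * (w^2 - c^2 / p) + 2 * \<bar>s\<bar> + s^2 / (\<beta> * w)"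
proof -
  define G where "G = \<theta> \<bullet> (W *v a)"
  define Q where "Q = \<theta> \<bullet> (W *v \<theta>)"
  define a'' where "a'' = (2 * c) *\<^sub>R \<theta> - a"
  define w' where "w' = wn a''"
  define D where "D = 4 * c * (c * Q - G)"
  have "a'' \<bullet> a'' = 1"
    by (simp add: a''_def inner_diff_left inner_diff_right unit' a' inner_commute algebra_simps power2_eq_square)
  then have "norm a'' = 1" by (simp add: norm_eq_1)
  then have "a'' \<bullet> u + \<beta> * w' \<le> \<mu>" using opt_le[of a''] by (simp add: w'_def)
  moreover have "a'' \<bullet> u = a \<bullet> u - 2 * s"
    by (simp add: a''_def s_def inner_diff_left algebra_simps)
  ultimately have opt': "\<beta> * (w' - w) \<le> 2 * s" by (simp add: \<mu>_def algebra_simps)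
  have aW: "a \<bullet> (W *v \<theta>) = G" using W_inner[of a \<theta>] by (simp add: G_def inner_commute)
  have w'2: "w'^2 = w^2 + D"
    unfolding w'_def wn_sq a''_def
    by (simp add: matrix_vector_mult_diff_distrib matrix_vector_mult_scaleR inner_diff_left inner_diff_right
        aW Q_def[symmetric] G_def[symmetric] D_def algebra_simps power2_eq_square)
  have w'0: "w' \<ge> 0" by (simp add: w'_def wn_nonneg)
  \<comment> \<open>\<open>D\<close> is the change of \<open>w^2\<close> under the reflection.
    Optimality limits the growth of \<open>w\<close> to \<open>2 * s / \<beta>\<close>, and
    \<open>D = h^2 + 2 * w * h\<close> carries this over to \<open>D\<close>. The mixed entry
    \<open>G\<close> is then eliminated below through
    \<open>c * G = c^2 * Q - D / 4\<close>.\<close>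
  have cross: "(\<beta> / w) * (D / 4) \<le> \<bar>s\<bar> + s^2 / (\<beta> * w)"
  proof (cases "D \<le> 0")
    case True
    then have "(\<beta> / w) * (D / 4) \<le> 0" using \<beta> w_pos by (intro mult_nonneg_nonpos) auto
    moreover have "0 \<le> s^2 / (\<beta> * w)" using \<beta> w_pos by simp
    ultimately show ?thesis by linarith
  next
    case False
    define h where "h = w' - w"
    have "w^2 < w'^2" using False w'2 by simp
    then have h: "h > 0" using w'0 by (simp add: h_def power_less_imp_less_base)
    have hs: "h \<le> 2 * s / \<beta>" using opt' \<beta> by (simp add: h_def field_simps)
    then have s: "s > 0" using h \<beta> by (smt (verit) divide_nonpos_pos)
    have "D = h^2 + 2 * w * h" using w'2 by (simp add: h_def power2_eq_square algebra_simps)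
    also have "\<dots> \<le> (2 * s / \<beta>)^2 + 2 * w * (2 * s / \<beta>)"
      using h hs w_pos by (intro add_mono power_mono mult_left_mono) auto
    finally have "(\<beta> / w) * (D / 4) \<le> (\<beta> / w) * (((2 * s / \<beta>)^2 + 2 * w * (2 * s / \<beta>)) / 4)"
      using \<beta> w_pos by (intro mult_left_mono) auto
    also have "\<dots> = s + s^2 / (\<beta> * w)"
      using \<beta> w_pos by (simp add: field_simps power2_eq_square)
    finally show ?thesis using s by simp
  qed
  have "(a - c *\<^sub>R \<theta>) \<bullet> (u + (\<beta> / w) *\<^sub>R (W *v a)) = \<mu> * y"
    unfolding maximiser by (simp add: y_def inner_diff_left power2_eq_square inner_commute[of \<theta>] right_diff_distrib)
  then have "\<mu> * y = s + (\<beta> / w) * (w^2 - c * G)"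
    by (simp add: inner_add_right s_def wn_sq inner_diff_left G_def)
  also have "c * G = c^2 * Q - D / 4" by (simp add: D_def power2_eq_square field_simps)
  also have "(\<beta> / w) * (w^2 - (c^2 * Q - D / 4)) = (\<beta> / w) * (w^2 - c^2 * Q) + (\<beta> / w) * (D / 4)"
    by (simp add: algebra_simps)
  finally have "\<mu> * y = s + (\<beta> / w) * (w^2 - c^2 * Q) + (\<beta> / w) * (D / 4)" by simp
  moreover have "(\<beta> / w) * (w^2 - c^2 * Q) \<le> (\<beta> / w) * (w^2 - c^2 / p)"
  proof (intro mult_left_mono diff_left_mono)
    show "c^2 / p \<le> c^2 * Q"
      using mult_left_mono[OF inverse_par_ge, of "c^2"] by (simp add: Q_def)
  qed (use \<beta> w_pos in auto)
  ultimately show ?thesis using cross by linarith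
qed

text \<open>The error is measured at scale \<open>l\<close> because \<open>l\<close> lies below both
  \<open>p\<close> and \<open>g\<close>. After division by \<open>\<mu>\<close>, the linear term in
  \<open>s\<close> is at most \<open>\<rho> * (y + l * w^2)\<close> and the quadratic one at most
  \<open>\<rho>^2 * y\<close>, so both can be absorbed.\<close>

lemma exploration_le_rho:
  assumes e: "(norm (u - \<theta>))^2 * l \<le> \<rho>^2 * \<beta>^2" and \<rho>: "0 < \<rho>" "\<rho> \<le> 1 / 4"
  shows "y \<le> l * ((1 + 5 * \<rho>) * w^2 - c^2 / p)"
proof -
  define s where "s = (a - c *\<^sub>R \<theta>) \<bullet> u"
  have \<mu>: "\<mu> > 0" using mu_ge_1 by simp
  have "s = (a - c *\<^sub>R \<theta>) \<bullet> (u - \<theta>)" by (simp add: s_def inner_diff_right inner_diff_left unit')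
  moreover have "(a - c *\<^sub>R \<theta>) \<bullet> (a - c *\<^sub>R \<theta>) = y"
    by (simp add: y_def inner_diff_right inner_diff_left unit' inner_commute power2_eq_square algebra_simps)
  ultimately have s2: "s^2 \<le> y * (norm (u - \<theta>))^2"
    using Cauchy_Schwarz_ineq[of "a - c *\<^sub>R \<theta>" "u - \<theta>"] by (simp add: power2_norm_eq_inner)
  have s2l: "s^2 * l \<le> \<rho>^2 * \<beta>^2 * y"
  proof -
    have "s^2 * l \<le> y * ((norm (u - \<theta>))^2 * l)" using s2 l_pos by simp
    also have "\<dots> \<le> y * (\<rho>^2 * \<beta>^2)" using e y_nonneg by (rule mult_left_mono)
    finally show ?thesis by (simp add: mult_ac)
  qed
  have lb: "l * \<mu> * w = \<beta>" using \<mu> w_pos by (simp add: l_def)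
  have t1: "s^2 / (\<beta> * w) / \<mu> \<le> \<rho>^2 * y"
  proof -
    have "s^2 / (\<beta> * w) / \<mu> = s^2 * l / \<beta>^2"
      using \<mu> w_pos \<beta> by (simp add: l_def field_simps power2_eq_square)
    also have "\<dots> \<le> \<rho>^2 * \<beta>^2 * y / \<beta>^2" using s2l by (intro divide_right_mono) auto
    finally show ?thesis using \<beta> by simp
  qed
  define v where "v = l * w^2"
  have v: "v \<ge> 0" using l_pos by (simp add: v_def)
  have t2: "2 * \<bar>s\<bar> / \<mu> \<le> \<rho> * (y + v)"
  proof -
    have "(s / \<mu>)^2 = s^2 * l * v / (l * \<mu> * w)^2"
      using l_pos w_pos \<mu> by (simp add: v_def power_mult_distrib power_divide power2_eq_square)
    also have "\<dots> \<le> (\<rho>^2 * \<beta>^2 * y) * v / (l * \<mu> * w)^2"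
      using s2l v by (intro divide_right_mono mult_right_mono) auto
    also have "\<dots> = \<rho>^2 * (y * v)" unfolding lb using \<beta> by simp
    also have "\<dots> \<le> \<rho>^2 * ((y + v) / 2)^2"
    proof (rule mult_left_mono)
      show "y * v \<le> ((y + v) / 2)^2"
        using zero_le_power2[of "y - v"] by (simp add: power2_eq_square field_simps)
    qed simp
    also have "\<dots> = (\<rho> * ((y + v) / 2))^2" by (simp only: power_mult_distrib)
    finally have "\<bar>s / \<mu>\<bar> \<le> \<bar>\<rho> * ((y + v) / 2)\<bar>" by (simp only: abs_le_square_iff)
    then have "\<bar>s\<bar> / \<mu> \<le> \<rho> * ((y + v) / 2)" using \<rho> v y_nonneg \<mu> by (simp add: abs_mult abs_divide)
    then show ?thesis by linarith
  qed
  have "y \<le> ((\<beta> / w) * (w^2 - c^2 / p) + 2 * \<bar>s\<bar> + s^2 / (\<beta> * w)) / \<mu>"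
    using exploration_le \<mu> by (simp add: s_def field_simps)
  also have "\<dots> = l * (w^2 - c^2 / p) + 2 * \<bar>s\<bar> / \<mu> + s^2 / (\<beta> * w) / \<mu>"
    by (simp add: l_def add_divide_distrib)
  finally have 1: "y \<le> v - l * (c^2 / p) + \<rho> * (y + v) + \<rho>^2 * y"
    using t1 t2 by (simp add: v_def right_diff_distrib)
  have lc: "l * (c^2 / p) \<ge> 0" using l_pos p_pos by simp
  have r2: "\<rho>^2 * y \<le> \<rho> * y / 4"
    using \<rho> y_nonneg mult_mono[of \<rho> "1/4" "\<rho> * y" "\<rho> * y"] by (simp add: power2_eq_square mult_ac)
  have rv: "\<rho> * v \<le> v / 4" and ry: "\<rho> * y \<le> y / 4"
    using \<rho> v y_nonneg mult_right_mono[of \<rho> "1/4" v] mult_right_mono[of \<rho> "1/4" y] by auto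
  \<comment> \<open>Only used to trade the remaining terms in \<open>y\<close> for terms in
    \<open>v\<close>: the total \<open>\<rho> + 2 * \<rho> + \<rho> / 2\<close> is at most
    \<open>5 * \<rho>\<close>.\<close>
  have "y \<le> 2 * v"
    using 1 lc r2 rv ry v by (simp add: distrib_left)
  then have "\<rho> * y \<le> \<rho> * (2 * v)" using \<rho> by (intro mult_left_mono) auto
  moreover have "\<rho> * v \<ge> 0" using \<rho> v by simp
  ultimately have "y \<le> v + 5 * (\<rho> * v) - l * (c^2 / p)"
    using 1 r2 by (simp add: distrib_left)
  then show ?thesis by (simp add: v_def algebra_simps)
qed

end

section \<open>Scalar dynamics of a run\<close>

text \<open>
  Scalar bookkeeping of a run: with \<open>V\<close> the design matrix after \<open>t\<close> rounds, \<open>p t\<close> is its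
  \<open>\<theta>\<close>-entry, \<open>X t\<close> the trace of the complementary block, \<open>D t\<close> its determinant, \<open>g t\<close> the
  geometric mean of the Schur complement, \<open>w t\<close> the confidence width of the next action and
  \<open>y t\<close> the squared length of its component orthogonal to \<open>\<theta>\<close>; \<open>qb t k\<close> says that
  \<open>V\<close> dominates \<open>k\<close> times the block diagonal form with entries \<open>p t\<close> and \<open>g t\<close>.
\<close>

definition kappa_early :: "real \<Rightarrow> real" where
  "kappa_early N = (1 / (3 * (N + 1))) powr (N + 1)"

text \<open>\<open>kappa_early\<close> restates \<open>D_root_early\<close>: with
  \<open>d = N + 1\<close>, the determinant is at least \<open>((t + d) / (3 * d)) ^ d\<close> in
  the initial phase. The bound \<open>1 / (11 * N)\<close> comes from \<open>good_late\<close>,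
  where \<open>t + 1\<close> is at most \<open>11 * N * p\<close>.\<close>

definition kappa :: "real \<Rightarrow> real" where
  "kappa N = min (kappa_early N) (1 / (11 * N))"

lemma kappa_positive: "kappa N > 0" "kappa_early N > 0" if "N \<ge> 1"
  using that by (auto simp: kappa_def kappa_early_def)

locale scalar_run =
  fixes N \<beta> \<rho> :: real and T :: nat
    and g p X y w l D \<mu> :: "nat \<Rightarrow> real" and qb :: "nat \<Rightarrow> real \<Rightarrow> bool"
  assumes N: "N \<ge> 1" and \<beta>: "\<beta> \<ge> 1" and \<rho>: "0 < \<rho>" "\<rho> \<le> 1 / 5"
    and init: "X 0 = N" "p 0 = 1" "g 0 = 1" "D 0 = 1"
    and X_Suc: "\<And>t. t < T ==> X (Suc t) = X t + y t"
    and p_Suc: "\<And>t. t < T ==> p (Suc t) = p t + (1 - y t)"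
    and D_Suc: "\<And>t. t < T ==> D (Suc t) = D t * (1 + (w t)^2)"
    and y: "\<And>t. t < T ==> 0 \<le> y t" "\<And>t. t < T ==> y t \<le> 1"
    and g_pos: "\<And>t. t \<le> T ==> 0 < g t" and p_ge: "\<And>t. t \<le> T ==> 1 \<le> p t"
    and D_ge: "\<And>t. t \<le> T ==> 1 \<le> D t"
    and g_eq: "\<And>t. t \<le> T ==> N * ln (g t) = ln (D t) - ln (p t)"
    and w_pos: "\<And>t. t < T ==> 0 < w t" and w_le: "\<And>t. t < T ==> (w t)^2 \<le> 1"
    and l_pos: "\<And>t. t < T ==> 0 < l t" and l_g: "\<And>t. t < T ==> l t \<le> g t"
    and l_p: "\<And>t. t < T ==> l t \<le> p t"
    and l_eq: "\<And>t. t < T ==> l t * (\<mu> t * w t) = \<beta>"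
    and mu_ge_1: "\<And>t. t < T ==> 1 \<le> \<mu> t" and mu_le: "\<And>t. t < T ==> \<mu> t \<le> 1 + \<beta> * w t"
    and mu_ge: "\<And>t. t < T ==> 1 + \<beta> / sqrt (real t + (N + 1)) \<le> \<mu> t"
    and lw_ge: "\<And>t. t < T ==> 1 - 1 / \<mu> t \<le> l t * (w t)^2"
    and Ng_X: "\<And>t. t \<le> T ==> N * g t \<le> X t"
    and qb_w: "\<And>t k. t < T ==> qb t k ==> 0 < k ==> k * (w t)^2 \<le> (1 - y t) / p t + y t / g t"
    and qb_near: "\<And>t \<eta>. t \<le> T ==> X t - N * g t \<le> \<eta> * g t ==> \<eta> \<le> 1 ==> qb t (1 - 4 * sqrt \<eta>)"
    and qb_mono: "\<And>t k k'. t \<le> T ==> qb t k ==> k' \<le> k ==> qb t k'"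
    and qb_early: "\<And>t k. t \<le> T ==> 0 < k ==> k * p t \<le> D t / (real t + (N + 1)) powr N ==>
        k * g t \<le> D t / (real t + (N + 1)) powr N ==> qb t k"
    and D_p: "\<And>t. t \<le> T ==> D t / (real t + (N + 1)) powr N \<le> p t"
    and D_g: "\<And>t. t \<le> T ==> D t / (real t + (N + 1)) powr N \<le> g t"
    and ln_D: "\<And>t. t \<le> T ==> ln (D t) \<le> (N + 1) * ln (1 + real t)"
    and y_le: "\<And>t. t < T ==> qb t (kappa N) ==> kappa N * (real t + 1) \<le> p t ==> kappa N * X t \<le> g t ==>
        y t \<le> l t * ((1 + 5 * \<rho>) * (w t)^2 - (1 - y t) / p t)"
begin

text \<open>The conditioning that \<open>y_le\<close> presupposes. It follows in turn from
  \<open>y_le\<close> at earlier rounds, so the estimates below are stated relative to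
  \<open>good\<close> at just those rounds that they use, ready for an induction along the
  run.\<close>

definition "good t \<longleftrightarrow> qb t (kappa N) \<and> kappa N * (real t + 1) \<le> p t \<and> kappa N * X t \<le> g t"

lemmas kappa_pos = kappa_positive[OF N]

lemma kappa_le: "kappa N \<le> kappa_early N" "kappa N \<le> 1 / (11 * N)" "kappa N \<le> 1 / 11"
proof -
  show 1: "kappa N \<le> kappa_early N" "kappa N \<le> 1 / (11 * N)" by (auto simp: kappa_def)
  have "1 / (11 * N) \<le> 1 / 11" using N by (simp add: field_simps)
  then show "kappa N \<le> 1 / 11" using 1(2) by linarith
qed

lemma X_p: "t \<le> T ==> X t + p t = real t + (N + 1)"
proof (induction t)
  case (Suc t)
  then show ?case using X_Suc[of t] p_Suc[of t] by simp
qed (simp add: init)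

lemma p_le: "t \<le> T ==> p t \<le> real t + (N + 1)"
proof -
  assume t: "t \<le> T"
  have "0 < N * g t" using N g_pos[OF t] by simp
  then show ?thesis using X_p[OF t] Ng_X[OF t] by linarith
qed

lemma X_le: "t \<le> T ==> X t \<le> real t + (N + 1)"
  using X_p[of t] p_ge[of t] by simp

lemma g_le: "t \<le> T ==> g t \<le> X t"
proof -
  assume t: "t \<le> T"
  have "1 * g t \<le> N * g t" using N g_pos[OF t] by (intro mult_right_mono) auto
  then show ?thesis using Ng_X[OF t] by simp
qed

lemma X_pos: "t \<le> T ==> 0 < X t" using g_le[of t] g_pos[of t] by simp

lemma ln_g_Suc:
  assumes "t < T"
  shows "N * (ln (g (Suc t)) - ln (g t)) = ln (1 + (w t)^2) - ln (1 + (1 - y t) / p t)"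
proof -
  have p: "p t > 0" using p_ge[of t] assms by simp
  have "ln (D (Suc t)) = ln (D t) + ln (1 + (w t)^2)"
    unfolding D_Suc[OF assms] using D_ge[of t] assms by (intro ln_mult_pos) (auto simp: add_pos_nonneg)
  moreover have "ln (p (Suc t)) = ln (p t) + ln (1 + (1 - y t) / p t)"
  proof -
    have "p (Suc t) = p t * (1 + (1 - y t) / p t)" using p p_Suc[OF assms] by (simp add: distrib_left)
    then show ?thesis using p y(2)[OF assms] by (simp add: ln_mult_pos add_pos_nonneg)
  qed
  ultimately show ?thesis using g_eq[of t] g_eq[of "Suc t"] assms by (simp add: algebra_simps)
qed

lemma P1_nonneg: "t < T ==> 0 \<le> (1 - y t) / p t"
  using y(2)[of t] p_ge[of t] by simp

subsection \<open>The initial phase\<close>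

lemma ln_one_plus_ge: "x / (1 + x) \<le> ln (1 + x)" if "x \<ge> 0" for x :: real
proof -
  have "ln (1 / (1 + x)) \<le> 1 / (1 + x) - 1" using that by (intro ln_le_minus_one) auto
  then show ?thesis using that by (simp add: ln_div field_simps)
qed

text \<open>With \<open>d = N + 1\<close>: while \<open>t + d \<le> \<beta>^2\<close>, the bonus
  makes \<open>\<mu> \<ge> 2\<close>, hence \<open>w^2 \<ge> 1 / (2 * l)\<close>; and
  \<open>l\<close> is at most the \<open>d\<close>-th root of \<open>D\<close>, because it is below
  \<open>p\<close> and below \<open>g\<close>. So this root gains a fixed amount per round. The
  hypothesis allows one more than \<open>\<beta>^2\<close> since the value at \<open>t\<close>
  depends only on \<open>w s\<close> with \<open>s < t\<close>.\<close>

lemma D_root_early: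
  assumes "t \<le> T" "real t + (N + 1) \<le> \<beta>^2 + 1"
  shows "1 + real t / (3 * (N + 1)) \<le> exp (ln (D t) / (N + 1))"
  using assms
proof (induction t)
  case (Suc t)
  let ?d = "N + 1"
  have t: "t < T" using Suc by simp
  define Y where "Y = exp (ln (D t) / ?d)"
  have IH: "1 + real t / (3 * ?d) \<le> Y" using Suc by (simp add: Y_def)
  have "0 \<le> real t / (3 * ?d)" using N by simp
  then have Y1: "Y \<ge> 1" using IH by simp
  have "real t + ?d \<le> \<beta>^2" using Suc.prems by simp
  then have "sqrt (real t + ?d) \<le> \<beta>" using \<beta> by (simp add: real_le_lsqrt)
  then have "1 \<le> \<beta> / sqrt (real t + ?d)" using N by simp
  then have "\<mu> t \<ge> 2" using mu_ge[OF t] by simp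
  then have "1 / \<mu> t \<le> 1 / 2" by (simp add: frac_le)
  then have lw: "1 / 2 \<le> l t * (w t)^2" using lw_ge[OF t] by linarith
  have "?d * ln (l t) \<le> ln (D t)"
  proof -
    have "N * ln (l t) \<le> N * ln (g t)" using l_g[OF t] l_pos[OF t] N by (intro mult_left_mono) auto
    moreover have "ln (l t) \<le> ln (p t)" using l_p[OF t] l_pos[OF t] by simp
    ultimately show ?thesis using g_eq[of t] t by (simp add: algebra_simps)
  qed
  then have "ln (l t) \<le> ln (D t) / ?d" using N by (simp add: field_simps)
  then have "exp (ln (l t)) \<le> Y" by (simp add: Y_def)
  then have lY: "l t \<le> Y" using l_pos[OF t] by simp
  have "1 / (2 * Y) \<le> (w t)^2"
  proof -
    have "l t * (w t)^2 \<le> Y * (w t)^2" using lY by (intro mult_right_mono) auto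
    then show ?thesis using lw Y1 by (simp add: field_simps)
  qed
  then have "ln (1 + 1 / (2 * Y)) \<le> ln (1 + (w t)^2)" using Y1 by (simp add: add_pos_nonneg)
  moreover have "1 / (3 * Y) \<le> ln (1 + 1 / (2 * Y))"
  proof -
    have "1 / (3 * Y) \<le> (1 / (2 * Y)) / (1 + 1 / (2 * Y))" using Y1 by (simp add: field_simps)
    also have "\<dots> \<le> ln (1 + 1 / (2 * Y))" using Y1 by (intro ln_one_plus_ge) simp
    finally show ?thesis .
  qed
  moreover have "ln (D (Suc t)) = ln (D t) + ln (1 + (w t)^2)"
    unfolding D_Suc[OF t] using D_ge[of t] t by (intro ln_mult_pos) (auto simp: add_pos_nonneg)
  ultimately have "ln (D t) + 1 / (3 * Y) \<le> ln (D (Suc t))" by linarith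
  then have "(ln (D t) + 1 / (3 * Y)) / ?d \<le> ln (D (Suc t)) / ?d" using N by (intro divide_right_mono) auto
  then have "exp (ln (D t) / ?d + 1 / (3 * Y * ?d)) \<le> exp (ln (D (Suc t)) / ?d)"
    by (simp add: add_divide_distrib)
  moreover have "Y + 1 / (3 * ?d) \<le> exp (ln (D t) / ?d + 1 / (3 * Y * ?d))"
  proof -
    have "Y + 1 / (3 * ?d) = Y * (1 + 1 / (3 * Y * ?d))"
    proof -
      have "Y * (1 / (3 * Y * ?d)) = 1 / (3 * ?d)" using Y1 by (simp del: distrib_left_numeral)
      then show ?thesis by (simp only: distrib_left mult_1_right)
    qed
    also have "\<dots> \<le> Y * exp (1 / (3 * Y * ?d))" using Y1 by (intro mult_left_mono exp_ge_add_one_self) auto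
    finally show ?thesis by (simp add: exp_add Y_def)
  qed
  ultimately have "Y + 1 / (3 * ?d) \<le> exp (ln (D (Suc t)) / ?d)" by linarith
  moreover have "real (Suc t) / (3 * ?d) = real t / (3 * ?d) + 1 / (3 * ?d)"
    unfolding add_divide_distrib[symmetric] by simp
  ultimately show ?case using IH by linarith
qed (simp add: init)

lemma D_early:
  assumes "t \<le> T" "real t + (N + 1) \<le> \<beta>^2 + 1"
  shows "kappa_early N * (real t + (N + 1)) \<le> D t / (real t + (N + 1)) powr N"
proof -
  let ?d = "N + 1"
  have d: "?d > 0" using N by simp
  have D: "D t > 0" using D_ge[OF assms(1)] by simp
  have "(real t + ?d) / (3 * ?d) \<le> 1 + real t / (3 * ?d)"
  proof -
    have "?d / (3 * ?d) = 1 / 3" using N by simp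
    then show ?thesis by (simp only: add_divide_distrib)
  qed
  also have "\<dots> \<le> exp (ln (D t) / ?d)" by (rule D_root_early[OF assms])
  finally have "((real t + ?d) / (3 * ?d)) powr ?d \<le> exp (ln (D t) / ?d) powr ?d"
    using d by (intro powr_mono2) auto
  also have "\<dots> = D t" using d D by (simp add: powr_def)
  finally have "((real t + ?d) * (1 / (3 * ?d))) powr ?d \<le> D t" by simp
  then have le: "(real t + ?d) powr ?d * kappa_early N \<le> D t"
    using d by (subst (asm) powr_mult) (auto simp: kappa_early_def)
  have "kappa_early N * (real t + ?d) = (real t + ?d) powr ?d * kappa_early N / (real t + ?d) powr N"
    using d by (simp add: powr_add)
  also have "\<dots> \<le> D t / (real t + ?d) powr N" using le by (rule divide_right_mono) simp
  finally show ?thesis .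
qed

lemma g_early:
  assumes "t \<le> T" "real t + (N + 1) \<le> \<beta>^2 + 1"
  shows "kappa_early N * (real t + (N + 1)) \<le> g t"
  using D_early[OF assms] D_g[OF assms(1)] by linarith

text \<open>\<open>D t / (t + d) ^ N\<close>, where \<open>d = N + 1\<close>, acts as a lower bound
  on the least eigenvalue. It grows linearly here, while \<open>p\<close>, \<open>g\<close> and
  \<open>X\<close> never exceed \<open>t + d\<close>; this covers all three conditions.\<close>

lemma good_early:
  assumes "t \<le> T" "real t + (N + 1) \<le> \<beta>^2 + 1"
  shows "good t"
proof -
  let ?q = "D t / (real t + (N + 1)) powr N"
  have k: "kappa N * z \<le> ?q" if "0 \<le> z" "z \<le> real t + (N + 1)" for z
  proof -
    have "kappa N * z \<le> kappa_early N * (real t + (N + 1))"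
      using that kappa_le kappa_pos by (intro mult_mono) auto
    then show ?thesis using D_early[OF assms] by linarith
  qed
  have "qb t (kappa N)"
    using k[of "p t"] k[of "g t"] p_ge[OF assms(1)] p_le[OF assms(1)] g_pos[OF assms(1)] g_le[OF assms(1)] X_le[OF assms(1)]
    by (intro qb_early[OF assms(1) kappa_pos(1)]) auto
  moreover have "kappa N * (real t + 1) \<le> p t" using k[of "real t + 1"] D_p[OF assms(1)] N by simp
  moreover have "kappa N * X t \<le> g t"
    using k[of "X t"] D_g[OF assms(1)] X_pos[OF assms(1)] X_le[OF assms(1)] by simp
  ultimately show ?thesis by (simp add: good_def)
qed

subsection \<open>The trace and the determinant\<close>

text \<open>The accumulated gap between the growth of \<open>X\<close> and that of
  \<open>N * g\<close>. The part with \<open>5 * \<rho>\<close> is the slack of the exploration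
  bound due to estimation error, the quartic part is the loss in
  \<open>ln (1 + w^2) \<ge> w^2 - w ^ 4\<close>.\<close>

definition "E t = (\<Sum>s<t. g s * (5 * \<rho> * (w s)^2 + (w s) ^ 4))"

lemma E_Suc: "E (Suc t) = E t + g t * (5 * \<rho> * (w t)^2 + (w t) ^ 4)" by (simp add: E_def)

lemma E_mono: "t < T ==> E t \<le> E (Suc t)"
  using g_pos[of t] \<rho> by (simp add: E_Suc)

definition "Yb t = (1 + 5 * \<rho>) * (w t)^2 - (1 - y t) / p t"

lemma y_le_lYb: "t < T ==> good t ==> y t \<le> l t * Yb t"
  using y_le by (simp add: good_def Yb_def)

lemma Yb_nonneg: "t < T ==> good t ==> 0 \<le> Yb t"
proof -
  assume t: "t < T" "good t"
  have "0 \<le> l t * Yb t" using y_le_lYb[OF t] y(1)[OF t(1)] by simp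
  then show ?thesis using l_pos[OF t(1)] by (simp add: zero_le_mult_iff)
qed

text \<open>Logarithmic increments become increments of \<open>g\<close> in the favourable
  direction, because \<open>g (Suc t) - g t\<close> is at least \<open>g t\<close> times the
  increment of \<open>ln g\<close>.\<close>

lemma g_step:
  assumes "t < T"
  shows "g t * Yb t - (E (Suc t) - E t) \<le> N * (g (Suc t) - g t)"
proof -
  have g: "g t > 0" "g (Suc t) > 0" using g_pos assms by auto
  have "ln (1 + (w t)^2) \<ge> (w t)^2 - ((w t)^2)^2"
    using w_le[OF assms] by (intro ln_one_plus_pos_lower_bound) auto
  moreover have "ln (1 + (1 - y t) / p t) \<le> (1 - y t) / p t"
    using P1_nonneg[OF assms] by (intro ln_add_one_self_le_self)
  ultimately have "Yb t - (5 * \<rho> * (w t)^2 + (w t) ^ 4) \<le> N * (ln (g (Suc t)) - ln (g t))"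
    unfolding ln_g_Suc[OF assms] Yb_def by (simp add: algebra_simps flip: power_mult)
  then have "g t * (Yb t - (5 * \<rho> * (w t)^2 + (w t) ^ 4)) \<le> g t * (N * (ln (g (Suc t)) - ln (g t)))"
    using g by (intro mult_left_mono) auto
  also have "\<dots> \<le> N * (g (Suc t) - g t)"
  proof -
    have "ln (g (Suc t) / g t) \<le> g (Suc t) / g t - 1" using g by (intro ln_le_minus_one) auto
    then have "g t * (ln (g (Suc t)) - ln (g t)) \<le> g (Suc t) - g t"
      using g by (simp add: ln_div field_simps)
    then have "N * (g t * (ln (g (Suc t)) - ln (g t))) \<le> N * (g (Suc t) - g t)"
      using N by (intro mult_left_mono) auto
    then show ?thesis by (simp add: mult_ac)
  qed
  finally show ?thesis by (simp add: E_Suc right_diff_distrib)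
qed

text \<open>The converse of \<open>Ng_X\<close> up to \<open>E\<close>: by \<open>l_g\<close> the
  increment of \<open>X\<close> is at most \<open>g t * Yb t\<close>, which \<open>g_step\<close>
  compares with that of \<open>N * g\<close>, and both sides start at \<open>N\<close>.\<close>

lemma X_le_Ng_E:
  assumes "t \<le> T" "\<And>s. s < t ==> good s"
  shows "X t \<le> N * g t + E t"
  using assms
proof (induction t)
  case (Suc t)
  have t: "t < T" "good t" using Suc.prems by auto
  have "y t \<le> g t * Yb t"
    using y_le_lYb[OF t] mult_right_mono[OF l_g[OF t(1)] Yb_nonneg[OF t]] by linarith
  then show ?case using Suc g_step[OF t(1)] X_Suc[OF t(1)] by (simp add: algebra_simps)
qed (simp add: init E_def)

text \<open>
  While \<open>p t\<close> is small compared with \<open>g t\<close>, the growth of the trace is at most half that of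
  \<open>N * g\<close>, which contradicts the arithmetic-geometric mean inequality \<open>Ng_X\<close> unless \<open>g\<close> stalls.
\<close>

lemma p_vs_g_aux:
  assumes "t \<le> T" "\<And>s. s < t ==> good s"
  shows "X t - N * g t / 2 - E t / 2 \<le> 2 * (N * p t) + E t / 2"
  using assms
proof (induction t)
  case (Suc t)
  have t: "t < T" "good t" using Suc.prems by auto
  have N0: "N > 0" using N by simp
  have pS: "N * p t \<le> N * p (Suc t)" using p_Suc[OF t(1)] y(2)[OF t(1)] N by (intro mult_left_mono) auto
  show ?case
  proof (cases "g t \<le> 2 * p t")
    \<comment> \<open>Here the bound is not inherited but holds afresh: \<open>w \<le> 1\<close>
      lets \<open>g\<close> at most double, so \<open>g (Suc t)\<close> is at most
      \<open>4 * p t\<close>.\<close>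
    case True
    have "ln (g (Suc t)) - ln (g t) \<le> N * (ln (g (Suc t)) - ln (g t)) \<or> ln (g (Suc t)) - ln (g t) \<le> 0"
      using N by (cases "ln (g (Suc t)) - ln (g t) \<le> 0") auto
    moreover have "ln (1 + (w t)^2) \<le> ln 2" using w_le[OF t(1)] by (simp add: add_pos_nonneg)
    moreover have "0 \<le> ln (1 + (1 - y t) / p t)" using P1_nonneg[OF t(1)] by simp
    moreover have "(0::real) \<le> ln 2" by simp
    ultimately have "ln (g (Suc t)) \<le> ln 2 + ln (g t)" using ln_g_Suc[OF t(1)] by linarith
    also have "\<dots> = ln (2 * g t)" using g_pos[of t] t by (simp add: ln_mult_pos)
    finally have "g (Suc t) \<le> 2 * g t" using g_pos[of t] g_pos[of "Suc t"] t by simp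
    then have "N * g (Suc t) \<le> N * (4 * p t)" using True N by (intro mult_left_mono) auto
    moreover have "X (Suc t) \<le> N * g (Suc t) + E (Suc t)" using Suc.prems by (intro X_le_Ng_E) auto
    ultimately show ?thesis using pS by linarith
  next
    case False
    have "y t \<le> p t * Yb t"
      using y_le_lYb[OF t] mult_right_mono[OF l_p[OF t(1)] Yb_nonneg[OF t]] by linarith
    also have "\<dots> \<le> g t * Yb t / 2"
      using mult_right_mono[of "p t" "g t / 2" "Yb t"] False Yb_nonneg[OF t] by simp
    finally have "y t \<le> N * (g (Suc t) - g t) / 2 + (E (Suc t) - E t) / 2"
      using g_step[OF t(1)] by (simp add: field_simps)
    then have "y t \<le> N * g (Suc t) / 2 - N * g t / 2 + (E (Suc t) - E t) / 2"
      by (simp add: right_diff_distrib diff_divide_distrib)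
    moreover have "X t - N * g t / 2 - E t / 2 \<le> 2 * (N * p t) + E t / 2" using Suc by auto
    moreover have "2 * (N * p t) \<le> 2 * (N * p (Suc t))" using pS by linarith
    moreover have "x' - A' / 2 - e' / 2 \<le> P' + e' / 2"
      if "z \<le> A' / 2 - A / 2 + (e' - e) / 2" "x - A / 2 - e / 2 \<le> P + e / 2" "P \<le> P'" "x' = x + z" "e \<le> e'"
      for x x' A A' P P' e e' z :: real
      using that by argo
    ultimately show ?thesis using X_Suc[OF t(1)] E_mono[OF t(1)] by blast
  qed
qed (use N in \<open>simp add: init E_def\<close>)

lemma g_le_p:
  assumes "t \<le> T" "\<And>s. s < t ==> good s"
  shows "N * g t \<le> 4 * (N * p t) + 2 * E t"
proof -
  have "N * g t / 2 - E t / 2 \<le> X t - N * g t / 2 - E t / 2" using Ng_X[OF assms(1)] by simp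
  also have "\<dots> \<le> 2 * (N * p t) + E t / 2" by (rule p_vs_g_aux[OF assms])
  finally show ?thesis by simp
qed

text \<open>64 makes the spectral factor \<open>1 - 4 * sqrt (1 / 64)\<close> equal to
  \<open>1 / 2\<close>. Then \<open>N * g \<le> 5 * (N * p)\<close> and
  \<open>X \<le> 2 * (N * g)\<close>, so that \<open>X + p\<close>, which exceeds \<open>t\<close>,
  is at most \<open>11 * (N * p)\<close>.\<close>

lemma good_late:
  assumes "t \<le> T" "\<And>s. s < t ==> good s" "E t \<le> g t / 64"
  shows "good t"
proof -
  have "X t \<le> N * g t + E t" by (rule X_le_Ng_E[OF assms(1,2)])
  then have Xg: "X t - N * g t \<le> (1 / 64) * g t" using assms(3) by simp
  have "sqrt (1 / 64) = 1 / (8::real)" by (simp add: real_sqrt_divide)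
  moreover have "qb t (1 - 4 * sqrt (1 / 64))" by (rule qb_near[OF assms(1) Xg]) simp
  ultimately have "qb t (1 / 2)" by (simp only:) simp
  then have 1: "qb t (kappa N)" by (rule qb_mono[OF assms(1)]) (use kappa_le in auto)
  have gN: "g t \<le> N * g t" using N g_pos[OF assms(1)] by simp
  have "N * g t \<le> 4 * (N * p t) + (1 / 32) * (N * g t)"
    using g_le_p[OF assms(1,2)] assms(3) gN by simp
  then have gp: "N * g t \<le> 5 * (N * p t)"
  proof -
    have "0 \<le> N * p t" using N p_ge[OF assms(1)] by simp
    moreover have "A \<le> 5 * B" if "A \<le> 4 * B + (1 / 32) * A" "0 \<le> B" for A B :: real using that by linarith
    ultimately show ?thesis using \<open>N * g t \<le> 4 * (N * p t) + (1 / 32) * (N * g t)\<close> by blast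
  qed
  have X2: "X t \<le> 2 * (N * g t)" using Xg gN g_pos[OF assms(1)] by linarith
  have Xp: "X t \<le> 10 * (N * p t)" using X2 gp by linarith
  have pN: "p t \<le> N * p t" using N p_ge[OF assms(1)] by simp
  have "real t + 1 \<le> 11 * (N * p t)" using X_p[OF assms(1)] Xp pN N by linarith
  then have "kappa N * (real t + 1) \<le> 1 / (11 * N) * (11 * (N * p t))"
    using kappa_le(2) kappa_pos N by (intro mult_mono) auto
  then have 2: "kappa N * (real t + 1) \<le> p t" using N by simp
  have "kappa N * X t \<le> 1 / (11 * N) * (2 * (N * g t))"
    using kappa_le(2) kappa_pos X2 X_pos[OF assms(1)] N by (intro mult_mono) auto
  then have 3: "kappa N * X t \<le> g t" using N g_pos[OF assms(1)] by simp
  show ?thesis using 1 2 3 by (simp add: good_def)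
qed

end

section \<open>Growth rates in the late phase\<close>

definition "R0 N = 2 / kappa N + N"
definition "c2 N = 1 / (sqrt (R0 N) * (1 + sqrt ((N + 1) * R0 N)))"
definition "c3 N = min (kappa_early N) (c2 N / 4)"
text \<open>In their respective scales, \<open>C1\<close> bounds \<open>y\<close>, \<open>C2\<close>
  bounds \<open>X\<close>, \<open>C0\<close> and \<open>C3\<close> bound \<open>g * w^2\<close> in
  the early and the late rounds, \<open>C4\<close> bounds the sum of these values and
  \<open>C5\<close> their maximum; \<open>C6\<close> combines both for \<open>E\<close>. All depend
  on \<open>N\<close> alone, as uniformity over runs demands.\<close>

definition "C1 N = 4 / (kappa N * c3 N) + 2 / kappa N"
definition "C2 N = 3 * C1 N + 2 * sqrt (N + 1)"
definition "C3 N = (C2 N / kappa N + C1 N) / kappa N"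
definition "C0 N = ((N + 1) / kappa N + 1) / kappa N"
definition "C4 N = 2 * sqrt (N + 1) * C0 N + 3 * C3 N"
definition "C5 N = max (C0 N) (C3 N * sqrt (N + 1))"
definition "C6 N = 5 * C4 N + 8 * C5 N * (N + 1)"

text \<open>Makes per-round bounds of order \<open>1 / sqrt t\<close> telescope.\<close>

lemma sqrt_Suc_diff: "1 / (3 * sqrt (real s + 1)) \<le> sqrt (real (Suc s) + 1) - sqrt (real s + 1)"
proof -
  let ?a = "sqrt (real s + 1)" and ?b = "sqrt (real (Suc s) + 1)"
  have a: "?a \<ge> 1" by simp
  have "(?b - ?a) * (?b + ?a) = 1" by (simp add: algebra_simps flip: power2_eq_square)
  moreover have "?b + ?a \<le> 3 * ?a"
  proof -
    have "real (Suc s) + 1 \<le> (2 * ?a)^2" by (simp add: power_mult_distrib)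
    then have "?b \<le> 2 * ?a" by (intro real_le_lsqrt) auto
    then show ?thesis by simp
  qed
  moreover have "?b - ?a \<ge> 0" by simp
  ultimately have "1 \<le> (?b - ?a) * (3 * ?a)" by (metis mult_left_mono)
  then show ?thesis using a by (simp add: field_simps)
qed

lemma le_of_sq_le_lin: "y \<le> B + A" if "y^2 \<le> A^2 + B * y" "0 \<le> A" "0 \<le> B" for y A B :: real
proof (rule ccontr)
  assume "\<not> y \<le> B + A"
  then have y: "y > B + A" by simp
  have "A^2 + B * y < y * y"
  proof -
    have "A * A \<le> A * y" using y that by (intro mult_left_mono) auto
    moreover have "(A + B) * y < y * y" using y that by (intro mult_strict_right_mono) auto
    ultimately show ?thesis by (simp add: power2_eq_square distrib_right)
  qed
  then show False using that(1) by (simp add: power2_eq_square)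
qed

lemma add_bound_step: "x' \<le> A' + B'" if "x \<le> A + B" "x' = x + z" "z \<le> B' - B" "A \<le> A'"
  for x x' z A A' B B' :: real
  using that by linarith

lemma constants_positive: "R0 N > 0" "R0 N \<ge> N" "c2 N > 0" "c3 N > 0" "c3 N \<le> kappa_early N" "c3 N \<le> c2 N / 4"
  "C1 N > 0" "C2 N > 0" "C3 N > 0" "C0 N > 0" "C4 N > 0" "C5 N > 0" "C6 N > 0" "C2 N \<ge> 3 * C1 N"
  if N: "N \<ge> 1" for N
proof -
  note k = kappa_positive[OF N]
  show R: "R0 N > 0" "R0 N \<ge> N" using k N by (simp_all add: R0_def add_pos_pos)
  have "sqrt (R0 N) > 0" "sqrt ((N + 1) * R0 N) > 0" using R N by auto
  then show c2: "c2 N > 0" by (simp add: c2_def add_pos_pos)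
  show c3: "c3 N > 0" "c3 N \<le> kappa_early N" "c3 N \<le> c2 N / 4" using c2 k by (auto simp: c3_def)
  show C1: "C1 N > 0" using k c3 by (simp add: C1_def add_pos_pos)
  have s: "sqrt (N + 1) > 0" using N by simp
  show C2: "C2 N > 0" "C2 N \<ge> 3 * C1 N" using C1 s by (simp_all add: C2_def add_pos_pos)
  show C3: "C3 N > 0" using C2 C1 k by (simp add: C3_def add_pos_pos)
  show C0: "C0 N > 0" using k N by (simp add: C0_def add_pos_pos)
  show C4: "C4 N > 0" using C0 C3 s by (simp add: C4_def add_pos_pos)
  show C5: "C5 N > 0" using C0 by (auto simp: C5_def)
  show "C6 N > 0" using C4 C5 N by (simp add: C6_def add_pos_pos)
qed

context scalar_run
begin

lemmas const_pos = constants_positive[OF N]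

text \<open>A round is late when \<open>t + d > \<beta>^2\<close>; the initial phase covers one more round.\<close>

definition "late t \<longleftrightarrow> \<beta>^2 < real t + (N + 1)"

lemma late_beta_le: "late t ==> \<beta> \<le> sqrt (N + 1) * sqrt (real t + 1)"
proof -
  assume "late t"
  then have "\<beta>^2 \<le> (N + 1) * (real t + 1)" using N by (simp add: late_def algebra_simps) (smt (verit) mult_nonneg_nonneg of_nat_0_le_iff)
  then have "\<beta> \<le> sqrt ((N + 1) * (real t + 1))" using \<beta> by (intro real_le_rsqrt) auto
  then show ?thesis by (simp add: real_sqrt_mult)
qed

lemma late_beta_sq_le: "late t ==> \<beta>^2 \<le> sqrt (N + 1) * (\<beta> * sqrt (real t + 1))"
  using mult_left_mono[OF late_beta_le, of t \<beta>] \<beta> by (simp add: power2_eq_square mult_ac)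

lemma late_mono: "late s ==> s \<le> t ==> late t" by (auto simp: late_def)

text \<open>Induction over the late rounds; the base case is the last round of the initial phase.\<close>

lemma late_induct [consumes 3, case_names base step]:
  assumes "t \<le> T" "late t" "N + 1 \<le> \<beta>^2"
    and base: "\<And>t. t \<le> T ==> late t ==> real t + (N + 1) \<le> \<beta>^2 + 1 ==> P t"
    and step: "\<And>s. s < t ==> s < T ==> late s ==> P s ==> P (Suc s)"
  shows "P t"
  using assms(1,2) step
proof (induction t)
  case 0
  then show ?case using assms(3) by (simp add: late_def)
next
  case (Suc t)
  show ?case
  proof (cases "late t")
    case True
    then show ?thesis using Suc by auto
  next
    case False
    then have "real (Suc t) + (N + 1) \<le> \<beta>^2 + 1" by (simp add: late_def)
    then show ?thesis using base Suc.prems by blast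
  qed
qed

text \<open>A small width forces a large \<open>g\<close>: \<open>\<beta> = l * \<mu> * w\<close> is
  at most \<open>g * (1 + \<beta> * w) * w\<close>, and in the late phase \<open>\<beta>\<close> is
  at most \<open>sqrt ((N + 1) * (t + 1))\<close>, so \<open>\<beta> * w\<close> stays bounded.
  \<open>c2\<close> is the threshold that results.\<close>

lemma w_sq_lower:
  assumes "t < T" "late t" "g t \<le> c2 N * \<beta> * sqrt (real t + 1)"
  shows "R0 N / (real t + 1) \<le> (w t)^2"
proof (rule ccontr)
  let ?s = "sqrt (real t + 1)" and ?r = "sqrt (R0 N)"
  assume "\<not> ?thesis"
  then have "(w t)^2 < (?r / ?s)^2" using const_pos(1) by (simp add: power_divide)
  then have w: "w t < ?r / ?s" using const_pos(1) by (intro power_less_imp_less_base[of "w t" 2]) auto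
  have s: "?s > 0" by simp
  have "\<beta> / g t \<le> \<mu> t * w t"
  proof -
    have "\<beta> = l t * (\<mu> t * w t)" by (simp add: l_eq[OF assms(1)])
    also have "\<dots> \<le> g t * (\<mu> t * w t)"
      using l_g[OF assms(1)] mu_ge_1[OF assms(1)] w_pos[OF assms(1)] by (intro mult_right_mono) auto
    finally show ?thesis using g_pos[of t] assms(1) by (simp add: field_simps)
  qed
  also have "\<dots> \<le> (1 + \<beta> * w t) * w t"
    using mu_le[OF assms(1)] w_pos[OF assms(1)] by (intro mult_right_mono) auto
  also have "\<dots> < (1 + sqrt (N + 1) * ?r) * (?r / ?s)"
  proof (rule mult_le_less_imp_less)
    have "\<beta> * w t \<le> (sqrt (N + 1) * ?s) * (?r / ?s)"
      using late_beta_le[OF assms(2)] w w_pos[OF assms(1)] \<beta> N by (intro mult_mono) auto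
    then show "1 + \<beta> * w t \<le> 1 + sqrt (N + 1) * ?r" using s by simp
  qed (use w w_pos[OF assms(1)] \<beta> in \<open>auto simp: add_pos_nonneg less_imp_le\<close>)
  also have "\<dots> = 1 / (c2 N * ?s)" using const_pos(1) N by (simp add: c2_def real_sqrt_mult mult.commute)
  finally have "\<beta> * (c2 N * ?s) < g t"
    using g_pos[of t] assms(1) const_pos(3) s by (simp add: field_simps)
  then show False using assms(3) by (simp add: mult_ac)
qed

text \<open>A restoring drift. Below the threshold \<open>c2\<close> the gain in \<open>ln D\<close>
  is at least \<open>R0 N / (2 * (t + 1))\<close> and that in \<open>ln p\<close> at most
  \<open>1 / (kappa N * (t + 1))\<close>; \<open>R0\<close> is chosen so that the difference is
  \<open>N / (2 * (t + 1))\<close>, enough to keep up with \<open>N * ln (sqrt (t + 1))\<close>.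
  Above the threshold one round costs \<open>g\<close> at most a factor 2, and another factor 2
  covers the growth of \<open>sqrt (t + 1)\<close>, whence \<open>c3 \<le> c2 / 4\<close>.\<close>

lemma g_late:
  assumes "t \<le> T" "late t" "\<And>s. s < t ==> good s" "N + 1 + R0 N \<le> \<beta>^2"
  shows "c3 N * \<beta> * sqrt (real t + 1) \<le> g t"
proof -
  have "N + 1 \<le> \<beta>^2" using assms(4) const_pos(1) by simp
  with assms(1,2) show ?thesis
  proof (induction rule: late_induct)
    case (base t)
    have "c3 N * (\<beta> * sqrt (real t + 1)) \<le> kappa_early N * (real t + (N + 1))"
    proof (rule mult_mono)
      have "\<beta> * sqrt (real t + 1) \<le> sqrt (real t + (N + 1)) * sqrt (real t + (N + 1))"
        using base(2) N \<beta> by (intro mult_mono real_le_rsqrt) (auto simp: late_def)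
      then show "\<beta> * sqrt (real t + 1) \<le> real t + (N + 1)" using N by simp
    qed (use const_pos kappa_pos \<beta> in auto)
    then show ?case using g_early[OF base(1,3)] by simp
  next
    case (step s)
    have gs: "good s" using step assms(3) by simp
    have p: "1 / p s \<le> 1 / (kappa N * (real s + 1))"
      using gs kappa_pos p_ge[of s] step by (intro divide_left_mono) (auto simp: good_def)
    have "1 - y s \<le> 1" using y(1) step by simp
    then have "(1 - y s) / p s \<le> 1 / p s" using p_ge[of s] step by (intro divide_right_mono) auto
    moreover have "ln (1 + (1 - y s) / p s) \<le> (1 - y s) / p s"
      using P1_nonneg step by (intro ln_add_one_self_le_self) auto
    ultimately have lnp: "ln (1 + (1 - y s) / p s) \<le> 1 / (kappa N * (real s + 1))" using p by linarith
    have sR: "R0 N \<le> real s + 1" using assms(4) step(3) by (simp add: late_def)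
    have g0: "g s > 0" "g (Suc s) > 0" using g_pos step by auto
    have ss: "sqrt (real (Suc s) + 1) \<le> 2 * sqrt (real s + 1)"
      by (intro real_le_lsqrt) (auto simp: power_mult_distrib)
    show ?case
    proof (cases "g s \<le> c2 N * \<beta> * sqrt (real s + 1)")
      case True
      let ?z = "R0 N / (real s + 1)"
      have "?z / 2 \<le> ?z / (1 + ?z)"
        using sR const_pos(1) by (intro divide_left_mono) (auto simp: add_pos_pos field_simps)
      also have "\<dots> \<le> ln (1 + ?z)" using const_pos(1) by (intro ln_one_plus_ge) auto
      also have "\<dots> \<le> ln (1 + (w s)^2)"
        using w_sq_lower[OF step(2,3) True] const_pos(1) by (simp add: add_pos_nonneg)
      finally have "?z / 2 - 1 / (kappa N * (real s + 1)) \<le> N * (ln (g (Suc s)) - ln (g s))"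
        unfolding ln_g_Suc[OF step(2)] using lnp by linarith
      moreover have "?z / 2 - 1 / (kappa N * (real s + 1)) = N * (1 / (2 * (real s + 1)))"
      proof -
        define c where "c = 1 / (real s + 1)"
        have "?z = R0 N * c" "1 / (kappa N * (real s + 1)) = c / kappa N" "1 / (2 * (real s + 1)) = c / 2"
          by (simp_all add: c_def)
        then show ?thesis by (simp only:) (simp add: R0_def algebra_simps)
      qed
      ultimately have 1: "1 / (2 * (real s + 1)) \<le> ln (g (Suc s)) - ln (g s)"
        using N by (simp only: mult_le_cancel_left_pos)
      have "ln (sqrt (real (Suc s) + 1)) - ln (sqrt (real s + 1)) = ln (1 + 1 / (real s + 1)) / 2"
      proof -
        have "1 + 1 / (real s + 1) = (real (Suc s) + 1) / (real s + 1)" by (simp add: field_simps)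
        moreover have "ln ((real (Suc s) + 1) / (real s + 1)) = ln (real (Suc s) + 1) - ln (real s + 1)"
          by (subst ln_div) auto
        ultimately show ?thesis by (simp only: ln_sqrt diff_divide_distrib simp_thms)
      qed
      also have "\<dots> \<le> (1 / (real s + 1)) / 2" by (intro divide_right_mono ln_add_one_self_le_self) auto
      also have "\<dots> = 1 / (2 * (real s + 1))" by simp
      finally have "ln (g s) + ln (sqrt (real (Suc s) + 1)) \<le> ln (g (Suc s)) + ln (sqrt (real s + 1))"
        using 1 by linarith
      then have "ln (g s * sqrt (real (Suc s) + 1)) \<le> ln (g (Suc s) * sqrt (real s + 1))"
        using g0 by (subst (1 2) ln_mult_pos) auto
      then have le: "g s * sqrt (real (Suc s) + 1) \<le> g (Suc s) * sqrt (real s + 1)"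
        using g0 by (subst (asm) ln_le_cancel_iff) auto
      have "(c3 N * \<beta> * sqrt (real s + 1)) * sqrt (real (Suc s) + 1) \<le> g s * sqrt (real (Suc s) + 1)"
        using step(4) by (intro mult_right_mono) auto
      also have "\<dots> \<le> g (Suc s) * sqrt (real s + 1)" by (rule le)
      also have "(c3 N * \<beta> * sqrt (real s + 1)) * sqrt (real (Suc s) + 1)
          = (c3 N * \<beta> * sqrt (real (Suc s) + 1)) * sqrt (real s + 1)" by (simp only: mult_ac)
      finally show ?thesis by (rule mult_right_le_imp_le) simp
    next
      case False
      have "1 / (kappa N * (real s + 1)) \<le> 1 / 2"
      proof -
        have "2 / kappa N \<le> real s + 1" using sR N by (simp add: R0_def)
        then show ?thesis using kappa_pos by (simp add: field_simps)
      qed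
      then have "- (1 / 2) \<le> N * (ln (g (Suc s)) - ln (g s))"
        unfolding ln_g_Suc[OF step(2)] using lnp by (smt (verit) ln_ge_zero zero_le_power2)
      moreover have "- (1 / 2) \<le> d" if "- (1 / 2) \<le> N * d" for d
      proof (cases "d \<ge> 0")
        case False
        then have "N * d \<le> 1 * d" using N by (intro mult_right_mono_neg) auto
        then show ?thesis using that by linarith
      qed simp
      ultimately have "- (1 / 2) \<le> ln (g (Suc s)) - ln (g s)" by blast
      moreover have "(1::real) / 2 \<le> ln 2" using ln_one_plus_ge[of 1] by simp
      moreover have "ln (2 * g (Suc s)) = ln 2 + ln (g (Suc s))" using g0 by (intro ln_mult_pos) auto
      ultimately have "ln (g s) \<le> ln (2 * g (Suc s))" by linarith
      then have "g s \<le> 2 * g (Suc s)" using g0 by simp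
      moreover have "(c2 N / 4) * \<beta> * sqrt (real (Suc s) + 1) \<le> (c2 N / 4) * \<beta> * (2 * sqrt (real s + 1))"
        using ss const_pos \<beta> by (intro mult_left_mono) auto
      moreover have "c3 N * \<beta> * sqrt (real (Suc s) + 1) \<le> (c2 N / 4) * \<beta> * sqrt (real (Suc s) + 1)"
        using const_pos \<beta> by (intro mult_right_mono) auto
      moreover have "(c2 N / 4) * \<beta> * (2 * sqrt (real s + 1)) = c2 N * \<beta> * sqrt (real s + 1) / 2" by simp
      ultimately show ?thesis using False by linarith
    qed
  qed
qed

lemma y_le_bw:
  assumes "t < T" "good t"
  shows "y t \<le> 2 * \<beta> * w t"
proof -
  have "y t \<le> l t * ((1 + 5 * \<rho>) * (w t)^2)"
    using y_le_lYb[OF assms] P1_nonneg[OF assms(1)] l_pos[OF assms(1)]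
    by (smt (verit) Yb_def mult_left_mono)
  also have "\<dots> \<le> l t * (2 * (w t)^2)"
    using \<rho> l_pos[OF assms(1)] by (intro mult_left_mono mult_right_mono) auto
  also have "\<dots> = 2 * (l t * w t) * w t" by (simp add: power2_eq_square)
  also have "l t * w t \<le> \<beta>"
  proof -
    have "(l t * w t) * 1 \<le> (l t * w t) * \<mu> t"
      using mu_ge_1[OF assms(1)] l_pos[OF assms(1)] w_pos[OF assms(1)] by (intro mult_left_mono) auto
    then show ?thesis using l_eq[OF assms(1)] by (simp add: mult_ac)
  qed
  finally show ?thesis using w_pos[OF assms(1)] by simp
qed

text \<open>\<open>y^2\<close> is at most \<open>4 * \<beta>^2 * w^2\<close>, and domination bounds
  \<open>w^2\<close> by \<open>1 / p + y / g\<close> up to \<open>kappa\<close>. This is a quadratic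
  inequality in \<open>y\<close>, and with \<open>p\<close> of order \<open>t\<close> and
  \<open>g\<close> of order \<open>\<beta> * sqrt t\<close> both of its coefficients have the
  claimed order.\<close>

lemma y_late:
  assumes "t < T" "late t" "\<And>s. s \<le> t ==> good s" "N + 1 + R0 N \<le> \<beta>^2"
  shows "y t \<le> C1 N * \<beta> / sqrt (real t + 1)"
proof -
  let ?s = "sqrt (real t + 1)"
  have g: "c3 N * \<beta> * ?s \<le> g t" using assms by (intro g_late) auto
  have gs: "good t" using assms by simp
  have pos: "c3 N * \<beta> * ?s > 0" using const_pos \<beta> by simp
  have w: "(w t)^2 \<le> (1 / p t + y t / g t) / kappa N"
  proof -
    have "kappa N * (w t)^2 \<le> (1 - y t) / p t + y t / g t"
      using gs kappa_pos assms(1) by (intro qb_w) (auto simp: good_def)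
    also have "(1 - y t) / p t \<le> 1 / p t" using y(1)[OF assms(1)] p_ge[of t] assms(1) by (intro divide_right_mono) auto
    finally show ?thesis using kappa_pos by (simp add: field_simps)
  qed
  have "(y t)^2 \<le> (2 * \<beta> * w t)^2"
    using y_le_bw[OF assms(1) gs] y(1)[OF assms(1)] by (intro power_mono) auto
  also have "\<dots> = 4 * \<beta>^2 * (w t)^2" by (simp add: power_mult_distrib)
  also have "\<dots> \<le> 4 * \<beta>^2 * ((1 / p t + y t / g t) / kappa N)" using w by (intro mult_left_mono) auto
  also have "\<dots> \<le> 4 * \<beta>^2 * ((1 / (kappa N * (real t + 1)) + y t / (c3 N * \<beta> * ?s)) / kappa N)"
  proof -
    have "1 / p t \<le> 1 / (kappa N * (real t + 1))"
      using gs kappa_pos p_ge[of t] assms by (intro divide_left_mono) (auto simp: good_def)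
    moreover have "y t / g t \<le> y t / (c3 N * \<beta> * ?s)"
      using g pos y(1)[OF assms(1)] g_pos[of t] assms(1) by (intro divide_left_mono) auto
    ultimately show ?thesis using kappa_pos by (intro mult_left_mono divide_right_mono add_mono) auto
  qed
  also have "\<dots> = (2 * \<beta> / (kappa N * ?s))^2 + (4 * \<beta> / (kappa N * c3 N * ?s)) * y t"
  proof -
    have "4 * B^2 * ((1 / (k * (s * s)) + z / (c * B * s)) / k) = (2 * B / (k * s))^2 + (4 * B / (k * c * s)) * z"
      if "k > 0" "c > 0" "B > 0" "s > 0" for k c B s z :: real
      using that by (simp add: field_simps power2_eq_square)
    from this[of "kappa N" "c3 N" \<beta> ?s "y t"] show ?thesis using kappa_pos const_pos \<beta> by simp
  qed
  finally have "y t \<le> 4 * \<beta> / (kappa N * c3 N * ?s) + 2 * \<beta> / (kappa N * ?s)"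
    by (rule le_of_sq_le_lin) (use kappa_pos const_pos \<beta> in simp_all)
  also have "\<dots> = C1 N * \<beta> / ?s" by (simp add: C1_def distrib_right add_divide_distrib)
  finally show ?thesis .
qed

lemma X_late:
  assumes "t \<le> T" "late t" "\<And>s. s < t ==> good s" "N + 1 + R0 N \<le> \<beta>^2"
  shows "X t \<le> C2 N * \<beta> * sqrt (real t + 1)"
proof -
  have aux: "X t \<le> 2 * (sqrt (N + 1) * (\<beta> * sqrt (real t + 1))) + 3 * C1 N * \<beta> * sqrt (real t + 1)"
    (is "_ \<le> ?f t")
  proof -
    have "N + 1 \<le> \<beta>^2" using assms(4) const_pos(1) by simp
    with assms(1,2) show ?thesis
    proof (induction rule: late_induct)
      case (base t)
      have "X t \<le> \<beta>^2 + 1" using X_le[OF base(1)] base(3) by simp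
      also have "\<dots> \<le> 2 * \<beta>^2" using \<beta> by simp
      also have "\<dots> \<le> 2 * (sqrt (N + 1) * (\<beta> * sqrt (real t + 1)))" using late_beta_sq_le[OF base(2)] by simp
      finally have "X t \<le> 2 * (sqrt (N + 1) * (\<beta> * sqrt (real t + 1)))" .
      moreover have "0 \<le> 3 * C1 N * \<beta> * sqrt (real t + 1)" using const_pos \<beta> by simp
      ultimately show ?case by linarith
    next
      case (step s)
      have "y s \<le> C1 N * \<beta> / sqrt (real s + 1)" using step assms by (intro y_late) auto
      also have "\<dots> = 3 * C1 N * \<beta> * (1 / (3 * sqrt (real s + 1)))" by simp
      also have "\<dots> \<le> 3 * C1 N * \<beta> * (sqrt (real (Suc s) + 1) - sqrt (real s + 1))"
        using sqrt_Suc_diff const_pos \<beta> by (intro mult_left_mono) auto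
      finally have 1: "y s \<le> 3 * C1 N * \<beta> * sqrt (real (Suc s) + 1) - 3 * C1 N * \<beta> * sqrt (real s + 1)"
        by (simp add: right_diff_distrib)
      have "2 * (sqrt (N + 1) * (\<beta> * sqrt (real s + 1))) \<le> 2 * (sqrt (N + 1) * (\<beta> * sqrt (real (Suc s) + 1)))"
        using N \<beta> by (intro mult_left_mono) auto
      then show ?case by (rule add_bound_step[OF step(4) X_Suc[OF step(2)] 1])
    qed
  qed
  then show ?thesis by (simp add: C2_def algebra_simps)
qed

lemma gw_early:
  assumes "t < T" "good t"
  shows "g t * (w t)^2 \<le> C0 N"
proof -
  have t: "t \<le> T" using assms by simp
  have "kappa N * (w t)^2 \<le> (1 - y t) / p t + y t / g t"
    using assms kappa_pos by (intro qb_w) (auto simp: good_def)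
  also have "\<dots> \<le> 1 / p t + 1 / g t"
    using y[OF assms(1)] p_ge[OF t] g_pos[OF t] by (intro add_mono divide_right_mono) auto
  finally have "g t * (kappa N * (w t)^2) \<le> g t * (1 / p t + 1 / g t)"
    using g_pos[OF t] by (intro mult_left_mono) auto
  also have "\<dots> = g t / p t + 1" using g_pos[OF t] by (simp add: distrib_left)
  also have "g t / p t \<le> (N + 1) / kappa N"
  proof -
    have "g t \<le> real t + (N + 1)" using g_le[OF t] X_le[OF t] by simp
    also have "\<dots> \<le> (N + 1) * (real t + 1)" using N by (simp add: algebra_simps)
    finally have "g t * (kappa N * (real t + 1)) \<le> (N + 1) * (real t + 1) * p t"
      using assms(2) N kappa_pos p_ge[OF t] by (intro mult_mono) (auto simp: good_def)
    then have "(g t * kappa N) * (real t + 1) \<le> ((N + 1) * p t) * (real t + 1)" by (simp add: mult_ac)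
    then have "g t * kappa N \<le> (N + 1) * p t" by (rule mult_right_le_imp_le) simp
    then show ?thesis using kappa_pos p_ge[OF t] by (simp add: field_simps)
  qed
  finally show ?thesis using kappa_pos by (simp add: C0_def field_simps)
qed

lemma gw_late:
  assumes "t < T" "late t" "\<And>s. s \<le> t ==> good s" "N + 1 + R0 N \<le> \<beta>^2"
  shows "g t * (w t)^2 \<le> C3 N * \<beta> / sqrt (real t + 1)"
proof -
  let ?s = "sqrt (real t + 1)"
  have t: "t \<le> T" and gs: "good t" using assms by auto
  have "kappa N * (w t)^2 \<le> (1 - y t) / p t + y t / g t"
    using assms gs kappa_pos by (intro qb_w) (auto simp: good_def)
  also have "(1 - y t) / p t \<le> 1 / (kappa N * (real t + 1))"
    using y[OF assms(1)] gs kappa_pos p_ge[OF t] by (intro frac_le) (auto simp: good_def)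
  finally have "g t * (kappa N * (w t)^2) \<le> g t * (1 / (kappa N * (real t + 1)) + y t / g t)"
    using g_pos[OF t] by (intro mult_left_mono) auto
  also have "\<dots> = g t / (kappa N * (real t + 1)) + y t" using g_pos[OF t] by (simp add: distrib_left)
  also have "\<dots> \<le> C2 N * \<beta> * ?s / (kappa N * (real t + 1)) + C1 N * \<beta> / ?s"
  proof (intro add_mono divide_right_mono)
    have "X t \<le> C2 N * \<beta> * ?s" using assms t by (intro X_late) auto
    then show "g t \<le> C2 N * \<beta> * ?s" using g_le[OF t] by simp
    show "y t \<le> C1 N * \<beta> / ?s" by (rule y_late[OF assms])
  qed (use kappa_pos in auto)
  also have "\<dots> = (C2 N / kappa N + C1 N) * \<beta> / ?s"
  proof -
    have "C * B * s / (k * (s * s)) = C / k * B / s" if "s > 0" "k > 0" for C B s k :: real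
      using that by simp
    from this[of ?s "kappa N" "C2 N" \<beta>]
    have "C2 N * \<beta> * ?s / (kappa N * (real t + 1)) = C2 N / kappa N * \<beta> / ?s"
      using kappa_pos by simp
    then show ?thesis by (simp add: distrib_right add_divide_distrib)
  qed
  finally show ?thesis using kappa_pos by (simp add: C3_def field_simps)
qed

lemma gw_le_C5:
  assumes "t < T" "\<And>s. s \<le> t ==> good s" "N + 1 + R0 N \<le> \<beta>^2"
  shows "g t * (w t)^2 \<le> C5 N"
proof (cases "late t")
  case True
  have "g t * (w t)^2 \<le> C3 N * (\<beta> / sqrt (real t + 1))" using gw_late[OF assms(1) True assms(2,3)] by simp
  also have "\<dots> \<le> C3 N * sqrt (N + 1)"
    using late_beta_le[OF True] const_pos by (intro mult_left_mono) (auto simp: field_simps)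
  finally show ?thesis by (simp add: C5_def)
next
  case False
  then show ?thesis using gw_early[OF assms(1)] assms(2) by (simp add: C5_def)
qed

lemma sum_gw_late:
  assumes "t \<le> T" "late t" "\<And>s. s < t ==> good s" "N + 1 + R0 N \<le> \<beta>^2"
  shows "(\<Sum>s<t. g s * (w s)^2) \<le> C4 N * \<beta> * sqrt (real t + 1)"
proof -
  have "(\<Sum>s<t. g s * (w s)^2) \<le> 2 * sqrt (N + 1) * C0 N * (\<beta> * sqrt (real t + 1)) + 3 * C3 N * \<beta> * sqrt (real t + 1)"
  proof -
    have "N + 1 \<le> \<beta>^2" using assms(4) const_pos(1) by simp
    with assms(1,2) show ?thesis
    proof (induction rule: late_induct)
      case (base t)
      have "(\<Sum>s<t. g s * (w s)^2) \<le> (\<Sum>s<t. C0 N)"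
      proof (rule sum_mono)
        fix s assume "s \<in> {..<t}"
        then show "g s * (w s)^2 \<le> C0 N"
          using base(1,3) by (intro gw_early good_early) auto
      qed
      also have "\<dots> = C0 N * real t" by simp
      also have "\<dots> \<le> C0 N * (2 * (sqrt (N + 1) * (\<beta> * sqrt (real t + 1))))"
      proof (rule mult_left_mono)
        have "real t \<le> \<beta>^2" using base(3) N by linarith
        moreover have "\<beta>^2 \<le> sqrt (N + 1) * (\<beta> * sqrt (real t + 1))" by (rule late_beta_sq_le[OF base(2)])
        moreover have "0 \<le> \<beta>^2" by simp
        ultimately show "real t \<le> 2 * (sqrt (N + 1) * (\<beta> * sqrt (real t + 1)))" by linarith
      qed (use const_pos in auto)
      also have "\<dots> = 2 * sqrt (N + 1) * C0 N * (\<beta> * sqrt (real t + 1))" by (simp only: mult_ac)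
      finally show ?case using const_pos \<beta> by (intro add_increasing2) auto
    next
      case (step s)
      have "g s * (w s)^2 \<le> C3 N * \<beta> / sqrt (real s + 1)" using step assms by (intro gw_late) auto
      also have "\<dots> = 3 * C3 N * \<beta> * (1 / (3 * sqrt (real s + 1)))" by simp
      also have "\<dots> \<le> 3 * C3 N * \<beta> * (sqrt (real (Suc s) + 1) - sqrt (real s + 1))"
        using sqrt_Suc_diff const_pos \<beta> by (intro mult_left_mono) auto
      finally have 1: "g s * (w s)^2 \<le> 3 * C3 N * \<beta> * sqrt (real (Suc s) + 1) - 3 * C3 N * \<beta> * sqrt (real s + 1)"
        by (simp add: right_diff_distrib)
      have "2 * sqrt (N + 1) * C0 N * (\<beta> * sqrt (real s + 1)) \<le> 2 * sqrt (N + 1) * C0 N * (\<beta> * sqrt (real (Suc s) + 1))"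
        using N \<beta> const_pos by (intro mult_left_mono) auto
      then show ?case by (rule add_bound_step[OF step(4) sum.lessThan_Suc 1])
    qed
  qed
  then show ?thesis by (simp add: C4_def algebra_simps)
qed

text \<open>The elliptical potential bound: \<open>w^2 / 2 \<le> ln (1 + w^2)\<close> for
  \<open>w \<le> 1\<close>, summed along the product formula for the determinant.\<close>

lemma sum_w_le:
  assumes "t \<le> T"
  shows "(\<Sum>s<t. (w s)\<^sup>2) \<le> 2 * ln (D t)"
  using assms
proof (induction t)
  case (Suc t)
  have t: "t < T" using Suc by simp
  have "ln (D (Suc t)) = ln (D t) + ln (1 + (w t)^2)"
    unfolding D_Suc[OF t] using D_ge[of t] t by (intro ln_mult_pos) (auto simp: add_pos_nonneg)
  moreover have "(w t)^2 / 2 \<le> (w t)^2 / (1 + (w t)^2)"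
    using w_le[OF t] w_pos[OF t] by (intro divide_left_mono) (auto simp: add_pos_pos)
  moreover have "(w t)^2 / (1 + (w t)^2) \<le> ln (1 + (w t)^2)" by (intro ln_one_plus_ge) simp
  moreover have "(\<Sum>s<t. (w s)\<^sup>2) \<le> 2 * ln (D t)" using Suc by simp
  ultimately show ?case unfolding sum.lessThan_Suc by linarith
qed (simp add: init)

text \<open>The part with \<open>\<rho>\<close> has order \<open>\<rho> * \<beta> * sqrt t\<close>.
  In the quartic part one factor \<open>g * w^2\<close> is bounded and the remaining sum of
  \<open>w^2\<close> is logarithmic, hence at most of order \<open>sqrt t\<close>, a fraction
  \<open>1 / \<beta>\<close> of the scale \<open>\<beta> * sqrt t\<close>.\<close>

lemma E_late:
  assumes "t \<le> T" "late t" "\<And>s. s < t ==> good s" "N + 1 + R0 N \<le> \<beta>^2"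
  shows "E t \<le> C6 N * (\<rho> + 1 / \<beta>) * (\<beta> * sqrt (real t + 1))"
proof -
  let ?h = "\<beta> * sqrt (real t + 1)"
  have h: "?h > 0" using \<beta> by simp
  have "E t = 5 * \<rho> * (\<Sum>s<t. g s * (w s)^2) + (\<Sum>s<t. g s * (w s)^2 * (w s)^2)"
    unfolding E_def by (simp add: sum_distrib_left distrib_left sum.distrib mult_ac flip: power_add)
  also have "(\<Sum>s<t. g s * (w s)^2 * (w s)^2) \<le> (\<Sum>s<t. C5 N * (w s)^2)"
    using assms by (intro sum_mono mult_right_mono gw_le_C5) auto
  also have "\<dots> = C5 N * (\<Sum>s<t. (w s)\<^sup>2)" by (simp add: sum_distrib_left)
  also have "\<dots> \<le> C5 N * (2 * ((N + 1) * (4 * sqrt (real t + 1))))"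
  proof (rule mult_left_mono)
    have "ln (1 + real t) \<le> 4 * sqrt (real t + 1)"
    proof -
      have "ln (1 + real t) = 2 * ln (sqrt (1 + real t))" by (simp add: ln_sqrt)
      also have "\<dots> \<le> 2 * sqrt (1 + real t)"
        using ln_le_minus_one[of "sqrt (1 + real t)"] by (simp add: add_pos_nonneg)
      also have "\<dots> \<le> 4 * sqrt (real t + 1)" by (simp add: add.commute)
      finally show ?thesis .
    qed
    then have "(N + 1) * ln (1 + real t) \<le> (N + 1) * (4 * sqrt (real t + 1))" using N by (intro mult_left_mono) auto
    then show "(\<Sum>s<t. (w s)\<^sup>2) \<le> 2 * ((N + 1) * (4 * sqrt (real t + 1)))"
      using sum_w_le[OF assms(1)] ln_D[OF assms(1)] by linarith
  qed (use const_pos in auto)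
  also have "\<dots> = 8 * C5 N * (N + 1) * (1 / \<beta>) * ?h" using \<beta> by simp
  also have "5 * \<rho> * (\<Sum>s<t. g s * (w s)^2) \<le> 5 * \<rho> * (C4 N * \<beta> * sqrt (real t + 1))"
    using sum_gw_late[OF assms] \<rho> by (intro mult_left_mono) auto
  finally have "E t \<le> (5 * C4 N * \<rho> + 8 * C5 N * (N + 1) * (1 / \<beta>)) * ?h" by (simp add: algebra_simps)
  also have "\<dots> \<le> (C6 N * \<rho> + C6 N * (1 / \<beta>)) * ?h"
    using const_pos N \<rho> \<beta> h by (intro mult_right_mono add_mono) (auto simp: C6_def)
  finally show ?thesis by (simp add: distrib_left)
qed

lemma E_le_g:
  assumes "t \<le> T" "late t" "\<And>s. s < t ==> good s" "N + 1 + R0 N \<le> \<beta>^2"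
  shows "E t \<le> C6 N * (\<rho> + 1 / \<beta>) / c3 N * g t"
proof -
  have "\<beta> * sqrt (real t + 1) \<le> g t / c3 N"
    using g_late[OF assms] const_pos by (simp add: field_simps)
  then have "C6 N * (\<rho> + 1 / \<beta>) * (\<beta> * sqrt (real t + 1)) \<le> C6 N * (\<rho> + 1 / \<beta>) * (g t / c3 N)"
    using const_pos \<rho> \<beta> by (intro mult_left_mono) auto
  then show ?thesis using E_late[OF assms] by simp
qed

text \<open>Closes the circle: \<open>good\<close> at the earlier rounds makes \<open>E\<close>
  small against \<open>g\<close>, and that is what \<open>good_late\<close> asks for. Rounds before
  the late phase are good without any history.\<close>

theorem all_good:
  assumes "N + 1 + R0 N \<le> \<beta>^2" "C6 N * (\<rho> + 1 / \<beta>) / c3 N \<le> 1 / 64" "t \<le> T"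
  shows "good t"
  using assms(3)
proof (induction t rule: less_induct)
  case (less t)
  have gs: "good s" if "s < t" for s using less that by simp
  show ?case
  proof (cases "late t")
    case True
    have "E t \<le> C6 N * (\<rho> + 1 / \<beta>) / c3 N * g t" by (rule E_le_g[OF less.prems True gs assms(1)])
    also have "\<dots> \<le> 1 / 64 * g t" using assms(2) g_pos[OF less.prems] by (intro mult_right_mono) auto
    finally have "E t \<le> g t / 64" by simp
    show ?thesis
    proof (rule good_late[OF less.prems])
      show "good s" if "s < t" for s by (rule gs[OF that])
    qed fact
  next
    case False
    then have "real t + (N + 1) \<le> \<beta>^2 + 1" unfolding late_def by linarith
    then show ?thesis by (rule good_early[OF less.prems])
  qed
qed

end

section \<open>Sharp growth constants\<close>

lemma square_growth_lower:
  fixes q :: "nat \<Rightarrow> real"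
  assumes t1: "5 \<le> t1" "t1 \<le> T" and N: "N \<ge> 1" and m: "0 \<le> m" "m \<le> 1" and B: "B \<ge> 0"
    and q0: "\<And>t. q t \<ge> 0"
    and step: "\<And>t. t1 \<le> t ==> t < T ==> q (Suc t) \<ge> q t + (2 / N) * ((1 - m) * B - (1 + m) * q t / real t)"
  shows "q T \<ge> (2 * (1 - m) * B / (N + 2 + 2 * m)) * (real T - real t1)"
proof -
  \<comment> \<open>The slope of the linear solution of the recursion, a discrete form of
    \<open>q' = (2 / N) * ((1 - m) * B - (1 + m) * q / t)\<close>. Below the line
    \<open>a * t\<close> an increment is at least \<open>a\<close>. Above it, one step can shrink
    \<open>q\<close> by the factor \<open>(t - 4) / t\<close> at worst, and the offset
    \<open>t1 \<ge> 5\<close> absorbs that.\<close>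
  define a where "a = 2 * (1 - m) * B / (N + 2 + 2 * m)"
  have a0: "a \<ge> 0" using N m B by (simp add: a_def)
  have aN: "a * (N + 2 + 2 * m) = 2 * (1 - m) * B" using N m by (simp add: a_def)
  have "q t \<ge> a * (real t - real t1)" if "t1 \<le> t" "t \<le> T" for t
    using that
  proof (induction t rule: dec_induct)
    case base
    then show ?case using q0[of t1] by simp
  next
    case (step t)
    have t: "t1 \<le> t" "t < T" "real t \<ge> 5" using step t1 by auto
    note st = assms(8)[OF t(1,2)]
    show ?case
    proof (cases "q t \<le> a * real t")
      case True
      have "q t / real t \<le> a" using True t(3) by (simp add: divide_le_eq)
      then have "(1 + m) * (q t / real t) \<le> (1 + m) * a" using m by (intro mult_left_mono) auto
      then have "(1 + m) * q t / real t \<le> (1 + m) * a" by simp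
      then have "(2 / N) * ((1 - m) * B - (1 + m) * a) \<le> (2 / N) * ((1 - m) * B - (1 + m) * q t / real t)"
        using N by (intro mult_left_mono) auto
      moreover have "(2 / N) * ((1 - m) * B - (1 + m) * a) = a"
        using aN N by (simp add: field_simps)
      ultimately have "a \<le> q (Suc t) - q t" using st by linarith
      moreover have "q t \<ge> a * (real t - real t1)" using step by simp
      ultimately show ?thesis by (simp add: algebra_simps)
    next
      case False
      have "(2 / N) * ((1 + m) * q t / real t) \<le> 2 * (2 * q t / real t)"
      proof (rule mult_mono)
        show "2 / N \<le> 2" using N by (simp add: divide_le_eq)
        show "(1 + m) * q t / real t \<le> 2 * q t / real t"
          using m q0[of t] t(3) by (intro divide_right_mono mult_right_mono) auto
      qed (use m q0[of t] in auto)
      moreover have "0 \<le> (2 / N) * ((1 - m) * B)" using N m B by simp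
      ultimately have "q (Suc t) \<ge> q t - 2 * (2 * q t / real t)"
        using st unfolding right_diff_distrib by linarith
      also have "q t - 2 * (2 * q t / real t) = q t * ((real t - 4) / real t)" using t(3) by (simp add: field_simps)
      finally have "q (Suc t) \<ge> q t * ((real t - 4) / real t)" .
      moreover have "q t * ((real t - 4) / real t) \<ge> a * real t * ((real t - 4) / real t)"
        using False t(3) by (intro mult_right_mono) auto
      moreover have "a * real t * ((real t - 4) / real t) = a * (real t - 4)" using t(3) by simp
      moreover have "a * (real (Suc t) - real t1) \<le> a * (real t - 4)" using a0 t1 by (intro mult_left_mono) auto
      ultimately show ?thesis by linarith
    qed
  qed
  then show ?thesis using t1 by (simp add: a_def)
qed

text \<open>A barrier argument: above the line \<open>A * t\<close> the square grows no faster than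
  the line, and from below it a single step overshoots by at most \<open>B\<close>. So
  \<open>B\<close> is paid only once.\<close>

lemma square_growth_upper:
  fixes X y :: "nat \<Rightarrow> real"
  assumes t1: "t1 \<le> T" and B: "B \<ge> 0"
    and X: "\<And>t. t1 \<le> t ==> t < T ==> X (Suc t) = X t + y t"
    and U1: "\<And>t. t1 \<le> t ==> t < T ==> (X t)^2 \<ge> A * real t ==> 2 * X t * y t + (y t)^2 \<le> A"
    and U2: "\<And>t. t1 \<le> t ==> t < T ==> (X t)^2 < A * real t ==> 2 * X t * y t + (y t)^2 \<le> A + B"
    and A: "A \<ge> 0"
  shows "(X T)^2 \<le> A * real T + ((X t1)^2 + B)"
proof -
  have "(X t)^2 \<le> A * real t + ((X t1)^2 + B)" if "t1 \<le> t" "t \<le> T" for t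
    using that
  proof (induction t rule: dec_induct)
    case base
    then show ?case using B A by simp
  next
    case (step t)
    have t: "t1 \<le> t" "t < T" using step by auto
    have e: "(X (Suc t))^2 = (X t)^2 + (2 * X t * y t + (y t)^2)"
      unfolding X[OF t] by (simp add: power2_sum)
    have AS: "A * real (Suc t) = A * real t + A" by (simp add: distrib_left)
    show ?case
    proof (cases "(X t)^2 \<ge> A * real t")
      case True
      then show ?thesis using U1[OF t] step e AS by linarith
    next
      case False
      then have "2 * X t * y t + (y t)^2 \<le> A + B" using U2[OF t] by simp
      moreover have "(X t1)^2 \<ge> 0" by simp
      ultimately show ?thesis using False e AS by linarith
    qed
  qed
  then show ?thesis using t1 by simp
qed

definition "C7 N = (1 / kappa N + C1 N / c3 N) / kappa N"

context scalar_run
begin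

lemma X_ge_N: "t \<le> T ==> N \<le> X t"
proof (induction t)
  case (Suc t)
  then show ?case using X_Suc[of t] y(1)[of t] by simp
qed (simp add: init)

lemma p_le_Suc: "t \<le> T ==> p t \<le> real t + 1" using X_p[of t] X_ge_N[of t] by simp

lemma C7_pos: "C7 N > 0" using kappa_pos const_pos by (simp add: C7_def add_pos_pos)

text \<open>\<open>m\<close> is the relative accuracy aimed at. \<open>Z\<close> is the common
  smallness of \<open>\<beta> / sqrt t\<close> and \<open>1 / t\<close>, small enough to beat each
  constant that multiplies it. \<open>\<eta>\<close> is the size of \<open>E\<close> relative to
  \<open>g\<close>.\<close>

context
  fixes Z m \<eta> :: real and t :: nat
  assumes t: "t < T" "late t" and gd: "\<And>s. s \<le> t ==> good s" and b2: "N + 1 + R0 N \<le> \<beta>^2"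
    and bx: "\<beta> \<le> Z * sqrt (real t + 1)" and tx: "1 / (real t + 1) \<le> Z"
    and m: "0 < m" "m \<le> 1 / 4"
    and Z: "0 < Z" "C2 N * Z \<le> m / 4" "2 * sqrt (C7 N) * Z \<le> m / 2" "Z / (c3 N)^2 \<le> m / 2"
      "C1 N * Z \<le> m" "Z \<le> m" "(C1 N)^2 * Z \<le> m"
    and \<eta>: "0 \<le> \<eta>" "\<eta> \<le> m" "E t \<le> \<eta> * g t" "4 * sqrt \<eta> * (1 + m) + 5 * \<rho> \<le> m^2"
begin

abbreviation (input) "s \<equiv> sqrt (real t + 1)"

lemma t': "t \<le> T" using t by simp

lemma s_pos: "s > 0" and s_sq: "s * s = real t + 1" by simp_all

lemma g_lo: "c3 N * \<beta> * s \<le> g t" using t gd b2 by (intro g_late) auto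

lemma X_up: "X t \<le> C2 N * \<beta> * s" using t gd b2 by (intro X_late) auto

lemma y_up: "y t \<le> C1 N * \<beta> / s" using t gd b2 by (intro y_late) auto

lemma y_up': "y t \<le> m"
proof -
  have "y t \<le> C1 N * (\<beta> / s)" using y_up by simp
  also have "\<dots> \<le> C1 N * Z" using bx s_pos const_pos by (intro mult_left_mono) (auto simp: field_simps)
  finally show ?thesis using Z by simp
qed

lemma p_lo: "(1 - m / 4) * (real t + 1) \<le> p t"
proof -
  have "X t \<le> C2 N * (\<beta> * s)" using X_up by simp
  also have "\<dots> \<le> C2 N * (Z * s * s)" using bx s_pos const_pos by (intro mult_left_mono mult_right_mono) auto
  also have "\<dots> = C2 N * Z * (real t + 1)" by (simp only: mult.assoc s_sq)
  also have "\<dots> \<le> m / 4 * (real t + 1)" using Z by (intro mult_right_mono) auto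
  finally show ?thesis using X_p[OF t'] N by (simp add: left_diff_distrib)
qed

lemma P1_up: "(1 - y t) / p t \<le> 1 / p t"
  using y(1)[OF t(1)] p_ge[OF t'] by (intro divide_right_mono) auto

lemma p_kappa: "kappa N * (real t + 1) \<le> p t" using gd[of t] by (simp add: good_def)

lemma w_up: "(w t)^2 \<le> C7 N / (real t + 1)"
proof -
  have "kappa N * (w t)^2 \<le> (1 - y t) / p t + y t / g t"
    using t gd[of t] kappa_pos by (intro qb_w) (auto simp: good_def)
  also have "\<dots> \<le> 1 / (kappa N * (real t + 1)) + (C1 N * \<beta> / s) / (c3 N * \<beta> * s)"
  proof (intro add_mono frac_le)
    show "1 - y t \<le> 1" using y(1)[OF t(1)] by simp
    show "0 < kappa N * (real t + 1)" using kappa_pos by simp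
    show "0 < c3 N * \<beta> * s" using const_pos \<beta> s_pos by simp
    show "0 \<le> C1 N * \<beta> / s" using const_pos \<beta> by simp
  qed (use p_kappa y_up g_lo in auto)
  also have "(C1 N * \<beta> / s) / (c3 N * \<beta> * s) = C1 N / c3 N / (s * s)"
    using \<beta> by simp
  finally have "kappa N * (w t)^2 \<le> (1 / kappa N + C1 N / c3 N) / (real t + 1)"
    unfolding s_sq by (simp add: add_divide_distrib)
  then have "(w t)^2 \<le> (1 / kappa N + C1 N / c3 N) / (real t + 1) / kappa N"
    using kappa_pos by (simp only: pos_le_divide_eq mult.commute)
  then show ?thesis unfolding C7_def by (simp add: mult.commute)
qed

text \<open>\<open>\<beta> \<le> g * (1 + \<beta> * w) * w\<close>, where \<open>\<beta> * w\<close>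
  is now small, puts \<open>w^2\<close> above \<open>\<beta>^2 / g^2\<close> up to a factor near 1;
  and \<open>p\<close> near \<open>t\<close> lets \<open>ln p\<close> grow by at most
  \<open>(1 + m) / t\<close>. The round \<open>t = 0\<close> is set aside because the drift divides
  by \<open>t\<close>.\<close>

lemma step_lower: "(1 - m) * \<beta>^2 / g t - (1 + m) * g t / real t \<le> N * (g (Suc t) - g t) \<or> t = 0"
proof (cases "t = 0")
  case False
  then have t0: "real t > 0" by simp
  have g: "g t > 0" "g (Suc t) > 0" using g_pos t by auto
  define \<zeta> where "\<zeta> = sqrt (C7 N) * Z"
  have \<zeta>0: "\<zeta> > 0" using C7_pos Z by (simp add: \<zeta>_def)
  have bw: "\<beta> * w t \<le> \<zeta>"
  proof -
    have "w t \<le> sqrt (C7 N) / s"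
      using w_up w_pos[OF t(1)] by (intro power2_le_imp_le[of "w t"]) (use C7_pos in \<open>auto simp: power_divide\<close>)
    then have "\<beta> * w t \<le> (Z * s) * (sqrt (C7 N) / s)"
      using bx \<beta> w_pos[OF t(1)] Z by (intro mult_mono) auto
    then show ?thesis using s_pos by (simp add: \<zeta>_def mult_ac)
  qed
  define z where "z = \<beta>^2 / ((1 + \<zeta>)^2 * (g t)^2)"
  have z0: "z \<ge> 0" by (simp add: z_def)
  have zw: "z \<le> (w t)^2"
  proof -
    have "\<beta> = l t * (\<mu> t * w t)" by (simp add: l_eq[OF t(1)])
    also have "\<dots> \<le> g t * ((1 + \<zeta>) * w t)"
      using l_g[OF t(1)] mu_ge_1[OF t(1)] mu_le[OF t(1)] bw w_pos[OF t(1)] g l_pos[OF t(1)]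
      by (intro mult_mono) auto
    finally have "\<beta>^2 \<le> (g t * ((1 + \<zeta>) * w t))^2" using \<beta> by (intro power_mono) auto
    then have "\<beta>^2 \<le> ((1 + \<zeta>)^2 * (g t)^2) * (w t)^2" by (simp add: power_mult_distrib mult_ac)
    moreover have "0 < (1 + \<zeta>)^2 * (g t)^2" using g \<zeta>0 by simp
    ultimately show ?thesis unfolding z_def by (simp add: divide_le_eq mult.commute)
  qed
  have gb: "\<beta>^2 / (g t)^2 \<le> 1 / ((c3 N)^2 * (real t + 1))"
  proof -
    have "(c3 N * \<beta> * s)^2 \<le> (g t)^2" using g_lo const_pos \<beta> by (intro power_mono) auto
    then have "\<beta>^2 * ((c3 N)^2 * (real t + 1)) \<le> (g t)^2" by (simp add: power_mult_distrib mult_ac)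
    moreover have "b / G \<le> 1 / c" if "b * c \<le> G" "G > 0" "c > 0" for b G c :: real
      using that by (simp add: field_simps)
    ultimately show ?thesis using const_pos g by simp
  qed
  have zz: "z \<le> m / 2"
  proof -
    have "z \<le> \<beta>^2 / (g t)^2"
    proof -
      have "1 * (g t)^2 \<le> (1 + \<zeta>)^2 * (g t)^2" using \<zeta>0 by (intro mult_right_mono one_le_power) auto
      then show ?thesis unfolding z_def using g \<zeta>0
        by (intro divide_left_mono mult_pos_pos zero_less_power) auto
    qed
    also have "\<dots> \<le> 1 / ((c3 N)^2 * (real t + 1))" by (rule gb)
    also have "\<dots> = 1 / (real t + 1) / (c3 N)^2" by simp
    also have "\<dots> \<le> Z / (c3 N)^2" using tx by (intro divide_right_mono) auto
    finally show ?thesis using Z(4) by (rule order_trans)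
  qed
  have lower: "(1 - m) * (\<beta>^2 / (g t)^2) \<le> z - z^2"
  proof -
    have "(1 - m / 2) * (1 + \<zeta>)^2 \<le> 1"
    proof -
      have z2: "2 * \<zeta> \<le> m / 2" using Z(3) by (simp only: \<zeta>_def mult.assoc)
      have "\<zeta> \<le> m / 4" using z2 by simp
      then have "(1 + \<zeta>)^2 \<le> (1 + m / 4)^2" using \<zeta>0 by (intro power_mono) auto
      then have "(1 - m / 2) * (1 + \<zeta>)^2 \<le> (1 - m / 2) * (1 + m / 4)^2"
        using m by (intro mult_left_mono) auto
      also have "\<dots> = 1 - m * m * (3 / 16) - m * m * m / 32" by (simp add: power2_eq_square field_simps)
      also have "\<dots> \<le> 1"
      proof -
        have "0 \<le> m" using m by simp
        then have "0 \<le> m * m * (3 / 16)" "0 \<le> m * m * m / 32" by (intro mult_nonneg_nonneg divide_nonneg_nonneg; simp)+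
        then show ?thesis by argo
      qed
      finally show ?thesis .
    qed
    then have "(1 - m / 2) * (\<beta>^2 / (g t)^2) \<le> z"
    proof -
      assume k: "(1 - m / 2) * (1 + \<zeta>)^2 \<le> 1"
      have "(1 - m / 2) \<le> 1 / (1 + \<zeta>)^2" using k \<zeta>0 by (subst pos_le_divide_eq) auto
      then have "(1 - m / 2) * (\<beta>^2 / (g t)^2) \<le> 1 / (1 + \<zeta>)^2 * (\<beta>^2 / (g t)^2)"
        by (rule mult_right_mono) simp
      then show ?thesis unfolding z_def by simp
    qed
    then have "(1 - m / 2) * ((1 - m / 2) * (\<beta>^2 / (g t)^2)) \<le> (1 - m / 2) * z"
      using m by (intro mult_left_mono) auto
    also have "\<dots> \<le> (1 - z) * z" using zz z0 by (intro mult_right_mono) auto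
    also have "\<dots> = z - z^2" by (simp add: power2_eq_square left_diff_distrib)
    also have "(1 - m / 2) * ((1 - m / 2) * (\<beta>^2 / (g t)^2)) = (1 - m / 2)^2 * (\<beta>^2 / (g t)^2)"
      by (simp only: power2_eq_square mult.assoc)
    finally have "(1 - m / 2)^2 * (\<beta>^2 / (g t)^2) \<le> z - z^2" .
    moreover have "(1 - m) * (\<beta>^2 / (g t)^2) \<le> (1 - m / 2)^2 * (\<beta>^2 / (g t)^2)"
    proof (rule mult_right_mono)
      have "(1 - m / 2)^2 = 1 - m + (m / 2)^2" by (simp add: power2_diff)
      moreover have "0 \<le> (m / 2)^2" by simp
      ultimately show "1 - m \<le> (1 - m / 2)^2" by argo
    qed simp
    ultimately show ?thesis by linarith
  qed
  have "ln (1 + z) \<ge> z - z^2" using z0 zz m by (intro ln_one_plus_pos_lower_bound) auto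
  moreover have "ln (1 + z) \<le> ln (1 + (w t)^2)" using zw z0 by (simp add: add_pos_nonneg)
  moreover have "ln (1 + (1 - y t) / p t) \<le> (1 - y t) / p t"
    using P1_nonneg[OF t(1)] by (intro ln_add_one_self_le_self)
  moreover have "1 / p t \<le> (1 + m) / real t"
  proof -
    have "real t * 1 \<le> (real t + 1) * ((1 + m) * (1 - m / 4))"
    proof (rule mult_mono)
      have "m * m \<le> m * (1 / 4)" using m by (intro mult_left_mono) auto
      then show "1 \<le> (1 + m) * (1 - m / 4)" using m by (simp add: algebra_simps)
    qed (use m in auto)
    also have "\<dots> \<le> (1 + m) * p t" using mult_left_mono[OF p_lo, of "1 + m"] m by (simp add: mult_ac)
    finally show ?thesis using t0 p_ge[OF t'] by (simp add: field_simps)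
  qed
  ultimately have "(1 - m) * (\<beta>^2 / (g t)^2) - (1 + m) / real t \<le> N * (ln (g (Suc t)) - ln (g t))"
    unfolding ln_g_Suc[OF t(1)] using lower P1_up by linarith
  then have "g t * ((1 - m) * (\<beta>^2 / (g t)^2) - (1 + m) / real t) \<le> g t * (N * (ln (g (Suc t)) - ln (g t)))"
    using g by (intro mult_left_mono) auto
  also have "\<dots> \<le> N * (g (Suc t) - g t)"
  proof -
    have "ln (g (Suc t) / g t) \<le> g (Suc t) / g t - 1" using g by (intro ln_le_minus_one) auto
    then have "g t * (ln (g (Suc t)) - ln (g t)) \<le> g (Suc t) - g t"
      using g by (simp add: ln_div field_simps)
    then have "N * (g t * (ln (g (Suc t)) - ln (g t))) \<le> N * (g (Suc t) - g t)"
      using N by (intro mult_left_mono) auto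
    then show ?thesis by (simp add: mult_ac)
  qed
  also have "g t * ((1 - m) * (\<beta>^2 / (g t)^2) - (1 + m) / real t)
      = (1 - m) * \<beta>^2 / g t - (1 + m) * g t / real t"
    using g by (simp add: right_diff_distrib power2_eq_square)
  finally show ?thesis by simp
qed simp

lemma w_near: "(1 - 4 * sqrt \<eta>) * (w t)^2 \<le> (1 - y t) / p t + y t / g t"
proof (rule qb_w[OF t(1)])
  have "X t \<le> N * g t + E t" using gd by (intro X_le_Ng_E t') auto
  then have "X t - N * g t \<le> \<eta> * g t" using \<eta> by simp
  then show "qb t (1 - 4 * sqrt \<eta>)" using \<eta> m by (intro qb_near t') auto
  have "4 * sqrt \<eta> * 1 \<le> 4 * sqrt \<eta> * (1 + m)" using m \<eta> by (intro mult_left_mono) auto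
  moreover have "m^2 \<le> 1 / 4" using m mult_mono[of m "1/4" m "1/4"] by (simp add: power2_eq_square)
  ultimately show "0 < 1 - 4 * sqrt \<eta>" using \<eta>(4) \<rho> by linarith
qed

text \<open>Up to constants near 1, the bound \<open>\<beta> * w - P * \<beta> / w\<close> on
  \<open>y\<close> increases in \<open>w\<close>. If \<open>w\<close> is at most
  \<open>(1 + m) * \<beta> / g\<close>, that value is inserted. If \<open>w\<close> is larger,
  \<open>w_near\<close> gives the lower bound \<open>g * (k * w^2 - P)\<close> with \<open>k\<close>
  near 1, and the two bounds on \<open>y\<close> are compatible only when \<open>w^2\<close> hardly
  exceeds \<open>P\<close>; then the bracket nearly cancels and \<open>y\<close> is small.\<close>

lemma y_step_upper:
  defines "P \<equiv> (1 - y t) / p t"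
  shows "y t \<le> 4 * m * \<beta> * sqrt P \<or> y t \<le> (1 + m)^2 * \<beta>^2 / g t - P * g t / (1 + m)"
proof -
  have g: "g t > 0" using g_pos t' by simp
  have w: "w t > 0" using w_pos t by simp
  have P0: "P \<ge> 0" unfolding P_def using P1_nonneg t by simp
  have r5: "5 * \<rho> \<le> m"
  proof -
    have "0 \<le> 4 * sqrt \<eta> * (1 + m)" using \<eta> m by simp
    moreover have "m^2 \<le> m * 1" using m unfolding power2_eq_square by (intro mult_left_mono) auto
    ultimately show ?thesis using \<eta>(4) by linarith
  qed
  have "y t \<le> l t * Yb t" using y_le_lYb gd t by auto
  also have "\<dots> \<le> (\<beta> / w t) * Yb t"
  proof (rule mult_right_mono)
    have "l t * w t * 1 \<le> l t * w t * \<mu> t"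
      using mu_ge_1[OF t(1)] l_pos[OF t(1)] w by (intro mult_left_mono) auto
    also have "\<dots> = \<beta>" using l_eq[OF t(1)] by (simp add: mult_ac)
    finally show "l t \<le> \<beta> / w t" using w by (simp add: field_simps)
    show "0 \<le> Yb t" using Yb_nonneg gd t by auto
  qed
  finally have y1: "y t \<le> (\<beta> / w t) * ((1 + 5 * \<rho>) * (w t)^2 - P)" by (simp add: Yb_def P_def)
  have "(\<beta> / w t) * ((1 + 5 * \<rho>) * (w t)^2 - P) = (1 + 5 * \<rho>) * (\<beta> * w t) - P * (\<beta> / w t)"
    using w by (simp add: right_diff_distrib power2_eq_square)
  with y1 have y2: "y t \<le> (1 + 5 * \<rho>) * (\<beta> * w t) - P * (\<beta> / w t)" by simp
  show ?thesis
  proof (cases "w t \<le> (1 + m) * \<beta> / g t")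
    case True
    have "(1 + 5 * \<rho>) * (\<beta> * w t) \<le> (1 + m) * (\<beta> * ((1 + m) * \<beta> / g t))"
      using True r5 m \<beta> w by (intro mult_mono) auto
    moreover have "P * (g t / (1 + m)) \<le> P * (\<beta> / w t)"
      using True P0 g w m by (intro mult_left_mono) (auto simp: field_simps)
    ultimately show ?thesis using y2 by (simp add: power2_eq_square mult_ac)
  next
    case False
    then have wb: "\<beta> / w t < g t / (1 + m)" using g w m by (simp add: field_simps)
    define k where "k = 1 - 4 * sqrt \<eta>"
    have "y t \<ge> g t * (k * (w t)^2 - P)" using w_near g by (simp add: k_def P_def field_simps)
    moreover have "(\<beta> / w t) * ((1 + 5 * \<rho>) * (w t)^2 - P) \<le> (g t / (1 + m)) * ((1 + 5 * \<rho>) * (w t)^2 - P)"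
      using wb Yb_nonneg[of t] gd t by (intro mult_right_mono) (auto simp: Yb_def P_def)
    ultimately have "g t * (k * (w t)^2 - P) \<le> g t * (((1 + 5 * \<rho>) * (w t)^2 - P) / (1 + m))" using y1 by simp
    then have "k * (w t)^2 - P \<le> ((1 + 5 * \<rho>) * (w t)^2 - P) / (1 + m)"
      using g by (simp only: mult_le_cancel_left_pos)
    then have "(k * (w t)^2 - P) * (1 + m) \<le> (1 + 5 * \<rho>) * (w t)^2 - P" using m by (simp add: pos_le_divide_eq)
    then have "(w t)^2 * (m - (4 * sqrt \<eta> * (1 + m) + 5 * \<rho>)) \<le> m * P" by (simp add: k_def algebra_simps)
    moreover have "(w t)^2 * (m - m^2) \<le> (w t)^2 * (m - (4 * sqrt \<eta> * (1 + m) + 5 * \<rho>))"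
      using \<eta>(4) by (intro mult_left_mono) auto
    ultimately have "m * ((w t)^2 * (1 - m)) \<le> m * P" by (simp add: power2_eq_square algebra_simps)
    then have wP: "(w t)^2 * (1 - m) \<le> P" using m by simp
    have "(w t)^2 \<le> 4 * P"
    proof -
      have "(w t)^2 * (1 / 4) \<le> (w t)^2 * (1 - m)" using m by (intro mult_left_mono) auto
      then show ?thesis using wP by simp
    qed
    then have "(w t)^2 \<le> (2 * sqrt P)^2" using P0 by (simp add: power_mult_distrib)
    then have w2: "w t \<le> 2 * sqrt P" by (rule power2_le_imp_le) (use P0 in simp)
    note y1
    also have "(\<beta> / w t) * ((1 + 5 * \<rho>) * (w t)^2 - P) \<le> (\<beta> / w t) * ((1 + 5 * \<rho>) * (w t)^2 - (w t)^2 * (1 - m))"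
      using wP \<beta> w by (intro mult_left_mono diff_left_mono) auto
    also have "\<dots> = \<beta> * w t * (5 * \<rho> + m)"
    proof -
      have "(B / v) * ((1 + r) * v^2 - v^2 * (1 - m)) = B * v * (r + m)" if "v > 0" for B v r :: real
        using that by (simp add: power2_eq_square field_simps)
      then show ?thesis using w by blast
    qed
    also have "\<dots> \<le> \<beta> * (2 * sqrt P) * (2 * m)"
      using w2 r5 \<beta> w \<rho> m P0 by (intro mult_mono mult_nonneg_nonneg) auto
    finally show ?thesis by (simp add: mult_ac)
  qed
qed

text \<open>\<open>R2\<close> makes \<open>U\<close> a supersolution of the limiting recursion:
  \<open>X^2\<close> above \<open>U * \<beta>^2 * t\<close> forces \<open>g\<close> to be large
  through \<open>X \<le> (N + m) * g\<close>, and then the negative term \<open>P * g\<close> holds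
  the increment of \<open>X^2\<close> below \<open>U * \<beta>^2\<close>. \<open>R1\<close> covers
  the alternative with small \<open>y\<close>.\<close>

lemma step_upper:
  assumes al: "U > 0" and XA: "(X t)^2 \<ge> U * \<beta>^2 * real t"
    and R1: "8 * C2 N * m / sqrt (kappa N) + m \<le> U"
    and R2: "2 * (N + m) * (1 + m)^2 + m - 2 * (1 - m)^2 * U / ((1 + m) * (N + m)) \<le> U"
  shows "2 * X t * y t + (y t)^2 \<le> U * \<beta>^2"
proof -
  define P where "P = (1 - y t) / p t"
  have g: "g t > 0" using g_pos t' by simp
  have X0: "X t > 0" using X_pos t' by simp
  have y0: "y t \<ge> 0" using y t by simp
  have y2: "(y t)^2 \<le> m * \<beta>^2"
  proof -
    have "(y t)^2 \<le> (C1 N * \<beta> / s)^2" using y_up y0 by (intro power_mono)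
    also have "\<dots> = (C1 N)^2 * (1 / (real t + 1)) * \<beta>^2" by (simp add: power_divide power_mult_distrib)
    also have "\<dots> \<le> (C1 N)^2 * Z * \<beta>^2" using tx by (intro mult_right_mono mult_left_mono) auto
    also have "\<dots> \<le> m * \<beta>^2" using Z by (intro mult_right_mono) auto
    finally show ?thesis .
  qed
  from y_step_upper consider (1) "y t \<le> 4 * m * \<beta> * sqrt P"
    | (2) "y t \<le> (1 + m)^2 * \<beta>^2 / g t - P * g t / (1 + m)"
    unfolding P_def by blast
  then show ?thesis
  proof cases
    case 1
    have "P \<le> 1 / (kappa N * (real t + 1))"
      unfolding P_def using y0 p_kappa kappa_pos by (intro frac_le) auto
    then have "sqrt P \<le> sqrt (1 / (kappa N * (real t + 1)))" by simp
    also have "\<dots> = 1 / (sqrt (kappa N) * s)" by (simp add: real_sqrt_divide real_sqrt_mult)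
    finally have "y t \<le> 4 * m * \<beta> * (1 / (sqrt (kappa N) * s))"
      using 1 m \<beta> by (meson mult_left_mono mult_nonneg_nonneg order_trans less_imp_le zero_le_numeral zero_le_one)
    then have "2 * X t * y t \<le> 2 * (C2 N * \<beta> * s) * (4 * m * \<beta> * (1 / (sqrt (kappa N) * s)))"
      using X_up X0 y0 by (intro mult_mono) auto
    also have "\<dots> = (8 * C2 N * m / sqrt (kappa N)) * \<beta>^2" using s_pos by (simp add: power2_eq_square)
    finally have "2 * X t * y t + (y t)^2 \<le> (8 * C2 N * m / sqrt (kappa N) + m) * \<beta>^2"
      using y2 by (simp add: distrib_right)
    also have "\<dots> \<le> U * \<beta>^2" using R1 by (intro mult_right_mono) auto
    finally show ?thesis .
  next
    case 2
    have Xg: "X t \<le> (N + m) * g t"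
    proof -
      have "X t \<le> N * g t + E t" using gd by (intro X_le_Ng_E t') auto
      also have "E t \<le> m * g t" using \<eta> mult_right_mono[of \<eta> m "g t"] g by linarith
      finally show ?thesis by (simp add: distrib_right)
    qed
    have Nt: "N + m > 0" using N m by simp
    have Pg: "(1 - m)^2 * U * \<beta>^2 / (N + m)^2 \<le> P * (g t)^2"
    proof -
      have "(X t)^2 \<le> ((N + m) * g t)^2" using Xg X0 by (intro power_mono) auto
      then have "U * \<beta>^2 * real t \<le> (N + m)^2 * (g t)^2" using XA by (simp add: power_mult_distrib)
      then have g2: "U * \<beta>^2 * real t / (N + m)^2 \<le> (g t)^2" using Nt by (simp add: field_simps)
      have tt: "(1 - m) * (real t + 1) \<le> real t"
      proof -
        have "1 \<le> m * (real t + 1)" using tx Z(6) by (simp add: field_simps) (smt (verit) mult_right_mono of_nat_0_le_iff)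
        then show ?thesis by (simp add: left_diff_distrib)
      qed
      have P: "(1 - m) / (real t + 1) \<le> P"
        unfolding P_def using y_up' p_le_Suc[OF t'] p_ge[OF t'] m y(2)[OF t(1)] by (intro frac_le) auto
      have "(1 - m)^2 * U * \<beta>^2 / (N + m)^2
          = ((1 - m) / (real t + 1)) * (U * \<beta>^2 * ((1 - m) * (real t + 1)) / (N + m)^2)"
        by (simp add: power2_eq_square)
      also have "\<dots> \<le> P * (g t)^2"
      proof (rule mult_mono)
        have "U * \<beta>^2 * ((1 - m) * (real t + 1)) / (N + m)^2 \<le> U * \<beta>^2 * real t / (N + m)^2"
          using tt al by (intro divide_right_mono mult_left_mono) auto
        then show "U * \<beta>^2 * ((1 - m) * (real t + 1)) / (N + m)^2 \<le> (g t)^2" using g2 by linarith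
        show "0 \<le> P" using P1_nonneg[OF t(1)] by (simp add: P_def)
      qed (use P al m in auto)
      finally show ?thesis .
    qed
    have "2 * X t * y t \<le> 2 * ((N + m) * g t) * ((1 + m)^2 * \<beta>^2 / g t - P * g t / (1 + m))"
      using 2 Xg X0 y0 by (intro mult_mono) auto
    also have "\<dots> = 2 * (N + m) * (1 + m)^2 * \<beta>^2 - 2 * (N + m) / (1 + m) * (P * (g t)^2)"
    proof -
      have "2 * (n * G) * (u^2 * B / G - P * G / u) = 2 * n * u^2 * B - 2 * n / u * (P * G^2)"
        if "G > 0" for n G u B P :: real
        using that by (simp add: right_diff_distrib power2_eq_square)
      then show ?thesis using g by blast
    qed
    also have "\<dots> \<le> 2 * (N + m) * (1 + m)^2 * \<beta>^2
        - 2 * (N + m) / (1 + m) * ((1 - m)^2 * U * \<beta>^2 / (N + m)^2)"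
      using Pg Nt m by (intro diff_left_mono mult_left_mono) auto
    also have "\<dots> = (2 * (N + m) * (1 + m)^2 - 2 * (1 - m)^2 * U / ((1 + m) * (N + m))) * \<beta>^2"
    proof -
      have "2 * n * u^2 * B - 2 * n / v * (k * a * B / n^2) = (2 * n * u^2 - 2 * k * a / (v * n)) * B"
        if "n > 0" for n u v k a B :: real
        using that by (simp add: left_diff_distrib power2_eq_square)
      then show ?thesis using Nt by blast
    qed
    finally have "2 * X t * y t + (y t)^2
        \<le> (2 * (N + m) * (1 + m)^2 + m - 2 * (1 - m)^2 * U / ((1 + m) * (N + m))) * \<beta>^2"
      using y2 by (simp add: distrib_right left_diff_distrib)
    also have "\<dots> \<le> U * \<beta>^2" using R2 by (intro mult_right_mono) auto
    finally show ?thesis .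
  qed
qed

lemma step_upper_low:
  assumes al: "U > 0" and XA: "(X t)^2 < U * \<beta>^2 * real t"
  shows "2 * X t * y t + (y t)^2 \<le> U * \<beta>^2 + (2 * sqrt U * C1 N + 1) * \<beta>^2"
proof -
  have "(X t)^2 \<le> (sqrt U * \<beta> * s)^2"
  proof -
    have "U * \<beta>^2 * real t \<le> U * \<beta>^2 * (real t + 1)" using al by (intro mult_left_mono) auto
    moreover have "(sqrt U * \<beta> * s)^2 = U * \<beta>^2 * (real t + 1)" using al by (simp add: power_mult_distrib)
    ultimately show ?thesis using XA by linarith
  qed
  then have "X t \<le> sqrt U * \<beta> * s" by (rule power2_le_imp_le) (use al \<beta> in simp)
  then have "2 * X t * y t \<le> 2 * (sqrt U * \<beta> * s) * (C1 N * \<beta> / s)"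
    using y_up X_pos[OF t'] y(1)[OF t(1)] by (intro mult_mono) auto
  also have "\<dots> = 2 * sqrt U * C1 N * \<beta>^2" using s_pos by (simp add: power2_eq_square)
  finally have 1: "2 * X t * y t \<le> 2 * sqrt U * C1 N * \<beta>^2" .
  have "(y t)^2 \<le> 1" using y[OF t(1)] by (simp add: power_le_one)
  also have "1 \<le> \<beta>^2" using \<beta> by (simp add: one_le_power)
  finally have "(y t)^2 \<le> \<beta>^2" .
  moreover have "0 \<le> U * \<beta>^2" using al by simp
  ultimately show ?thesis using 1 by (simp add: distrib_right)
qed

end

end

context scalar_run
begin

lemma final_bounds:
  fixes Z m U :: real and t1 :: nat
  defines "\<eta> \<equiv> C6 N * (\<rho> + 1 / \<beta>) / c3 N"
  assumes b2: "N + 1 + R0 N \<le> \<beta>^2" and \<eta>1: "\<eta> \<le> 1 / 64"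
    and m: "0 < m" "m \<le> 1 / 4"
    and Z: "0 < Z" "C2 N * Z \<le> m / 4" "2 * sqrt (C7 N) * Z \<le> m / 2" "Z / (c3 N)^2 \<le> m / 2"
      "C1 N * Z \<le> m" "Z \<le> m" "(C1 N)^2 * Z \<le> m"
    and \<eta>: "\<eta> \<le> m" "4 * sqrt \<eta> * (1 + m) + 5 * \<rho> \<le> m^2"
    and t1: "5 \<le> t1" "t1 \<le> T" "late t1" "\<beta> \<le> Z * sqrt (real t1 + 1)" "1 / (real t1 + 1) \<le> Z"
    and al: "U > 0"
    and R1: "8 * C2 N * m / sqrt (kappa N) + m \<le> U"
    and R2: "2 * (N + m) * (1 + m)^2 + m - 2 * (1 - m)^2 * U / ((1 + m) * (N + m)) \<le> U"
  shows "good T" "X T - N * g T \<le> \<eta> * g T"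
    "(2 * (1 - m) * \<beta>^2 / (N + 2 + 2 * m)) * (real T - real t1) \<le> (g T)^2"
    "(X T)^2 \<le> U * \<beta>^2 * real T + ((C2 N * \<beta>)^2 * (real t1 + 1) + (2 * sqrt U * C1 N + 1) * \<beta>^2)"
proof -
  have gd: "good s" if "s \<le> T" for s using all_good b2 \<eta>1 that by (simp add: \<eta>_def)
  then show "good T" by simp
  have \<eta>0: "0 \<le> \<eta>" using const_pos \<rho> \<beta> by (simp add: \<eta>_def)
  have E: "E t \<le> \<eta> * g t" if "t \<le> T" "late t" for t
    unfolding \<eta>_def by (rule E_le_g[OF that _ b2]) (use gd that in auto)
  have "late T" using t1 late_mono by blast
  then show "X T - N * g T \<le> \<eta> * g T"
    using X_le_Ng_E[of T] gd E[of T] by simp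
  have lt: "late t" if "t1 \<le> t" for t using late_mono[OF t1(3) that] .
  have bx: "\<beta> \<le> Z * sqrt (real t + 1)" if "t1 \<le> t" for t
  proof -
    have "Z * sqrt (real t1 + 1) \<le> Z * sqrt (real t + 1)" using that Z by (intro mult_left_mono) auto
    then show ?thesis using t1(4) by linarith
  qed
  have tx: "1 / (real t + 1) \<le> Z" if "t1 \<le> t" for t
  proof -
    have "1 / (real t + 1) \<le> 1 / (real t1 + 1)" using that by (intro divide_left_mono) auto
    then show ?thesis using t1(5) by linarith
  qed
  have gd': "\<And>s. s \<le> t ==> good s" if "t < T" for t using gd that by simp
  note step_args = lt gd' b2 bx tx m Z \<eta>0 \<eta>(1) E \<eta>(2)
  show "(2 * (1 - m) * \<beta>^2 / (N + 2 + 2 * m)) * (real T - real t1) \<le> (g T)^2"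
  proof (rule square_growth_lower[of t1 T N m "\<beta>^2" "\<lambda>t. (g t)\<^sup>2", OF t1(1,2) N])
    fix t assume t: "t1 \<le> t" "t < T"
    have g: "g t > 0" using g_pos t by simp
    have "(1 - m) * \<beta>^2 / g t - (1 + m) * g t / real t \<le> N * (g (Suc t) - g t) \<or> t = 0"
      by (rule step_lower[OF t(2) lt[OF t(1)] gd'[OF t(2)] b2 bx[OF t(1)] tx[OF t(1)] m Z \<eta>0 \<eta>(1) E \<eta>(2)])
        (use t lt in auto)
    then have st: "(1 - m) * \<beta>^2 / g t - (1 + m) * g t / real t \<le> N * (g (Suc t) - g t)" using t t1 by auto
    have "(2 / N) * ((1 - m) * \<beta>^2 - (1 + m) * (g t)^2 / real t)
        = (2 * g t / N) * ((1 - m) * \<beta>^2 / g t - (1 + m) * g t / real t)"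
      using g by (simp add: right_diff_distrib power2_eq_square)
    also have "\<dots> \<le> (2 * g t / N) * (N * (g (Suc t) - g t))" using st g N by (intro mult_left_mono) auto
    also have "\<dots> = 2 * g t * (g (Suc t) - g t)" using N by simp
    also have "\<dots> = (g (Suc t))^2 - (g t)^2 - (g (Suc t) - g t)^2" by (simp add: power2_eq_square algebra_simps)
    also have "\<dots> \<le> (g (Suc t))^2 - (g t)^2" by simp
    finally show "(g (Suc t))^2 \<ge> (g t)^2 + (2 / N) * ((1 - m) * \<beta>^2 - (1 + m) * (g t)^2 / real t)" by simp
  qed (use m in auto)
  have Xt1: "(X t1)^2 \<le> (C2 N * \<beta>)^2 * (real t1 + 1)"
  proof -
    have "X t1 \<le> C2 N * \<beta> * sqrt (real t1 + 1)" using t1 gd b2 by (intro X_late) auto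
    then have "(X t1)^2 \<le> (C2 N * \<beta> * sqrt (real t1 + 1))^2" using X_pos[OF t1(2)] by (intro power_mono) auto
    also have "\<dots> = (C2 N * \<beta>)^2 * (real t1 + 1)" by (simp only: power_mult_distrib) simp
    finally show ?thesis .
  qed
  have "(X T)^2 \<le> (U * \<beta>^2) * real T + ((X t1)^2 + (2 * sqrt U * C1 N + 1) * \<beta>^2)"
  proof (rule square_growth_upper[OF t1(2), where y = y])
    show "0 \<le> (2 * sqrt U * C1 N + 1) * \<beta>^2" using al const_pos by simp
    show "0 \<le> U * \<beta>^2" using al by simp
    fix t assume t: "t1 \<le> t" "t < T"
    show "X (Suc t) = X t + y t" by (rule X_Suc[OF t(2)])
    have Et: "E t \<le> \<eta> * g t" using E t lt by simp
    show "2 * X t * y t + (y t)^2 \<le> U * \<beta>^2" if "U * \<beta>^2 * real t \<le> (X t)^2"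
      by (rule step_upper[OF t(2) lt[OF t(1)] gd'[OF t(2)] b2 bx[OF t(1)] tx[OF t(1)] m Z \<eta>0 \<eta>(1) Et \<eta>(2) al that R1 R2])
        simp
    show "2 * X t * y t + (y t)^2 \<le> U * \<beta>^2 + (2 * sqrt U * C1 N + 1) * \<beta>^2" if "(X t)^2 < U * \<beta>^2 * real t"
      by (rule step_upper_low[OF t(2) lt[OF t(1)] gd'[OF t(2)] b2 bx[OF t(1)] tx[OF t(1)] m Z \<eta>0 \<eta>(1) Et \<eta>(2) al that])
        simp
  qed
  then show "(X T)^2 \<le> U * \<beta>^2 * real T + ((C2 N * \<beta>)^2 * (real t1 + 1) + (2 * sqrt U * C1 N + 1) * \<beta>^2)"
    using Xt1 by linarith
qed

end

text \<open>\<open>x\<close> is uniform over all runs because the statement is applied to each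
  outcome separately. The choices depend on one another in the order \<open>U\<close>,
  \<open>m\<close>, \<open>Z\<close>, the starting fraction \<open>\<theta>\<close>, and finally
  \<open>x\<close>.\<close>

theorem scalar_run_limit:
  assumes N: "N \<ge> (1::real)" and \<delta>: "0 < \<delta>" "\<delta> \<le> 1"
  shows "\<exists>x>0. \<forall>\<beta> \<rho> T g p X y w l D \<mu> qb. scalar_run N \<beta> \<rho> T g p X y w l D \<mu> qb \<longrightarrow>
      \<rho> \<le> x \<longrightarrow> 1 / \<beta> \<le> x \<longrightarrow> \<beta> \<le> x * sqrt (real T) \<longrightarrow>
      qb T (kappa N) \<and> kappa N * (real T + 1) \<le> p T \<and> X T - N * g T \<le> \<delta> * g T \<and>
      (1 - \<delta>) * (2 * \<beta>^2 * real T / (N + 2)) \<le> (g T)^2 \<and>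
      (g T)^2 \<le> (1 + \<delta>) * (2 * \<beta>^2 * real T / (N + 2))"
proof -
  note cp = constants_positive[OF N] kappa_positive[OF N]
  define B where "B = 2 / (N + 2)"
  have B: "B > 0" using N by (simp add: B_def)
  \<comment> \<open>The limiting slope of \<open>X^2 / \<beta>^2\<close> is \<open>N^2 * B\<close>,
    since \<open>X\<close> is nearly \<open>N * g\<close>. The excess makes the supersolution
    condition strict at \<open>m = 0\<close>, so that it survives for small
    \<open>m\<close>.\<close>
  define U where "U = (1 + \<delta> / 2) * (N^2 * B)"
  have al: "U > 0" using N \<delta> B by (simp add: U_def)
  have e1: "eventually (\<lambda>m. 8 * C2 N * m / sqrt (kappa N) + m < U) (at_right 0)"
  proof -
    have "((\<lambda>m. 8 * C2 N * m / sqrt (kappa N) + m) \<longlongrightarrow> 8 * C2 N * 0 / sqrt (kappa N) + 0) (at_right 0)"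
      using cp by (intro tendsto_intros) auto
    then show ?thesis using al by (intro order_tendstoD) auto
  qed
  have e2: "eventually (\<lambda>m. 2 * (N + m) * (1 + m)^2 + m - 2 * (1 - m)^2 * U / ((1 + m) * (N + m)) < U) (at_right 0)"
  proof -
    have "((\<lambda>m. 2 * (N + m) * (1 + m)^2 + m - 2 * (1 - m)^2 * U / ((1 + m) * (N + m)))
        \<longlongrightarrow> 2 * (N + 0) * (1 + 0)^2 + 0 - 2 * (1 - 0)^2 * U / ((1 + 0) * (N + 0))) (at_right 0)"
      using N by (intro tendsto_intros) auto
    moreover have "2 * (N + 0) * (1 + 0)^2 + 0 - 2 * (1 - 0)^2 * U / ((1 + 0) * (N + 0)) < U"
    proof -
      have "U + 2 * U / N = U * ((N + 2) / N)" using N by (simp add: field_simps)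
      also have "\<dots> = (1 + \<delta> / 2) * (2 * N)" using N by (simp add: U_def B_def power2_eq_square)
      also have "\<dots> = 2 * N + \<delta> * N" by (simp add: distrib_right)
      also have "\<dots> > 2 * N" using \<delta> N by simp
      finally show ?thesis by simp
    qed
    ultimately show ?thesis by (rule order_tendstoD)
  qed
  have e3: "eventually (\<lambda>m. (1 - \<delta> / 2) * B < 2 * (1 - m) / (N + 2 + 2 * m)) (at_right 0)"
  proof -
    have "((\<lambda>m. 2 * (1 - m) / (N + 2 + 2 * m)) \<longlongrightarrow> 2 * (1 - 0) / (N + 2 + 2 * 0)) (at_right 0)"
      using N by (intro tendsto_intros) auto
    moreover have "(1 - \<delta> / 2) * B < 2 * (1 - 0) / (N + 2 + 2 * 0)" using B \<delta> by (simp add: B_def[symmetric] left_diff_distrib)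
    ultimately show ?thesis by (rule order_tendstoD)
  qed
  have e4: "eventually (\<lambda>m. m > 0 \<and> m < 1 / 4) (at_right (0::real))"
    by (rule eventually_at_rightI[of 0 "1/4"]) auto
  obtain m where m: "0 < m" "m \<le> 1 / 4" and R1: "8 * C2 N * m / sqrt (kappa N) + m \<le> U"
    and R2: "2 * (N + m) * (1 + m)^2 + m - 2 * (1 - m)^2 * U / ((1 + m) * (N + m)) \<le> U"
    and R3: "(1 - \<delta> / 2) * B \<le> 2 * (1 - m) / (N + 2 + 2 * m)"
    using eventually_happens[OF eventually_conj[OF e1 eventually_conj[OF e2 eventually_conj[OF e3 e4]]]]
    by (auto simp: less_imp_le)
  have small: "eventually (\<lambda>x. k * x < c) (at_right 0)" if "c > 0" for k c :: real
  proof -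
    have "((\<lambda>x. k * x) \<longlongrightarrow> k * 0) (at_right 0)" by (intro tendsto_intros)
    then show ?thesis using that by (intro order_tendstoD) auto
  qed
  have pos: "eventually (\<lambda>x. x > 0) (at_right (0::real))" by (simp add: eventually_at_right_less)
  have "eventually (\<lambda>Z. 0 < Z \<and> C2 N * Z < m / 4 \<and> (2 * sqrt (C7 N)) * Z < m / 2 \<and> (1 / (c3 N)^2) * Z < m / 2 \<and>
      C1 N * Z < m \<and> 1 * Z < m \<and> (C1 N)^2 * Z < m) (at_right 0)"
    using m by (intro eventually_conj pos small) auto
  then obtain Z where Z': "0 < Z \<and> C2 N * Z < m / 4 \<and> (2 * sqrt (C7 N)) * Z < m / 2 \<and> (1 / (c3 N)^2) * Z < m / 2 \<and>
      C1 N * Z < m \<and> 1 * Z < m \<and> (C1 N)^2 * Z < m"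
    using eventually_happens by force
  then have Z: "0 < Z" "C2 N * Z \<le> m / 4" "2 * sqrt (C7 N) * Z \<le> m / 2" "Z / (c3 N)^2 \<le> m / 2"
      "C1 N * Z \<le> m" "Z \<le> m" "(C1 N)^2 * Z \<le> m" by auto
  \<comment> \<open>Here \<open>\<theta>\<close> is a number, the fraction of the horizon after
    which the sharp recursions start. It is so small that the crude bound on \<open>X\<close> at
    that time costs only a share of \<open>\<delta>\<close>.\<close>
  define \<theta> where "\<theta> = min (\<delta> / 4) (\<delta> / 4 * (N^2 * B) / (C2 N)^2)"
  have \<theta>: "\<theta> > 0" "\<theta> \<le> \<delta> / 4" "(C2 N)^2 * \<theta> \<le> \<delta> / 4 * (N^2 * B)"
  proof -
    show "\<theta> > 0" "\<theta> \<le> \<delta> / 4" using \<delta> N B cp by (auto simp: \<theta>_def)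
    have "(C2 N)^2 * \<theta> \<le> (C2 N)^2 * (\<delta> / 4 * (N^2 * B) / (C2 N)^2)" by (intro mult_left_mono) (auto simp: \<theta>_def)
    then show "(C2 N)^2 * \<theta> \<le> \<delta> / 4 * (N^2 * B)" using cp by simp
  qed
  \<comment> \<open>The lower bounds on \<open>T\<close> that are used below. A small
    \<open>x\<close> enforces them, because \<open>1 \<le> \<beta>^2\<close> and
    \<open>\<beta>^2 \<le> x * T\<close>.\<close>
  define K where "K = max (5 / \<theta>) (max (1 / (\<theta> * Z)) (max (4 / \<delta>) ((2 * (C2 N)^2 + 2 * sqrt U * C1 N + 1) / (\<delta> / 4 * (N^2 * B)))))"
  have K: "K \<ge> 4 / \<delta>" "K \<ge> 5 / \<theta>" "K \<ge> 1 / (\<theta> * Z)"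
    "K \<ge> (2 * (C2 N)^2 + 2 * sqrt U * C1 N + 1) / (\<delta> / 4 * (N^2 * B))" by (auto simp: K_def)
  have K0: "K > 0" using K(1) \<delta> by (smt (verit) divide_pos_pos)
  define h where "h x = C6 N * (2 * x) / c3 N" for x
  have h0: "eventually (\<lambda>x. h x < c) (at_right 0)" if "c > 0" for c
    using small[OF that, of "C6 N * 2 / c3 N"] by (simp add: h_def mult_ac)
  have h1: "eventually (\<lambda>x. 4 * sqrt (h x) * (1 + m) + 5 * x < m^2) (at_right 0)"
  proof -
    have "((\<lambda>x. 4 * sqrt (h x) * (1 + m) + 5 * x) \<longlongrightarrow> 4 * sqrt (h 0) * (1 + m) + 5 * 0) (at_right 0)"
      unfolding h_def using cp by (intro tendsto_intros) auto
    then show ?thesis using m by (intro order_tendstoD) (auto simp: h_def)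
  qed
  have "eventually (\<lambda>x. 0 < x \<and> h x < 1 / 64 \<and> h x < m \<and> h x < \<delta> \<and> 4 * sqrt (h x) * (1 + m) + 5 * x < m^2 \<and>
      (N + 1 + R0 N) * x < 1 \<and> 1 * x < 1 \<and> 1 * x < Z * sqrt \<theta> \<and> 1 * x < \<theta> \<and> K * x < 1) (at_right 0)"
    using m \<delta> Z(1) \<theta> by (intro eventually_conj pos small h0 h1) auto
  then obtain x where x': "0 < x \<and> h x < 1 / 64 \<and> h x < m \<and> h x < \<delta> \<and> 4 * sqrt (h x) * (1 + m) + 5 * x < m^2 \<and>
      (N + 1 + R0 N) * x < 1 \<and> 1 * x < 1 \<and> 1 * x < Z * sqrt \<theta> \<and> 1 * x < \<theta> \<and> K * x < 1"
    using eventually_happens by force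
  then have x: "0 < x" "h x < 1 / 64" "h x < m" "h x < \<delta>" "4 * sqrt (h x) * (1 + m) + 5 * x < m^2"
      "(N + 1 + R0 N) * x < 1" "x < 1" "x < Z * sqrt \<theta>" "x < \<theta>" "K * x < 1" by auto
  have "qb T (kappa N) \<and> kappa N * (real T + 1) \<le> p T \<and> X T - N * g T \<le> \<delta> * g T \<and>
      (1 - \<delta>) * (2 * \<beta>^2 * real T / (N + 2)) \<le> (g T)^2 \<and>
      (g T)^2 \<le> (1 + \<delta>) * (2 * \<beta>^2 * real T / (N + 2))"
    if run: "scalar_run N \<beta> \<rho> T g p X y w l D \<mu> qb" and \<rho>x: "\<rho> \<le> x" and \<beta>x: "1 / \<beta> \<le> x" "\<beta> \<le> x * sqrt (real T)"
    for \<beta> \<rho> T g p X y w l D \<mu> qb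
  proof -
    interpret scalar_run N \<beta> \<rho> T g p X y w l D \<mu> qb by (rule run)
    define \<eta> where "\<eta> = C6 N * (\<rho> + 1 / \<beta>) / c3 N"
    have \<eta>h: "\<eta> \<le> h x"
      unfolding \<eta>_def h_def using \<rho>x \<beta>x(1) cp by (intro divide_right_mono mult_left_mono) auto
    have \<eta>0: "0 \<le> \<eta>" using cp \<rho> \<beta> by (simp add: \<eta>_def)
    have \<eta>2: "4 * sqrt \<eta> * (1 + m) + 5 * \<rho> \<le> m^2"
    proof -
      have "4 * sqrt \<eta> * (1 + m) \<le> 4 * sqrt (h x) * (1 + m)"
        using \<eta>h m by (intro mult_right_mono) auto
      then show ?thesis using x(5) \<rho>x by linarith
    qed
    have b2: "N + 1 + R0 N \<le> \<beta>^2"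
    proof -
      have "N + 1 + R0 N \<le> 1 / x" using x(1,6) by (simp add: field_simps)
      also have "\<dots> \<le> \<beta>" using \<beta>x(1) x(1) \<beta> by (simp add: field_simps)
      also have "\<dots> \<le> \<beta>^2" using \<beta> by (simp add: power2_eq_square)
      finally show ?thesis .
    qed
    have bT: "\<beta>^2 \<le> x * real T"
    proof -
      have "\<beta>^2 \<le> (x * sqrt (real T))^2" using \<beta>x(2) \<beta> by (intro power_mono) auto
      also have "\<dots> = x * (x * real T)" by (simp add: power_mult_distrib power2_eq_square)
      also have "\<dots> \<le> 1 * (x * real T)" using x by (intro mult_right_mono) auto
      finally show ?thesis by simp
    qed
    have KT: "K \<le> real T"
    proof -
      have "1 \<le> \<beta>^2" using \<beta> by (simp add: one_le_power)
      then have "1 \<le> x * real T" using bT by linarith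
      then have "x * K \<le> x * real T" using x(10) by (simp add: mult.commute)
      then show ?thesis using x(1) by simp
    qed
    define t1 where "t1 = nat \<lceil>\<theta> * real T\<rceil>"
    have tT: "5 \<le> \<theta> * real T" "1 / Z \<le> \<theta> * real T"
    proof -
      have "\<theta> * (5 / \<theta>) \<le> \<theta> * real T" using KT K(2) \<theta> by (intro mult_left_mono) auto
      then show "5 \<le> \<theta> * real T" using \<theta> by simp
      have "\<theta> * (1 / (\<theta> * Z)) \<le> \<theta> * real T" using KT K(3) \<theta> by (intro mult_left_mono) auto
      then show "1 / Z \<le> \<theta> * real T" using \<theta> by simp
    qed
    have t1: "\<theta> * real T \<le> real t1" "real t1 \<le> \<theta> * real T + 1"
      using tT(1) unfolding t1_def by linarith+
    have t1_5: "5 \<le> t1" using t1(1) tT(1) by linarith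
    have t1T: "real t1 \<le> (\<delta> / 2) * real T"
    proof -
      have "\<theta> * real T \<le> \<delta> / 4 * real T" using \<theta> by (intro mult_right_mono) auto
      moreover have "1 \<le> \<delta> / 4 * real T"
      proof -
        have "4 / \<delta> \<le> real T" using KT K(1) by linarith
        then have "4 \<le> real T * \<delta>" using \<delta> by (simp only: pos_divide_le_eq)
        then show ?thesis by (simp add: mult.commute)
      qed
      ultimately show ?thesis using t1(2) by linarith
    qed
    also have "\<dots> \<le> 1 * real T" using \<delta> by (intro mult_right_mono) auto
    finally have t1_T: "t1 \<le> T" by (simp only: mult_1_left of_nat_le_iff)
    have late1: "late t1"
    proof -
      have "x * real T \<le> \<theta> * real T" using x(9) by (intro mult_right_mono) auto
      then show ?thesis unfolding late_def using bT t1(1) N by linarith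
    qed
    have bt1: "\<beta> \<le> Z * sqrt (real t1 + 1)"
    proof -
      note \<beta>x(2)
      also have "x * sqrt (real T) \<le> (Z * sqrt \<theta>) * sqrt (real T)" using x(8) by (intro mult_right_mono) auto
      also have "\<dots> = Z * sqrt (\<theta> * real T)" by (simp add: real_sqrt_mult)
      also have "\<dots> \<le> Z * sqrt (real t1 + 1)" using t1(1) Z(1) by (intro mult_left_mono) auto
      finally show ?thesis .
    qed
    have xt1: "1 / (real t1 + 1) \<le> Z"
    proof -
      have "1 / Z \<le> real t1 + 1" using t1(1) tT(2) by linarith
      then show ?thesis using Z(1) by (simp add: field_simps)
    qed
    have "\<eta> \<le> 1 / 64" "\<eta> \<le> m" using \<eta>h x by auto
    note fb = final_bounds[OF b2 this(1)[unfolded \<eta>_def] m Z this(2)[unfolded \<eta>_def] \<eta>2[unfolded \<eta>_def]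
        t1_5 t1_T late1 bt1 xt1 al R1 R2]
    have gT: "g T > 0" using g_pos by simp
    have 1: "X T - N * g T \<le> \<delta> * g T"
    proof -
      have "\<eta> * g T \<le> \<delta> * g T" using \<eta>h x(4) gT by (intro mult_right_mono) auto
      then show ?thesis using fb(2) by (simp add: \<eta>_def)
    qed
    have 2: "(1 - \<delta>) * (B * \<beta>^2 * real T) \<le> (g T)^2"
    proof -
      have "(1 - \<delta>) * (B * \<beta>^2 * real T) \<le> ((1 - \<delta> / 2) * (1 - \<delta> / 2)) * (B * \<beta>^2 * real T)"
      proof (rule mult_right_mono)
        have "(1 - \<delta> / 2) * (1 - \<delta> / 2) = 1 - \<delta> + (\<delta> / 2)^2" by (simp add: power2_eq_square field_simps)
        moreover have "0 \<le> (\<delta> / 2)^2" by simp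
        ultimately show "1 - \<delta> \<le> (1 - \<delta> / 2) * (1 - \<delta> / 2)" by argo
      qed (use B in simp)
      also have "\<dots> = ((1 - \<delta> / 2) * B) * (\<beta>^2 * ((1 - \<delta> / 2) * real T))" by (simp only: mult_ac)
      also have "\<dots> \<le> (2 * (1 - m) / (N + 2 + 2 * m)) * (\<beta>^2 * (real T - real t1))"
      proof (rule mult_mono[OF R3])
        show "\<beta>^2 * ((1 - \<delta> / 2) * real T) \<le> \<beta>^2 * (real T - real t1)"
          using t1T by (intro mult_left_mono) (auto simp: left_diff_distrib)
      qed (use m N \<delta> in auto)
      also have "\<dots> = (2 * (1 - m) * \<beta>^2 / (N + 2 + 2 * m)) * (real T - real t1)" by simp
      finally show ?thesis using fb(3) by linarith
    qed
    have 3: "(g T)^2 \<le> (1 + \<delta>) * (B * \<beta>^2 * real T)"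
    proof -
      have "(C2 N)^2 * (real t1 + 1) + (2 * sqrt U * C1 N + 1)
          \<le> (C2 N)^2 * (\<theta> * real T + 2) + (2 * sqrt U * C1 N + 1)"
        using t1(2) by (intro add_right_mono mult_left_mono) auto
      also have "\<dots> = ((C2 N)^2 * \<theta>) * real T + (2 * (C2 N)^2 + 2 * sqrt U * C1 N + 1)"
        by (simp add: algebra_simps)
      also have "\<dots> \<le> (\<delta> / 4 * (N^2 * B)) * real T + (\<delta> / 4 * (N^2 * B)) * real T"
      proof (rule add_mono)
        show "((C2 N)^2 * \<theta>) * real T \<le> (\<delta> / 4 * (N^2 * B)) * real T" using \<theta>(3) by (rule mult_right_mono) simp
        have "(2 * (C2 N)^2 + 2 * sqrt U * C1 N + 1) / (\<delta> / 4 * (N^2 * B)) \<le> real T" using K(4) KT by linarith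
        moreover have "0 < \<delta> / 4 * (N^2 * B)" using \<delta> N B by simp
        ultimately show "2 * (C2 N)^2 + 2 * sqrt U * C1 N + 1 \<le> (\<delta> / 4 * (N^2 * B)) * real T"
          by (subst (asm) pos_divide_le_eq) (auto simp: mult.commute)
      qed
      also have "\<dots> = (\<delta> / 2) * (N^2 * B) * real T" by simp
      finally have M: "(C2 N)^2 * (real t1 + 1) + (2 * sqrt U * C1 N + 1) \<le> (\<delta> / 2) * (N^2 * B) * real T" .
      have "(N * g T)^2 \<le> (X T)^2" using Ng_X[of T] gT N by (intro power_mono) auto
      also note fb(4)
      also have "U * \<beta>^2 * real T + ((C2 N * \<beta>)^2 * (real t1 + 1) + (2 * sqrt U * C1 N + 1) * \<beta>^2)
          = \<beta>^2 * (U * real T + ((C2 N)^2 * (real t1 + 1) + (2 * sqrt U * C1 N + 1)))"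
        by (simp add: power_mult_distrib algebra_simps)
      also have "\<dots> \<le> \<beta>^2 * (U * real T + (\<delta> / 2) * (N^2 * B) * real T)"
        using M by (intro mult_left_mono add_left_mono) auto
      also have "\<dots> = N^2 * ((1 + \<delta>) * (B * \<beta>^2 * real T))" by (simp add: U_def algebra_simps)
      finally have "N^2 * (g T)^2 \<le> N^2 * ((1 + \<delta>) * (B * \<beta>^2 * real T))" by (simp add: power_mult_distrib)
      moreover have "N^2 > 0" using N by simp
      ultimately show ?thesis by (simp only: mult_le_cancel_left_pos)
    qed
    have Beq: "2 * \<beta>^2 * real T / (N + 2) = B * \<beta>^2 * real T" by (simp add: B_def)
    show ?thesis using fb(1) 1 2 3 unfolding Beq good_def by blast
  qed
  then show ?thesis using x(1) by blast
qed

section \<open>Trajectories\<close>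

definition dominates :: "real^'n^'n \<Rightarrow> real^'n \<Rightarrow> real \<Rightarrow> bool" where
  "dominates V \<theta> k \<longleftrightarrow> (\<forall>z. k * (par V \<theta> * (z \<bullet> \<theta>)^2 + gm V \<theta> * (z \<bullet> z - (z \<bullet> \<theta>)^2)) \<le> z \<bullet> (V *v z))"

lemma design_matrix_0: "design_matrix a 0 = mat 1"
  by (simp add: design_matrix_def)

lemma design_matrix_Suc: "design_matrix a (Suc t) = design_matrix a t + outer (a (Suc t)) (a (Suc t))"
  by (simp add: design_matrix_def outer_square_eq_outer)

lemma design_matrix_sym: "transpose (design_matrix a t) = design_matrix a t"
  by (induction t) (simp_all add: design_matrix_0 design_matrix_Suc transpose_add transpose_outer)

lemma design_matrix_mult: "design_matrix a t *v z = z + (\<Sum>s=1..t. (a s \<bullet> z) *\<^sub>R a s)"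
  by (induction t)
    (simp_all add: design_matrix_0 design_matrix_Suc matrix_vector_mult_add_rdistrib outer_mult_vec)

lemma design_matrix_quad: "z \<bullet> (design_matrix a t *v z) = z \<bullet> z + (\<Sum>s=1..t. (z \<bullet> a s)\<^sup>2)"
  by (simp add: design_matrix_mult inner_add_right inner_sum_right power2_eq_square inner_commute)

lemma design_matrix_pd: "z \<bullet> z \<le> z \<bullet> (design_matrix a t *v z)"
  by (simp add: design_matrix_quad sum_nonneg)

locale trajectory =
  fixes \<theta> :: "real^'n" and \<beta> :: real and T :: nat and a u :: "nat \<Rightarrow> real^'n"
  assumes unit: "norm \<theta> = 1" and dim: "CARD('n) \<ge> 2" and \<beta>: "\<beta> \<ge> 1"
    and u: "\<And>t. t \<le> T ==> norm (u t) = 1"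
    and opt: "\<And>t. t < T ==> is_arg_max (ucb_index \<beta> (design_matrix a t) (u t)) (\<lambda>x. x \<in> cball 0 1) (a (Suc t))"
begin

abbreviation "V t \<equiv> design_matrix a t"

lemma pd: "pd_matrix (V t) \<theta>"
  by unfold_locales (use design_matrix_sym design_matrix_pd unit dim in auto)

lemma step: "t < T ==> ucb_step (V t) \<theta> (u t) (a (Suc t)) \<beta>"
  unfolding ucb_step_def ucb_step_axioms_def using pd u \<beta> opt by simp

lemma norm_a: "t < T ==> norm (a (Suc t)) = 1" using ucb_step.norm_a[OF step] .

lemma trace_V: "t \<le> T ==> trace (V t) = real t + real CARD('n)"
proof (induction t)
  case (Suc t)
  then have "a (Suc t) \<bullet> a (Suc t) = 1" using norm_a[of t] by (simp add: norm_eq_1)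
  then show ?case using Suc by (simp add: design_matrix_Suc trace_add trace_outer)
qed (simp add: design_matrix_0 trace_I)

text \<open>A bound on the least eigenvalue, obtained from \<open>det_le_quad\<close> with the
  direction of \<open>z\<close> in place of \<open>\<theta>\<close> and the trace as a bound on the
  complementary block.\<close>

lemma det_quad_lower:
  assumes "t \<le> T"
  shows "det (V t) / (real t + real CARD('n)) ^ (CARD('n) - 1) * (z \<bullet> z) \<le> z \<bullet> (V t *v z)"
proof (cases "z = 0")
  case False
  define v where "v = (1 / norm z) *\<^sub>R z"
  have v: "norm v = 1" using False by (simp add: v_def)
  interpret v: pd_matrix "V t" v by unfold_locales (use design_matrix_sym design_matrix_pd v dim in auto)
  have d: "real t + real CARD('n) > 0" using dim by simp
  have X0: "0 \<le> perp (V t) v" using v.N_g_le v.g_pos v.N_ge by (meson mult_nonneg_nonneg less_imp_le order_trans zero_le_one)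
  have "perp (V t) v / (real CARD('n) - 1) \<le> perp (V t) v / 1"
    using X0 v.N_ge by (intro divide_left_mono) auto
  also have "\<dots> \<le> real t + real CARD('n)" using trace_V[OF assms] v.p_pos by (simp add: perp_def)
  finally have "(perp (V t) v / (real CARD('n) - 1)) ^ (CARD('n) - 1) \<le> (real t + real CARD('n)) ^ (CARD('n) - 1)"
    using X0 v.N_ge by (intro power_mono) auto
  then have "det (V t) \<le> par (V t) v * (real t + real CARD('n)) ^ (CARD('n) - 1)"
    using v.det_le_quad v.p_pos by (meson less_imp_le mult_left_mono order_trans)
  then have "det (V t) / (real t + real CARD('n)) ^ (CARD('n) - 1) \<le> par (V t) v"
    using d by (simp add: pos_divide_le_eq)
  also have "par (V t) v = (z \<bullet> (V t *v z)) / (z \<bullet> z)"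
    by (simp add: par_def v_def matrix_vector_mult_scaleR power2_norm_eq_inner[symmetric] power2_eq_square)
  finally show ?thesis using False by (simp add: pos_le_divide_eq)
qed simp

lemma det_le_par: "t \<le> T ==> det (V t) / (real t + real CARD('n)) ^ (CARD('n) - 1) \<le> par (V t) \<theta>"
  using det_quad_lower[of t \<theta>] unit by (simp add: par_def norm_eq_1)

lemma det_le_gm:
  assumes "t \<le> T"
  shows "det (V t) / (real t + real CARD('n)) ^ (CARD('n) - 1) \<le> gm (V t) \<theta>"
proof -
  interpret pd_matrix "V t" \<theta> by (rule pd)
  have "0 < real t + real CARD('n)" using dim by simp
  then show ?thesis using det_ge by (intro le_g det_quad_lower assms divide_pos_pos zero_less_power) auto
qed

lemma sq_inner_le: "(z \<bullet> \<theta>)^2 \<le> z \<bullet> z"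
  using Cauchy_Schwarz_ineq[of z \<theta>] unit by (simp add: norm_eq_1)

lemma dominates_mono: "dominates (V t) \<theta> k ==> k' \<le> k ==> dominates (V t) \<theta> k'"
proof -
  assume k: "dominates (V t) \<theta> k" "k' \<le> k"
  interpret pd_matrix "V t" \<theta> by (rule pd)
  have "0 \<le> par (V t) \<theta> * (z \<bullet> \<theta>)^2 + gm (V t) \<theta> * (z \<bullet> z - (z \<bullet> \<theta>)^2)" for z
    using p_pos g_pos sq_inner_le[of z] by simp
  then show ?thesis using k unfolding dominates_def by (meson mult_right_mono order_trans)
qed

lemma scalar_run:
  assumes \<rho>: "0 < \<rho>" "\<rho> \<le> 1 / 5"
    and e: "\<And>t. t < T ==> dominates (V t) \<theta> (kappa (real CARD('n) - 1)) ==>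
      kappa (real CARD('n) - 1) * (real t + 1) \<le> par (V t) \<theta> ==>
      kappa (real CARD('n) - 1) * perp (V t) \<theta> \<le> gm (V t) \<theta> ==>
      (norm (u t - \<theta>))^2 * min (par (V t) \<theta>) (gm (V t) \<theta>) \<le> \<rho>^2 * \<beta>^2"
  shows "scalar_run (real CARD('n) - 1) \<beta> \<rho> T (\<lambda>t. gm (V t) \<theta>) (\<lambda>t. par (V t) \<theta>) (\<lambda>t. perp (V t) \<theta>)
    (\<lambda>t. ucb_step.y \<theta> (a (Suc t))) (\<lambda>t. pd_matrix.wn (V t) (a (Suc t)))
    (\<lambda>t. ucb_step.l (V t) (u t) (a (Suc t)) \<beta>) (\<lambda>t. det (V t))
    (\<lambda>t. ucb_step.\<mu> (V t) (u t) (a (Suc t)) \<beta>) (\<lambda>t k. dominates (V t) \<theta> k)"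
proof -
  have powr: "(real t + (real CARD('n) - 1 + 1)) powr (real CARD('n) - 1) = (real t + real CARD('n)) ^ (CARD('n) - 1)" for t
    using dim by (simp add: powr_realpow[symmetric] of_nat_diff)
  show ?thesis
  \<comment> \<open>The cases follow the order of the locale assumptions. The estimation error
    enters only in the last one, through \<open>e\<close>.\<close>
  proof (unfold_locales, goal_cases)
    case 1
    show ?case using dim by simp
  next
    case 2
    show ?case by (rule \<beta>)
  next
    case 3
    show ?case by (rule \<rho>)
  next
    case 4
    show ?case by (rule \<rho>)
  next
    case 5
    show ?case using unit by (simp add: design_matrix_0 perp_def par_def trace_I norm_eq_1)
  next
    case 6
    show ?case using unit by (simp add: design_matrix_0 par_def norm_eq_1)
  next
    case 7
    show ?case using unit by (simp add: design_matrix_0 gm_def par_def norm_eq_1)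
  next
    case 8
    show ?case by (simp add: design_matrix_0)
  next
    case (9 t)
    interpret ucb_step "V t" \<theta> "u t" "a (Suc t)" \<beta> by (rule step[OF 9])
    show ?case
      by (simp add: perp_def par_def design_matrix_Suc trace_add trace_outer y_def matrix_vector_mult_add_rdistrib
          outer_mult_vec inner_add_right power2_eq_square inner_commute[of \<theta>])
  next
    case (10 t)
    interpret ucb_step "V t" \<theta> "u t" "a (Suc t)" \<beta> by (rule step[OF 10])
    show ?case
      by (simp add: par_def design_matrix_Suc matrix_vector_mult_add_rdistrib
          outer_mult_vec inner_add_right c_sq[symmetric] power2_eq_square inner_commute[of \<theta>])
  next
    case (11 t)
    interpret ucb_step "V t" \<theta> "u t" "a (Suc t)" \<beta> by (rule step[OF 11])
    show ?case using det_nz by (simp add: design_matrix_Suc det_rank_one_update wn_sq)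
  next
    case (12 t)
    interpret ucb_step "V t" \<theta> "u t" "a (Suc t)" \<beta> by (rule step[OF 12])
    show ?case by (rule y_nonneg)
  next
    case (13 t)
    interpret ucb_step "V t" \<theta> "u t" "a (Suc t)" \<beta> by (rule step[OF 13])
    show ?case by (rule y_le)
  next
    case (14 t)
    show ?case by (rule pd_matrix.g_pos[OF pd])
  next
    case (15 t)
    show ?case by (rule pd_matrix.p_ge[OF pd])
  next
    case (16 t)
    show ?case by (rule pd_matrix.det_ge[OF pd])
  next
    case (17 t)
    interpret pd_matrix "V t" \<theta> by (rule pd)
    show ?case using N_ge det_ge p_pos by (simp add: gm_def ln_powr ln_div)
  next
    case (18 t)
    interpret ucb_step "V t" \<theta> "u t" "a (Suc t)" \<beta> by (rule step[OF 18])
    show ?case by (rule w_pos)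
  next
    case (19 t)
    interpret ucb_step "V t" \<theta> "u t" "a (Suc t)" \<beta> by (rule step[OF 19])
    show ?case by (rule w_le_1)
  next
    case (20 t)
    interpret ucb_step "V t" \<theta> "u t" "a (Suc t)" \<beta> by (rule step[OF 20])
    show ?case by (rule l_pos)
  next
    case (21 t)
    interpret ucb_step "V t" \<theta> "u t" "a (Suc t)" \<beta> by (rule step[OF 21])
    show ?case by (rule l_le_g)
  next
    case (22 t)
    interpret ucb_step "V t" \<theta> "u t" "a (Suc t)" \<beta> by (rule step[OF 22])
    show ?case by (rule l_le_p)
  next
    case (23 t)
    interpret ucb_step "V t" \<theta> "u t" "a (Suc t)" \<beta> by (rule step[OF 23])
    show ?case using w_pos mu_ge_1 by (simp add: l_def)
  next
    case (24 t)
    interpret ucb_step "V t" \<theta> "u t" "a (Suc t)" \<beta> by (rule step[OF 24])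
    show ?case by (rule mu_ge_1)
  next
    case (25 t)
    interpret ucb_step "V t" \<theta> "u t" "a (Suc t)" \<beta> by (rule step[OF 25])
    show ?case by (rule mu_le)
  next
    case (26 t)
    interpret ucb_step "V t" \<theta> "u t" "a (Suc t)" \<beta> by (rule step[OF 26])
    have d: "0 < real t + real CARD('n)" using dim by simp
    have "1 \<le> (wn (u t))^2 * (real t + real CARD('n))" using wn_ge[OF u] 26 trace_V[of t] by simp
    then have "(1 / sqrt (real t + real CARD('n)))^2 \<le> (wn (u t))^2"
      using d by (simp add: power_divide pos_divide_le_eq)
    then have "1 / sqrt (real t + real CARD('n)) \<le> wn (u t)" by (rule power2_le_imp_le) (rule wn_nonneg)
    then have "\<beta> * (1 / sqrt (real t + real CARD('n))) \<le> \<beta> * wn (u t)" using \<beta> by (intro mult_left_mono) auto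
    then show ?case using mu_ge by simp
  next
    case (27 t)
    interpret ucb_step "V t" \<theta> "u t" "a (Suc t)" \<beta> by (rule step[OF 27])
    show ?case by (rule l_w_ge)
  next
    case (28 t)
    show ?case by (rule pd_matrix.N_g_le[OF pd])
  next
    case (29 t k)
    interpret ucb_step "V t" \<theta> "u t" "a (Suc t)" \<beta> by (rule step[OF 29(1)])
    show ?case
      using wn_dual_le[OF _ 29(3), of "a (Suc t)"] 29(2) unfolding dominates_def c_sq[symmetric]
      by (simp add: y_def a')
  next
    case (30 t \<eta>)
    show ?case unfolding dominates_def using pd_matrix.quad_ge[OF pd] 30 by blast
  next
    case (31 t k k')
    then show ?case using dominates_mono by blast
  next
    case (32 t k)
    interpret pd_matrix "V t" \<theta> by (rule pd)
    show ?case unfolding dominates_def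
    proof
      fix z
      let ?q = "det (V t) / (real t + real CARD('n)) ^ (CARD('n) - 1)"
      have "k * par (V t) \<theta> * (z \<bullet> \<theta>)^2 \<le> ?q * (z \<bullet> \<theta>)^2"
        using 32(3) unfolding powr by (intro mult_right_mono) auto
      have "k * gm (V t) \<theta> * (z \<bullet> z - (z \<bullet> \<theta>)^2) \<le> ?q * (z \<bullet> z - (z \<bullet> \<theta>)^2)"
        using 32(4) sq_inner_le unfolding powr by (intro mult_right_mono) auto
      have "?q * (z \<bullet> z) \<le> z \<bullet> (V t *v z)" by (rule det_quad_lower[OF 32(1)])
      show "k * (par (V t) \<theta> * (z \<bullet> \<theta>)^2 + gm (V t) \<theta> * (z \<bullet> z - (z \<bullet> \<theta>)^2)) \<le> z \<bullet> (V t *v z)"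
      proof -
        have "k * (P * A + G * (Z - A)) \<le> R" if "k * P * A \<le> q * A" "k * G * (Z - A) \<le> q * (Z - A)" "q * Z \<le> R"
          for P A G Z q R :: real using that by (simp add: algebra_simps)
        then show ?thesis
          using \<open>k * par (V t) \<theta> * (z \<bullet> \<theta>)^2 \<le> _\<close> \<open>k * gm (V t) \<theta> * _ \<le> _\<close> \<open>?q * (z \<bullet> z) \<le> _\<close> by blast
      qed
    qed
  next
    case (33 t)
    show ?case unfolding powr by (rule det_le_par[OF 33])
  next
    case (34 t)
    show ?case unfolding powr by (rule det_le_gm[OF 34])
  next
    case (35 t)
    interpret pd_matrix "V t" \<theta> by (rule pd)
    have "0 \<le> z \<bullet> (V t *v z)" for z by (rule V_nonneg)
    then have "det (V t) \<le> ((real t + real CARD('n)) / real CARD('n)) ^ CARD('n)"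
      using psd_det_le[OF design_matrix_sym[of a t]] trace_V[OF 35] by simp
    also have "\<dots> \<le> (1 + real t) ^ CARD('n)"
    proof (rule power_mono)
      have "real t * 1 \<le> real t * real CARD('n)" using dim by (intro mult_left_mono) auto
      then show "(real t + real CARD('n)) / real CARD('n) \<le> 1 + real t" using dim by (simp add: field_simps)
    qed simp
    finally have "ln (det (V t)) \<le> ln ((1 + real t) ^ CARD('n))" using det_ge by simp
    then show ?case by (simp add: ln_realpow)
  next
    case (36 t)
    interpret ucb_step "V t" \<theta> "u t" "a (Suc t)" \<beta> by (rule step[OF 36(1)])
    have "(norm (u t - \<theta>))^2 * l \<le> (norm (u t - \<theta>))^2 * min (par (V t) \<theta>) (gm (V t) \<theta>)"
      using l_le_g l_le_p by (intro mult_left_mono) auto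
    also have "\<dots> \<le> \<rho>^2 * \<beta>^2" by (rule e[OF 36])
    finally show ?case using exploration_le_rho[OF _ \<rho>(1)] \<rho>(2) by (simp add: c_sq)
  qed
qed

end

section \<open>Estimation error along a trajectory\<close>

lemma norm_diff_unit_projection_le:
  assumes "is_unit_projection x v" "norm \<theta> = 1"
  shows "norm (v - \<theta>) \<le> 2 * norm (x - \<theta>)"
proof (cases "x = 0")
  case True
  then show ?thesis using norm_triangle_ineq4[of v \<theta>] assms by (simp add: is_unit_projection_def)
next
  case False
  then have v: "v = (1 / norm x) *\<^sub>R x" using assms by (simp add: is_unit_projection_def)
  \<comment> \<open>Normalising moves \<open>x\<close> by exactly the difference between its norm
    and 1, which the reverse triangle inequality bounds by the distance to
    \<open>\<theta>\<close>.\<close>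
  have "v - x = (1 / norm x - 1) *\<^sub>R x" by (simp add: v scaleR_diff_left)
  then have "norm (v - x) = \<bar>1 / norm x - 1\<bar> * norm x" by simp
  also have "\<dots> = \<bar>(1 / norm x - 1) * norm x\<bar>" by (simp add: abs_mult)
  also have "(1 / norm x - 1) * norm x = norm \<theta> - norm x" using False assms by (simp add: left_diff_distrib)
  also have "\<bar>norm \<theta> - norm x\<bar> \<le> norm (x - \<theta>)" using norm_triangle_ineq3[of \<theta> x] by (simp add: norm_minus_commute)
  finally have "norm (v - x) \<le> norm (x - \<theta>)" .
  then show ?thesis using norm_triangle_ineq[of "v - x" "x - \<theta>"] by simp
qed

text \<open>The projected coordinate axes form a Parseval frame of the hyperplane orthogonal to a
  unit vector \<open>\<theta>\<close>; they serve in place of an orthonormal basis and need no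
  choice.\<close>

abbreviation tangent :: "real^'n \<Rightarrow> 'n \<Rightarrow> real^'n" where
  "tangent \<theta> i \<equiv> axis i 1 - \<theta> $ i *\<^sub>R \<theta>"

lemma sum_projected_axes_sq:
  fixes \<theta> v :: "real^'n"
  assumes "norm \<theta> = 1"
  shows "(\<Sum>i\<in>UNIV. (tangent \<theta> i \<bullet> v)\<^sup>2) = v \<bullet> v - (v \<bullet> \<theta>)^2"
proof -
  have "tangent \<theta> i \<bullet> v = (v - (v \<bullet> \<theta>) *\<^sub>R \<theta>) $ i" for i
    by (simp add: inner_diff_left inner_axis' inner_commute[of v \<theta>] mult.commute)
  then have "(\<Sum>i\<in>UNIV. (tangent \<theta> i \<bullet> v)\<^sup>2) = (v - (v \<bullet> \<theta>) *\<^sub>R \<theta>) \<bullet> (v - (v \<bullet> \<theta>) *\<^sub>R \<theta>)"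
    by (simp only: inner_vec_def[of "v - _"] inner_real_def power2_eq_square)
  also have "\<dots> = v \<bullet> v - (v \<bullet> \<theta>)^2"
    using assms by (simp add: inner_diff_left inner_diff_right norm_eq_1 inner_commute power2_eq_square)
  finally show ?thesis .
qed

definition noise_sum :: "(nat \<Rightarrow> real^'n) \<Rightarrow> (nat \<Rightarrow> real) \<Rightarrow> nat \<Rightarrow> real^'n" where
  "noise_sum a e t = (\<Sum>s=1..t. e s *\<^sub>R a s)"

text \<open>One outcome with controlled noise. \<open>B\<close> is the iterated-logarithm level,
  uniform over all rounds, and the self-normalised form of the two noise bounds matches the entries
  of the design matrix.\<close>

locale noisy_trajectory = trajectory \<theta> \<beta> T a u
  for \<theta> :: "real^'n" and \<beta> :: real and T :: nat and a u :: "nat \<Rightarrow> real^'n" +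
  fixes r e :: "nat \<Rightarrow> real" and B :: real
  assumes est: "\<And>t. t \<le> T ==> is_unit_projection (ridge_estimator a r t) (u t)"
    and reward: "\<And>t. t \<in> {1..T} ==> r t = a t \<bullet> \<theta> + e t"
    and B: "B \<ge> 1"
    and noise_par: "\<And>t. t \<le> T ==> (\<theta> \<bullet> noise_sum a e t)^2 \<le> B * (1 + (\<Sum>s=1..t. (\<theta> \<bullet> a s)\<^sup>2))"
    and noise_perp: "\<And>t i. t \<le> T ==> (tangent \<theta> i \<bullet> noise_sum a e t)^2
      \<le> B * (1 + (\<Sum>s=1..t. (tangent \<theta> i \<bullet> a s)\<^sup>2))"
begin

abbreviation "S \<equiv> noise_sum a e"

lemma par_eq: "par (V t) \<theta> = 1 + (\<Sum>s=1..t. (\<theta> \<bullet> a s)\<^sup>2)"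
  using unit by (simp add: par_def design_matrix_quad norm_eq_1)

lemma perp_eq:
  assumes "t \<le> T"
  shows "perp (V t) \<theta> = real CARD('n) - 1 + (\<Sum>s=1..t. a s \<bullet> a s - (a s \<bullet> \<theta>)^2)"
proof -
  have "a s \<bullet> a s = 1" if "s \<in> {1..t}" for s
  proof -
    have "s - 1 < T" "Suc (s - 1) = s" using that assms by auto
    then show ?thesis using norm_a[of "s - 1"] by (simp add: norm_eq_1)
  qed
  then have "(\<Sum>s=1..t. a s \<bullet> a s - (a s \<bullet> \<theta>)^2) = real t - (\<Sum>s=1..t. (\<theta> \<bullet> a s)\<^sup>2)"
    by (simp add: sum_subtractf inner_commute)
  then show ?thesis by (simp add: perp_def par_eq trace_V[OF assms])
qed

lemma S_perp:
  assumes "t \<le> T"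
  shows "S t \<bullet> S t - (S t \<bullet> \<theta>)^2 \<le> 2 * B * perp (V t) \<theta>"
proof -
  interpret pd_matrix "V t" \<theta> by (rule pd)
  have "S t \<bullet> S t - (S t \<bullet> \<theta>)^2 = (\<Sum>i\<in>UNIV. (tangent \<theta> i \<bullet> S t)\<^sup>2)"
    by (simp add: sum_projected_axes_sq[OF unit])
  also have "\<dots> \<le> (\<Sum>i\<in>UNIV. B * (1 + (\<Sum>s=1..t. (tangent \<theta> i \<bullet> a s)\<^sup>2)))"
    by (intro sum_mono noise_perp assms)
  also have "\<dots> = B * (real CARD('n) + (\<Sum>s=1..t. \<Sum>i\<in>UNIV. (tangent \<theta> i \<bullet> a s)\<^sup>2))"
    by (subst sum.swap) (simp add: sum_distrib_left[symmetric] sum.distrib)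
  also have "\<dots> = B * (perp (V t) \<theta> + 1)"
    by (simp add: sum_projected_axes_sq[OF unit] perp_eq[OF assms])
  also have "\<dots> \<le> B * (2 * perp (V t) \<theta>)"
  proof -
    have "0 \<le> (\<Sum>s=1..t. a s \<bullet> a s - (a s \<bullet> \<theta>)^2)"
      using sq_inner_le by (intro sum_nonneg) simp
    then have "1 \<le> perp (V t) \<theta>" using perp_eq[OF assms] N_ge by linarith
    then show ?thesis using B by (intro mult_left_mono) auto
  qed
  finally show ?thesis by simp
qed

definition "z t = matrix_inv (V t) *v (S t - \<theta>)"

lemma ridge_eq:
  assumes "t \<le> T"
  shows "ridge_estimator a r t = \<theta> + z t"
proof -
  interpret pd_matrix "V t" \<theta> by (rule pd)
  have "(\<Sum>s=1..t. r s *\<^sub>R a s) = (\<Sum>s=1..t. (a s \<bullet> \<theta>) *\<^sub>R a s + e s *\<^sub>R a s)"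
    using assms by (intro sum.cong refl) (simp add: reward scaleR_add_left)
  also have "\<dots> = V t *v \<theta> + (S t - \<theta>)"
    by (simp add: sum.distrib design_matrix_mult noise_sum_def)
  finally show ?thesis by (simp add: ridge_estimator_def z_def matrix_vector_right_distrib W_V)
qed

text \<open>\<open>k\<close> is squared because domination is used twice on the same number: as a
  lower bound for the \<open>V\<close>-form at \<open>z t\<close> and, through
  \<open>wn_dual_le\<close>, as an upper bound for the inverse form at
  \<open>S t - \<theta>\<close>.\<close>

lemma z_quad_le:
  assumes "t \<le> T" and k: "k > 0" "dominates (V t) \<theta> k"
  shows "k^2 * (par (V t) \<theta> * (z t \<bullet> \<theta>)^2 + gm (V t) \<theta> * (z t \<bullet> z t - (z t \<bullet> \<theta>)^2))
    \<le> (S t \<bullet> \<theta> - 1)^2 / par (V t) \<theta> + (S t \<bullet> S t - (S t \<bullet> \<theta>)^2) / gm (V t) \<theta>"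
proof -
  interpret pd_matrix "V t" \<theta> by (rule pd)
  have eq: "z t \<bullet> (V t *v z t) = (wn (S t - \<theta>))^2" by (simp add: z_def V_W wn_sq inner_commute)
  have v: "(S t - \<theta>) \<bullet> \<theta> = S t \<bullet> \<theta> - 1"
    "(S t - \<theta>) \<bullet> (S t - \<theta>) - (S t \<bullet> \<theta> - 1)^2 = S t \<bullet> S t - (S t \<bullet> \<theta>)^2"
    by (simp_all add: inner_diff_left inner_diff_right unit' inner_commute power2_eq_square algebra_simps)
  have "k * (k * (p * (z t \<bullet> \<theta>)^2 + g * (z t \<bullet> z t - (z t \<bullet> \<theta>)^2))) \<le> k * (wn (S t - \<theta>))^2"
    using k unfolding dominates_def eq[symmetric] by (intro mult_left_mono) auto
  also have "\<dots> \<le> (S t \<bullet> \<theta> - 1)^2 / p + (S t \<bullet> S t - (S t \<bullet> \<theta>)^2) / g"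
    using wn_dual_le[OF _ k(1), of "S t - \<theta>"] k(2) unfolding dominates_def v by simp
  finally show ?thesis by (simp add: power2_eq_square mult.assoc)
qed

lemma z_norm_le:
  assumes "t \<le> T" and k: "k > 0" "dominates (V t) \<theta> k"
  shows "k^2 * ((norm (z t))^2 * min (par (V t) \<theta>) (gm (V t) \<theta>))
    \<le> (S t \<bullet> \<theta> - 1)^2 / par (V t) \<theta> + (S t \<bullet> S t - (S t \<bullet> \<theta>)^2) / gm (V t) \<theta>"
proof -
  interpret pd_matrix "V t" \<theta> by (rule pd)
  have "min p g * (z t \<bullet> \<theta>)^2 \<le> p * (z t \<bullet> \<theta>)^2"
    "min p g * (z t \<bullet> z t - (z t \<bullet> \<theta>)^2) \<le> g * (z t \<bullet> z t - (z t \<bullet> \<theta>)^2)"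
    using sq_inner_le by (intro mult_right_mono; simp)+
  then have "(norm (z t))^2 * min p g \<le> p * (z t \<bullet> \<theta>)^2 + g * (z t \<bullet> z t - (z t \<bullet> \<theta>)^2)"
    by (simp add: power2_norm_eq_inner algebra_simps)
  then have "k^2 * ((norm (z t))^2 * min p g) \<le> k^2 * (p * (z t \<bullet> \<theta>)^2 + g * (z t \<bullet> z t - (z t \<bullet> \<theta>)^2))"
    by (rule mult_left_mono) simp
  then show ?thesis using z_quad_le[OF assms] by linarith
qed

text \<open>The outer 4 is the squared loss of the normalisation. Inside, the component along
  \<open>\<theta>\<close> contributes \<open>2 * B + 2\<close>, at most \<open>4 * B\<close>, and
  the orthogonal ones \<open>2 * B / k\<close>, because \<open>k * X \<le> g\<close>.\<close>

lemma estimation_error: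
  assumes t: "t \<le> T" and k: "0 < k" "dominates (V t) \<theta> k" "k * perp (V t) \<theta> \<le> gm (V t) \<theta>"
  shows "(norm (u t - \<theta>))^2 * min (par (V t) \<theta>) (gm (V t) \<theta>) \<le> 4 * (4 + 2 / k) / k^2 * B"
proof -
  interpret pd_matrix "V t" \<theta> by (rule pd)
  have m: "min p g > 0" using p_pos g_pos by simp
  have "norm (u t - \<theta>) \<le> 2 * norm (z t)"
    using norm_diff_unit_projection_le[OF est[OF t] unit] by (simp add: ridge_eq[OF t])
  then have "(norm (u t - \<theta>))^2 \<le> (2 * norm (z t))^2" by (intro power_mono) auto
  then have "(norm (u t - \<theta>))^2 * min p g \<le> (2 * norm (z t))^2 * min p g" using m by (intro mult_right_mono) auto
  also have "\<dots> = 4 * ((norm (z t))^2 * min p g)" by (simp add: power_mult_distrib)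
  also have "(norm (z t))^2 * min p g \<le> ((4 + 2 / k) * B) / k^2"
  proof -
    have "(S t \<bullet> \<theta> - 1)^2 / p \<le> 2 * B + 2"
    proof -
      have "(S t \<bullet> \<theta> - 1)^2 \<le> 2 * (S t \<bullet> \<theta>)^2 + 2"
        using zero_le_power2[of "S t \<bullet> \<theta> + 1"] by (simp add: power2_eq_square algebra_simps)
      also have "\<dots> \<le> 2 * (B * p) + 2 * p" using noise_par[OF t] p_ge by (simp add: par_eq inner_commute)
      finally show ?thesis using p_pos by (simp add: pos_divide_le_eq algebra_simps)
    qed
    moreover have "(S t \<bullet> S t - (S t \<bullet> \<theta>)^2) / g \<le> 2 * B / k"
    proof -
      have "S t \<bullet> S t - (S t \<bullet> \<theta>)^2 \<le> 2 * B * X" by (rule S_perp[OF t])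
      also have "\<dots> \<le> 2 * B * (g / k)"
        using k B by (intro mult_left_mono) (auto simp: pos_le_divide_eq mult.commute)
      finally show ?thesis using g_pos by (simp add: pos_divide_le_eq)
    qed
    moreover have "2 * B + 2 + 2 * B / k \<le> (4 + 2 / k) * B" using B by (simp add: distrib_right)
    ultimately have "k^2 * ((norm (z t))^2 * min p g) \<le> (4 + 2 / k) * B"
      using z_norm_le[OF t k(1,2)] by linarith
    then show ?thesis using k(1) by (simp add: pos_le_divide_eq mult.commute)
  qed
  finally have "(norm (u t - \<theta>))^2 * min p g \<le> 4 * (((4 + 2 / k) * B) / k^2)" by (simp del: distrib_right_numeral)
  moreover have "4 * (4 + 2 / k) / k^2 * B = 4 * (((4 + 2 / k) * B) / k^2)"
    by (simp only: times_divide_eq_right times_divide_eq_left mult.assoc)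
  ultimately show ?thesis by (simp only:)
qed

text \<open>The second conclusion keeps its noise bounds as premises: the one orthogonal to
  \<open>\<theta>\<close> becomes available only after the first conclusion has bounded the
  variation by a multiple of \<open>L\<close>.\<close>

lemma final_estimator:
  assumes k: "0 < k" "dominates (V T) \<theta> k" "k * (real T + 1) \<le> par (V T) \<theta>"
    and \<delta>: "0 < \<delta>" "\<delta> \<le> 1 / 4" "perp (V T) \<theta> - (real CARD('n) - 1) * gm (V T) \<theta> \<le> \<delta> * gm (V T) \<theta>"
    and L: "0 < L" "\<bar>gm (V T) \<theta> - L\<bar> \<le> \<delta> * L"
    and \<zeta>: "\<zeta> \<bullet> \<theta> = 0"
  shows "\<bar>\<zeta> \<bullet> (V T *v \<zeta>) - L * (\<zeta> \<bullet> \<zeta>)\<bar> \<le> 9 * sqrt \<delta> * L * (\<zeta> \<bullet> \<zeta>)"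
    and "(\<theta> \<bullet> S T)^2 \<le> K * real T ==> S T \<bullet> S T - (S T \<bullet> \<theta>)^2 \<le> K * L ==> K \<ge> 0 ==>
      4 * ((2 * K + 2) / k + 2 * K) \<le> (k * \<nu>)^2 * min (k * (real T + 1)) L ==> 0 < \<nu> ==> \<nu> \<le> 1 / 2 ==>
      \<bar>sqrt L * (\<zeta> \<bullet> u T) - (\<zeta> \<bullet> S T) / sqrt L\<bar>
        \<le> norm \<zeta> * sqrt ((2 * K + 2) / k + 2 * K) * (20 * sqrt \<delta> / k + 2 * \<nu> * (20 * sqrt \<delta> / k + 2))"
proof -
  interpret pd_matrix "V T" \<theta> by (rule pd)
  have gL: "(1 - \<delta>) * L \<le> g" "g \<le> (1 + \<delta>) * L" using L(2) by (simp_all add: abs_le_iff algebra_simps)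
  have gL': "L / 2 \<le> g" "g \<le> 2 * L"
  proof -
    have "\<delta> * L \<le> (1 / 4) * L" using \<delta> L by (intro mult_right_mono) auto
    then show "L / 2 \<le> g" "g \<le> 2 * L" using L by linarith+
  qed
  have \<delta>s: "\<delta> \<le> sqrt \<delta>" and s2: "sqrt \<delta> \<le> 1 / 2"
  proof -
    have "\<delta> * \<delta> \<le> 1 * \<delta>" using \<delta> by (intro mult_right_mono) auto
    then show "\<delta> \<le> sqrt \<delta>" using \<delta> by (intro real_le_rsqrt) (simp add: power2_eq_square)
    show "sqrt \<delta> \<le> 1 / 2" using \<delta> by (intro real_le_lsqrt) (auto simp: power2_eq_square)
  qed
  have quad: "\<bar>y \<bullet> (V T *v y) - L * (y \<bullet> y)\<bar> \<le> 9 * sqrt \<delta> * L * (y \<bullet> y)" if y: "y \<bullet> \<theta> = 0" for y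
  proof -
    have "y \<bullet> (V T *v y) \<le> (1 + 4 * sqrt \<delta>) * g * (y \<bullet> y)"
      using quad_perp_le[OF \<delta>(3) _ y] \<delta> by simp
    also have "\<dots> \<le> ((1 + 4 * sqrt \<delta>) * ((1 + \<delta>) * L)) * (y \<bullet> y)"
      using gL \<delta> by (intro mult_right_mono mult_left_mono) auto
    also have "\<dots> \<le> ((1 + 9 * sqrt \<delta>) * L) * (y \<bullet> y)"
    proof -
      have "sqrt \<delta> * \<delta> \<le> sqrt \<delta> * (1 / 4)" using \<delta> by (intro mult_left_mono) auto
      then have "(1 + 4 * sqrt \<delta>) * (1 + \<delta>) \<le> 1 + 9 * sqrt \<delta>"
      proof -
        have "(1 + 4 * a) * (1 + d) \<le> 1 + 9 * a" if "a * d \<le> a * (1 / 4)" "d \<le> a" "0 \<le> a" for a d :: real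
          using that by (simp add: algebra_simps)
        then show ?thesis using \<delta>s \<delta> \<open>sqrt \<delta> * \<delta> \<le> _\<close> by simp
      qed
      then have "((1 + 4 * sqrt \<delta>) * (1 + \<delta>)) * L \<le> (1 + 9 * sqrt \<delta>) * L" using L by (intro mult_right_mono) auto
      then show ?thesis by (intro mult_right_mono) (auto simp: mult.assoc)
    qed
    finally have up: "y \<bullet> (V T *v y) \<le> ((1 + 9 * sqrt \<delta>) * L) * (y \<bullet> y)" .
    have "((1 - 9 * sqrt \<delta>) * L) * (y \<bullet> y) \<le> ((1 - 4 * sqrt \<delta>) * g) * (y \<bullet> y)"
    proof (cases "1 - 4 * sqrt \<delta> \<ge> 0")
      case True
      have "(1 - 9 * sqrt \<delta>) \<le> (1 - 4 * sqrt \<delta>) * (1 - \<delta>)"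
      proof -
        have "0 \<le> 4 * sqrt \<delta> * \<delta>" using \<delta> by simp
        then have "1 - 4 * sqrt \<delta> - \<delta> \<le> (1 - 4 * sqrt \<delta>) * (1 - \<delta>)" by (simp add: algebra_simps)
        then show ?thesis using \<delta>s \<delta> real_sqrt_ge_zero[of \<delta>] by linarith
      qed
      then have "(1 - 9 * sqrt \<delta>) * L \<le> (1 - 4 * sqrt \<delta>) * (1 - \<delta>) * L" using L by (intro mult_right_mono) auto
      also have "\<dots> \<le> (1 - 4 * sqrt \<delta>) * g" using gL True by (simp add: mult.assoc mult_left_mono)
      finally show ?thesis by (intro mult_right_mono) auto
    next
      case False
      have "(1 - 9 * sqrt \<delta>) * L \<le> (2 * (1 - 4 * sqrt \<delta>)) * L"
        using s2 \<delta>s \<delta> L real_sqrt_ge_zero[of \<delta>] by (intro mult_right_mono) auto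
      also have "\<dots> \<le> (1 - 4 * sqrt \<delta>) * g"
        using mult_left_mono_neg[OF gL'(2), of "1 - 4 * sqrt \<delta>"] False by (simp add: mult_ac)
      finally show ?thesis by (intro mult_right_mono) auto
    qed
    also have "\<dots> \<le> y \<bullet> (V T *v y)"
      using quad_ge[OF \<delta>(3), of y] \<delta> y by simp
    finally show ?thesis using up by (simp add: abs_le_iff algebra_simps)
  qed
  then show "\<bar>\<zeta> \<bullet> (V T *v \<zeta>) - L * (\<zeta> \<bullet> \<zeta>)\<bar> \<le> 9 * sqrt \<delta> * L * (\<zeta> \<bullet> \<zeta>)" using \<zeta> by blast
  have bil: "\<bar>y \<bullet> (V T *v x) - L * (y \<bullet> x)\<bar> \<le> 9 * sqrt \<delta> * L * (norm y * norm x)"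
    if y: "y \<bullet> \<theta> = 0" and x: "x \<bullet> \<theta> = 0" for x y
  proof -
    define F where "F v = v \<bullet> (V T *v v) - L * (v \<bullet> v)" for v
    \<comment> \<open>Polarisation. Both vectors are scaled to the norm
      \<open>norm x * norm y\<close>, so that the parallelogram sum is a multiple of the square of
      this product.\<close>
    define y' where "y' = norm x *\<^sub>R y" define x' where "x' = norm y *\<^sub>R x"
    have c: "x' \<bullet> (V T *v y') = y' \<bullet> (V T *v x')" by (metis V_inner inner_commute)
    have "F (y' + x') - F (y' - x') = 4 * (y' \<bullet> (V T *v x') - L * (y' \<bullet> x'))"
      using c by (simp add: F_def matrix_vector_right_distrib matrix_vector_mult_diff_distrib inner_add_left inner_add_right
        inner_diff_left inner_diff_right inner_commute[of x' y'] algebra_simps)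
    moreover have "y' \<bullet> (V T *v x') - L * (y' \<bullet> x') = (norm x * norm y) * (y \<bullet> (V T *v x) - L * (y \<bullet> x))"
      by (simp add: y'_def x'_def matrix_vector_mult_scaleR algebra_simps)
    ultimately have "4 * \<bar>(norm x * norm y) * (y \<bullet> (V T *v x) - L * (y \<bullet> x))\<bar> = \<bar>F (y' + x') - F (y' - x')\<bar>" by simp
    also have "\<dots> \<le> 9 * sqrt \<delta> * L * ((y' + x') \<bullet> (y' + x')) + 9 * sqrt \<delta> * L * ((y' - x') \<bullet> (y' - x'))"
    proof -
      have o: "(y' + x') \<bullet> \<theta> = 0" "(y' - x') \<bullet> \<theta> = 0"
        using x y by (simp_all add: y'_def x'_def inner_add_left inner_diff_left)
      have "\<bar>F (y' + x')\<bar> \<le> 9 * sqrt \<delta> * L * ((y' + x') \<bullet> (y' + x'))"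
        "\<bar>F (y' - x')\<bar> \<le> 9 * sqrt \<delta> * L * ((y' - x') \<bullet> (y' - x'))" unfolding F_def by (rule quad[OF o(1)], rule quad[OF o(2)])
      then show ?thesis by linarith
    qed
    also have "\<dots> = 9 * sqrt \<delta> * L * ((y' + x') \<bullet> (y' + x') + (y' - x') \<bullet> (y' - x'))" by (simp only: distrib_left)
    also have "(y' + x') \<bullet> (y' + x') + (y' - x') \<bullet> (y' - x') = 4 * (norm x * norm y)^2"
      by (simp add: inner_add_left inner_add_right inner_diff_left inner_diff_right y'_def x'_def inner_commute
          power_mult_distrib power2_norm_eq_inner power2_eq_square[of "norm x"] power2_eq_square[of "norm y"])
        (simp add: power2_norm_eq_inner[symmetric] power2_eq_square)
    finally have "(norm x * norm y) * \<bar>y \<bullet> (V T *v x) - L * (y \<bullet> x)\<bar> \<le> (norm x * norm y) * (9 * sqrt \<delta> * L * (norm y * norm x))"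
      by (simp add: abs_mult power2_eq_square mult_ac)
    then show ?thesis
    proof (cases "norm x * norm y = 0")
      case True
      then show ?thesis by auto
    next
      case False
      then have "norm x * norm y > 0" by (simp add: less_le)
      then show ?thesis
        using \<open>(norm x * norm y) * _ \<le> _\<close> by (simp only: mult_le_cancel_left_pos)
    qed
  qed
  assume K: "(\<theta> \<bullet> S T)^2 \<le> K * real T" "S T \<bullet> S T - (S T \<bullet> \<theta>)^2 \<le> K * L" "K \<ge> 0"
    and \<nu>: "4 * ((2 * K + 2) / k + 2 * K) \<le> (k * \<nu>)^2 * min (k * (real T + 1)) L" "0 < \<nu>" "\<nu> \<le> 1 / 2"
  define Q where "Q = (2 * K + 2) / k + 2 * K"
  have Q0: "Q > 0" using K k by (simp add: Q_def add_pos_nonneg)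
  have SQ: "(S T \<bullet> \<theta> - 1)^2 / p + (S T \<bullet> S T - (S T \<bullet> \<theta>)^2) / g \<le> Q"
  proof -
    have "(S T \<bullet> \<theta> - 1)^2 / p \<le> (2 * K + 2) * (real T + 1) / p"
    proof (rule divide_right_mono)
      have "(S T \<bullet> \<theta> - 1)^2 \<le> 2 * (S T \<bullet> \<theta>)^2 + 2"
        using zero_le_power2[of "S T \<bullet> \<theta> + 1"] by (simp add: power2_eq_square algebra_simps)
      also have "\<dots> \<le> 2 * (K * real T) + 2" using K(1) by (simp add: inner_commute)
      also have "\<dots> \<le> (2 * K + 2) * (real T + 1)" using K(3) by (simp add: algebra_simps)
      finally show "(S T \<bullet> \<theta> - 1)^2 \<le> (2 * K + 2) * (real T + 1)" .
    qed (use p_pos in simp)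
    also have "\<dots> \<le> (2 * K + 2) * (real T + 1) / (k * (real T + 1))"
      using k K p_pos by (intro divide_left_mono) auto
    also have "\<dots> = (2 * K + 2) / k" by simp
    finally have 1: "(S T \<bullet> \<theta> - 1)^2 / p \<le> (2 * K + 2) / k" .
    have "S T \<bullet> S T - (S T \<bullet> \<theta>)^2 \<le> K * (2 * g)"
    proof -
      have "K * L \<le> K * (2 * g)" using K gL' by (intro mult_left_mono) auto
      then show ?thesis using K(2) by linarith
    qed
    then have "(S T \<bullet> S T - (S T \<bullet> \<theta>)^2) / g \<le> 2 * K" using g_pos by (simp add: pos_divide_le_eq mult_ac)
    then show ?thesis using 1 by (simp add: Q_def)
  qed
  let ?z = "z T"
  define zp where "zp = ?z - (?z \<bullet> \<theta>) *\<^sub>R \<theta>"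
  have zp: "zp \<bullet> \<theta> = 0" "zp \<bullet> zp = ?z \<bullet> ?z - (?z \<bullet> \<theta>)^2"
    by (simp_all add: zp_def inner_diff_left inner_diff_right unit' inner_commute power2_eq_square)
  have zq: "k^2 * (p * (?z \<bullet> \<theta>)^2 + g * (zp \<bullet> zp)) \<le> Q"
    using z_quad_le[OF order_refl k(1,2)] SQ unfolding zp by linarith
  have zp_le: "norm zp \<le> sqrt Q / (k * sqrt g)"
  proof -
    have "k^2 * (g * (zp \<bullet> zp)) \<le> k^2 * (p * (?z \<bullet> \<theta>)^2 + g * (zp \<bullet> zp))"
      using p_pos by (intro mult_left_mono) auto
    then have "(k * sqrt g * norm zp)^2 \<le> (sqrt Q)^2"
      using zq g_pos Q0 by (simp add: power_mult_distrib power2_norm_eq_inner mult.assoc)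
    then have "k * sqrt g * norm zp \<le> sqrt Q" by (rule power2_le_imp_le) (use Q0 in simp)
    then show ?thesis using k g_pos by (simp add: pos_le_divide_eq mult_ac)
  qed
  have z0_le: "\<bar>?z \<bullet> \<theta>\<bar> \<le> sqrt Q / (k * sqrt p)"
  proof -
    have "k^2 * (p * (?z \<bullet> \<theta>)^2) \<le> k^2 * (p * (?z \<bullet> \<theta>)^2 + g * (zp \<bullet> zp))"
      using g_pos by (intro mult_left_mono) auto
    then have "(k * sqrt p * \<bar>?z \<bullet> \<theta>\<bar>)^2 \<le> (sqrt Q)^2"
      using zq p_pos Q0 by (simp add: power_mult_distrib mult.assoc)
    then have "k * sqrt p * \<bar>?z \<bullet> \<theta>\<bar> \<le> sqrt Q" by (rule power2_le_imp_le) (use Q0 in simp)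
    then show ?thesis using k p_pos by (simp add: pos_le_divide_eq mult_ac)
  qed
  \<comment> \<open>The part of \<open>V T *v \<zeta>\<close> orthogonal to \<open>\<theta>\<close>,
    minus its target. Pairing \<open>V T *v \<zeta>\<close> with \<open>z T\<close> avoids inverting
    \<open>V T\<close>; in the identity \<open>main\<close> below, only this residual and the cross
    term \<open>b \<bullet> \<zeta>\<close> disturb.\<close>
  define y where "y = V T *v \<zeta> - (\<theta> \<bullet> (V T *v \<zeta>)) *\<^sub>R \<theta> - L *\<^sub>R \<zeta>"
  have \<theta>V: "\<theta> \<bullet> (V T *v \<zeta>) = b \<bullet> \<zeta>"
  proof -
    have "\<theta> \<bullet> (V T *v \<zeta>) = (V T *v \<theta>) \<bullet> \<zeta>" by (simp add: V_inner)
    then show ?thesis using \<zeta> by (simp add: V_theta inner_add_left inner_commute[of \<theta>])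
  qed
  have y\<theta>: "y \<bullet> \<theta> = 0" using \<zeta> by (simp add: y_def inner_diff_left unit' inner_commute[of "V T *v \<zeta>"])
  have ny: "norm y \<le> 9 * sqrt \<delta> * L * norm \<zeta>"
  proof -
    have "(norm y)^2 = y \<bullet> (V T *v \<zeta>) - L * (y \<bullet> \<zeta>)"
      unfolding power2_norm_eq_inner using y\<theta> by (subst (2) y_def) (simp add: inner_diff_right)
    also have "\<dots> \<le> 9 * sqrt \<delta> * L * (norm y * norm \<zeta>)" using bil[OF y\<theta> \<zeta>] by linarith
    finally have "norm y * norm y \<le> norm y * (9 * sqrt \<delta> * L * norm \<zeta>)" by (simp add: power2_eq_square mult_ac)
    then show ?thesis
    proof (cases "norm y = 0")
      case False
      then have "norm y > 0" by simp
      then show ?thesis using \<open>norm y * norm y \<le> _\<close> by (simp only: mult_le_cancel_left_pos)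
    qed (use \<delta> L in simp)
  qed
  have b\<zeta>: "\<bar>b \<bullet> \<zeta>\<bar> \<le> sqrt (\<delta> * g * p) * norm \<zeta>"
  proof -
    have "(b \<bullet> \<zeta>)^2 \<le> \<delta> * g * (\<zeta> \<bullet> \<zeta>) * p" using cross_inner_le[OF \<delta>(3), of \<zeta>] p_pos by (simp add: pos_divide_le_eq)
    also have "\<dots> = (sqrt (\<delta> * g * p) * norm \<zeta>)^2" using \<delta> g_pos p_pos by (simp add: power_mult_distrib power2_norm_eq_inner)
    finally show ?thesis by (rule abs_le_square_iff[THEN iffD2, THEN order_trans]) (use \<delta> g_pos p_pos in simp)
  qed
  have main: "L * (\<zeta> \<bullet> ?z) = \<zeta> \<bullet> S T - (y \<bullet> zp + (b \<bullet> \<zeta>) * (?z \<bullet> \<theta>))"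
  proof -
    have "\<zeta> \<bullet> S T = \<zeta> \<bullet> (S T - \<theta>)" using \<zeta> by (simp add: inner_diff_right)
    also have "\<dots> = (V T *v \<zeta>) \<bullet> ?z" by (simp add: z_def V_inner V_W)
    also have "V T *v \<zeta> = y + (b \<bullet> \<zeta>) *\<^sub>R \<theta> + L *\<^sub>R \<zeta>" by (simp add: y_def \<theta>V)
    finally have "\<zeta> \<bullet> S T = y \<bullet> ?z + (b \<bullet> \<zeta>) * (?z \<bullet> \<theta>) + L * (\<zeta> \<bullet> ?z)"
      by (simp add: inner_add_left inner_commute[of ?z \<theta>])
    moreover have "y \<bullet> ?z = y \<bullet> zp" using y\<theta> by (simp add: zp_def inner_diff_right)
    ultimately show ?thesis by simp
  qed
  have sL: "sqrt L > 0" using L by simp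
  have sg: "sqrt g > 0" using g_pos by simp
  have Lg: "sqrt L \<le> 2 * sqrt g" "sqrt g \<le> 2 * sqrt L"
  proof -
    have "sqrt L \<le> sqrt (4 * g)" "sqrt g \<le> sqrt (4 * L)" using gL' L by simp_all
    then show "sqrt L \<le> 2 * sqrt g" "sqrt g \<le> 2 * sqrt L" by (simp_all add: real_sqrt_mult)
  qed
  define c1 where "c1 = 20 * sqrt \<delta> / k"
  have A: "\<bar>sqrt L * (\<zeta> \<bullet> ?z) - (\<zeta> \<bullet> S T) / sqrt L\<bar> \<le> norm \<zeta> * sqrt Q * c1"
  proof -
    have "sqrt L * (\<zeta> \<bullet> ?z) - (\<zeta> \<bullet> S T) / sqrt L = - (y \<bullet> zp + (b \<bullet> \<zeta>) * (?z \<bullet> \<theta>)) / sqrt L"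
    proof -
      have "sqrt L * (\<zeta> \<bullet> ?z) = L * (\<zeta> \<bullet> ?z) / sqrt L"
      proof -
        have "L / sqrt L = sqrt L" using L by (intro real_div_sqrt) simp
        then have "(L / sqrt L) * (\<zeta> \<bullet> ?z) = sqrt L * (\<zeta> \<bullet> ?z)" by (simp only:)
        then show ?thesis by simp
      qed
      then show ?thesis unfolding main by (simp add: diff_divide_distrib add_divide_distrib)
    qed
    then have "\<bar>sqrt L * (\<zeta> \<bullet> ?z) - (\<zeta> \<bullet> S T) / sqrt L\<bar> = \<bar>y \<bullet> zp + (b \<bullet> \<zeta>) * (?z \<bullet> \<theta>)\<bar> / sqrt L"
      using sL by (simp add: abs_divide abs_minus_commute)
    also have "\<dots> \<le> (9 * sqrt \<delta> * L * norm \<zeta> * (sqrt Q / (k * sqrt g))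
        + sqrt (\<delta> * g * p) * norm \<zeta> * (sqrt Q / (k * sqrt p))) / sqrt L"
    proof (rule divide_right_mono)
      have "\<bar>y \<bullet> zp\<bar> \<le> norm y * norm zp" by (rule Cauchy_Schwarz_ineq2)
      also have "\<dots> \<le> 9 * sqrt \<delta> * L * norm \<zeta> * (sqrt Q / (k * sqrt g))"
        using ny zp_le L \<delta> by (intro mult_mono) auto
      finally have 1: "\<bar>y \<bullet> zp\<bar> \<le> 9 * sqrt \<delta> * L * norm \<zeta> * (sqrt Q / (k * sqrt g))" .
      have "\<bar>(b \<bullet> \<zeta>) * (?z \<bullet> \<theta>)\<bar> \<le> sqrt (\<delta> * g * p) * norm \<zeta> * (sqrt Q / (k * sqrt p))"
        unfolding abs_mult using b\<zeta> z0_le \<delta> g_pos p_pos by (intro mult_mono) auto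
      then show "\<bar>y \<bullet> zp + (b \<bullet> \<zeta>) * (?z \<bullet> \<theta>)\<bar> \<le> 9 * sqrt \<delta> * L * norm \<zeta> * (sqrt Q / (k * sqrt g))
        + sqrt (\<delta> * g * p) * norm \<zeta> * (sqrt Q / (k * sqrt p))" using 1 by linarith
    qed (use sL in simp)
    also have "\<dots> = (norm \<zeta> * sqrt Q * sqrt \<delta> / k) * (9 * (L / (sqrt g * sqrt L)) + sqrt g / sqrt L)"
    proof -
      have "(9 * d * L * n * (q / (k * sg)) + d * sg * sp * n * (q / (k * sp))) / sl = (n * q * d / k) * (9 * (L / (sg * sl)) + sg / sl)"
        if "sg > 0" "sp > 0" "sl > 0" for d n q sg sp sl :: real
        using that k(1) by (simp add: field_simps)
      from this[of "sqrt g" "sqrt p" "sqrt L" "sqrt \<delta>" "norm \<zeta>" "sqrt Q"] show ?thesis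
        using sg sL p_pos by (simp add: real_sqrt_mult)
    qed
    also have "\<dots> \<le> (norm \<zeta> * sqrt Q * sqrt \<delta> / k) * (9 * 2 + 2)"
    proof (intro mult_left_mono add_mono)
      have "L / (sqrt g * sqrt L) = sqrt L / sqrt g"
      proof -
        have "L / sqrt L = sqrt L" using L by (intro real_div_sqrt) simp
        then have "(L / sqrt L) / sqrt g = sqrt L / sqrt g" by (simp only:)
        then show ?thesis by (simp add: mult.commute)
      qed
      also have "\<dots> \<le> 2" using Lg sg by (simp add: pos_divide_le_eq)
      finally show "L / (sqrt g * sqrt L) \<le> 2" .
      show "sqrt g / sqrt L \<le> 2" using Lg sL by (simp add: pos_divide_le_eq)
    qed (use k Q0 \<delta> in auto)
    finally show ?thesis by (simp add: c1_def mult_ac)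
  qed
  have nz: "norm ?z \<le> \<nu> / 1"
  proof -
    have "min p g \<ge> min (k * (real T + 1)) L / 4"
    proof -
      define m where "m = min (k * (real T + 1)) L"
      have "0 < m" "m \<le> k * (real T + 1)" "m \<le> L" using k(1) L by (auto simp: m_def)
      then have "m / 4 \<le> p" "m / 4 \<le> g" using k(3) gL'(1) by linarith+
      then show ?thesis by (simp add: m_def)
    qed
    have m: "min p g > 0" using p_pos g_pos by simp
    have "k^2 * ((norm ?z)^2 * min p g) \<le> Q" using z_norm_le[OF order_refl k(1,2)] SQ by linarith
    also have "4 * Q \<le> (k * \<nu>)^2 * (4 * min p g)"
      using \<nu>(1) \<open>min p g \<ge> _\<close> by (intro order_trans[OF \<nu>(1)[folded Q_def]] mult_left_mono) auto
    then have "Q \<le> k^2 * (\<nu>^2 * min p g)" by (simp add: power_mult_distrib)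
    finally have "(norm ?z)^2 \<le> \<nu>^2" using k m by (simp add: mult_le_cancel_left)
    then have "norm ?z \<le> \<nu>" by (rule power2_le_imp_le) (use \<nu> in simp)
    then show ?thesis by simp
  qed
  define x where "x = \<theta> + ?z"
  have nx: "\<bar>norm x - 1\<bar> \<le> \<nu>"
    using norm_triangle_ineq3[of x \<theta>] nz unit by (simp add: x_def)
  have x0: "norm x \<ge> 1 / 2" using nx \<nu> by linarith
  have uT: "u T = (1 / norm x) *\<^sub>R x"
    using est[of T] x0 by (auto simp: ridge_eq x_def is_unit_projection_def)
  have \<zeta>u: "\<zeta> \<bullet> u T = (\<zeta> \<bullet> ?z) / norm x" using \<zeta> by (simp add: uT x_def inner_add_right)
  have q: "\<bar>1 / norm x - 1\<bar> \<le> 2 * \<nu>"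
  proof -
    have "\<bar>1 / norm x - 1\<bar> = \<bar>norm x - 1\<bar> / norm x"
    proof -
      have "1 / norm x - 1 = (1 - norm x) / norm x"
      proof -
        have "norm x \<noteq> 0" using x0 by linarith
        then show ?thesis by (simp add: diff_divide_distrib)
      qed
      then show ?thesis by (simp add: abs_divide abs_minus_commute)
    qed
    also have "\<dots> \<le> \<nu> / (1 / 2)" using nx x0 by (intro frac_le) auto
    finally show ?thesis by simp
  qed
  have Sz: "\<bar>\<zeta> \<bullet> S T\<bar> / sqrt L \<le> norm \<zeta> * sqrt Q * 2"
  proof -
    define Sp where "Sp = S T - (S T \<bullet> \<theta>) *\<^sub>R \<theta>"
    have Spp: "Sp \<bullet> Sp = S T \<bullet> S T - (S T \<bullet> \<theta>)^2"
      by (simp add: Sp_def inner_diff_left inner_diff_right unit' inner_commute power2_eq_square)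
    have "(norm Sp)^2 \<le> (sqrt Q * sqrt L)^2"
    proof -
      have "K * L \<le> Q * L" using L K k by (intro mult_right_mono) (auto simp: Q_def add_increasing)
      then have "Sp \<bullet> Sp \<le> Q * L" using K(2) Spp by linarith
      then show ?thesis using Q0 L by (simp add: power2_norm_eq_inner power_mult_distrib)
    qed
    then have nS: "norm Sp \<le> sqrt Q * sqrt L" by (rule power2_le_imp_le) (use Q0 L in simp)
    have "\<zeta> \<bullet> S T = \<zeta> \<bullet> Sp" using \<zeta> by (simp add: Sp_def inner_diff_right)
    then have "\<bar>\<zeta> \<bullet> S T\<bar> \<le> norm \<zeta> * norm Sp" using Cauchy_Schwarz_ineq2[of \<zeta> Sp] by simp
    also have "\<dots> \<le> norm \<zeta> * (sqrt Q * sqrt L)" using nS by (intro mult_left_mono) auto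
    finally have "\<bar>\<zeta> \<bullet> S T\<bar> / sqrt L \<le> norm \<zeta> * sqrt Q" using sL by (simp add: pos_divide_le_eq mult.assoc)
    moreover have "0 \<le> norm \<zeta> * sqrt Q" using Q0 by simp
    ultimately show ?thesis by linarith
  qed
  define Y where "Y = sqrt L * (\<zeta> \<bullet> ?z)"
  have Yb: "\<bar>Y\<bar> \<le> norm \<zeta> * sqrt Q * (c1 + 2)"
  proof -
    have "\<bar>Y\<bar> \<le> \<bar>Y - (\<zeta> \<bullet> S T) / sqrt L\<bar> + \<bar>\<zeta> \<bullet> S T\<bar> / sqrt L"
    proof -
      have "\<bar>\<zeta> \<bullet> S T\<bar> / sqrt L = \<bar>(\<zeta> \<bullet> S T) / sqrt L\<bar>" using sL by (simp add: abs_divide)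
      then show ?thesis by linarith
    qed
    then show ?thesis using A Sz unfolding Y_def by (simp add: distrib_left)
  qed
  have "sqrt L * (\<zeta> \<bullet> u T) = Y + Y * (1 / norm x - 1)" by (simp add: \<zeta>u Y_def right_diff_distrib)
  then have "\<bar>sqrt L * (\<zeta> \<bullet> u T) - (\<zeta> \<bullet> S T) / sqrt L\<bar>
      \<le> \<bar>Y - (\<zeta> \<bullet> S T) / sqrt L\<bar> + \<bar>Y\<bar> * \<bar>1 / norm x - 1\<bar>" unfolding abs_mult[symmetric] by linarith
  also have "\<dots> \<le> norm \<zeta> * sqrt Q * c1 + (norm \<zeta> * sqrt Q * (c1 + 2)) * (2 * \<nu>)"
    using A Yb q \<nu> by (intro add_mono mult_mono) (auto simp: Y_def)
  also have "\<dots> = norm \<zeta> * sqrt Q * (c1 + 2 * \<nu> * (c1 + 2))" by (simp add: algebra_simps)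
  finally show "\<bar>sqrt L * (\<zeta> \<bullet> u T) - (\<zeta> \<bullet> S T) / sqrt L\<bar>
        \<le> norm \<zeta> * sqrt ((2 * K + 2) / k + 2 * K) * (20 * sqrt \<delta> / k + 2 * \<nu> * (20 * sqrt \<delta> / k + 2))"
    by (simp add: Q_def c1_def)
qed

end

lemma abs_diff_le_if_squares_near:
  fixes g L \<delta> :: real
  assumes "0 \<le> g" "0 \<le> L" "0 \<le> \<delta>" "\<delta> \<le> 1" "(1 - \<delta>) * L^2 \<le> g^2" "g^2 \<le> (1 + \<delta>) * L^2"
  shows "\<bar>g - L\<bar> \<le> \<delta> * L"
proof -
  have "(1 + \<delta>) * L^2 \<le> (1 + \<delta>)^2 * L^2" "(1 - \<delta>)^2 * L^2 \<le> (1 - \<delta>) * L^2"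
  proof -
    have "(1 + \<delta>) * 1 \<le> (1 + \<delta>) * (1 + \<delta>)" "(1 - \<delta>) * (1 - \<delta>) \<le> (1 - \<delta>) * 1"
      using assms(3,4) by (intro mult_left_mono; simp)+
    then have "1 + \<delta> \<le> (1 + \<delta>)^2" "(1 - \<delta>)^2 \<le> 1 - \<delta>" by (simp_all only: power2_eq_square mult_1_right)
    then show "(1 + \<delta>) * L^2 \<le> (1 + \<delta>)^2 * L^2" "(1 - \<delta>)^2 * L^2 \<le> (1 - \<delta>) * L^2"
      by (intro mult_right_mono; simp)+
  qed
  then have "g^2 \<le> ((1 + \<delta>) * L)^2" "((1 - \<delta>) * L)^2 \<le> g^2"
    using assms(5,6) by (simp_all only: power_mult_distrib)
  then have "g \<le> (1 + \<delta>) * L" "(1 - \<delta>) * L \<le> g"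
    using assms(1-4) by (auto intro: power2_le_imp_le)
  then show ?thesis by (simp add: abs_le_iff algebra_simps)
qed

lemma noisy_trajectory_limit:
  assumes dim: "CARD('n::finite) \<ge> 2" and \<epsilon>: "\<epsilon> > 0" and K: "K \<ge> 0"
  shows "\<exists>x>0. \<forall>(\<theta> :: real^'n) \<beta> T a u r e B. noisy_trajectory \<theta> \<beta> T a u r e B \<longrightarrow>
      1 / \<beta> \<le> x \<longrightarrow> \<beta> \<le> x * sqrt (real T) \<longrightarrow> B \<le> x * \<beta>^2 \<longrightarrow>
      (let L = sqrt (2 * \<beta>^2 * real T / (real CARD('n) + 1)); V = design_matrix a T; S = noise_sum a e T in
        (\<forall>\<zeta>. \<zeta> \<bullet> \<theta> = 0 \<longrightarrow> \<bar>\<zeta> \<bullet> (V *v \<zeta>) - L * (\<zeta> \<bullet> \<zeta>)\<bar> \<le> \<epsilon> * L * (\<zeta> \<bullet> \<zeta>)) \<and>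
        ((\<theta> \<bullet> S)^2 \<le> K * real T \<longrightarrow> S \<bullet> S - (S \<bullet> \<theta>)^2 \<le> K * L \<longrightarrow>
          (\<forall>\<zeta>. \<zeta> \<bullet> \<theta> = 0 \<longrightarrow> \<bar>sqrt L * (\<zeta> \<bullet> u T) - (\<zeta> \<bullet> S) / sqrt L\<bar> \<le> \<epsilon> * norm \<zeta>)))"
proof -
  define N where "N = real CARD('n) - 1"
  have N: "N \<ge> 1" using dim by (simp add: N_def)
  have N2: "N + 2 = real CARD('n) + 1" by (simp add: N_def)
  define k where "k = kappa N"
  have k: "k > 0" using kappa_positive(1)[OF N] by (simp add: k_def)
  define Q where "Q = sqrt ((2 * K + 2) / k + 2 * K)"
  have Q: "Q \<ge> 0" "Q^2 = (2 * K + 2) / k + 2 * K" using K k by (simp_all add: Q_def)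
  \<comment> \<open>\<open>s\<close> will be \<open>sqrt \<delta>\<close>. The bound
    \<open>\<epsilon> / 9\<close> serves the quadratic form, and the last one serves the term
    \<open>20 * sqrt \<delta> / k\<close> of \<open>final_estimator\<close>.\<close>
  define s where "s = min (1 / 2) (min (\<epsilon> / 9) (k / 20 * min 1 (\<epsilon> / (2 * (Q + 1)))))"
  have s: "0 < s" "s \<le> 1 / 2" "s \<le> \<epsilon> / 9" "s \<le> k / 20 * min 1 (\<epsilon> / (2 * (Q + 1)))"
  proof -
    show "0 < s" using \<epsilon> k Q by (simp add: s_def)
    show "s \<le> 1 / 2" unfolding s_def by (rule min.cobounded1)
    show "s \<le> \<epsilon> / 9" unfolding s_def by (rule min.coboundedI2, rule min.cobounded1)
    show "s \<le> k / 20 * min 1 (\<epsilon> / (2 * (Q + 1)))" unfolding s_def by (rule min.coboundedI2, rule min.cobounded2)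
  qed
  define \<delta> where "\<delta> = s^2"
  have sd: "sqrt \<delta> = s" using s by (simp add: \<delta>_def)
  have \<delta>: "0 < \<delta>" "\<delta> \<le> 1 / 4"
    using s power_mono[of s "1 / 2" 2] by (simp_all add: \<delta>_def power2_eq_square)
  have \<delta>1: "\<delta> \<le> 1" using \<delta>(2) by simp
  define \<nu> where "\<nu> = min (1 / 2) (\<epsilon> / (12 * (Q + 1)))"
  have \<nu>: "0 < \<nu>" "\<nu> \<le> 1 / 2" "\<nu> \<le> \<epsilon> / (12 * (Q + 1))"
  proof -
    show "0 < \<nu>" using \<epsilon> Q by (simp add: \<nu>_def)
    show "\<nu> \<le> 1 / 2" unfolding \<nu>_def by (rule min.cobounded1)
    show "\<nu> \<le> \<epsilon> / (12 * (Q + 1))" unfolding \<nu>_def by (rule min.cobounded2)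
  qed
  have small: "Q * (20 * s / k + 2 * \<nu> * (20 * s / k + 2)) \<le> \<epsilon>"
  proof -
    have "20 * s / k \<le> min 1 (\<epsilon> / (2 * (Q + 1)))" using s(4) k by (simp only: pos_divide_le_eq) (simp add: mult.commute)
    then have a: "20 * s / k \<le> 1" "20 * s / k \<le> \<epsilon> / (2 * (Q + 1))" by auto
    have "2 * \<nu> * (20 * s / k + 2) \<le> 2 * \<nu> * 3" using \<nu>(1) a(1) by (intro mult_left_mono) auto
    also have "\<dots> \<le> 6 * (\<epsilon> / (12 * (Q + 1)))" using \<nu>(3) by simp
    also have "\<dots> = \<epsilon> / (2 * (Q + 1))"
    proof -
      have "6 * (\<epsilon> / (12 * D)) = \<epsilon> / (2 * D)" for D by simp
      then show ?thesis .
    qed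
    finally have "20 * s / k + 2 * \<nu> * (20 * s / k + 2) \<le> \<epsilon> / (2 * (Q + 1)) + \<epsilon> / (2 * (Q + 1))" using a(2) by linarith
    also have "\<dots> = \<epsilon> / (Q + 1)"
    proof -
      have "\<epsilon> / (2 * D) + \<epsilon> / (2 * D) = \<epsilon> / D" for D by simp
      then show ?thesis .
    qed
    finally have "Q * (20 * s / k + 2 * \<nu> * (20 * s / k + 2)) \<le> Q * (\<epsilon> / (Q + 1))" using Q by (intro mult_left_mono) auto
    also have "\<dots> \<le> \<epsilon>" using Q \<epsilon> by (simp add: field_simps)
    finally show ?thesis .
  qed
  obtain x0 where x0: "x0 > 0" and lim: "\<forall>\<beta> \<rho> T g p X y w l D \<mu> qb. scalar_run N \<beta> \<rho> T g p X y w l D \<mu> qb \<longrightarrow>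
      \<rho> \<le> x0 \<longrightarrow> 1 / \<beta> \<le> x0 \<longrightarrow> \<beta> \<le> x0 * sqrt (real T) \<longrightarrow>
      qb T (kappa N) \<and> kappa N * (real T + 1) \<le> p T \<and> X T - N * g T \<le> \<delta> * g T \<and>
      (1 - \<delta>) * (2 * \<beta>^2 * real T / (N + 2)) \<le> (g T)^2 \<and>
      (g T)^2 \<le> (1 + \<delta>) * (2 * \<beta>^2 * real T / (N + 2))"
    using scalar_run_limit[OF N \<delta>(1) \<delta>1] by (elim exE conjE) (rule that)
  define \<rho> where "\<rho> = min x0 (1 / 5)"
  have \<rho>: "0 < \<rho>" "\<rho> \<le> 1 / 5" "\<rho> \<le> x0" using x0 by (auto simp: \<rho>_def)
  define c where "c = 4 * (4 + 2 / k) / k^2"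
  have c: "c > 0" using k by (simp add: c_def add_pos_pos)
  \<comment> \<open>The size that \<open>final_estimator\<close>, with this \<open>\<nu>\<close>,
    demands of \<open>k * (T + 1)\<close> and of \<open>L\<close>; horizons above \<open>J\<close>
    provide it.\<close>
  define H where "H = 4 * Q^2 / (k * \<nu>)^2"
  have H: "H \<ge> 0" by (simp add: H_def)
  define J where "J = H / k + H^2 * (N + 2) + 1"
  have J: "J \<ge> 1" "H / k \<le> J" "H^2 * (N + 2) \<le> J" using H k N by (simp_all add: J_def)
  define x where "x = min x0 (min 1 (min (\<rho>^2 / c) (1 / J)))"
  have x: "0 < x" "x \<le> x0" "x \<le> 1" "x \<le> \<rho>^2 / c" "x \<le> 1 / J"
  proof -
    show "0 < x" using x0 \<rho> c J by (simp add: x_def)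
    show "x \<le> x0" unfolding x_def by (rule min.cobounded1)
    show "x \<le> 1" unfolding x_def by (rule min.coboundedI2, rule min.cobounded1)
    show "x \<le> \<rho>^2 / c" unfolding x_def by (rule min.coboundedI2, rule min.coboundedI2, rule min.cobounded1)
    show "x \<le> 1 / J" unfolding x_def by (rule min.coboundedI2, rule min.coboundedI2, rule min.cobounded2)
  qed
  show ?thesis
  proof (intro exI[of _ x] conjI x(1) allI impI)
    fix \<theta> :: "real^'n" and \<beta> T a u r e B
    assume nt: "noisy_trajectory \<theta> \<beta> T a u r e B" and b: "1 / \<beta> \<le> x" "\<beta> \<le> x * sqrt (real T)" "B \<le> x * \<beta>^2"
    interpret noisy_trajectory \<theta> \<beta> T a u r e B by (rule nt)
    have b0: "\<beta> > 0" using \<beta> by simp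
    have cB: "c * B \<le> \<rho>^2 * \<beta>^2"
    proof -
      have "c * B \<le> c * (x * \<beta>^2)" using b(3) c by (intro mult_left_mono) auto
      also have "\<dots> \<le> c * ((\<rho>^2 / c) * \<beta>^2)" using x(4) c by (intro mult_left_mono mult_right_mono) auto
      also have "\<dots> = \<rho>^2 * \<beta>^2" using c by simp
      finally show ?thesis .
    qed
    have eb: "(norm (u t - \<theta>))^2 * min (par (V t) \<theta>) (gm (V t) \<theta>) \<le> \<rho>^2 * \<beta>^2"
      if "t < T" "dominates (V t) \<theta> k" "k * perp (V t) \<theta> \<le> gm (V t) \<theta>" for t
      by (rule order_trans[OF estimation_error[OF less_imp_le[OF that(1)] k that(2,3), folded c_def] cB])
    have run: "scalar_run N \<beta> \<rho> T (\<lambda>t. gm (V t) \<theta>) (\<lambda>t. par (V t) \<theta>) (\<lambda>t. perp (V t) \<theta>)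
      (\<lambda>t. ucb_step.y \<theta> (a (Suc t))) (\<lambda>t. pd_matrix.wn (V t) (a (Suc t)))
      (\<lambda>t. ucb_step.l (V t) (u t) (a (Suc t)) \<beta>) (\<lambda>t. det (V t))
      (\<lambda>t. ucb_step.\<mu> (V t) (u t) (a (Suc t)) \<beta>) (\<lambda>t k. dominates (V t) \<theta> k)"
      unfolding N_def by (rule scalar_run[OF \<rho>(1,2)]) (rule eb[unfolded k_def N_def]; assumption)
    have b': "1 / \<beta> \<le> x0" "\<beta> \<le> x0 * sqrt (real T)"
      using b x mult_right_mono[of x x0 "sqrt (real T)"] by auto
    note lims = lim[rule_format, OF run \<rho>(3) b', folded k_def]
    define L where "L = sqrt (2 * \<beta>^2 * real T / (real CARD('n) + 1))"
    have L2: "L^2 = 2 * \<beta>^2 * real T / (N + 2)" unfolding L_def N2 by simp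
    interpret pd_matrix "V T" \<theta> by (rule pd)
    have TJ: "J \<le> real T"
    proof -
      have "1 \<le> x * \<beta>" using b(1) b0 by (simp add: pos_divide_le_eq)
      also have "\<dots> \<le> x * (x * sqrt (real T))" using b(2) x(1) by (intro mult_left_mono) auto
      finally have "1^2 \<le> (x * (x * sqrt (real T)))^2" by (intro power_mono) auto
      also have "(x * (x * sqrt (real T)))^2 = x ^ 4 * (sqrt (real T))^2"
        by (simp only: power2_eq_square power4_eq_xxxx mult_ac)
      finally have "1 \<le> x ^ 4 * real T" by simp
      also have "x ^ 4 * real T \<le> x ^ 1 * real T" using x by (intro mult_right_mono power_decreasing) auto
      also have "\<dots> \<le> 1 / J * real T" using x(5) by (intro mult_right_mono) auto
      finally show ?thesis using J(1) by (simp add: pos_le_divide_eq)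
    qed
    have Lpos: "L > 0" unfolding L_def using TJ J b0 by (auto intro!: divide_pos_pos mult_pos_pos)
    have LH: "H \<le> L"
    proof (rule power2_le_imp_le)
      have "H^2 * (N + 2) \<le> 1 * real T" using J(3) TJ by simp
      also have "\<dots> \<le> (2 * \<beta>^2) * real T"
      proof (rule mult_right_mono)
        have "1 \<le> \<beta>^2" using \<beta> by (rule one_le_power)
        then show "1 \<le> 2 * \<beta>^2" by linarith
      qed simp
      finally show "H^2 \<le> L^2" unfolding L2 using N by (simp add: pos_le_divide_eq)
    qed (use Lpos in simp)
    have gL: "\<bar>gm (V T) \<theta> - L\<bar> \<le> \<delta> * L"
      using lims \<delta> g_pos Lpos by (intro abs_diff_le_if_squares_near) (auto simp: L2)
    have X: "perp (V T) \<theta> - (real CARD('n) - 1) * gm (V T) \<theta> \<le> \<delta> * gm (V T) \<theta>" using lims unfolding N_def by blast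
    have kT: "k * (real T + 1) \<le> par (V T) \<theta>" and dom: "dominates (V T) \<theta> k" using lims by auto
    note fin = final_estimator[OF k dom kT \<delta> X Lpos gL, unfolded sd]
    have m: "4 * ((2 * K + 2) / k + 2 * K) \<le> (k * \<nu>)^2 * min (k * (real T + 1)) L"
    proof -
      have "H \<le> k * (real T + 1)"
      proof -
        have "H / k \<le> real T + 1" using J(2) TJ by linarith
        then show ?thesis using k by (simp add: pos_divide_le_eq mult.commute)
      qed
      then have "(k * \<nu>)^2 * H \<le> (k * \<nu>)^2 * min (k * (real T + 1)) L" using LH by (intro mult_left_mono) auto
      moreover have "(k * \<nu>)^2 * H = 4 * Q^2" using k \<nu> by (simp add: H_def)
      ultimately show ?thesis by (simp only: Q(2))
    qed
    have A: "\<bar>\<zeta> \<bullet> (V T *v \<zeta>) - L * (\<zeta> \<bullet> \<zeta>)\<bar> \<le> \<epsilon> * L * (\<zeta> \<bullet> \<zeta>)" if "\<zeta> \<bullet> \<theta> = 0" for \<zeta>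
    proof -
      have "9 * s * L * (\<zeta> \<bullet> \<zeta>) \<le> \<epsilon> * L * (\<zeta> \<bullet> \<zeta>)" using s Lpos by (intro mult_right_mono) auto
      then show ?thesis using fin(1)[OF that] by linarith
    qed
    have Bd: "\<bar>sqrt L * (\<zeta> \<bullet> u T) - (\<zeta> \<bullet> S T) / sqrt L\<bar> \<le> \<epsilon> * norm \<zeta>"
      if "(\<theta> \<bullet> S T)^2 \<le> K * real T" "S T \<bullet> S T - (S T \<bullet> \<theta>)^2 \<le> K * L" "\<zeta> \<bullet> \<theta> = 0" for \<zeta>
    proof -
      have "norm \<zeta> * sqrt ((2 * K + 2) / k + 2 * K) * (20 * s / k + 2 * \<nu> * (20 * s / k + 2)) \<le> \<epsilon> * norm \<zeta>"
        using mult_left_mono[OF small, of "norm \<zeta>"] by (simp only: Q_def[symmetric] mult.assoc mult.commute[of \<epsilon>] norm_ge_zero simp_thms)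
      then show ?thesis using fin(2)[OF that(3,1,2) K m \<nu>(1,2)] by linarith
    qed
    show "let L = sqrt (2 * \<beta>^2 * real T / (real CARD('n) + 1)); V = design_matrix a T; S = noise_sum a e T in
        (\<forall>\<zeta>. \<zeta> \<bullet> \<theta> = 0 \<longrightarrow> \<bar>\<zeta> \<bullet> (V *v \<zeta>) - L * (\<zeta> \<bullet> \<zeta>)\<bar> \<le> \<epsilon> * L * (\<zeta> \<bullet> \<zeta>)) \<and>
        ((\<theta> \<bullet> S)^2 \<le> K * real T \<longrightarrow> S \<bullet> S - (S \<bullet> \<theta>)^2 \<le> K * L \<longrightarrow>
          (\<forall>\<zeta>. \<zeta> \<bullet> \<theta> = 0 \<longrightarrow> \<bar>sqrt L * (\<zeta> \<bullet> u T) - (\<zeta> \<bullet> S) / sqrt L\<bar> \<le> \<epsilon> * norm \<zeta>))"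
      unfolding Let_def L_def[symmetric] using A Bd by blast
  qed
qed

section \<open>Maximal inequalities for sub-Gaussian noise\<close>

text \<open>\<open>F t\<close> is the information just before \<open>e t\<close> is revealed. Hence
  \<open>e s\<close> is known at \<open>F t\<close> only for \<open>s < t\<close>, and a process is
  predictable when its value at \<open>t\<close> is measurable with respect to \<open>F t\<close>
  itself.\<close>

locale subgaussian_noise = prob_space M
  for M :: "'w measure" and F :: "nat \<Rightarrow> 'w measure" and \<sigma> :: real and T :: nat and e :: "nat \<Rightarrow> 'w \<Rightarrow> real" +
  assumes subalg: "\<And>t. t \<in> {1..T} ==> subalgebra M (F t)"
    and F_mono: "\<And>s t. s \<in> {1..T} ==> t \<in> {1..T} ==> s \<le> t ==> sets (F s) \<subseteq> sets (F t)"
    and e_adapted: "\<And>s t. s \<in> {1..T} ==> t \<in> {1..T} ==> s < t ==> e s \<in> borel_measurable (F t)"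
    and e_measurable: "\<And>t. t \<in> {1..T} ==> e t \<in> borel_measurable M"
    and exp_integrable: "\<And>t l. t \<in> {1..T} ==> integrable M (\<lambda>w. exp (l * e t w))"
    and e_mean: "\<And>t. t \<in> {1..T} ==> AE w in M. real_cond_exp M (F t) (e t) w = 0"
    and e_variance: "\<And>t. t \<in> {1..T} ==> AE w in M. real_cond_exp M (F t) (\<lambda>w. (e t w)\<^sup>2) w = \<sigma>^2"
    and e_subgaussian: "\<And>t l. t \<in> {1..T} ==>
      AE w in M. real_cond_exp M (F t) (\<lambda>w. exp (l * e t w)) w \<le> exp (\<sigma>^2 * l^2 / 2)"
begin

lemma cond_exp_locale: "t \<in> {1..T} ==> sigma_finite_subalgebra M (F t)"
proof -
  assume t: "t \<in> {1..T}"
  interpret finite_measure_subalgebra M "F t" by unfold_locales (rule subalg[OF t])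
  show ?thesis by unfold_locales
qed

lemma space_F: "t \<in> {1..T} ==> space (F t) = space M"
  using subalg by (simp add: subalgebra_def)

lemma measurable_F_mono:
  "s \<in> {1..T} ==> t \<in> {1..T} ==> s \<le> t ==> f \<in> borel_measurable (F s) ==> f \<in> borel_measurable (F t)"
proof (rule measurable_from_subalg[of "F t" "F s"])
  assume a: "s \<in> {1..T}" "t \<in> {1..T}" "s \<le> t"
  show "subalgebra (F t) (F s)"
    unfolding subalgebra_def space_F[OF a(1)] space_F[OF a(2)] using F_mono[OF a] by (rule conjI[OF refl])
qed assumption

lemma measurable_F_M: "t \<in> {1..T} ==> f \<in> measurable (F t) N ==> f \<in> measurable M N"
  using measurable_from_subalg[OF subalg] .

lemma nn_exp_le:
  assumes t: "t \<in> {1..T}" and Z: "Z \<in> borel_measurable (F t)"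
  shows "(\<integral>\<^sup>+w. Z w * ennreal (exp (l * e t w)) \<partial>M) \<le> (\<integral>\<^sup>+w. Z w * ennreal (exp (\<sigma>^2 * l^2 / 2)) \<partial>M)"
proof -
  interpret sigma_finite_subalgebra M "F t" by (rule cond_exp_locale[OF t])
  let ?f = "\<lambda>w. exp (l * e t w)"
  have f[measurable]: "?f \<in> borel_measurable M" using e_measurable[OF t] by measurable
  \<comment> \<open>\<open>real_cond_exp\<close> passes through \<open>enn2real\<close>, which maps
    infinity to 0. Almost sure finiteness is needed before the real bound can be read as a bound in
    \<open>ennreal\<close>.\<close>
  have fin: "(\<integral>\<^sup>+w. nn_cond_exp M (F t) (\<lambda>w. ennreal (?f w)) w \<partial>M) \<noteq> \<infinity>"
  proof -
    have "(\<integral>\<^sup>+w. 1 * nn_cond_exp M (F t) (\<lambda>w. ennreal (?f w)) w \<partial>M) = (\<integral>\<^sup>+w. 1 * ennreal (?f w) \<partial>M)"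
      by (rule nn_cond_exp_intg) auto
    also have "\<dots> < \<infinity>" using exp_integrable[OF t, of l] by (simp add: integrable_iff_bounded)
    finally show ?thesis by simp
  qed
  have "AE w in M. nn_cond_exp M (F t) (\<lambda>w. ennreal (?f w)) w \<noteq> \<infinity>"
    by (rule nn_integral_noteq_infinite[OF _ fin]) simp
  moreover have "AE w in M. nn_cond_exp M (F t) (\<lambda>w. ennreal (- ?f w)) w = 0"
  proof -
    have "AE w in M. 0 = nn_cond_exp M (F t) (\<lambda>_. 0) w" by (rule nn_cond_exp_F_meas) simp
    then show ?thesis by (simp add: ennreal_neg)
  qed
  ultimately have "AE w in M. nn_cond_exp M (F t) (\<lambda>w. ennreal (?f w)) w \<le> ennreal (exp (\<sigma>^2 * l^2 / 2))"
    using e_subgaussian[OF t, of l]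
  proof eventually_elim
    case (elim w)
    then have "enn2real (nn_cond_exp M (F t) (\<lambda>w. ennreal (?f w)) w) \<le> exp (\<sigma>^2 * l^2 / 2)"
      by (simp add: real_cond_exp_def)
    then have "ennreal (enn2real (nn_cond_exp M (F t) (\<lambda>w. ennreal (?f w)) w)) \<le> ennreal (exp (\<sigma>^2 * l^2 / 2))"
      by (rule ennreal_leI)
    then show ?case using elim(1) by (simp add: less_top)
  qed
  then have "(\<integral>\<^sup>+w. Z w * nn_cond_exp M (F t) (\<lambda>w. ennreal (?f w)) w \<partial>M) \<le> (\<integral>\<^sup>+w. Z w * ennreal (exp (\<sigma>^2 * l^2 / 2)) \<partial>M)"
    by (intro nn_integral_mono_AE) (auto elim!: eventually_mono intro!: mult_left_mono)
  moreover have "(\<integral>\<^sup>+w. Z w * nn_cond_exp M (F t) (\<lambda>w. ennreal (?f w)) w \<partial>M) = (\<integral>\<^sup>+w. Z w * ennreal (?f w) \<partial>M)"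
    by (rule nn_cond_exp_intg[OF Z]) simp
  ultimately show ?thesis by simp
qed

text \<open>
  The conditional bound is only available for one deterministic exponent at a time; a predictable
  exponent is reached through its discretisations and Fatou's lemma.
\<close>

lemma nn_exp_predictable_le:
  assumes t: "t \<in> {1..T}" and Z[measurable]: "Z \<in> borel_measurable (F t)" and z[measurable]: "z \<in> borel_measurable (F t)"
    and bd: "\<And>w. \<bar>z w\<bar> \<le> b" and Zfin: "\<And>w. Z w < top"
  shows "(\<integral>\<^sup>+w. Z w * ennreal (exp (z w * e t w - \<sigma>^2 * (z w)^2 / 2)) \<partial>M) \<le> (\<integral>\<^sup>+w. Z w \<partial>M)"
proof -
  have ZM[measurable]: "Z \<in> borel_measurable M" and zM[measurable]: "z \<in> borel_measurable M"
    by (rule measurable_F_M[OF t Z], rule measurable_F_M[OF t z])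
  have eM[measurable]: "e t \<in> borel_measurable M" by (rule e_measurable[OF t])
  define zn where "zn n w = real_of_int \<lfloor>real (Suc n) * z w\<rfloor> / real (Suc n)" for n w
  define G where "G x w = Z w * ennreal (exp (x * e t w - \<sigma>^2 * x^2 / 2))" for x w
  have fixed: "(\<integral>\<^sup>+w. indicator A w * G x w \<partial>M) \<le> (\<integral>\<^sup>+w. indicator A w * Z w \<partial>M)" if A[measurable]: "A \<in> sets (F t)" for A x
  proof -
    define c where "c = ennreal (exp (- (\<sigma>^2 * x^2 / 2)))"
    have "ennreal (exp (x * e t w - \<sigma>^2 * x^2 / 2)) = c * ennreal (exp (x * e t w))" for w
      unfolding c_def by (subst ennreal_mult'[symmetric]) (auto simp flip: exp_add)
    then have GA: "indicator A w * G x w = (indicator A w * Z w * c) * ennreal (exp (x * e t w))" for w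
      unfolding G_def by (simp only: mult.assoc)
    have "(\<integral>\<^sup>+w. indicator A w * G x w \<partial>M) \<le> (\<integral>\<^sup>+w. (indicator A w * Z w * c) * ennreal (exp (\<sigma>^2 * x^2 / 2)) \<partial>M)"
    proof (unfold GA, rule nn_exp_le[OF t])
      show "(\<lambda>w. indicator A w * Z w * c) \<in> borel_measurable (F t)" by measurable
    qed
    also have "\<dots> = (\<integral>\<^sup>+w. indicator A w * Z w \<partial>M)"
    proof -
      have "c * ennreal (exp (\<sigma>^2 * x^2 / 2)) = 1"
        unfolding c_def by (subst ennreal_mult'[symmetric]) (auto simp flip: exp_add)
      then show ?thesis by (simp only: mult.assoc mult_1_right)
    qed
    finally show ?thesis .
  qed
  have le: "(\<integral>\<^sup>+w. G (zn n w) w \<partial>M) \<le> (\<integral>\<^sup>+w. Z w \<partial>M)" for n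
  proof -
    \<comment> \<open>On a level set of the discretisation the exponent is deterministic, and the
      indicator of the set joins the weight \<open>Z\<close>. Boundedness of \<open>z\<close> leaves
      finitely many level sets.\<close>
    define A where "A k = {w \<in> space M. \<lfloor>real (Suc n) * z w\<rfloor> = k}" for k
    define K where "K = {\<lfloor>- (real (Suc n) * b)\<rfloor>..\<lfloor>real (Suc n) * b\<rfloor>}"
    have A[measurable]: "A k \<in> sets (F t)" for k
      unfolding A_def space_F[OF t, symmetric] by measurable
    have AM: "A k \<in> sets M" for k using subalg[OF t] A by (auto simp: subalgebra_def)
    have part: "H \<lfloor>real (Suc n) * z w\<rfloor> = (\<Sum>k\<in>K. indicator (A k) w * H k)" if "w \<in> space M" for w and H :: "int \<Rightarrow> ennreal"
    proof -
      have "real (Suc n) * z w \<le> real (Suc n) * b" "- (real (Suc n) * b) \<le> real (Suc n) * z w"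
        using bd[of w] mult_left_mono[of "z w" b "real (Suc n)"] mult_left_mono[of "-b" "z w" "real (Suc n)"] by (auto simp: abs_le_iff)
      then have "\<lfloor>real (Suc n) * z w\<rfloor> \<in> K" by (auto simp: K_def intro!: floor_mono)
      then have "(\<Sum>k\<in>K. indicator (A k) w * H k) = (\<Sum>k\<in>K. if k = \<lfloor>real (Suc n) * z w\<rfloor> then H k else 0)"
        using that by (intro sum.cong) (auto simp: A_def indicator_def)
      then show ?thesis using \<open>\<lfloor>real (Suc n) * z w\<rfloor> \<in> K\<close> by (simp add: K_def)
    qed
    have G[measurable]: "(\<lambda>w. indicator (A k) w * G x w) \<in> borel_measurable M" for k x
      using AM unfolding G_def by measurable
    have "(\<integral>\<^sup>+w. G (zn n w) w \<partial>M) = (\<integral>\<^sup>+w. (\<Sum>k\<in>K. indicator (A k) w * G (real_of_int k / real (Suc n)) w) \<partial>M)"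
      using part[of _ "\<lambda>k. G (real_of_int k / real (Suc n)) _"] by (intro nn_integral_cong) (simp add: zn_def)
    also have "\<dots> = (\<Sum>k\<in>K. \<integral>\<^sup>+w. indicator (A k) w * G (real_of_int k / real (Suc n)) w \<partial>M)"
      by (rule nn_integral_sum) simp
    also have "\<dots> \<le> (\<Sum>k\<in>K. \<integral>\<^sup>+w. indicator (A k) w * Z w \<partial>M)"
      by (intro sum_mono fixed A)
    also have "\<dots> = (\<integral>\<^sup>+w. (\<Sum>k\<in>K. indicator (A k) w * Z w) \<partial>M)"
      using AM by (intro nn_integral_sum[symmetric] borel_measurable_times_ennreal ZM borel_measurable_indicator) auto
    also have "\<dots> = (\<integral>\<^sup>+w. Z w \<partial>M)"
      using part[of _ "\<lambda>k. Z _"] by (intro nn_integral_cong) simp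
    finally show ?thesis .
  qed
  have lim: "(\<lambda>n. zn n w) \<longlonglongrightarrow> z w" for w
  proof (rule tendsto_sandwich)
    show "\<forall>\<^sub>F n in sequentially. z w - 1 / real (Suc n) \<le> zn n w"
    proof (intro always_eventually allI)
      fix n
      have "real (Suc n) * z w - 1 \<le> real_of_int \<lfloor>real (Suc n) * z w\<rfloor>" by linarith
      then have "(real (Suc n) * z w - 1) / real (Suc n) \<le> zn n w" unfolding zn_def by (intro divide_right_mono) auto
      then show "z w - 1 / real (Suc n) \<le> zn n w" by (simp add: diff_divide_distrib del: of_nat_Suc)
    qed
    show "\<forall>\<^sub>F n in sequentially. zn n w \<le> z w"
    proof (intro always_eventually allI)
      fix n
      have "real_of_int \<lfloor>real (Suc n) * z w\<rfloor> / real (Suc n) \<le> real (Suc n) * z w / real (Suc n)" by (intro divide_right_mono) auto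
      then show "zn n w \<le> z w" by (simp add: zn_def del: of_nat_Suc)
    qed
    have "(\<lambda>n. z w - 1 / real (Suc n)) \<longlonglongrightarrow> z w - 0" by (intro tendsto_intros LIMSEQ_Suc lim_1_over_n)
    then show "(\<lambda>n. z w - 1 / real (Suc n)) \<longlonglongrightarrow> z w" by simp
  qed auto
  have Glim: "G (z w) w = liminf (\<lambda>n. G (zn n w) w)" for w
  proof -
    have "(\<lambda>n. ennreal (exp (zn n w * e t w - \<sigma>^2 * (zn n w)^2 / 2))) \<longlonglongrightarrow> ennreal (exp (z w * e t w - \<sigma>^2 * (z w)^2 / 2))"
      by (intro tendsto_ennrealI tendsto_intros lim) auto
    then have "(\<lambda>n. G (zn n w) w) \<longlonglongrightarrow> G (z w) w"
      unfolding G_def by (rule ennreal_tendsto_cmult[OF Zfin])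
    then show ?thesis by (simp add: lim_imp_Liminf)
  qed
  have Gm: "(\<lambda>w. G (zn n w) w) \<in> borel_measurable M" for n unfolding G_def zn_def by measurable
  have "(\<integral>\<^sup>+w. G (z w) w \<partial>M) = (\<integral>\<^sup>+w. liminf (\<lambda>n. G (zn n w) w) \<partial>M)" by (simp add: Glim)
  also have "\<dots> \<le> liminf (\<lambda>n. \<integral>\<^sup>+w. G (zn n w) w \<partial>M)" by (rule nn_integral_liminf[OF Gm])
  also have "\<dots> \<le> (\<integral>\<^sup>+w. Z w \<partial>M)" using le by (intro Liminf_le) (auto intro!: always_eventually)
  finally show ?thesis by (simp add: G_def)
qed

definition predictable :: "(nat \<Rightarrow> 'w \<Rightarrow> real) \<Rightarrow> bool" where
  "predictable z \<longleftrightarrow> (\<forall>t\<in>{1..T}. z t \<in> borel_measurable (F t))"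

lemma predictableD:
  assumes "predictable z" "s \<in> {1..T}" "t \<in> {1..T}" "s \<le> t"
  shows "z s \<in> borel_measurable (F t)"
proof (rule measurable_F_mono[OF assms(2-4)])
  show "z s \<in> borel_measurable (F s)" by (rule bspec[OF assms(1)[unfolded predictable_def] assms(2)])
qed

lemma predictable_sum:
  assumes z: "predictable z" and s: "t \<in> {1..T}" and g: "\<And>x y. (\<lambda>(x, y). g x y) \<in> borel_measurable (borel :: (real \<times> real) measure)"
  shows "(\<lambda>w. \<Sum>s\<in>{1..<t}. g (z s w) (e s w) :: real) \<in> borel_measurable (F t)"
proof (rule borel_measurable_sum)
  fix s' assume s': "s' \<in> {1..<t}"
  then have [measurable]: "z s' \<in> borel_measurable (F t)" "e s' \<in> borel_measurable (F t)"
    using predictableD[OF z, of s' t] e_adapted[of s' t] s by auto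
  have "(\<lambda>w. (\<lambda>(x, y). g x y) (z s' w, e s' w)) \<in> borel_measurable (F t)"
    by (rule measurable_compose[OF _ g]) (simp add: borel_prod[symmetric])
  then show "(\<lambda>w. g (z s' w) (e s' w)) \<in> borel_measurable (F t)" by simp
qed

lemma exp_supermartingale:
  assumes z: "predictable z" and bd: "\<And>s w. \<bar>z s w\<bar> \<le> b" and t: "t \<le> T"
  shows "(\<integral>\<^sup>+w. ennreal (exp (\<Sum>s=1..t. z s w * e s w - \<sigma>^2 * (z s w)^2 / 2)) \<partial>M) \<le> 1"
  using t
proof (induction t)
  case 0
  then show ?case by (simp add: emeasure_space_1)
next
  case (Suc t)
  then have St: "Suc t \<in> {1..T}" by simp
  let ?P = "\<lambda>w. ennreal (exp (\<Sum>s=1..t. z s w * e s w - \<sigma>^2 * (z s w)^2 / 2))"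
  have P: "?P \<in> borel_measurable (F (Suc t))"
  proof -
    have "(\<lambda>w. \<Sum>s\<in>{1..<Suc t}. z s w * e s w - \<sigma>^2 * (z s w)^2 / 2) \<in> borel_measurable (F (Suc t))"
      by (rule predictable_sum[OF z St, of "\<lambda>x y. x * y - \<sigma>^2 * x^2 / 2"]) (simp add: borel_prod[symmetric] case_prod_beta)
    then show ?thesis unfolding atLeastLessThanSuc_atLeastAtMost by measurable
  qed
  have "(\<integral>\<^sup>+w. ennreal (exp (\<Sum>s=1..Suc t. z s w * e s w - \<sigma>^2 * (z s w)^2 / 2)) \<partial>M)
     = (\<integral>\<^sup>+w. ?P w * ennreal (exp (z (Suc t) w * e (Suc t) w - \<sigma>^2 * (z (Suc t) w)^2 / 2)) \<partial>M)"
    by (intro nn_integral_cong) (simp add: exp_add[symmetric] ennreal_mult'[symmetric])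
  also have "\<dots> \<le> (\<integral>\<^sup>+w. ?P w \<partial>M)"
    using z St by (intro nn_exp_predictable_le[OF St P _ bd]) (auto simp: predictable_def)
  also have "\<dots> \<le> 1" using Suc by simp
  finally show ?case .
qed

definition "msum v t w = (\<Sum>s=1..t. v s w * e s w)"
definition "qvar v t w = (\<Sum>s=1..t. (v s w)\<^sup>2)" for v :: "nat \<Rightarrow> 'w \<Rightarrow> real"

lemma predictable_M: "predictable v ==> s \<in> {1..T} ==> v s \<in> borel_measurable M"
  by (rule measurable_F_M[of s "v s" borel]) (simp_all only: predictable_def)

lemma msum_measurable: "predictable v ==> t \<le> T ==> msum v t \<in> borel_measurable M"
  unfolding msum_def using predictable_M e_measurable by (intro borel_measurable_sum borel_measurable_times) auto

lemma qvar_measurable: "predictable v ==> t \<le> T ==> qvar v t \<in> borel_measurable M"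
  unfolding qvar_def using predictable_M by (intro borel_measurable_sum borel_measurable_power) auto

lemma qvar_predictable: "predictable v ==> predictable (qvar v)"
proof -
  assume v: "predictable v"
  have "qvar v t \<in> borel_measurable (F t)" if t: "t \<in> {1..T}" for t
    unfolding qvar_def
  proof (intro borel_measurable_sum borel_measurable_power)
    show "v s \<in> borel_measurable (F t)" if "s \<in> {1..t}" for s
      by (rule predictableD[OF v _ t]) (use that t in auto)
  qed
  then show ?thesis unfolding predictable_def by (rule ballI)
qed

lemma msum_predictable: "predictable v ==> predictable (\<lambda>t. msum v (t - 1))"
proof -
  assume v: "predictable v"
  have "msum v (t - 1) \<in> borel_measurable (F t)" if t: "t \<in> {1..T}" for t
    unfolding msum_def
  proof (intro borel_measurable_sum borel_measurable_times)
    fix s assume s: "s \<in> {1..t - 1}"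
    show "v s \<in> borel_measurable (F t)" by (rule predictableD[OF v _ t]) (use s t in auto)
    show "e s \<in> borel_measurable (F t)" by (rule e_adapted[OF _ t]) (use s t in auto)
  qed
  then show ?thesis unfolding predictable_def by (rule ballI)
qed

lemma quadratic_event_measurable:
  assumes v: "predictable v"
  shows "{w \<in> space M. \<exists>t\<le>T. B * (1 + qvar v t w) < (msum v t w)^2} \<in> sets M"
proof -
  have [measurable]: "msum v t \<in> borel_measurable M" "qvar v t \<in> borel_measurable M" if "t \<in> {..T}" for t
    using that v msum_measurable qvar_measurable by auto
  have "{w \<in> space M. \<exists>t\<in>{..T}. B * (1 + qvar v t w) < (msum v t w)^2} \<in> sets M" by measurable
  then show ?thesis by (simp add: Bex_def)
qed

lemma tail_event_measurable:
  assumes v: "predictable v" and [measurable]: "Measurable.pred borel P"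
  shows "{w \<in> space M. \<exists>t\<le>T. P (msum v t w) \<and> qvar v t w \<le> R} \<in> sets M"
proof -
  have [measurable]: "msum v t \<in> borel_measurable M" "qvar v t \<in> borel_measurable M" if "t \<in> {..T}" for t
    using that v msum_measurable qvar_measurable by auto
  have "{w \<in> space M. \<exists>t\<in>{..T}. P (msum v t w) \<and> qvar v t w \<le> R} \<in> sets M" by measurable
  then show ?thesis by (simp add: Bex_def)
qed

text \<open>Freezing the martingale once it reaches level \<open>x\<close> turns the supremum into a terminal value.\<close>

lemma maximal_tail_upper:
  assumes v: "predictable v" and v1: "\<And>s w. \<bar>v s w\<bar> \<le> 1" and x: "x > 0" and R: "R > 0" and \<sigma>: "\<sigma> > 0"
  shows "prob {w \<in> space M. \<exists>t\<le>T. x \<le> msum v t w \<and> qvar v t w \<le> R} \<le> exp (- (x^2 / (2 * \<sigma>^2 * R)))"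
proof -
  \<comment> \<open>The optimal Chernoff exponent for level \<open>x\<close> and variance proxy
    \<open>\<sigma>^2 * R\<close>.\<close>
  define c0 where "c0 = x / (\<sigma>^2 * R)"
  have c0: "c0 > 0" using x R \<sigma> by (simp add: c0_def)
  \<comment> \<open>Whether round \<open>s\<close> is kept may depend only on what precedes its
    noise: the martingale strictly before \<open>s\<close>, and the variation up to and including
    \<open>s\<close>, which is predictable.\<close>
  define on where "on s w \<longleftrightarrow> (\<forall>r<s. msum v r w < x) \<and> qvar v s w \<le> R" for s w
  define z where "z s w = (if on s w then c0 * v s w else 0)" for s w
  have z: "predictable z"
    unfolding predictable_def
  proof
    fix t assume t: "t \<in> {1..T}"
    have [measurable]: "v t \<in> borel_measurable (F t)" "qvar v t \<in> borel_measurable (F t)"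
      using v qvar_predictable[OF v] t by (auto simp: predictable_def)
    have [measurable]: "msum v r \<in> borel_measurable (F t)" if r: "r \<in> {..<t}" for r
      unfolding msum_def
    proof (intro borel_measurable_sum borel_measurable_times)
      fix s assume s: "s \<in> {1..r}"
      show "v s \<in> borel_measurable (F t)" by (rule predictableD[OF v _ t]) (use s t r in auto)
      show "e s \<in> borel_measurable (F t)" by (rule e_adapted[OF _ t]) (use s t r in auto)
    qed
    have [measurable]: "Measurable.pred (F t) (\<lambda>w. \<forall>r\<in>{..<t}. msum v r w < x)"
      by measurable
    show "z t \<in> borel_measurable (F t)"
      unfolding z_def on_def lessThan_iff[symmetric] Ball_def[symmetric] by measurable
  qed
  have zb: "\<bar>z s w\<bar> \<le> c0" for s w
    using mult_left_mono[OF v1, of c0 s w] c0 by (simp add: z_def abs_mult)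
  define E where "E = {w \<in> space M. \<exists>t\<le>T. x \<le> msum v t w \<and> qvar v t w \<le> R}"
  let ?P = "\<lambda>w. exp (\<Sum>s=1..T. z s w * e s w - \<sigma>^2 * (z s w)^2 / 2)"
  define c where "c = exp (x^2 / (2 * \<sigma>^2 * R))"
  have big: "c \<le> ?P w" if E: "w \<in> E" for w
  proof -
    from E obtain t0 where t0: "t0 \<le> T" "x \<le> msum v t0 w" "qvar v t0 w \<le> R" unfolding E_def by blast
    define \<tau> where "\<tau> = (LEAST t. x \<le> msum v t w)"
    have \<tau>x: "x \<le> msum v \<tau> w" unfolding \<tau>_def by (rule LeastI[of _ t0]) (rule t0)
    have \<tau>t: "\<tau> \<le> t0" unfolding \<tau>_def by (rule Least_le) (rule t0)
    have before: "msum v r w < x" if "r < \<tau>" for r using not_less_Least[of r "\<lambda>t. x \<le> msum v t w"] that by (simp add: \<tau>_def)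
    have qm: "qvar v s w \<le> R" if "s \<le> \<tau>" for s
    proof -
      have "qvar v s w \<le> qvar v t0 w" unfolding qvar_def using that \<tau>t by (intro sum_mono2) auto
      then show ?thesis using t0 by simp
    qed
    have zs: "z s w = (if s \<le> \<tau> then c0 * v s w else 0)" for s
      using before qm[of s] \<tau>x by (force simp: z_def on_def not_le)
    have restrict: "(\<Sum>s=1..T. f (z s w) s) = (\<Sum>s=1..\<tau>. f (c0 * v s w) s)" if "\<And>s. f 0 s = 0" for f :: "real \<Rightarrow> nat \<Rightarrow> real"
    proof -
      have "(\<Sum>s=1..T. f (z s w) s) = (\<Sum>s=1..\<tau>. f (z s w) s)"
        using \<tau>t t0(1) that by (intro sum.mono_neutral_right) (auto simp: zs)
      also have "\<dots> = (\<Sum>s=1..\<tau>. f (c0 * v s w) s)" by (intro sum.cong) (auto simp: zs)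
      finally show ?thesis .
    qed
    have "(\<Sum>s=1..T. z s w * e s w - \<sigma>^2 * (z s w)^2 / 2) = (\<Sum>s=1..\<tau>. c0 * v s w * e s w - \<sigma>^2 * (c0 * v s w)^2 / 2)"
      using restrict[of "\<lambda>x s. x * e s w - \<sigma>^2 * x^2 / 2"] by simp
    also have "\<dots> = c0 * msum v \<tau> w - \<sigma>^2 * c0^2 / 2 * qvar v \<tau> w"
      by (simp add: msum_def qvar_def sum_subtractf sum_distrib_left power_mult_distrib mult_ac)
    also have "\<dots> \<ge> c0 * x - \<sigma>^2 * c0^2 / 2 * R"
      using \<tau>x qm[of \<tau>] c0 by (intro diff_mono mult_left_mono) auto
    also have "c0 * x - \<sigma>^2 * c0^2 / 2 * R = x^2 / (2 * \<sigma>^2 * R)"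
      using R \<sigma> by (simp add: c0_def field_simps power2_eq_square)
    finally show ?thesis by (simp add: c_def)
  qed
  have mE: "E \<in> sets M" unfolding E_def by (rule tail_event_measurable[OF v, of "\<lambda>y. x \<le> y"]) measurable
  have "ennreal c * emeasure M E = (\<integral>\<^sup>+w. ennreal c * indicator E w \<partial>M)"
    by (rule nn_integral_cmult_indicator[OF mE, symmetric])
  also have "\<dots> \<le> (\<integral>\<^sup>+w. ennreal (?P w) \<partial>M)"
  proof (rule nn_integral_mono)
    show "ennreal c * indicator E w \<le> ennreal (?P w)" for w
    proof (cases "w \<in> E")
      case True
      then have i: "indicator E w = (1 :: ennreal)" by (rule indicator_simps(1))
      show ?thesis unfolding i mult_1_right by (rule ennreal_leI[OF big[OF True]])
    next
      case False
      then have i: "indicator E w = (0 :: ennreal)" by (rule indicator_simps(2))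
      show ?thesis unfolding i mult_zero_right by (rule zero_le)
    qed
  qed
  also have "\<dots> \<le> 1" by (rule exp_supermartingale[OF z zb order_refl])
  finally have "ennreal (c * prob E) \<le> ennreal 1" by (simp add: emeasure_eq_measure ennreal_mult' c_def)
  then have "c * prob E \<le> 1" by (subst (asm) ennreal_le_iff) auto
  then have "prob E \<le> 1 / c" by (simp add: c_def pos_le_divide_eq mult.commute)
  also have "1 / c = exp (- (x^2 / (2 * \<sigma>^2 * R)))" by (simp only: c_def exp_minus inverse_eq_divide)
  finally show ?thesis unfolding E_def .
qed

lemma maximal_tail:
  assumes v: "predictable v" and v1: "\<And>s w. \<bar>v s w\<bar> \<le> 1" and x: "x > 0" and R: "R > 0" and \<sigma>: "\<sigma> > 0"
  shows "prob {w \<in> space M. \<exists>t\<le>T. x \<le> \<bar>msum v t w\<bar> \<and> qvar v t w \<le> R} \<le> 2 * exp (- (x^2 / (2 * \<sigma>^2 * R)))"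
proof -
  let ?v' = "\<lambda>s w. - v s w"
  have v': "predictable ?v'" using v by (auto simp: predictable_def)
  have n: "msum ?v' t w = - msum v t w" "qvar ?v' t w = qvar v t w" for t w
    by (simp_all add: msum_def qvar_def sum_negf)
  define E where "E P = {w \<in> space M. \<exists>t\<le>T. P (msum v t w) \<and> qvar v t w \<le> R}" for P :: "real \<Rightarrow> bool"
  have m: "E P \<in> sets M" if "Measurable.pred borel P" for P
    unfolding E_def by (rule tail_event_measurable[OF v that])
  have m1: "E (\<lambda>y. x \<le> y) \<in> sets M" by (rule m) measurable
  have m2: "E (\<lambda>y. x \<le> - y) \<in> sets M" by (rule m) measurable
  have sub: "E (\<lambda>y. x \<le> \<bar>y\<bar>) \<subseteq> E (\<lambda>y. x \<le> y) \<union> E (\<lambda>y. x \<le> - y)"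
  proof
    fix w assume "w \<in> E (\<lambda>y. x \<le> \<bar>y\<bar>)"
    then obtain t where t: "w \<in> space M" "t \<le> T" "x \<le> \<bar>msum v t w\<bar>" "qvar v t w \<le> R" unfolding E_def by blast
    have "x \<le> msum v t w \<or> x \<le> - msum v t w" using t(3) by linarith
    then show "w \<in> E (\<lambda>y. x \<le> y) \<union> E (\<lambda>y. x \<le> - y)" using t(1,2,4) unfolding E_def by blast
  qed
  have p1: "prob (E (\<lambda>y. x \<le> y)) \<le> exp (- (x^2 / (2 * \<sigma>^2 * R)))"
    unfolding E_def by (rule maximal_tail_upper[OF v v1 x R \<sigma>])
  have p2: "prob (E (\<lambda>y. x \<le> - y)) \<le> exp (- (x^2 / (2 * \<sigma>^2 * R)))"
    unfolding E_def using maximal_tail_upper[OF v' _ x R \<sigma>] v1 unfolding n by simp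
  have "prob (E (\<lambda>y. x \<le> \<bar>y\<bar>)) \<le> prob (E (\<lambda>y. x \<le> y) \<union> E (\<lambda>y. x \<le> - y))"
    by (rule finite_measure_mono[OF sub]) (rule sets.Un[OF m1 m2])
  also have "\<dots> \<le> prob (E (\<lambda>y. x \<le> y)) + prob (E (\<lambda>y. x \<le> - y))"
    by (rule measure_Un_le[OF m1 m2])
  finally have "prob (E (\<lambda>y. x \<le> \<bar>y\<bar>)) \<le> 2 * exp (- (x^2 / (2 * \<sigma>^2 * R)))" using p1 p2 by linarith
  then show ?thesis unfolding E_def .
qed

end

context subgaussian_noise
begin

text \<open>Peeling over dyadic values of the quadratic variation.\<close>

lemma law_of_iterated_logarithm_tail:
  assumes v: "predictable v" and v1: "\<And>s w. \<bar>v s w\<bar> \<le> 1" and B: "B > 0" and \<sigma>: "\<sigma> > 0" and m: "real T + 1 < 2 ^ Suc m"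
  shows "prob {w \<in> space M. \<exists>t\<le>T. B * (1 + qvar v t w) < (msum v t w)^2} \<le> 2 * real (Suc m) * exp (- (B / (4 * \<sigma>^2)))"
proof -
  define A where "A k = {w \<in> space M. \<exists>t\<le>T. sqrt (B * 2 ^ k) \<le> \<bar>msum v t w\<bar> \<and> qvar v t w \<le> 2 ^ Suc k}" for k :: nat
  have AM: "A k \<in> sets M" for k
    unfolding A_def by (rule tail_event_measurable[OF v, of "\<lambda>y. sqrt (B * 2 ^ k) \<le> \<bar>y\<bar>"]) measurable
  have PA: "prob (A k) \<le> 2 * exp (- (B / (4 * \<sigma>^2)))" for k
  proof -
    have "prob (A k) \<le> 2 * exp (- ((sqrt (B * 2 ^ k))^2 / (2 * \<sigma>^2 * 2 ^ Suc k)))"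
      unfolding A_def by (rule maximal_tail[OF v v1 _ _ \<sigma>]) (use B in auto)
    also have "(sqrt (B * 2 ^ k))^2 / (2 * \<sigma>^2 * 2 ^ Suc k) = B / (4 * \<sigma>^2)" using B \<sigma> by simp
    finally show ?thesis .
  qed
  have "{w \<in> space M. \<exists>t\<le>T. B * (1 + qvar v t w) < (msum v t w)^2} \<subseteq> (\<Union>k\<in>{..m}. A k)"
  proof (rule subsetI)
    fix w assume "w \<in> {w \<in> space M. \<exists>t\<le>T. B * (1 + qvar v t w) < (msum v t w)^2}"
    then obtain t where t: "w \<in> space M" "t \<le> T" "B * (1 + qvar v t w) < (msum v t w)^2" by auto
    define q where "q = 1 + qvar v t w"
    have q0: "1 \<le> q" by (simp add: q_def qvar_def sum_nonneg)
    have "qvar v t w \<le> (\<Sum>s=1..t. 1)" unfolding qvar_def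
      by (intro sum_mono) (use v1 in \<open>simp add: abs_square_le_1\<close>)
    then have qT: "q < 2 ^ Suc m" using t m by (simp add: q_def)
    \<comment> \<open>The dyadic block of \<open>1 + qvar\<close>, which is at least 1, so blocks
      start at 0. In block \<open>k\<close> the squared level \<open>B * 2 ^ k\<close> and the
      variation bound \<open>2 ^ Suc k\<close> have a ratio independent of \<open>k\<close>, and
      every block gets the same tail.\<close>
    define k where "k = (LEAST k. q < 2 ^ Suc k)"
    have k1: "q < 2 ^ Suc k" unfolding k_def by (rule LeastI[of _ m]) (rule qT)
    have km: "k \<le> m" unfolding k_def by (rule Least_le) (rule qT)
    have k2: "2 ^ k \<le> q"
    proof (cases k)
      case (Suc j)
      then have "j < (LEAST k. q < 2 ^ Suc k)" by (simp only: k_def[symmetric] lessI)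
      from not_less_Least[OF this] show ?thesis using Suc by (simp only: not_less)
    qed (use q0 in simp)
    have "B * 2 ^ k \<le> B * q" using k2 B by simp
    then have "B * 2 ^ k \<le> (msum v t w)^2" using t by (simp add: q_def)
    then have "sqrt (B * 2 ^ k) \<le> \<bar>msum v t w\<bar>" using real_sqrt_le_mono by fastforce
    moreover have "qvar v t w \<le> 2 ^ Suc k" using k1 unfolding q_def by linarith
    ultimately have "w \<in> A k" using t unfolding A_def by blast
    then show "w \<in> (\<Union>k\<in>{..m}. A k)" using km by blast
  qed
  then have "prob {w \<in> space M. \<exists>t\<le>T. B * (1 + qvar v t w) < (msum v t w)^2} \<le> prob (\<Union>k\<in>{..m}. A k)"
    by (rule finite_measure_mono) (use AM in auto)
  also have "\<dots> \<le> (\<Sum>k\<in>{..m}. prob (A k))" by (rule finite_measure_subadditive_finite) (use AM in auto)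
  also have "\<dots> \<le> (\<Sum>k\<in>{..m}. 2 * exp (- (B / (4 * \<sigma>^2))))" by (intro sum_mono PA)
  finally show ?thesis by (simp add: algebra_simps)
qed

end

section \<open>Central limit theorem for martingale transforms\<close>

lemma abs_power3_le_exp: "\<bar>x\<bar> ^ 3 \<le> 27 * (exp x + exp (- x))" for x :: real
proof -
  have "(1 + \<bar>x\<bar> / 3) ^ 3 \<le> exp (\<bar>x\<bar> / 3) ^ 3" by (intro power_mono exp_ge_add_one_self) simp
  also have "\<dots> = exp \<bar>x\<bar>" by (simp flip: exp_of_nat_mult)
  also have "\<dots> \<le> exp x + exp (- x)" by (cases "x \<ge> 0") auto
  finally have "(1 + \<bar>x\<bar> / 3) ^ 3 \<le> exp x + exp (- x)" .
  moreover have "(\<bar>x\<bar> / 3) ^ 3 \<le> (1 + \<bar>x\<bar> / 3) ^ 3" by (intro power_mono) auto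
  ultimately show ?thesis by (simp add: power_divide)
qed

lemma abs_power_le_exp:
  fixes x :: real
  assumes "n \<le> 3" shows "\<bar>x\<bar> ^ n \<le> 28 * (exp x + exp (- x))"
proof -
  have 1: "1 \<le> exp x + exp (- x)" by (cases "x \<ge> 0") (auto intro: add_increasing add_increasing2)
  show ?thesis
  proof (cases "\<bar>x\<bar> \<le> 1")
    case True
    then have "\<bar>x\<bar> ^ n \<le> 1" by (simp add: power_le_one)
    also have "1 \<le> 28 * (exp x + exp (- x))" using 1 by simp
    finally show ?thesis .
  next
    case False
    then have "\<bar>x\<bar> ^ n \<le> \<bar>x\<bar> ^ 3" using assms by (intro power_increasing) auto
    also have "\<bar>x\<bar> ^ 3 \<le> 27 * (exp x + exp (- x))" by (rule abs_power3_le_exp)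
    also have "\<dots> \<le> 28 * (exp x + exp (- x))" using 1 by simp
    finally show ?thesis .
  qed
qed

lemma iexp_second_order:
  "cmod (iexp x - (1 + \<i> * x - (complex_of_real x)^2 / 2)) \<le> \<bar>x\<bar> ^ 3 / 6" for x :: real
proof -
  have "cmod (iexp x - (\<Sum>k \<le> 2. (\<i> * x) ^ k / fact k)) \<le> \<bar>x\<bar> ^ Suc 2 / fact (Suc 2)" by (rule iexp_approx1)
  moreover have "(\<Sum>k \<le> 2. (\<i> * x) ^ k / fact k) = 1 + \<i> * x - (complex_of_real x)^2 / 2"
    by (simp add: numeral_2_eq_2 power_mult_distrib)
  moreover have "\<bar>x\<bar> ^ Suc 2 / fact (Suc 2) = \<bar>x\<bar> ^ 3 / 6" by (simp add: fact_numeral)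
  ultimately show ?thesis by (simp only:)
qed

text \<open>For the compensator: \<open>exp q * (1 - q)\<close> differs from 1 only in second
  order.\<close>

lemma exp_times_one_minus_bound:
  fixes q :: real assumes "q \<ge> 0"
  shows "\<bar>exp q - 1 - exp q * q\<bar> \<le> exp q * q^2"
proof -
  have a: "1 - q \<le> exp (- q)" using exp_ge_add_one_self[of "- q"] by simp
  have b: "exp (- q) \<le> 1 - q + q^2"
  proof -
    have "exp (- q) * (1 + q) \<le> exp (- q) * exp q" by (intro mult_left_mono exp_ge_add_one_self) simp
    then have "exp (- q) \<le> 1 / (1 + q)" using assms by (simp add: pos_le_divide_eq flip: exp_add)
    also have "\<dots> \<le> 1 - q + q^2"
    proof -
      have "1 \<le> (1 - q + q^2) * (1 + q)" using assms by (simp add: power2_eq_square algebra_simps)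
      then show ?thesis using assms by (simp add: pos_divide_le_eq)
    qed
    finally show ?thesis .
  qed
  have "exp q - 1 - exp q * q = exp q * (1 - q - exp (- q))" by (simp add: algebra_simps flip: exp_add)
  moreover have "\<bar>1 - q - exp (- q)\<bar> \<le> q^2" using a b by linarith
  ultimately show ?thesis by (simp add: abs_mult)
qed

lemma exp_diff_le: "\<bar>exp x - exp y\<bar> \<le> exp M * \<bar>x - y\<bar>" if "x \<le> M" "y \<le> M" for x y :: real
proof -
  have *: "exp x - exp y \<le> exp M * (x - y)" "exp x \<ge> exp y" if "y \<le> x" "x \<le> M" for x y
  proof -
    have "exp x * (1 - (x - y)) \<le> exp x * exp (- (x - y))"
    proof (rule mult_left_mono)
      show "1 - (x - y) \<le> exp (- (x - y))" using exp_ge_add_one_self[of "- (x - y)"] by linarith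
    qed simp
    also have "\<dots> = exp y" by (simp flip: exp_add)
    finally have "exp x - exp y \<le> exp x * (x - y)" by (simp add: algebra_simps)
    also have "\<dots> \<le> exp M * (x - y)" using that by (intro mult_right_mono) auto
    finally show "exp x - exp y \<le> exp M * (x - y)" .
    show "exp x \<ge> exp y" using that by simp
  qed
  show ?thesis using *[of y x] *[of x y] that by (cases "y \<le> x") auto
qed

context subgaussian_noise
begin

lemma integrable_power:
  assumes t: "t \<in> {1..T}" and n: "n \<le> 3"
  shows "integrable M (\<lambda>w. \<bar>e t w\<bar> ^ n)" "integrable M (\<lambda>w. (e t w) ^ n)"
proof -
  have [measurable]: "e t \<in> borel_measurable M" by (rule e_measurable[OF t])
  have i: "integrable M (\<lambda>w. 28 * (exp (e t w) + exp (- e t w)))"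
    using exp_integrable[OF t, of 1] exp_integrable[OF t, of "-1"] by simp
  show "integrable M (\<lambda>w. \<bar>e t w\<bar> ^ n)"
    by (rule Bochner_Integration.integrable_bound[OF i]) (use abs_power_le_exp[OF n] in \<open>auto simp: power_abs\<close>)
  show "integrable M (\<lambda>w. (e t w) ^ n)"
    by (rule Bochner_Integration.integrable_bound[OF i]) (use abs_power_le_exp[OF n] in \<open>auto simp: power_abs\<close>)
qed

lemma integrable_bounded_times:
  fixes h :: "'w \<Rightarrow> 'b :: {banach, second_countable_topology, real_normed_algebra}"
  assumes "integrable M f" "h \<in> borel_measurable M" "\<And>w. norm (h w) \<le> c"
  shows "integrable M (\<lambda>w. h w * f w)"
proof (rule Bochner_Integration.integrable_bound)
  show "integrable M (\<lambda>w. c * norm (f w))" using assms(1) by auto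
  show "(\<lambda>w. h w * f w) \<in> borel_measurable M" using assms(1,2) by measurable
  have c: "0 \<le> c" using order_trans[OF norm_ge_zero assms(3)[of undefined]] .
  show "AE w in M. norm (h w * f w) \<le> norm (c * norm (f w))"
  proof (rule AE_I2)
    fix w
    have "norm (h w * f w) \<le> norm (h w) * norm (f w)" by (rule norm_mult_ineq)
    also have "\<dots> \<le> c * norm (f w)" by (rule mult_right_mono[OF assms(3)]) simp
    finally show "norm (h w * f w) \<le> norm (c * norm (f w))" using c by simp
  qed
qed

lemma expectation_predictable_times:
  assumes t: "t \<in> {1..T}" and h: "h \<in> borel_measurable (F t)" "\<And>w. \<bar>h w\<bar> \<le> c"
  shows "(\<integral>w. h w * e t w \<partial>M) = 0"
    and "(\<integral>w. h w * (e t w)^2 \<partial>M) = \<sigma>^2 * (\<integral>w. h w \<partial>M)"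
    and "(\<And>w. 0 \<le> h w) ==> (\<integral>w. h w * \<bar>e t w\<bar> ^ 3 \<partial>M) \<le> 54 * exp (\<sigma>^2 / 2) * (\<integral>w. h w \<partial>M)"
proof -
  interpret sigma_finite_subalgebra M "F t" by (rule cond_exp_locale[OF t])
  have hM[measurable]: "h \<in> borel_measurable M" by (rule measurable_F_M[OF t h(1)])
  have eM[measurable]: "e t \<in> borel_measurable M" by (rule e_measurable[OF t])
  have ih: "integrable M h" by (rule integrable_const_bound[of _ c]) (use h(2) in auto)
  have i: "integrable M (\<lambda>w. h w * f w)" if "integrable M f" for f
    by (rule integrable_bounded_times[OF that hM]) (use h(2) in auto)
  have ce: "(\<integral>w. h w * f w \<partial>M) = (\<integral>w. h w * real_cond_exp M (F t) f w \<partial>M)" "integrable M (\<lambda>w. h w * real_cond_exp M (F t) f w)"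
    if "integrable M f" for f
    using real_cond_exp_intg[OF i[OF that] h(1)] that by auto
  have i1: "integrable M (e t)" using integrable_power(2)[OF t, of 1] by simp
  have i2: "integrable M (\<lambda>w. (e t w)\<^sup>2)" using integrable_power(2)[OF t, of 2] by simp
  have i3: "integrable M (\<lambda>w. \<bar>e t w\<bar> ^ 3)" using integrable_power(1)[OF t, of 3] by simp
  have "(\<integral>w. h w * real_cond_exp M (F t) (e t) w \<partial>M) = (\<integral>w. 0 \<partial>M)"
    by (rule integral_cong_AE) (use e_mean[OF t] in auto)
  then show "(\<integral>w. h w * e t w \<partial>M) = 0" by (simp add: ce(1)[OF i1])
  have "(\<integral>w. h w * real_cond_exp M (F t) (\<lambda>w. (e t w)\<^sup>2) w \<partial>M) = (\<integral>w. h w * \<sigma>^2 \<partial>M)"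
    by (rule integral_cong_AE) (use e_variance[OF t] in auto)
  then show "(\<integral>w. h w * (e t w)^2 \<partial>M) = \<sigma>^2 * (\<integral>w. h w \<partial>M)" by (simp add: ce(1)[OF i2])
  assume h0: "\<And>w. 0 \<le> h w"
  \<comment> \<open>The third absolute moment is controlled by the exponential moments at
    \<open>l = 1\<close> and \<open>l = -1\<close>, which are what the sub-Gaussian condition
    bounds.\<close>
  have ex: "(\<integral>w. h w * exp (l * e t w) \<partial>M) \<le> exp (\<sigma>^2 / 2) * (\<integral>w. h w \<partial>M)" if l: "l^2 = 1" for l
  proof -
    have "(\<integral>w. h w * exp (l * e t w) \<partial>M) = (\<integral>w. h w * real_cond_exp M (F t) (\<lambda>w. exp (l * e t w)) w \<partial>M)"
      by (rule ce(1)[OF exp_integrable[OF t]])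
    also have "\<dots> \<le> (\<integral>w. h w * exp (\<sigma>^2 / 2) \<partial>M)"
    proof (rule integral_mono_AE)
      show "integrable M (\<lambda>w. h w * real_cond_exp M (F t) (\<lambda>w. exp (l * e t w)) w)" by (rule ce(2)[OF exp_integrable[OF t]])
      show "integrable M (\<lambda>w. h w * exp (\<sigma>^2 / 2))" using ih by simp
      show "AE w in M. h w * real_cond_exp M (F t) (\<lambda>w. exp (l * e t w)) w \<le> h w * exp (\<sigma>^2 / 2)"
        using e_subgaussian[OF t, of l] by eventually_elim (auto intro!: mult_left_mono simp: l h0)
    qed
    finally show ?thesis by (simp add: mult.commute)
  qed
  have ie: "integrable M (\<lambda>w. h w * exp (1 * e t w))" "integrable M (\<lambda>w. h w * exp (-1 * e t w))"
    by (rule i[OF exp_integrable[OF t]])+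
  have "(\<integral>w. h w * \<bar>e t w\<bar> ^ 3 \<partial>M) \<le> (\<integral>w. 27 * (h w * exp (1 * e t w) + h w * exp (-1 * e t w)) \<partial>M)"
  proof (rule integral_mono)
    show "integrable M (\<lambda>w. h w * \<bar>e t w\<bar> ^ 3)" by (rule i[OF i3])
    show "integrable M (\<lambda>w. 27 * (h w * exp (1 * e t w) + h w * exp (-1 * e t w)))" using ie by auto
    show "h w * \<bar>e t w\<bar> ^ 3 \<le> 27 * (h w * exp (1 * e t w) + h w * exp (-1 * e t w))" for w
      using mult_left_mono[OF abs_power3_le_exp[of "e t w"] h0[of w]] by (simp add: algebra_simps)
  qed
  also have "\<dots> = 27 * ((\<integral>w. h w * exp (1 * e t w) \<partial>M) + (\<integral>w. h w * exp (-1 * e t w) \<partial>M))"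
    using ie by (subst integral_mult_right_zero, subst Bochner_Integration.integral_add) auto
  also have "\<dots> \<le> 27 * (exp (\<sigma>^2 / 2) * (\<integral>w. h w \<partial>M) + exp (\<sigma>^2 / 2) * (\<integral>w. h w \<partial>M))"
    using ex[of 1] ex[of "-1"] by (intro mult_left_mono add_mono) auto
  finally show "(\<integral>w. h w * \<bar>e t w\<bar> ^ 3 \<partial>M) \<le> 54 * exp (\<sigma>^2 / 2) * (\<integral>w. h w \<partial>M)" by (simp add: mult_ac)
qed

lemma expectation_predictable_times_complex:
  assumes t: "t \<in> {1..T}" and h: "h \<in> borel_measurable (F t)" "\<And>w. cmod (h w) \<le> c"
  shows "(\<integral>w. h w * complex_of_real (e t w) \<partial>M) = 0"
    and "(\<integral>w. h w * complex_of_real ((e t w)^2 - \<sigma>^2) \<partial>M) = 0"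
proof -
  have hM[measurable]: "h \<in> borel_measurable M" by (rule measurable_F_M[OF t h(1)])
  have eM[measurable]: "e t \<in> borel_measurable M" by (rule e_measurable[OF t])
  have R: "(\<lambda>w. Re (h w)) \<in> borel_measurable (F t)" "\<bar>Re (h w)\<bar> \<le> c" for w
    using h(1) order_trans[OF abs_Re_le_cmod h(2)] by auto
  have I: "(\<lambda>w. Im (h w)) \<in> borel_measurable (F t)" "\<bar>Im (h w)\<bar> \<le> c" for w
    using h(1) order_trans[OF abs_Im_le_cmod h(2)] by auto
  have i1: "integrable M (e t)" using integrable_power(2)[OF t, of 1] by simp
  have i2: "integrable M (\<lambda>w. (e t w)\<^sup>2)" using integrable_power(2)[OF t, of 2] by simp
  have ic: "integrable M (\<lambda>w. h w * complex_of_real (f w))" if "integrable M f" for f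
    by (rule integrable_bounded_times[OF _ hM h(2)]) (use that in auto)
  have ib: "integrable M (\<lambda>w. k w * f w)" if "integrable M f" "k \<in> borel_measurable (F t)" "\<And>w. \<bar>k w\<bar> \<le> c" for f k :: "'w \<Rightarrow> real"
    by (rule integrable_bounded_times[OF that(1) measurable_F_M[OF t that(2)]]) (use that(3) in auto)
  have one: "integrable M k" if "k \<in> borel_measurable (F t)" "\<And>w. \<bar>k w\<bar> \<le> c" for k :: "'w \<Rightarrow> real"
    using ib[of "\<lambda>_. 1" k] that by simp
  show "(\<integral>w. h w * complex_of_real (e t w) \<partial>M) = 0"
  proof (rule complex_eqI)
    show "Re (\<integral>w. h w * complex_of_real (e t w) \<partial>M) = Re 0"
      using expectation_predictable_times(1)[OF t R] by (subst integral_Re[symmetric]) (auto intro!: ic i1)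
    show "Im (\<integral>w. h w * complex_of_real (e t w) \<partial>M) = Im 0"
      using expectation_predictable_times(1)[OF t I] by (subst integral_Im[symmetric]) (auto intro!: ic i1)
  qed
  have sub: "(\<integral>w. k w * ((e t w)^2 - \<sigma>^2) \<partial>M) = 0" if k: "k \<in> borel_measurable (F t)" "\<And>w. \<bar>k w\<bar> \<le> c" for k :: "'w \<Rightarrow> real"
  proof -
    have "(\<integral>w. k w * ((e t w)^2 - \<sigma>^2) \<partial>M) = (\<integral>w. k w * (e t w)^2 - \<sigma>^2 * k w \<partial>M)"
      by (simp add: algebra_simps)
    also have "\<dots> = (\<integral>w. k w * (e t w)^2 \<partial>M) - \<sigma>^2 * (\<integral>w. k w \<partial>M)"
      using ib[OF i2 k] one[OF k] by (subst Bochner_Integration.integral_diff) auto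
    also have "\<dots> = 0" using expectation_predictable_times(2)[OF t k] by simp
    finally show ?thesis .
  qed
  have i2': "integrable M (\<lambda>w. (e t w)\<^sup>2 - \<sigma>^2)" using i2 by simp
  show "(\<integral>w. h w * complex_of_real ((e t w)^2 - \<sigma>^2) \<partial>M) = 0"
  proof (rule complex_eqI)
    show "Re (\<integral>w. h w * complex_of_real ((e t w)^2 - \<sigma>^2) \<partial>M) = Re 0"
      using sub[OF R] by (subst integral_Re[symmetric, OF ic[OF i2']]) simp
    show "Im (\<integral>w. h w * complex_of_real ((e t w)^2 - \<sigma>^2) \<partial>M) = Im 0"
      using sub[OF I] by (subst integral_Im[symmetric, OF ic[OF i2']]) simp
  qed
qed

text \<open>The first summand is the second-order error of the compensator, the second the cubic
  Taylor remainder: 9 is 54 from the third moment over 6 from the Taylor bound, with one exponential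
  from the moment and one from the compensator.\<close>

definition "clt_const = \<sigma> ^ 4 * exp (\<sigma>^2 / 2) + 9 * exp (\<sigma>^2 / 2) * exp (\<sigma>^2 / 2)"

text \<open>The terms proportional to \<open>e t\<close> and to \<open>(e t)^2 - \<sigma>^2\<close>
  have coefficients known before the round, so their sum \<open>lin\<close> has expectation zero.
  What remains is the error of the compensator and a cubic remainder; each carries a factor
  \<open>(x w)^2\<close> and one more factor bounded by \<open>\<eta>\<close>.\<close>

lemma characteristic_step:
  assumes t: "t \<in> {1..T}" and h: "h \<in> borel_measurable (F t)" "\<And>w. cmod (h w) \<le> c"
    and x: "x \<in> borel_measurable (F t)" "\<And>w. \<bar>x w\<bar> \<le> \<eta>" and \<eta>: "\<eta> \<le> 1"
  shows "cmod (\<integral>w. h w * (exp (\<i> * complex_of_real (x w * e t w) + complex_of_real (\<sigma>^2 / 2 * (x w)^2)) - 1) \<partial>M)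
    \<le> c * clt_const * \<eta> * (\<integral>w. (x w)\<^sup>2 \<partial>M)"
proof -
  have hM[measurable]: "h \<in> borel_measurable M" by (rule measurable_F_M[OF t h(1)])
  have xM[measurable]: "x \<in> borel_measurable M" by (rule measurable_F_M[OF t x(1)])
  have eM[measurable]: "e t \<in> borel_measurable M" by (rule e_measurable[OF t])
  have \<eta>0: "0 \<le> \<eta>" using order_trans[OF abs_ge_zero x(2)[of undefined]] .
  have c0: "0 \<le> c" using order_trans[OF norm_ge_zero h(2)[of undefined]] .
  have x1: "\<bar>x w\<bar> \<le> 1" for w using x(2)[of w] \<eta> by linarith
  have x21: "(x w)^2 \<le> 1" for w using x1[of w] by (simp add: abs_square_le_1)
  define q where "q w = \<sigma>^2 / 2 * (x w)^2" for w
  have q: "0 \<le> q w" "q w \<le> \<sigma>^2 / 2" for w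
    using mult_left_mono[OF x21, of "\<sigma>^2 / 2" w] by (simp_all add: q_def)
  define A where "A w = exp (q w)" for w
  have A: "0 < A w" "A w \<le> exp (\<sigma>^2 / 2)" for w using q by (simp_all add: A_def)
  have AM[measurable]: "A \<in> borel_measurable (F t)" unfolding A_def q_def using x(1) by measurable
  define W where "W w = h w * (exp (\<i> * complex_of_real (x w * e t w) + complex_of_real (q w)) - 1)" for w
  define l1 where "l1 w = h w * \<i> * complex_of_real (A w * x w)" for w
  define l2 where "l2 w = - (h w * complex_of_real (A w * (x w)^2 / 2))" for w
  have l1: "l1 \<in> borel_measurable (F t)" "cmod (l1 w) \<le> c * exp (\<sigma>^2 / 2)" for w
  proof -
    show "l1 \<in> borel_measurable (F t)" unfolding l1_def using h(1) x(1) AM by measurable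
    have e: "cmod (l1 w) = cmod (h w) * (A w * \<bar>x w\<bar>)" using A(1)[of w] by (simp add: l1_def norm_mult)
    have m: "A w * \<bar>x w\<bar> \<le> exp (\<sigma>^2 / 2) * 1" using A[of w] x1 by (intro mult_mono) auto
    show "cmod (l1 w) \<le> c * exp (\<sigma>^2 / 2)"
      unfolding e by (intro mult_mono h(2) c0) (use A(1)[of w] m in auto)
  qed
  have l2: "l2 \<in> borel_measurable (F t)" "cmod (l2 w) \<le> c * exp (\<sigma>^2 / 2)" for w
  proof -
    show "l2 \<in> borel_measurable (F t)" unfolding l2_def using h(1) x(1) AM by measurable
    have e: "cmod (l2 w) = cmod (h w) * (A w * ((x w)^2 / 2))" using A(1)[of w] by (simp add: l2_def norm_mult norm_divide norm_power)
    have m: "A w * ((x w)^2 / 2) \<le> exp (\<sigma>^2 / 2) * 1" using A[of w] x21[of w] by (intro mult_mono) auto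
    show "cmod (l2 w) \<le> c * exp (\<sigma>^2 / 2)"
      unfolding e by (intro mult_mono h(2) c0) (use A(1)[of w] m in auto)
  qed
  have i1: "integrable M (e t)" using integrable_power(2)[OF t, of 1] by simp
  have i2: "integrable M (\<lambda>w. (e t w)\<^sup>2)" using integrable_power(2)[OF t, of 2] by simp
  have i3: "integrable M (\<lambda>w. \<bar>e t w\<bar> ^ 3)" using integrable_power(1)[OF t, of 3] by simp
  define lin where "lin w = l1 w * complex_of_real (e t w) + l2 w * complex_of_real ((e t w)^2 - \<sigma>^2)" for w
  have j1: "integrable M (\<lambda>w. l1 w * complex_of_real (e t w))"
    by (rule integrable_bounded_times[OF _ measurable_F_M[OF t l1(1)] l1(2)]) (use i1 in auto)
  have j2: "integrable M (\<lambda>w. l2 w * complex_of_real ((e t w)^2 - \<sigma>^2))"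
  proof (rule integrable_bounded_times[OF _ measurable_F_M[OF t l2(1)] l2(2)])
    have "integrable M (\<lambda>w. (e t w)\<^sup>2 - \<sigma>^2)" using i2 by simp
    then show "integrable M (\<lambda>w. complex_of_real ((e t w)^2 - \<sigma>^2))" by (simp only: complex_of_real_integrable_eq)
  qed
  have jl: "integrable M lin" unfolding lin_def using j1 j2 by (rule Bochner_Integration.integrable_add)
  have lin0: "(\<integral>w. lin w \<partial>M) = 0"
    unfolding lin_def using expectation_predictable_times_complex(1)[OF t l1] expectation_predictable_times_complex(2)[OF t l2]
    by (subst Bochner_Integration.integral_add[OF j1 j2]) simp
  have cW: "cmod (W w) \<le> c * (exp (\<sigma>^2 / 2) + 1)" for w
  proof -
    have "cmod (exp (\<i> * complex_of_real (x w * e t w) + complex_of_real (q w)) - 1) \<le> exp (q w) + 1"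
      by (rule order_trans[OF norm_triangle_ineq4]) (simp add: norm_exp_eq_Re)
    also have "\<dots> \<le> exp (\<sigma>^2 / 2) + 1" using q by simp
    finally show ?thesis unfolding W_def norm_mult using h(2) c0 by (intro mult_mono) auto
  qed
  have WM[measurable]: "W \<in> borel_measurable M" unfolding W_def q_def by measurable
  have jW: "integrable M W" by (rule integrable_const_bound[of _ "c * (exp (\<sigma>^2 / 2) + 1)"]) (use cW in auto)
  define D where "D w = c * \<eta> * (\<sigma> ^ 4 * exp (\<sigma>^2 / 2) * (x w)^2 + exp (\<sigma>^2 / 2) / 6 * ((x w)^2 * \<bar>e t w\<bar> ^ 3))" for w
  have DW: "cmod (W w - lin w) \<le> D w" for w
  proof -
    define y where "y = x w * e t w"
    define rr where "rr = iexp y - (1 + \<i> * complex_of_real y - (complex_of_real y)^2 / 2)"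
    have rr: "cmod rr \<le> \<eta> * ((x w)^2 * \<bar>e t w\<bar> ^ 3) / 6"
    proof -
      have "cmod rr \<le> \<bar>y\<bar> ^ 3 / 6" unfolding rr_def by (rule iexp_second_order)
      also have "\<bar>y\<bar> ^ 3 = \<bar>x w\<bar> * ((x w)^2 * \<bar>e t w\<bar> ^ 3)"
        using power_Suc[of "\<bar>x w\<bar>" 2] by (simp add: y_def abs_mult power_mult_distrib)
      also have "\<dots> \<le> \<eta> * ((x w)^2 * \<bar>e t w\<bar> ^ 3)" using x(2) by (intro mult_right_mono) auto
      finally show ?thesis by simp
    qed
    have ex: "exp (\<i> * complex_of_real y + complex_of_real (q w)) = complex_of_real (A w) * (rr + (1 + \<i> * complex_of_real y - (complex_of_real y)^2 / 2))"
      by (simp add: rr_def A_def exp_add exp_of_real)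
    have "W w - lin w = h w * (complex_of_real (A w - 1 - A w * q w) + complex_of_real (A w) * rr)"
      unfolding W_def y_def[symmetric] ex lin_def l1_def l2_def
      by (simp add: q_def y_def field_simps power2_eq_square)
    then have "cmod (W w - lin w) = cmod (h w) * cmod (complex_of_real (A w - 1 - A w * q w) + complex_of_real (A w) * rr)"
      by (simp only: norm_mult)
    also have "\<dots> \<le> c * (exp (\<sigma>^2 / 2) * (\<sigma> ^ 4 * (\<eta> * (x w)^2)) + exp (\<sigma>^2 / 2) * (\<eta> * ((x w)^2 * \<bar>e t w\<bar> ^ 3) / 6))"
    proof (intro mult_mono h(2) c0 norm_triangle_mono norm_ge_zero)
      have "cmod (complex_of_real (A w - 1 - A w * q w)) = \<bar>exp (q w) - 1 - exp (q w) * q w\<bar>" by (simp only: norm_of_real A_def)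
      also have "\<dots> \<le> exp (q w) * (q w)^2" by (rule exp_times_one_minus_bound[OF q(1)])
      also have "\<dots> \<le> exp (\<sigma>^2 / 2) * (\<sigma> ^ 4 * (\<eta> * (x w)^2))"
      proof (intro mult_mono)
        have "(x w)^2 * (x w)^2 \<le> \<eta> * (x w)^2"
        proof (rule mult_right_mono)
          have "\<bar>x w\<bar> * \<bar>x w\<bar> \<le> \<eta> * 1" using x(2) x1 \<eta>0 by (intro mult_mono) auto
          then show "(x w)^2 \<le> \<eta>" by (simp add: power2_eq_square)
        qed simp
        then have "\<sigma> ^ 4 * ((x w)^2 * (x w)^2) \<le> \<sigma> ^ 4 * (\<eta> * (x w)^2)" by (intro mult_left_mono) auto
        moreover have "0 \<le> \<sigma> ^ 4 * ((x w)^2 * (x w)^2)" by simp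
        moreover have "(q w)^2 = \<sigma> ^ 4 * ((x w)^2 * (x w)^2) / 4" by (simp add: q_def power2_eq_square power4_eq_xxxx)
        ultimately show "(q w)^2 \<le> \<sigma> ^ 4 * (\<eta> * (x w)^2)" by linarith
      qed (use q in auto)
      finally show "cmod (complex_of_real (A w - 1 - A w * q w)) \<le> exp (\<sigma>^2 / 2) * (\<sigma> ^ 4 * (\<eta> * (x w)^2))" .
      show "cmod (complex_of_real (A w) * rr) \<le> exp (\<sigma>^2 / 2) * (\<eta> * ((x w)^2 * \<bar>e t w\<bar> ^ 3) / 6)"
        unfolding norm_mult using A[of w] rr by (intro mult_mono) auto
    qed
    also have "\<dots> = D w" by (simp add: D_def algebra_simps)
    finally show ?thesis .
  qed
  have x2: "(\<lambda>w. (x w)\<^sup>2) \<in> borel_measurable (F t)" "\<bar>(x w)^2\<bar> \<le> 1" for w using x(1) x21 by auto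
  have jx: "integrable M (\<lambda>w. (x w)\<^sup>2)" by (rule integrable_const_bound[of _ 1]) (use x21 in auto)
  have jx3: "integrable M (\<lambda>w. (x w)\<^sup>2 * \<bar>e t w\<bar> ^ 3)" by (rule integrable_bounded_times[OF i3, of _ 1]) (use x21 in auto)
  have jD: "integrable M D" unfolding D_def using jx jx3 by auto
  have "(\<integral>w. W w \<partial>M) = (\<integral>w. W w - lin w \<partial>M)"
    by (subst Bochner_Integration.integral_diff[OF jW jl]) (simp add: lin0)
  also have "cmod \<dots> \<le> (\<integral>w. D w \<partial>M)"
    by (rule order_trans[OF integral_norm_bound integral_mono]) (use jW jl jD DW in auto)
  also have "\<dots> = c * \<eta> * (\<sigma> ^ 4 * exp (\<sigma>^2 / 2) * (\<integral>w. (x w)\<^sup>2 \<partial>M) + exp (\<sigma>^2 / 2) / 6 * (\<integral>w. (x w)\<^sup>2 * \<bar>e t w\<bar> ^ 3 \<partial>M))"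
    unfolding D_def using jx jx3 by (subst integral_mult_right_zero, subst Bochner_Integration.integral_add) auto
  also have "\<dots> \<le> c * \<eta> * (\<sigma> ^ 4 * exp (\<sigma>^2 / 2) * (\<integral>w. (x w)\<^sup>2 \<partial>M) + exp (\<sigma>^2 / 2) / 6 * (54 * exp (\<sigma>^2 / 2) * (\<integral>w. (x w)\<^sup>2 \<partial>M)))"
    using expectation_predictable_times(3)[OF t x2] c0 \<eta>0 by (intro mult_left_mono add_left_mono) auto
  also have "\<dots> = c * clt_const * \<eta> * (\<integral>w. (x w)\<^sup>2 \<partial>M)" by (simp add: clt_const_def algebra_simps)
  finally show ?thesis by (simp add: W_def q_def)
qed

lemma clt_const_nonneg: "0 \<le> clt_const" by (simp add: clt_const_def)

text \<open>The factor \<open>exp (\<sigma>^2 / 2 * qvar)\<close> turns the exponential product into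
  nearly a martingale of mean 1. One-step errors add up to a multiple of the expected variation, and
  \<open>R\<close> keeps the compensator bounded.\<close>

lemma characteristic_compensated:
  assumes z: "predictable z" and bd: "\<And>s w. \<bar>z s w\<bar> \<le> \<eta>" and \<eta>: "\<eta> \<le> 1" and R: "\<And>w. qvar z T w \<le> R" and t: "t \<le> T"
  shows "cmod ((\<integral>w. exp (\<i> * complex_of_real (msum z t w) + complex_of_real (\<sigma>^2 / 2 * qvar z t w)) \<partial>M) - 1)
    \<le> exp (\<sigma>^2 / 2 * R) * clt_const * \<eta> * (\<integral>w. qvar z t w \<partial>M)"
  using t
proof (induction t)
  case 0
  then show ?case by (simp add: msum_def qvar_def prob_space)
next
  case (Suc t)
  then have St: "Suc t \<in> {1..T}" by simp
  let ?Y = "\<lambda>t w. exp (\<i> * complex_of_real (msum z t w) + complex_of_real (\<sigma>^2 / 2 * qvar z t w))"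
  have qR: "qvar z s w \<le> R" if "s \<le> T" for s w
  proof -
    have "qvar z s w \<le> qvar z T w" unfolding qvar_def using that by (intro sum_mono2) auto
    then show ?thesis using R[of w] by simp
  qed
  have YM: "?Y s \<in> borel_measurable M" if "s \<le> T" for s
    using msum_measurable[OF z that] qvar_measurable[OF z that] by measurable
  have Yb: "cmod (?Y s w) \<le> exp (\<sigma>^2 / 2 * R)" if "s \<le> T" for s w
    using mult_left_mono[OF qR[OF that], of "\<sigma>^2 / 2" w] by (simp add: norm_exp_eq_Re)
  have Yi: "integrable M (?Y s)" if "s \<le> T" for s
    by (rule integrable_const_bound[of _ "exp (\<sigma>^2 / 2 * R)"]) (use Yb[OF that] YM[OF that] in auto)
  have YF: "?Y t \<in> borel_measurable (F (Suc t))"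
  proof -
    have "msum z t \<in> borel_measurable (F (Suc t))"
      using msum_predictable[OF z] St by (simp only: predictable_def) (drule bspec[of _ _ "Suc t"], auto)
    moreover have "qvar z t \<in> borel_measurable (F (Suc t))"
      unfolding qvar_def using St by (intro borel_measurable_sum borel_measurable_power predictableD[OF z]) auto
    ultimately show ?thesis by measurable
  qed
  have zF: "z (Suc t) \<in> borel_measurable (F (Suc t))" by (rule predictableD[OF z St St]) simp
  have iq: "integrable M (qvar z s)" if "s \<le> T" for s
    by (rule integrable_const_bound[of _ R]) (use qR[OF that] qvar_measurable[OF z that] in \<open>auto simp: qvar_def sum_nonneg\<close>)
  have iz: "integrable M (\<lambda>w. (z (Suc t) w)\<^sup>2)"
  proof -
    have "integrable M (\<lambda>w. qvar z (Suc t) w - qvar z t w)" using iq[of t] iq[of "Suc t"] Suc.prems by auto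
    then show ?thesis by (simp add: qvar_def)
  qed
  have "?Y (Suc t) w = ?Y t w + ?Y t w * (exp (\<i> * complex_of_real (z (Suc t) w * e (Suc t) w) + complex_of_real (\<sigma>^2 / 2 * (z (Suc t) w)^2)) - 1)" for w
  proof -
    have "?Y (Suc t) w = ?Y t w * exp (\<i> * complex_of_real (z (Suc t) w * e (Suc t) w) + complex_of_real (\<sigma>^2 / 2 * (z (Suc t) w)^2))"
      unfolding exp_add[symmetric] by (rule arg_cong[of _ _ exp]) (simp add: msum_def qvar_def algebra_simps)
    then show ?thesis by (simp add: algebra_simps)
  qed
  note Yrec = this
  let ?W = "\<lambda>w. ?Y t w * (exp (\<i> * complex_of_real (z (Suc t) w * e (Suc t) w) + complex_of_real (\<sigma>^2 / 2 * (z (Suc t) w)^2)) - 1)"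
  have Wi: "integrable M ?W"
  proof -
    have "integrable M (\<lambda>w. ?Y (Suc t) w - ?Y t w)" using Yi[of t] Yi[of "Suc t"] Suc.prems by auto
    then show ?thesis by (subst (asm) Yrec) simp
  qed
  have eq: "(\<integral>w. ?Y (Suc t) w \<partial>M) - 1 = ((\<integral>w. ?Y t w \<partial>M) - 1) + (\<integral>w. ?W w \<partial>M)"
  proof -
    have "(\<integral>w. ?Y (Suc t) w \<partial>M) = (\<integral>w. ?Y t w + ?W w \<partial>M)" by (rule Bochner_Integration.integral_cong[OF refl Yrec])
    also have "\<dots> = (\<integral>w. ?Y t w \<partial>M) + (\<integral>w. ?W w \<partial>M)"
      by (rule Bochner_Integration.integral_add[OF Yi Wi]) (use Suc.prems in simp)
    finally show ?thesis by simp
  qed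
  have "cmod ((\<integral>w. ?Y (Suc t) w \<partial>M) - 1) \<le> cmod ((\<integral>w. ?Y t w \<partial>M) - 1) + cmod (\<integral>w. ?W w \<partial>M)"
    unfolding eq by (rule norm_triangle_ineq)
  also have "\<dots> \<le> exp (\<sigma>^2 / 2 * R) * clt_const * \<eta> * (\<integral>w. qvar z t w \<partial>M) + exp (\<sigma>^2 / 2 * R) * clt_const * \<eta> * (\<integral>w. (z (Suc t) w)\<^sup>2 \<partial>M)"
  proof (rule add_mono)
    show "cmod ((\<integral>w. ?Y t w \<partial>M) - 1) \<le> exp (\<sigma>^2 / 2 * R) * clt_const * \<eta> * (\<integral>w. qvar z t w \<partial>M)"
      by (rule Suc.IH) (use Suc.prems in simp)
    show "cmod (\<integral>w. ?W w \<partial>M) \<le> exp (\<sigma>^2 / 2 * R) * clt_const * \<eta> * (\<integral>w. (z (Suc t) w)\<^sup>2 \<partial>M)"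
      by (rule characteristic_step[OF St YF Yb zF bd \<eta>]) (use Suc.prems in simp)
  qed
  also have "\<dots> = exp (\<sigma>^2 / 2 * R) * clt_const * \<eta> * (\<integral>w. qvar z (Suc t) w \<partial>M)"
  proof -
    have "(\<integral>w. qvar z (Suc t) w \<partial>M) = (\<integral>w. qvar z t w + (z (Suc t) w)^2 \<partial>M)" by (simp add: qvar_def)
    also have "\<dots> = (\<integral>w. qvar z t w \<partial>M) + (\<integral>w. (z (Suc t) w)\<^sup>2 \<partial>M)"
      by (rule Bochner_Integration.integral_add[OF iq iz]) (use Suc.prems in simp)
    finally show ?thesis by (simp only: distrib_left)
  qed
  finally show ?case .
qed

end

context subgaussian_noise
begin

text \<open>The variation is close to \<open>L * b^2\<close> only outside an exceptional event,
  whereas the compensated bound needs it bounded everywhere. So the transform is switched off once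
  its variation exceeds twice that value: this is a predictable rule, and it changes nothing outside
  the event.\<close>

lemma characteristic_limit:
  assumes v: "predictable v" and bd: "\<And>s w. \<bar>v s w\<bar> \<le> b" and L: "L > 0" "b \<le> sqrt L" and \<epsilon>: "0 \<le> \<epsilon>" "\<epsilon> \<le> 1"
  shows "cmod ((\<integral>w. iexp (msum v T w / sqrt L) \<partial>M) - exp (- (\<sigma>^2 * b^2) / 2))
    \<le> 2 * b^2 * exp (\<sigma>^2 * b^2) * clt_const * (b / sqrt L) + \<sigma>^2 * b^2 * exp (\<sigma>^2 * b^2) * \<epsilon>
      + (2 + exp (\<sigma>^2 * b^2)) * prob {w \<in> space M. \<epsilon> * L * b^2 < \<bar>qvar v T w - L * b^2\<bar>}"
proof -
  have b0: "0 \<le> b" using order_trans[OF abs_ge_zero bd[of 0 undefined]] .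
  define z where "z s w = (if qvar v s w \<le> 2 * L * b^2 then v s w / sqrt L else 0)" for s w
  have z: "predictable z"
    unfolding predictable_def
  proof
    fix t assume t: "t \<in> {1..T}"
    have [measurable]: "v t \<in> borel_measurable (F t)" "qvar v t \<in> borel_measurable (F t)"
      using v qvar_predictable[OF v] t by (auto simp: predictable_def)
    show "z t \<in> borel_measurable (F t)" unfolding z_def by measurable
  qed
  have zb: "\<bar>z s w\<bar> \<le> b / sqrt L" for s w
    using divide_right_mono[OF bd[of s w], of "sqrt L"] L b0 by (simp add: z_def)
  have b1: "b / sqrt L \<le> 1" using L by simp
  have qmono: "qvar v s w \<le> qvar v t w" if "s \<le> t" for s t w
    unfolding qvar_def using that by (intro sum_mono2) auto
  have qz: "qvar z t w \<le> 2 * b^2 \<and> (qvar v t w \<le> 2 * L * b^2 \<longrightarrow> qvar z t w = qvar v t w / L \<and> msum z t w = msum v t w / sqrt L)" for t w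
  proof -
    have eq: "qvar z s w = qvar v s w / L \<and> msum z s w = msum v s w / sqrt L" if s: "qvar v s w \<le> 2 * L * b^2" for s
    proof -
      have "z r w = v r w / sqrt L" if "r \<in> {1..s}" for r
        using qmono[of r s w] that s by (simp add: z_def)
      then show ?thesis using L
        by (simp add: qvar_def msum_def power_divide sum_divide_distrib)
    qed
    have "qvar z t w \<le> 2 * b^2"
    proof (induction t)
      case 0 then show ?case by (simp add: qvar_def)
    next
      case (Suc t)
      show ?case
      proof (cases "qvar v (Suc t) w \<le> 2 * L * b^2")
        case True
        then show ?thesis using eq[OF True] L by (simp add: pos_divide_le_eq mult_ac)
      next
        case False
        then have "qvar z (Suc t) w = qvar z t w" by (simp add: qvar_def z_def)
        then show ?thesis using Suc by simp
      qed
    qed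
    then show ?thesis using eq by blast
  qed
  define Q where "Q = qvar z T"
  define m where "m = msum z T"
  have Q: "0 \<le> Q w" "Q w \<le> 2 * b^2" for w using qz[of T w] by (auto simp: Q_def qvar_def sum_nonneg)
  have mM[measurable]: "m \<in> borel_measurable M" "Q \<in> borel_measurable M" "msum v T \<in> borel_measurable M" "qvar v T \<in> borel_measurable M"
    unfolding m_def Q_def using msum_measurable qvar_measurable z v by auto
  define E where "E = {w \<in> space M. \<epsilon> * L * b^2 < \<bar>qvar v T w - L * b^2\<bar>}"
  have EM[measurable]: "E \<in> sets M" unfolding E_def by measurable
  have off: "Q w = qvar v T w / L" "m w = msum v T w / sqrt L" "\<bar>Q w - b^2\<bar> \<le> \<epsilon> * b^2" if "w \<in> space M" "w \<notin> E" for w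
  proof -
    have d: "\<bar>qvar v T w - L * b^2\<bar> \<le> \<epsilon> * L * b^2" using that unfolding E_def by auto
    have "\<epsilon> * L * b^2 \<le> 1 * L * b^2" using \<epsilon> L by (intro mult_right_mono) auto
    then have "qvar v T w \<le> 2 * L * b^2" using d by linarith
    then show 1: "Q w = qvar v T w / L" "m w = msum v T w / sqrt L" using qz[of T w] by (auto simp: Q_def m_def)
    have "Q w - b^2 = (qvar v T w - L * b^2) / L" using L by (simp add: 1 field_simps)
    then have "\<bar>Q w - b^2\<bar> = \<bar>qvar v T w - L * b^2\<bar> / L" using L by simp
    also have "\<dots> \<le> \<epsilon> * L * b^2 / L" using d L by (intro divide_right_mono) auto
    finally show "\<bar>Q w - b^2\<bar> \<le> \<epsilon> * b^2" using L by simp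
  qed
  define K where "K = exp (\<sigma>^2 * b^2)"
  have K: "K \<ge> 1" by (simp add: K_def)
  \<comment> \<open>The compensator at the limiting variation; \<open>1 / g\<close> is the Gaussian
    value that is sought.\<close>
  define g where "g = exp (\<sigma>^2 / 2 * b^2)"
  have g: "1 \<le> g" "g \<le> K" by (simp_all add: g_def K_def)
  define Y where "Y w = exp (\<i> * complex_of_real (m w) + complex_of_real (\<sigma>^2 / 2 * Q w))" for w
  have Yeq: "Y w = iexp (m w) * complex_of_real (exp (\<sigma>^2 / 2 * Q w))" for w by (simp only: Y_def exp_add exp_of_real)
  have eQ: "exp (\<sigma>^2 / 2 * Q w) \<le> K" for w
    using mult_left_mono[OF Q(2)[of w], of "\<sigma>^2 / 2"] by (simp add: K_def)
  have YM[measurable]: "Y \<in> borel_measurable M" unfolding Y_def by measurable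
  have iY: "integrable M Y"
    by (rule integrable_const_bound[of _ K]) (use eQ in \<open>auto simp: Yeq norm_mult\<close>)
  have im: "integrable M (\<lambda>w. iexp (m w))" by (rule integrable_const_bound[of _ 1]) auto
  have iv: "integrable M (\<lambda>w. iexp (msum v T w / sqrt L))" by (rule integrable_const_bound[of _ 1]) auto
  have iE: "integrable M (\<lambda>w. indicator E w :: real)" by (rule integrable_const_bound[of _ 1]) auto
  have 1: "cmod ((\<integral>w. Y w \<partial>M) - 1) \<le> 2 * b^2 * K * clt_const * (b / sqrt L)"
  proof -
    have "cmod ((\<integral>w. Y w \<partial>M) - 1) \<le> exp (\<sigma>^2 / 2 * (2 * b^2)) * clt_const * (b / sqrt L) * (\<integral>w. Q w \<partial>M)"
      unfolding Y_def m_def Q_def by (rule characteristic_compensated[OF z zb b1]) (use qz in auto)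
    also have "\<dots> \<le> exp (\<sigma>^2 / 2 * (2 * b^2)) * clt_const * (b / sqrt L) * (2 * b^2)"
    proof (rule mult_left_mono)
      have "integrable M Q" by (rule integrable_const_bound[of _ "2 * b^2"]) (use Q in auto)
      then have "(\<integral>w. Q w \<partial>M) \<le> (\<integral>w. 2 * b^2 \<partial>M)" by (rule integral_mono) (use Q in auto)
      then show "(\<integral>w. Q w \<partial>M) \<le> 2 * b^2" by (simp add: prob_space)
      show "0 \<le> exp (\<sigma>^2 / 2 * (2 * b^2)) * clt_const * (b / sqrt L)"
        using clt_const_nonneg b0 L by (intro mult_nonneg_nonneg divide_nonneg_pos) auto
    qed
    also have "exp (\<sigma>^2 / 2 * (2 * b^2)) = K" by (simp add: K_def)
    finally show ?thesis by (simp only: mult_ac)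
  qed
  have 2: "cmod (complex_of_real g * (\<integral>w. iexp (m w) \<partial>M) - (\<integral>w. Y w \<partial>M)) \<le> \<sigma>^2 * b^2 * K * \<epsilon> + K * prob E"
  proof -
    have "complex_of_real g * (\<integral>w. iexp (m w) \<partial>M) - (\<integral>w. Y w \<partial>M) = (\<integral>w. complex_of_real g * iexp (m w) - Y w \<partial>M)"
      using im iY by (subst Bochner_Integration.integral_diff) auto
    also have "cmod \<dots> \<le> (\<integral>w. \<sigma>\<^sup>2 * b^2 * K * \<epsilon> + K * indicator E w \<partial>M)"
    proof (rule order_trans[OF integral_norm_bound integral_mono])
      show "integrable M (\<lambda>w. cmod (complex_of_real g * iexp (m w) - Y w))" using im iY by auto
      show "integrable M (\<lambda>w. \<sigma>\<^sup>2 * b^2 * K * \<epsilon> + K * indicator E w)" using iE by auto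
      fix w assume w: "w \<in> space M"
      have "complex_of_real g * iexp (m w) - Y w = iexp (m w) * complex_of_real (g - exp (\<sigma>^2 / 2 * Q w))"
        by (simp add: Yeq algebra_simps)
      then have e: "cmod (complex_of_real g * iexp (m w) - Y w) = \<bar>g - exp (\<sigma>^2 / 2 * Q w)\<bar>" by (simp only: norm_mult norm_of_real) simp
      show "cmod (complex_of_real g * iexp (m w) - Y w) \<le> \<sigma>^2 * b^2 * K * \<epsilon> + K * indicator E w"
      proof (cases "w \<in> E")
        case True
        have "0 < exp (\<sigma>^2 / 2 * Q w)" by simp
        then have "\<bar>g - exp (\<sigma>^2 / 2 * Q w)\<bar> \<le> K" using g eQ[of w] by linarith
        moreover have "0 \<le> \<sigma>^2 * b^2 * K * \<epsilon>" using \<epsilon> K by simp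
        ultimately show ?thesis using True unfolding e by simp
      next
        case False
        have "\<bar>g - exp (\<sigma>^2 / 2 * Q w)\<bar> \<le> exp (\<sigma>^2 * b^2) * \<bar>\<sigma>^2 / 2 * b^2 - \<sigma>^2 / 2 * Q w\<bar>"
          unfolding g_def by (rule exp_diff_le) (use mult_left_mono[OF Q(2)[of w], of "\<sigma>^2 / 2"] in simp_all)
        also have "\<bar>\<sigma>^2 / 2 * b^2 - \<sigma>^2 / 2 * Q w\<bar> = \<sigma>^2 / 2 * \<bar>Q w - b^2\<bar>"
          unfolding right_diff_distrib[symmetric] abs_mult by (simp add: abs_minus_commute)
        also have "\<dots> \<le> \<sigma>^2 * (\<epsilon> * b^2)" using off(3)[OF w False] \<epsilon> by (intro mult_mono) auto
        finally have "\<bar>g - exp (\<sigma>^2 / 2 * Q w)\<bar> \<le> K * (\<sigma>^2 * (\<epsilon> * b^2))" by (simp add: K_def)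
        then show ?thesis unfolding e using False by (simp add: mult_ac)
      qed
    qed
    also have "\<dots> = \<sigma>^2 * b^2 * K * \<epsilon> + K * prob E"
      using iE by (subst Bochner_Integration.integral_add) (auto simp: prob_space)
    finally show ?thesis .
  qed
  have 3: "cmod ((\<integral>w. iexp (msum v T w / sqrt L) \<partial>M) - (\<integral>w. iexp (m w) \<partial>M)) \<le> 2 * prob E"
  proof -
    have "(\<integral>w. iexp (msum v T w / sqrt L) \<partial>M) - (\<integral>w. iexp (m w) \<partial>M) = (\<integral>w. iexp (msum v T w / sqrt L) - iexp (m w) \<partial>M)"
      using im iv by (subst Bochner_Integration.integral_diff) auto
    also have "cmod \<dots> \<le> (\<integral>w. 2 * indicator E w \<partial>M)"
    proof (rule order_trans[OF integral_norm_bound integral_mono])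
      show "integrable M (\<lambda>w. cmod (iexp (msum v T w / sqrt L) - iexp (m w)))" using im iv by auto
      show "integrable M (\<lambda>w. 2 * indicator E w :: real)" using iE by auto
      fix w assume w: "w \<in> space M"
      show "cmod (iexp (msum v T w / sqrt L) - iexp (m w)) \<le> 2 * indicator E w"
      proof (cases "w \<in> E")
        case True
        have "cmod (iexp (msum v T w / sqrt L) - iexp (m w)) \<le> 1 + 1"
          by (rule order_trans[OF norm_triangle_ineq4]) simp
        then show ?thesis using True by simp
      next
        case False
        then show ?thesis using off(2)[OF w False] by simp
      qed
    qed
    also have "\<dots> = 2 * prob E" by simp
    finally show ?thesis .
  qed
  have 4: "cmod ((\<integral>w. iexp (m w) \<partial>M) - complex_of_real (1 / g)) \<le> 2 * b^2 * K * clt_const * (b / sqrt L) + (\<sigma>^2 * b^2 * K * \<epsilon> + K * prob E)"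
  proof -
    let ?\<phi> = "\<integral>w. iexp (m w) \<partial>M"
    have "?\<phi> - complex_of_real (1 / g) = complex_of_real (1 / g) * (complex_of_real g * ?\<phi> - 1)"
      using g(1) by (simp add: field_simps)
    then have "cmod (?\<phi> - complex_of_real (1 / g)) = 1 / g * cmod (complex_of_real g * ?\<phi> - 1)"
      using g(1) by (simp only: norm_mult norm_of_real) simp
    also have "\<dots> \<le> 1 * cmod (complex_of_real g * ?\<phi> - 1)" using g(1) by (intro mult_right_mono) auto
    also have "complex_of_real g * ?\<phi> - 1 = (complex_of_real g * ?\<phi> - (\<integral>w. Y w \<partial>M)) + ((\<integral>w. Y w \<partial>M) - 1)" by simp
    also have "1 * cmod \<dots> \<le> cmod (complex_of_real g * ?\<phi> - (\<integral>w. Y w \<partial>M)) + cmod ((\<integral>w. Y w \<partial>M) - 1)"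
      using norm_triangle_ineq by (simp only: mult_1_left)
    finally show ?thesis using 1 2 by linarith
  qed
  have e: "complex_of_real (exp (- (\<sigma>^2 * b^2) / 2)) = complex_of_real (1 / g)"
    by (simp add: g_def exp_minus inverse_eq_divide)
  have "cmod ((\<integral>w. iexp (msum v T w / sqrt L) \<partial>M) - complex_of_real (1 / g))
    \<le> cmod ((\<integral>w. iexp (msum v T w / sqrt L) \<partial>M) - (\<integral>w. iexp (m w) \<partial>M)) + cmod ((\<integral>w. iexp (m w) \<partial>M) - complex_of_real (1 / g))"
    using norm_triangle_ineq[of "(\<integral>w. iexp (msum v T w / sqrt L) \<partial>M) - (\<integral>w. iexp (m w) \<partial>M)" "(\<integral>w. iexp (m w) \<partial>M) - complex_of_real (1 / g)"] by simp
  also have "\<dots> \<le> 2 * prob E + (2 * b^2 * K * clt_const * (b / sqrt L) + (\<sigma>^2 * b^2 * K * \<epsilon> + K * prob E))"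
    using 3 4 by (rule add_mono)
  also have "\<dots> = 2 * b^2 * K * clt_const * (b / sqrt L) + \<sigma>^2 * b^2 * K * \<epsilon> + (2 + K) * prob E"
    by (simp only: distrib_right add_ac)
  finally show ?thesis unfolding e E_def[symmetric] K_def .
qed

end

section \<open>Weak convergence from characteristic functions\<close>

text \<open>Written as a product over coordinates so that integrals against plane waves factorise;
  \<open>gaussian_eq\<close> recovers the radial form.\<close>

definition gaussian :: "real \<Rightarrow> 'a::euclidean_space \<Rightarrow> real" where
  "gaussian h x = (\<Prod>b\<in>Basis. normal_density 0 h (x \<bullet> b))"

lemma gaussian_measurable [measurable]: "gaussian h \<in> borel_measurable borel"
  unfolding gaussian_def by measurable

lemma gaussian_nonneg: "0 \<le> gaussian h x"
  unfolding gaussian_def by (intro prod_nonneg) simp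

lemma gaussian_eq:
  assumes "h > 0"
  shows "gaussian h (x :: 'a::euclidean_space) = (1 / sqrt (2 * pi * h^2)) ^ DIM('a) * exp (- (norm x)\<^sup>2 / (2 * h^2))"
proof -
  have "(norm x)^2 = (\<Sum>b\<in>Basis. (x \<bullet> b)\<^sup>2)"
    unfolding power2_norm_eq_inner by (subst euclidean_inner) (simp add: power2_eq_square)
  then have "exp (- (norm x)\<^sup>2 / (2 * h^2)) = (\<Prod>b\<in>Basis. exp (- (x \<bullet> b)\<^sup>2 / (2 * h^2)))"
    by (simp add: exp_sum[symmetric] sum_divide_distrib sum_negf)
  then show ?thesis by (simp add: gaussian_def normal_density_def prod_dividef power_one_over)
qed

lemma gaussian_le: "h > 0 ==> gaussian h (x :: 'a::euclidean_space) \<le> (1 / sqrt (2 * pi * h^2)) ^ DIM('a)"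
  unfolding gaussian_eq by (rule mult_left_le) auto

lemma gaussian_minus_commute: "h > 0 ==> gaussian h (x - y) = gaussian h (y - x)"
  by (simp add: gaussian_eq norm_minus_commute)

lemma normal_density_char:
  assumes h: "h > 0"
  shows "(\<integral>x. complex_of_real (normal_density 0 h x) * iexp (t * x) \<partial>lborel) = complex_of_real (exp (- (h^2 * t^2) / 2))"
proof -
  have "complex_of_real (exp (- ((h * t)^2) / 2)) = char std_normal_distribution (h * t)"
    by (simp add: char_std_normal_distribution)
  also have "\<dots> = (\<integral>x. std_normal_density x *\<^sub>R iexp (h * t * x) \<partial>lborel)"
    unfolding char_def by (subst integral_density) auto
  also have "\<dots> = \<bar>1 / h\<bar> *\<^sub>R (\<integral>x. std_normal_density (0 + 1 / h * x) *\<^sub>R iexp (h * t * (0 + 1 / h * x)) \<partial>lborel)"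
    by (rule lborel_integral_real_affine) (use h in simp)
  also have "\<dots> = (\<integral>x. \<bar>1 / h\<bar> *\<^sub>R (std_normal_density (0 + 1 / h * x) *\<^sub>R iexp (h * t * (0 + 1 / h * x))) \<partial>lborel)"
    by (rule integral_scaleR_right[symmetric])
  also have "\<dots> = (\<integral>x. complex_of_real (normal_density 0 h x) * iexp (t * x) \<partial>lborel)"
  proof (rule Bochner_Integration.integral_cong[OF refl])
    fix x
    have "\<bar>1 / h\<bar> * std_normal_density (0 + 1 / h * x) = normal_density 0 h x"
      using h by (simp add: normal_density_def real_sqrt_mult power_divide field_simps)
    then show "\<bar>1 / h\<bar> *\<^sub>R (std_normal_density (0 + 1 / h * x) *\<^sub>R iexp (h * t * (0 + 1 / h * x))) = complex_of_real (normal_density 0 h x) * iexp (t * x)"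
      using h by (simp only: scaleR_scaleR) (simp add: scaleR_conv_of_real)
  qed
  finally show ?thesis by (simp add: power_mult_distrib)
qed

lemma gaussian_char:
  assumes h: "h > 0"
  shows "integrable lborel (\<lambda>x :: 'a::euclidean_space. complex_of_real (gaussian h x) * iexp (t \<bullet> x))"
    and "(\<integral>x. complex_of_real (gaussian h x) * iexp (t \<bullet> x) \<partial>lborel) = complex_of_real (exp (- (h^2 * (norm t)^2) / 2))"
proof -
  interpret product_sigma_finite "\<lambda>_::'a. lborel :: real measure" by unfold_locales
  define f where "f b y = complex_of_real (normal_density 0 h y) * iexp ((t \<bullet> b) * y)" for b :: 'a and y :: real
  have f: "integrable lborel (f b)" for b
  proof (rule Bochner_Integration.integrable_bound[OF integrable_normal_density[OF h, of 0]])
    show "f b \<in> borel_measurable lborel" unfolding f_def by measurable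
    show "AE x in lborel. norm (f b x) \<le> norm (normal_density 0 h x)" by (simp add: f_def norm_mult)
  qed
  have split: "complex_of_real (gaussian h x) * iexp (t \<bullet> x) = (\<Prod>b\<in>Basis. f b (x \<bullet> b))" for x
  proof -
    have "iexp (t \<bullet> x) = (\<Prod>b\<in>Basis. iexp ((t \<bullet> b) * (x \<bullet> b)))"
      by (subst exp_sum[symmetric]) (auto simp: sum_distrib_left[symmetric] euclidean_inner[of t x])
    then show ?thesis by (simp add: f_def gaussian_def prod.distrib)
  qed
  have coord: "(\<Sum>b\<in>Basis. g b *\<^sub>R b) \<bullet> b = g b" if "b \<in> Basis" for b and g :: "'a \<Rightarrow> real"
    using that by simp
  have m: "(\<lambda>x. \<Prod>b\<in>Basis. f b (x \<bullet> b)) \<in> borel_measurable borel" unfolding f_def by measurable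
  have ti: "(\<lambda>f. \<Sum>b\<in>Basis. f b *\<^sub>R b) \<in> (\<Pi>\<^sub>M b\<in>Basis. lborel) \<rightarrow>\<^sub>M (borel :: 'a measure)" by measurable
  show "integrable lborel (\<lambda>x. complex_of_real (gaussian h x) * iexp (t \<bullet> x))"
    unfolding split
    by (subst lborel_eq, subst integrable_distr_eq[OF ti m])
       (use product_integrable_prod[OF finite_Basis f] in \<open>simp add: coord cong: prod.cong\<close>)
  have "(\<integral>x. complex_of_real (gaussian h x) * iexp (t \<bullet> x) \<partial>lborel) = (\<integral>g. (\<Prod>b\<in>Basis. f b (g b)) \<partial>(\<Pi>\<^sub>M b\<in>Basis. lborel))"
    unfolding split
    by (subst lborel_eq, subst integral_distr[OF ti m]) (simp add: coord cong: prod.cong)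
  also have "\<dots> = (\<Prod>b\<in>Basis. \<integral>y. f b y \<partial>lborel)" by (rule product_integral_prod[OF finite_Basis f])
  also have "\<dots> = (\<Prod>b\<in>Basis. complex_of_real (exp (- (h^2 * (t \<bullet> b)^2) / 2)))"
    unfolding f_def normal_density_char[OF h] ..
  also have "\<dots> = complex_of_real (exp (\<Sum>b\<in>Basis. - (h^2 * (t \<bullet> b)^2) / 2))" by (simp add: exp_sum)
  also have "(\<Sum>b\<in>Basis. - (h^2 * (t \<bullet> b)^2) / 2) = - (h^2 * (norm t)^2) / 2"
  proof -
    have "(norm t)^2 = (\<Sum>b\<in>Basis. (t \<bullet> b)\<^sup>2)"
      unfolding power2_norm_eq_inner by (subst euclidean_inner) (simp add: power2_eq_square)
    then show ?thesis by (simp add: sum_negf sum_divide_distrib[symmetric] sum_distrib_left[symmetric])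
  qed
  finally show "(\<integral>x. complex_of_real (gaussian h x) * iexp (t \<bullet> x) \<partial>lborel) = complex_of_real (exp (- (h^2 * (norm t)^2) / 2))" .
qed

lemma gaussian_integrable: "h > 0 ==> integrable lborel (gaussian h :: 'a::euclidean_space \<Rightarrow> real)"
  using gaussian_char(1)[of h "0 :: 'a"] by (simp add: complex_of_real_integrable_eq)

lemma gaussian_integral: "h > 0 ==> (\<integral>x. gaussian h x \<partial>(lborel :: 'a::euclidean_space measure)) = 1"
proof -
  assume h: "h > 0"
  have "complex_of_real (\<integral>x. gaussian h x \<partial>(lborel :: 'a measure)) = 1"
    using gaussian_char(2)[OF h, of "0 :: 'a"] by (simp add: integral_complex_of_real)
  then show ?thesis by simp
qed

lemma lborel_translate:
  fixes f :: "'a::euclidean_space \<Rightarrow> 'b::{banach, second_countable_topology}"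
  assumes f: "integrable lborel f"
  shows "integrable lborel (\<lambda>y. f (y - x))" "(\<integral>y. f (y - x) \<partial>lborel) = (\<integral>y. f y \<partial>lborel)"
proof -
  have fm: "f \<in> borel_measurable borel" using f by auto
  have d: "distr lborel borel ((+) (- x)) = lborel" by (rule lborel_distr_plus)
  have "integrable (distr lborel borel ((+) (- x))) f" using f by (simp only: d)
  then show "integrable lborel (\<lambda>y. f (y - x))" by (subst (asm) integrable_distr_eq) (use fm in auto)
  have "(\<integral>y. f y \<partial>lborel) = (\<integral>y. f y \<partial>(distr lborel borel ((+) (- x))))" by (simp only: d)
  also have "\<dots> = (\<integral>y. f (y - x) \<partial>lborel)" by (subst integral_distr) (use fm in auto)
  finally show "(\<integral>y. f (y - x) \<partial>lborel) = (\<integral>y. f y \<partial>lborel)" by simp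
qed

text \<open>\<open>u * exp (- (2 * u)) \<le> exp (- u)\<close> trades the quadratic factor for a
  Gaussian wider by \<open>sqrt 2\<close>, whose integral is known.\<close>

lemma gaussian_second_moment:
  assumes h: "h > 0"
  shows "integrable lborel (\<lambda>x :: 'a::euclidean_space. (norm x)\<^sup>2 * gaussian h x)"
    and "(\<integral>x. (norm (x::'a))\<^sup>2 * gaussian h x \<partial>lborel) \<le> 4 * h^2 * sqrt 2 ^ DIM('a)"
proof -
  define k where "k = sqrt 2 * h"
  have k: "k > 0" "k^2 = 2 * h^2" using h by (simp_all add: k_def power_mult_distrib)
  have le: "(norm x)^2 * gaussian h x \<le> 4 * h^2 * sqrt 2 ^ DIM('a) * gaussian k x" for x :: 'a
  proof -
    define u where "u = (norm x)^2 / (4 * h^2)"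
    have n: "(norm x)^2 = 4 * h^2 * u" using h by (simp add: u_def)
    have "u * exp (- (2 * u)) \<le> exp u * exp (- (2 * u))"
    proof (rule mult_right_mono)
      show "u \<le> exp u" using exp_ge_add_one_self[of u] by linarith
    qed simp
    also have "\<dots> = exp (- u)" by (simp flip: exp_add)
    finally have ue: "u * exp (- (2 * u)) \<le> exp (- u)" .
    define c where "c = (1 / sqrt (2 * pi * h^2)) ^ DIM('a)"
    have c: "c \<ge> 0" by (simp add: c_def)
    have "gaussian h x = c * exp (- (2 * u))"
      unfolding gaussian_eq[OF h] c_def n using h by (simp add: field_simps)
    moreover have "sqrt 2 ^ DIM('a) * gaussian k x = c * exp (- u)"
    proof -
      have "sqrt (2 * pi * k^2) = sqrt 2 * sqrt (2 * pi * h^2)" unfolding k(2) by (simp add: real_sqrt_mult)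
      then have "sqrt 2 ^ DIM('a) * (1 / sqrt (2 * pi * k^2)) ^ DIM('a) = c"
        unfolding c_def power_mult_distrib[symmetric] by simp
      moreover have "- (norm x)\<^sup>2 / (2 * k^2) = - u" using h by (simp add: u_def k(2))
      ultimately show ?thesis unfolding gaussian_eq[OF k(1)] by (simp only: mult.assoc[symmetric])
    qed
    ultimately have "(norm x)^2 * gaussian h x = (4 * h^2 * c) * (u * exp (- (2 * u)))"
      "4 * h^2 * sqrt 2 ^ DIM('a) * gaussian k x = (4 * h^2 * c) * exp (- u)"
      by (simp_all add: n)
    then show ?thesis using mult_left_mono[OF ue, of "4 * h^2 * c"] c
      by (metis mult_nonneg_nonneg zero_le_numeral zero_le_power2)
  qed
  have i: "integrable lborel (\<lambda>x :: 'a. 4 * h^2 * sqrt 2 ^ DIM('a) * gaussian k x)"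
    using gaussian_integrable[OF k(1), where 'a='a] by simp
  show I: "integrable lborel (\<lambda>x :: 'a. (norm x)\<^sup>2 * gaussian h x)"
  proof (rule Bochner_Integration.integrable_bound[OF i])
    show "AE x in lborel. norm ((norm (x::'a))^2 * gaussian h x) \<le> norm (4 * h^2 * sqrt 2 ^ DIM('a) * gaussian k x)"
      using le by (intro AE_I2) (simp add: abs_mult abs_of_nonneg[OF gaussian_nonneg])
  qed measurable
  have "(\<integral>x. (norm (x::'a))\<^sup>2 * gaussian h x \<partial>lborel) \<le> (\<integral>x. 4 * h^2 * sqrt 2 ^ DIM('a) * gaussian k (x::'a) \<partial>lborel)"
    by (rule integral_mono[OF I i]) (rule le)
  then show "(\<integral>x. (norm (x::'a))\<^sup>2 * gaussian h x \<partial>lborel) \<le> 4 * h^2 * sqrt 2 ^ DIM('a)"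
    by (simp add: gaussian_integral[OF k(1)])
qed

lemma Fubini_dominated:
  fixes F :: "'a::euclidean_space \<Rightarrow> 'a \<Rightarrow> 'b::{banach, second_countable_topology}"
  assumes \<mu>: "prob_space \<mu>" "sets \<mu> = sets borel"
    and F: "(\<lambda>(x, y). F x y) \<in> borel_measurable (borel \<Otimes>\<^sub>M borel)"
    and k: "\<And>x y. norm (F x y) \<le> k y" "integrable lborel k"
  shows "(\<integral>x. (\<integral>y. F x y \<partial>lborel) \<partial>\<mu>) = (\<integral>y. (\<integral>x. F x y \<partial>\<mu>) \<partial>lborel)"
proof -
  interpret prob_space \<mu> by (rule \<mu>(1))
  interpret pair_sigma_finite \<mu> lborel by unfold_locales
  have s: "borel_measurable (\<mu> \<Otimes>\<^sub>M lborel) = borel_measurable (borel \<Otimes>\<^sub>M borel :: ('a \<times> 'a) measure)"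
    by (intro measurable_cong_sets sets_pair_measure_cong \<mu>(2) refl) simp
  have Fm: "(\<lambda>(x, y). F x y) \<in> borel_measurable (\<mu> \<Otimes>\<^sub>M lborel)" unfolding s by (rule F)
  have km: "k \<in> borel_measurable borel" using k(2) by auto
  have km2: "(\<lambda>(x, y). k y) \<in> borel_measurable (\<mu> \<Otimes>\<^sub>M lborel)" unfolding s using km by measurable
  have ik: "integrable (\<mu> \<Otimes>\<^sub>M lborel) (\<lambda>(x, y). k y)"
    by (rule Fubini_integrable[OF km2]) (use k(2) in auto)
  have "integrable (\<mu> \<Otimes>\<^sub>M lborel) (\<lambda>(x, y). F x y)"
  proof (rule Bochner_Integration.integrable_bound[OF ik Fm])
    show "AE z in \<mu> \<Otimes>\<^sub>M lborel. norm (case z of (x, y) \<Rightarrow> F x y) \<le> norm (case z of (x, y) \<Rightarrow> k y)"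
      using order_trans[OF k(1) abs_ge_self] by (intro AE_I2) auto
  qed
  from Fubini_integral[OF this] show ?thesis by simp
qed

text \<open>A Gaussian is up to scaling its own Fourier transform. So the mixture density is the
  characteristic function of \<open>\<mu>\<close> integrated against an integrable weight that is
  independent of \<open>\<mu>\<close>, ready for dominated convergence.\<close>

lemma gaussian_mixture_Fourier:
  fixes \<mu> :: "'a::euclidean_space measure"
  assumes \<mu>: "prob_space \<mu>" "sets \<mu> = sets borel" and h: "h > 0"
  shows "complex_of_real (\<integral>x. gaussian h (x - y) \<partial>\<mu>) = (1 / sqrt (2 * pi * h^2)) ^ DIM('a) *
     (\<integral>t. complex_of_real (gaussian (1 / h) t) * iexp (- (t \<bullet> y)) * (\<integral>x. iexp (t \<bullet> x) \<partial>\<mu>) \<partial>lborel)"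
proof -
  define C where "C = (1 / sqrt (2 * pi * h^2)) ^ DIM('a)"
  have h': "1 / h > 0" using h by simp
  have g: "complex_of_real (gaussian h (x - y)) = C * (\<integral>t. complex_of_real (gaussian (1 / h) t) * iexp (t \<bullet> (x - y)) \<partial>lborel)" for x
  proof -
    have "(\<integral>t. complex_of_real (gaussian (1 / h) t) * iexp (t \<bullet> (x - y)) \<partial>lborel) = complex_of_real (exp (- (norm (x - y))\<^sup>2 / (2 * h^2)))"
      using gaussian_char(2)[OF h', of "x - y"] by (simp add: inner_commute power_divide)
    then show ?thesis by (simp add: gaussian_eq[OF h] C_def)
  qed
  have "complex_of_real (\<integral>x. gaussian h (x - y) \<partial>\<mu>) = (\<integral>x. complex_of_real (gaussian h (x - y)) \<partial>\<mu>)"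
    by (rule integral_complex_of_real[symmetric])
  also have "\<dots> = C * (\<integral>x. (\<integral>t. complex_of_real (gaussian (1 / h) t) * iexp (t \<bullet> (x - y)) \<partial>lborel) \<partial>\<mu>)"
    unfolding g by simp
  also have "(\<integral>x. (\<integral>t. complex_of_real (gaussian (1 / h) t) * iexp (t \<bullet> (x - y)) \<partial>lborel) \<partial>\<mu>)
     = (\<integral>t. (\<integral>x. complex_of_real (gaussian (1 / h) t) * iexp (t \<bullet> (x - y)) \<partial>\<mu>) \<partial>lborel)"
  proof (rule Fubini_dominated[OF \<mu>])
    show "(\<lambda>(x, t). complex_of_real (gaussian (1 / h) t) * iexp (t \<bullet> (x - y))) \<in> borel_measurable (borel \<Otimes>\<^sub>M borel)" by measurable
    show "integrable lborel (gaussian (1 / h) :: 'a \<Rightarrow> real)" by (rule gaussian_integrable[OF h'])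
    show "norm (complex_of_real (gaussian (1 / h) t) * iexp (t \<bullet> (x - y))) \<le> gaussian (1 / h) t" for x t
      using gaussian_nonneg[of "1 / h" t] by (simp add: norm_mult)
  qed
  also have "\<dots> = (\<integral>t. complex_of_real (gaussian (1 / h) t) * iexp (- (t \<bullet> y)) * (\<integral>x. iexp (t \<bullet> x) \<partial>\<mu>) \<partial>lborel)"
  proof (rule Bochner_Integration.integral_cong[OF refl])
    fix t
    have "complex_of_real (gaussian (1 / h) t) * iexp (t \<bullet> (x - y)) = complex_of_real (gaussian (1 / h) t) * iexp (- (t \<bullet> y)) * iexp (t \<bullet> x)" for x
    proof -
      have "iexp (t \<bullet> (x - y)) = iexp (- (t \<bullet> y)) * iexp (t \<bullet> x)"
        unfolding exp_add[symmetric] by (rule arg_cong[of _ _ exp]) (simp add: inner_diff_right algebra_simps)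
      then show ?thesis by (simp only: mult.assoc)
    qed
    then show "(\<integral>x. complex_of_real (gaussian (1 / h) t) * iexp (t \<bullet> (x - y)) \<partial>\<mu>) = complex_of_real (gaussian (1 / h) t) * iexp (- (t \<bullet> y)) * (\<integral>x. iexp (t \<bullet> x) \<partial>\<mu>)"
      by (simp only: integral_mult_right_zero)
  qed
  finally show ?thesis by (simp only: C_def)
qed

context
  fixes \<mu> :: "nat \<Rightarrow> 'a::euclidean_space measure" and \<nu> :: "'a measure"
  assumes \<mu>: "\<And>n. prob_space (\<mu> n)" "\<And>n. sets (\<mu> n) = sets borel" and \<nu>: "prob_space \<nu>" "sets \<nu> = sets borel"
    and char: "\<And>t. (\<lambda>n. \<integral>x. iexp (t \<bullet> x) \<partial>\<mu> n) \<longlonglongrightarrow> (\<integral>x. iexp (t \<bullet> x) \<partial>\<nu>)"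
begin

lemma cmod_char_le: "prob_space m ==> sets m = sets borel ==> cmod (\<integral>x. iexp (t \<bullet> x) \<partial>m) \<le> 1" for m :: "'a measure"
proof -
  assume "prob_space m" then interpret prob_space m .
  show ?thesis by (rule order_trans[OF integral_norm_bound]) (simp add: prob_space)
qed

lemma char_measurable: "prob_space m ==> sets m = sets borel ==> (\<lambda>t. \<integral>x. iexp (t \<bullet> x) \<partial>m) \<in> borel_measurable borel" for m :: "'a measure"
proof -
  assume m: "prob_space m" "sets m = sets borel"
  interpret prob_space m by (rule m)
  have "borel_measurable (borel \<Otimes>\<^sub>M m) = borel_measurable (borel \<Otimes>\<^sub>M borel :: ('a \<times> 'a) measure)"
    by (intro measurable_cong_sets sets_pair_measure_cong m refl)
  then have "(\<lambda>(t, x). iexp (t \<bullet> x)) \<in> borel_measurable (borel \<Otimes>\<^sub>M m)" by (rule ssubst) measurable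
  then show ?thesis by (rule borel_measurable_lebesgue_integral)
qed

lemma gaussian_mixture_tendsto:
  assumes h: "h > 0"
  shows "(\<lambda>n. \<integral>x. gaussian h (x - y) \<partial>\<mu> n) \<longlonglongrightarrow> (\<integral>x. gaussian h (x - y) \<partial>\<nu>)"
proof -
  have h': "1 / h > 0" using h by simp
  let ?f = "\<lambda>m t. complex_of_real (gaussian (1 / h) t) * iexp (- (t \<bullet> y)) * (\<integral>x. iexp (t \<bullet> x) \<partial>m)"
  have "(\<lambda>n. complex_of_real (\<integral>x. gaussian h (x - y) \<partial>\<mu> n)) \<longlonglongrightarrow> complex_of_real (\<integral>x. gaussian h (x - y) \<partial>\<nu>)"
    unfolding gaussian_mixture_Fourier[OF \<mu> h] gaussian_mixture_Fourier[OF \<nu> h]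
  proof (intro tendsto_mult[OF tendsto_const] integral_dominated_convergence[where w="gaussian (1 / h)"])
    show "integrable lborel (gaussian (1 / h) :: 'a \<Rightarrow> real)" by (rule gaussian_integrable[OF h'])
    note char_measurable[OF \<mu>, measurable] char_measurable[OF \<nu>, measurable]
    show "(\<lambda>t. ?f \<nu> t) \<in> borel_measurable lborel" by measurable
    show "(\<lambda>t. ?f (\<mu> n) t) \<in> borel_measurable lborel" for n by measurable
    show "AE t in lborel. (\<lambda>n. ?f (\<mu> n) t)
      \<longlonglongrightarrow> ?f \<nu> t"
      by (intro AE_I2 tendsto_mult[OF tendsto_const] char)
    show "AE t in lborel. norm (?f (\<mu> n) t) \<le> gaussian (1 / h) t" for n
    proof (intro AE_I2)
      fix t :: 'a
      have "norm (?f (\<mu> n) t) = gaussian (1 / h) t * cmod (\<integral>x. iexp (t \<bullet> x) \<partial>\<mu> n)"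
        using gaussian_nonneg[of "1 / h" t] by (simp add: norm_mult)
      also have "\<dots> \<le> gaussian (1 / h) t * 1" by (intro mult_left_mono cmod_char_le[OF \<mu>] gaussian_nonneg)
      finally show "norm (?f (\<mu> n) t) \<le> gaussian (1 / h) t" by simp
    qed
  qed
  then show ?thesis by (simp only: tendsto_of_real_iff)
qed

text \<open>Exchanging the integrals leaves \<open>f\<close> against the mixture density, which
  converges pointwise and is bounded by a constant; integrability of \<open>f\<close> then gives the
  domination.\<close>

lemma smoothed_tendsto:
  assumes h: "h > 0" and f: "integrable lborel f"
  shows "(\<lambda>n. \<integral>x. (\<integral>y. f y * gaussian h (x - y) \<partial>lborel) \<partial>\<mu> n) \<longlonglongrightarrow> (\<integral>x. (\<integral>y. f y * gaussian h (x - y) \<partial>lborel) \<partial>\<nu>)"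
proof -
  define C where "C = (1 / sqrt (2 * pi * h^2)) ^ DIM('a)"
  have fm[measurable]: "f \<in> borel_measurable borel" using f by auto
  have b: "norm (f y * gaussian h (x - y)) \<le> \<bar>f y\<bar> * C" for x y
    using gaussian_nonneg[of h "x - y"] gaussian_le[OF h, of "x - y"] by (auto simp: abs_mult C_def intro!: mult_left_mono)
  have swap: "(\<integral>x. (\<integral>y. f y * gaussian h (x - y) \<partial>lborel) \<partial>m) = (\<integral>y. f y * (\<integral>x. gaussian h (x - y) \<partial>m) \<partial>lborel)"
    if "prob_space m" "sets m = sets borel" for m
    by (subst Fubini_dominated[OF that _ b]) (use f in auto)
  have mm: "(\<lambda>y. \<integral>x. gaussian h (x - y) \<partial>m) \<in> borel_measurable borel" if m: "prob_space m" "sets m = sets borel" for m :: "'a measure"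
  proof -
    interpret prob_space m by (rule m)
    have "borel_measurable (borel \<Otimes>\<^sub>M m) = borel_measurable (borel \<Otimes>\<^sub>M borel :: ('a \<times> 'a) measure)"
      by (intro measurable_cong_sets sets_pair_measure_cong m refl)
    then have "(\<lambda>(y, x). gaussian h (x - y)) \<in> borel_measurable (borel \<Otimes>\<^sub>M m)" by (rule ssubst) measurable
    then show ?thesis by (rule borel_measurable_lebesgue_integral)
  qed
  have kb: "\<bar>\<integral>x. gaussian h (x - y) \<partial>m\<bar> \<le> C" if "prob_space m" "sets m = sets borel" for m :: "'a measure" and y
  proof -
    interpret prob_space m by (rule that)
    have [measurable_cong]: "sets m = sets borel" by (rule that)
    have "integrable m (\<lambda>x. gaussian h (x - y))"
      by (rule integrable_const_bound[of _ C]) (auto simp: C_def gaussian_nonneg gaussian_le[OF h])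
    then have "(\<integral>x. gaussian h (x - y) \<partial>m) \<le> (\<integral>x. C \<partial>m)"
      by (rule integral_mono) (use gaussian_le[OF h] in \<open>auto simp: C_def\<close>)
    moreover have "0 \<le> (\<integral>x. gaussian h (x - y) \<partial>m)" by (intro Bochner_Integration.integral_nonneg gaussian_nonneg)
    ultimately show ?thesis by (simp add: prob_space)
  qed
  note mm[OF \<mu>, measurable] mm[OF \<nu>, measurable]
  show ?thesis
    unfolding swap[OF \<mu>] swap[OF \<nu>]
  proof (rule integral_dominated_convergence[where w="\<lambda>y. \<bar>f y\<bar> * C"])
    show "integrable lborel (\<lambda>y. \<bar>f y\<bar> * C)" using f by auto
    show "(\<lambda>y. f y * (\<integral>x. gaussian h (x - y) \<partial>\<nu>)) \<in> borel_measurable lborel" by measurable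
    show "(\<lambda>y. f y * (\<integral>x. gaussian h (x - y) \<partial>\<mu> n)) \<in> borel_measurable lborel" for n by measurable
    show "AE y in lborel. (\<lambda>n. f y * (\<integral>x. gaussian h (x - y) \<partial>\<mu> n)) \<longlonglongrightarrow> f y * (\<integral>x. gaussian h (x - y) \<partial>\<nu>)"
      by (intro AE_I2 tendsto_mult[OF tendsto_const] gaussian_mixture_tendsto h)
    show "AE y in lborel. norm (f y * (\<integral>x. gaussian h (x - y) \<partial>\<mu> n)) \<le> \<bar>f y\<bar> * C" for n
      using kb[OF \<mu>] by (intro AE_I2) (simp add: abs_mult mult_left_mono)
  qed
qed

end

text \<open>Within distance \<open>d\<close> the modulus of continuity applies. Beyond it the
  oscillation \<open>2 * C\<close> is multiplied by \<open>(norm (y - x) / d)^2\<close>, at least 1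
  there, as in Chebyshev's inequality.\<close>

lemma smoothing_error:
  fixes f :: "'a::euclidean_space \<Rightarrow> real"
  assumes f: "integrable lborel f" "\<And>x. \<bar>f x\<bar> \<le> C" and d: "0 < d" "\<And>x y. norm (y - x) < d ==> \<bar>f y - f x\<bar> \<le> \<epsilon>" and h: "h > 0" and \<epsilon>: "\<epsilon> \<ge> 0"
  shows "\<bar>(\<integral>y. f y * gaussian h (x - y) \<partial>lborel) - f x\<bar> \<le> \<epsilon> + 2 * C / d^2 * (4 * h^2 * sqrt 2 ^ DIM('a))"
proof -
  have C: "0 \<le> C" using order_trans[OF abs_ge_zero f(2)[of 0]] .
  have fm[measurable]: "f \<in> borel_measurable borel" using f by auto
  let ?g = "\<lambda>y. gaussian h (y - x)"
  have g: "integrable lborel ?g" "(\<integral>y. ?g y \<partial>lborel) = 1"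
    using lborel_translate[OF gaussian_integrable[OF h], of x] gaussian_integral[OF h, where 'a='a] by auto
  have g2: "integrable lborel (\<lambda>y. (norm (y - x))\<^sup>2 * ?g y)" "(\<integral>y. (norm (y - x))\<^sup>2 * ?g y \<partial>lborel) \<le> 4 * h^2 * sqrt 2 ^ DIM('a)"
    using lborel_translate[OF gaussian_second_moment(1)[OF h], of x] gaussian_second_moment(2)[OF h, where 'a='a] by auto
  have fg: "integrable lborel (\<lambda>y. f y * ?g y)"
  proof (rule Bochner_Integration.integrable_bound)
    show "integrable lborel (\<lambda>y. C * ?g y)" using g by simp
    show "AE y in lborel. norm (f y * ?g y) \<le> norm (C * ?g y)"
      using f(2) C gaussian_nonneg[of h] by (intro AE_I2) (simp add: abs_mult mult_right_mono)
  qed measurable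
  have "(\<integral>y. f y * gaussian h (x - y) \<partial>lborel) - f x = (\<integral>y. f y * ?g y \<partial>lborel) - (\<integral>y. f x * ?g y \<partial>lborel)"
    by (simp add: g(2) gaussian_minus_commute[OF h, of x])
  also have "\<dots> = (\<integral>y. f y * ?g y - f x * ?g y \<partial>lborel)"
    using fg g by (subst Bochner_Integration.integral_diff) auto
  finally have e: "(\<integral>y. f y * gaussian h (x - y) \<partial>lborel) - f x = (\<integral>y. f y * ?g y - f x * ?g y \<partial>lborel)" .
  have "\<bar>(\<integral>y. f y * ?g y - f x * ?g y \<partial>lborel)\<bar> \<le> (\<integral>y. \<bar>f y * ?g y - f x * ?g y\<bar> \<partial>lborel)"
    using integral_norm_bound[of lborel "\<lambda>y. f y * ?g y - f x * ?g y"] by simp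
  also have "\<dots> \<le> (\<integral>y. \<epsilon> * ?g y + 2 * C / d^2 * ((norm (y - x))^2 * ?g y) \<partial>lborel)"
  proof (rule integral_mono)
    show "integrable lborel (\<lambda>y. \<bar>f y * ?g y - f x * ?g y\<bar>)" using fg g by auto
    show "integrable lborel (\<lambda>y. \<epsilon> * ?g y + 2 * C / d^2 * ((norm (y - x))^2 * ?g y))" using g g2 by auto
    fix y
    have "\<bar>f y - f x\<bar> \<le> \<epsilon> + 2 * C / d^2 * (norm (y - x))^2"
    proof (cases "norm (y - x) < d")
      case True
      have "0 \<le> 2 * C / d^2 * (norm (y - x))^2" using C by simp
      then show ?thesis using d(2)[OF True] by linarith
    next
      case False
      then have "d^2 \<le> (norm (y - x))^2" using d(1) by (intro power_mono) auto
      then have "2 * C / d^2 * d^2 \<le> 2 * C / d^2 * (norm (y - x))^2" using C by (intro mult_left_mono) auto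
      then have "2 * C \<le> 2 * C / d^2 * (norm (y - x))^2" using d(1) by simp
      then show ?thesis using f(2)[of x] f(2)[of y] \<epsilon> by linarith
    qed
    then have "\<bar>f y - f x\<bar> * ?g y \<le> (\<epsilon> + 2 * C / d^2 * (norm (y - x))^2) * ?g y" by (rule mult_right_mono) (rule gaussian_nonneg)
    moreover have "\<bar>f y * ?g y - f x * ?g y\<bar> = \<bar>f y - f x\<bar> * ?g y"
      using gaussian_nonneg[of h "y - x"] by (simp add: abs_mult left_diff_distrib[symmetric])
    ultimately show "\<bar>f y * ?g y - f x * ?g y\<bar> \<le> \<epsilon> * ?g y + 2 * C / d^2 * ((norm (y - x))^2 * ?g y)"
      by (simp only: distrib_right mult.assoc)
  qed
  also have "\<dots> = \<epsilon> * (\<integral>y. ?g y \<partial>lborel) + 2 * C / d^2 * (\<integral>y. (norm (y - x))\<^sup>2 * ?g y \<partial>lborel)"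
    using g g2 by (subst Bochner_Integration.integral_add) auto
  also have "\<dots> \<le> \<epsilon> + 2 * C / d^2 * (4 * h^2 * sqrt 2 ^ DIM('a))"
    using g2(2) C unfolding g(2) by (intro add_mono mult_left_mono) auto
  finally show ?thesis unfolding e .
qed

lemma (in prob_space) expectation_diff_le:
  fixes f g :: "'a \<Rightarrow> real"
  assumes "integrable M f" "integrable M g" "\<And>x. \<bar>f x - g x\<bar> \<le> c"
  shows "\<bar>expectation f - expectation g\<bar> \<le> c"
proof -
  have "\<bar>expectation f - expectation g\<bar> = \<bar>\<integral>x. f x - g x \<partial>M\<bar>"
    using assms by (subst Bochner_Integration.integral_diff) auto
  also have "\<dots> \<le> (\<integral>x. \<bar>f x - g x\<bar> \<partial>M)" using integral_norm_bound[of M "\<lambda>x. f x - g x"] by simp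
  also have "\<dots> \<le> (\<integral>x. c \<partial>M)" by (rule integral_mono) (use assms in auto)
  finally show ?thesis by (simp add: prob_space)
qed

text \<open>A continuous plateau of compact support: it makes a bounded continuous test function
  integrable and uniformly continuous, as smoothing requires.\<close>

definition cutoff :: "real \<Rightarrow> 'a::real_normed_vector \<Rightarrow> real" where
  "cutoff R x = max 0 (min 1 (R + 1 - norm x))"

lemma cutoff_bounds: "0 \<le> cutoff R x" "cutoff R x \<le> 1"
  by (auto simp: cutoff_def)

lemma cutoff_eq: "R + 1 \<le> norm x ==> cutoff R x = 0" "norm x \<le> R ==> cutoff R x = 1"
  by (auto simp: cutoff_def)

lemma cutoff_continuous: "continuous_on UNIV (cutoff R)"
  unfolding cutoff_def by (intro continuous_intros)

lemma uniformly_continuous_cutoff: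
  fixes f :: "'a::euclidean_space \<Rightarrow> real"
  assumes f: "continuous_on UNIV f" and \<epsilon>: "\<epsilon> > 0"
  shows "\<exists>d>0. \<forall>x y. norm (y - x) < d \<longrightarrow> \<bar>f y * cutoff R y - f x * cutoff R x\<bar> \<le> \<epsilon>"
proof -
  define g where "g x = f x * cutoff R x" for x
  have "continuous_on (cball 0 (R + 2)) g"
    unfolding g_def using f cutoff_continuous by (intro continuous_on_mult) (auto intro: continuous_on_subset)
  then have "uniformly_continuous_on (cball 0 (R + 2)) g" by (rule compact_uniformly_continuous) simp
  then obtain d where d: "d > 0" "\<And>x y. x \<in> cball 0 (R + 2) ==> y \<in> cball 0 (R + 2) ==> dist y x < d ==> dist (g y) (g x) < \<epsilon>"
    unfolding uniformly_continuous_on_def using \<epsilon> by metis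
  show ?thesis
  proof (intro exI[of _ "min d 1"] conjI allI impI)
    fix x y :: 'a assume xy: "norm (y - x) < min d 1"
    have t: "norm y \<le> norm x + norm (y - x)" "norm x \<le> norm y + norm (y - x)"
      using norm_triangle_sub[of y x] norm_triangle_sub[of x y] by (auto simp: norm_minus_commute)
    show "\<bar>f y * cutoff R y - f x * cutoff R x\<bar> \<le> \<epsilon>"
    proof (cases "norm x \<le> R + 2 \<and> norm y \<le> R + 2")
      case True
      then show ?thesis using d(2)[of x y] xy by (simp add: dist_norm g_def)
    next
      case False
      then have "R + 1 \<le> norm x" "R + 1 \<le> norm y" using t xy by auto
      then show ?thesis using \<epsilon> by (simp add: cutoff_eq)
    qed
  qed (use d in simp)
qed

lemma cutoff_integrable:
  fixes f :: "'a::euclidean_space \<Rightarrow> real"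
  assumes f: "continuous_on UNIV f"
  shows "integrable lborel (\<lambda>x. f x * cutoff R x)"
proof -
  have c: "continuous_on UNIV (\<lambda>x. f x * cutoff R x)"
    using f cutoff_continuous by (intro continuous_on_mult)
  have "integrable lborel (\<lambda>x. indicator (cball 0 (R + 1)) x *\<^sub>R (f x * cutoff R x))"
    by (rule borel_integrable_compact) (auto intro: continuous_on_subset[OF c])
  moreover have "(\<lambda>x. indicator (cball 0 (R + 1)) x *\<^sub>R (f x * cutoff R x)) = (\<lambda>x. f x * cutoff R x)"
  proof
    show "indicator (cball 0 (R + 1)) x *\<^sub>R (f x * cutoff R x) = f x * cutoff R x" for x
      by (cases "norm x \<le> R + 1") (auto simp: cutoff_eq)
  qed
  ultimately show ?thesis by (simp only:)
qed

text \<open>Smoothing settles integrable, uniformly continuous test functions. Bounded continuous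
  ones are reduced to these by a cutoff, and tightness comes with it: the cutoff is itself such a
  test function, so its integrals converge to those under \<open>\<nu>\<close>, which are near 1 for
  a large radius.\<close>

theorem weakly_converges_if_char_tendsto:
  fixes \<mu> :: "nat \<Rightarrow> 'a::euclidean_space measure" and \<nu> :: "'a measure"
  assumes \<mu>: "\<And>n. prob_space (\<mu> n)" "\<And>n. sets (\<mu> n) = sets borel" and \<nu>: "prob_space \<nu>" "sets \<nu> = sets borel"
    and char: "\<And>t. (\<lambda>n. \<integral>x. iexp (t \<bullet> x) \<partial>\<mu> n) \<longlonglongrightarrow> (\<integral>x. iexp (t \<bullet> x) \<partial>\<nu>)"
  shows "weakly_converges \<mu> \<nu>"
proof -
  have int: "integrable m f" if "prob_space m" "sets m = sets borel" "f \<in> borel_measurable borel" "\<And>x. \<bar>f x\<bar> \<le> C" for m :: "'a measure" and f :: "'a \<Rightarrow> real" and C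
  proof -
    interpret prob_space m by (rule that)
    show ?thesis by (rule integrable_const_bound[of _ C]) (use that in \<open>auto simp: measurable_cong_sets[OF that(2) refl]\<close>)
  qed
  have uc: "(\<lambda>n. \<integral>x. f x \<partial>\<mu> n) \<longlonglongrightarrow> (\<integral>x. f x \<partial>\<nu>)"
    if f: "integrable lborel f" "\<And>x. \<bar>f x\<bar> \<le> C" and u: "\<And>\<epsilon>. \<epsilon> > 0 ==> \<exists>d>0. \<forall>x y. norm (y - x) < d \<longrightarrow> \<bar>f y - f x\<bar> \<le> \<epsilon>" for f :: "'a \<Rightarrow> real" and C
  proof (rule LIMSEQ_I)
    fix \<epsilon> :: real assume \<epsilon>: "0 < \<epsilon>"
    have C: "0 \<le> C" using order_trans[OF abs_ge_zero f(2)[of 0]] .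
    have fm[measurable]: "f \<in> borel_measurable borel" using f by auto
    from u[of "\<epsilon> / 8"] \<epsilon> obtain d where d: "d > 0" "\<And>x y. norm (y - x) < d ==> \<bar>f y - f x\<bar> \<le> \<epsilon> / 8" by auto
    define K where "K = 2 * C / d^2 * (4 * sqrt 2 ^ DIM('a))"
    have K: "K \<ge> 0" using C by (simp add: K_def)
    define h where "h = sqrt (\<epsilon> / (8 * (K + 1)))"
    have h: "h > 0" using K \<epsilon> by (simp add: h_def)
    have "K * h^2 \<le> \<epsilon> / 8"
    proof -
      have "h^2 = \<epsilon> / (8 * (K + 1))" using K \<epsilon> by (simp add: h_def)
      then have "K * h^2 = K / (K + 1) * (\<epsilon> / 8)" by simp
      also have "\<dots> \<le> 1 * (\<epsilon> / 8)" using K \<epsilon> by (intro mult_right_mono) auto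
      finally show ?thesis by simp
    qed
    moreover have "2 * C / d^2 * (4 * h^2 * sqrt 2 ^ DIM('a)) = K * h^2" by (simp add: K_def)
    ultimately have hK: "\<epsilon> / 8 + 2 * C / d^2 * (4 * h^2 * sqrt 2 ^ DIM('a)) \<le> \<epsilon> / 4" by linarith
    define sm where "sm x = (\<integral>y. f y * gaussian h (x - y) \<partial>lborel)" for x
    have near: "\<bar>sm x - f x\<bar> \<le> \<epsilon> / 4" for x
      unfolding sm_def using smoothing_error[OF f d h, of x] \<epsilon> hK by simp
    have smm: "sm \<in> borel_measurable borel"
    proof -
      have "(\<lambda>(x, y). f y * gaussian h (x - y)) \<in> borel_measurable (borel \<Otimes>\<^sub>M lborel)" by measurable
      then show ?thesis unfolding sm_def[abs_def] by (rule lborel.borel_measurable_lebesgue_integral)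
    qed
    have smb: "\<bar>sm x\<bar> \<le> C + \<epsilon> / 4" for x using near[of x] f(2)[of x] by linarith
    have app: "\<bar>(\<integral>x. sm x \<partial>m) - (\<integral>x. f x \<partial>m)\<bar> \<le> \<epsilon> / 4" if m: "prob_space m" "sets m = sets borel" for m
    proof -
      interpret prob_space m by (rule m)
      show ?thesis by (rule expectation_diff_le[OF int[OF m smm smb] int[OF m fm f(2)] near])
    qed
    have "(\<lambda>n. \<integral>x. sm x \<partial>\<mu> n) \<longlonglongrightarrow> (\<integral>x. sm x \<partial>\<nu>)"
      unfolding sm_def by (rule smoothed_tendsto[OF \<mu> \<nu> char h f(1)])
    then obtain n0 where n0: "\<And>n. n \<ge> n0 ==> norm ((\<integral>x. sm x \<partial>\<mu> n) - (\<integral>x. sm x \<partial>\<nu>)) < \<epsilon> / 4"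
      using LIMSEQ_D[of _ _ "\<epsilon> / 4"] \<epsilon> by (metis divide_pos_pos zero_less_numeral)
    show "\<exists>n0. \<forall>n\<ge>n0. norm ((\<integral>x. f x \<partial>\<mu> n) - (\<integral>x. f x \<partial>\<nu>)) < \<epsilon>"
    proof (intro exI[of _ n0] allI impI)
      fix n assume "n0 \<le> n"
      then have "\<bar>(\<integral>x. sm x \<partial>\<mu> n) - (\<integral>x. sm x \<partial>\<nu>)\<bar> < \<epsilon> / 4" using n0 by simp
      then have "\<bar>(\<integral>x. f x \<partial>\<mu> n) - (\<integral>x. f x \<partial>\<nu>)\<bar> < \<epsilon>" using app[OF \<mu>, of n] app[OF \<nu>] \<epsilon> by linarith
      then show "norm ((\<integral>x. f x \<partial>\<mu> n) - (\<integral>x. f x \<partial>\<nu>)) < \<epsilon>" by simp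
    qed
  qed
  have cut: "(\<lambda>n. \<integral>x. f x * cutoff R x \<partial>\<mu> n) \<longlonglongrightarrow> (\<integral>x. f x * cutoff R x \<partial>\<nu>)"
    if f: "continuous_on UNIV f" "\<And>x. \<bar>f x\<bar> \<le> C" for f :: "'a \<Rightarrow> real" and C R
  proof (rule uc)
    show "integrable lborel (\<lambda>x. f x * cutoff R x)" by (rule cutoff_integrable[OF f(1)])
    show "\<bar>f x * cutoff R x\<bar> \<le> C" for x
      using mult_mono[OF f(2)[of x] cutoff_bounds(2)[of R x]] order_trans[OF abs_ge_zero f(2)[of x]] cutoff_bounds(1)[of R x]
      by (simp add: abs_mult)
  qed (rule uniformly_continuous_cutoff[OF f(1)])
  show ?thesis
    unfolding weakly_converges_def
  proof (intro allI impI)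
    fix f :: "'a \<Rightarrow> real" assume "continuous_on UNIV f \<and> bounded (range f)"
    then obtain C where f: "continuous_on UNIV f" "\<And>x. \<bar>f x\<bar> \<le> C" by (auto simp: bounded_iff)
    have fm: "f \<in> borel_measurable borel" by (rule borel_measurable_continuous_onI[OF f(1)])
    have cm: "cutoff R \<in> borel_measurable borel" for R :: real by (rule borel_measurable_continuous_onI[OF cutoff_continuous])
    have C: "0 \<le> C" using order_trans[OF abs_ge_zero f(2)[of 0]] .
    \<comment> \<open>The mass lost is written with \<open>1 * cutoff R x\<close> so that
      \<open>cut\<close> applies to it with the constant function 1.\<close>
    have tail: "\<bar>(\<integral>x. f x \<partial>m) - (\<integral>x. f x * cutoff R x \<partial>m)\<bar> \<le> C * (1 - (\<integral>x. 1 * cutoff R x \<partial>m))"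
      if m: "prob_space m" "sets m = sets borel" for m R
    proof -
      interpret prob_space m by (rule m)
      have i: "integrable m f" by (rule int[OF m fm f(2)])
      have j: "integrable m (cutoff R)" by (rule int[OF m cm, of _ 1]) (simp add: abs_of_nonneg[OF cutoff_bounds(1)] cutoff_bounds(2))
      have k: "integrable m (\<lambda>x. f x * cutoff R x)"
      proof (rule int[OF m])
        show "(\<lambda>x. f x * cutoff R x) \<in> borel_measurable borel" using fm cm by measurable
        show "\<bar>f x * cutoff R x\<bar> \<le> C" for x
          using mult_mono[OF f(2)[of x] cutoff_bounds(2)[of R x]] C cutoff_bounds(1)[of R x] by (simp add: abs_mult)
      qed
      have "\<bar>(\<integral>x. f x \<partial>m) - (\<integral>x. f x * cutoff R x \<partial>m)\<bar> = \<bar>\<integral>x. f x - f x * cutoff R x \<partial>m\<bar>"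
        using i k by (subst Bochner_Integration.integral_diff) auto
      also have "\<dots> \<le> (\<integral>x. \<bar>f x - f x * cutoff R x\<bar> \<partial>m)" using integral_norm_bound[of m "\<lambda>x. f x - f x * cutoff R x"] by simp
      also have "\<dots> \<le> (\<integral>x. C * (1 - cutoff R x) \<partial>m)"
      proof (rule integral_mono)
        show "integrable m (\<lambda>x. \<bar>f x - f x * cutoff R x\<bar>)" using i k by auto
        show "integrable m (\<lambda>x. C * (1 - cutoff R x))" using j by auto
        fix x
        have "f x - f x * cutoff R x = f x * (1 - cutoff R x)" by (simp add: algebra_simps)
        then show "\<bar>f x - f x * cutoff R x\<bar> \<le> C * (1 - cutoff R x)"
          using mult_right_mono[OF f(2)[of x], of "1 - cutoff R x"] cutoff_bounds[of R x] by (simp add: abs_mult)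
      qed
      also have "\<dots> = C * (1 - (\<integral>x. 1 * cutoff R x \<partial>m))" using j by (simp add: prob_space)
      finally show ?thesis .
    qed
    have one: "(\<lambda>n. \<integral>x. 1 * cutoff R x \<partial>\<mu> n) \<longlonglongrightarrow> (\<integral>x. 1 * cutoff R x \<partial>\<nu>)" for R :: real
      by (rule cut[of "\<lambda>_. 1" 1]) auto
    have tight: "(\<lambda>k. \<integral>x. 1 * cutoff (real k) x \<partial>\<nu>) \<longlonglongrightarrow> 1"
    proof -
      interpret prob_space \<nu> by (rule \<nu>)
      have "(\<lambda>k. \<integral>x. 1 * cutoff (real k) x \<partial>\<nu>) \<longlonglongrightarrow> (\<integral>x. 1 \<partial>\<nu>)"
      proof (rule integral_dominated_convergence[where w="\<lambda>_. 1"])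
        show "AE x in \<nu>. (\<lambda>k. 1 * cutoff (real k) x) \<longlonglongrightarrow> 1"
        proof (rule AE_I2)
          fix x :: 'a
          have "\<forall>\<^sub>F k in sequentially. 1 * cutoff (real k) x = 1"
            using eventually_ge_at_top[of "nat \<lceil>norm x\<rceil>"] by eventually_elim (simp add: cutoff_eq nat_ceiling_le_eq)
          then show "(\<lambda>k. 1 * cutoff (real k) x) \<longlonglongrightarrow> 1" by (rule tendsto_eventually)
        qed
        show "AE x in \<nu>. norm (1 * cutoff (real k) x) \<le> 1" for k
          by (intro AE_I2) (simp add: abs_of_nonneg[OF cutoff_bounds(1)] cutoff_bounds(2))
        show "(\<lambda>x. 1 * cutoff (real k) x) \<in> borel_measurable \<nu>" for k
          using cm[of "real k"] by (simp add: measurable_cong_sets[OF \<nu>(2) refl])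
      qed simp_all
      then show ?thesis by (simp add: prob_space)
    qed
    show "(\<lambda>n. \<integral>x. f x \<partial>\<mu> n) \<longlonglongrightarrow> (\<integral>x. f x \<partial>\<nu>)"
    proof (rule LIMSEQ_I)
      fix \<epsilon> :: real assume \<epsilon>: "0 < \<epsilon>"
      define \<eta> where "\<eta> = \<epsilon> / (4 * (C + 1))"
      have \<eta>: "\<eta> > 0" "C * \<eta> \<le> \<epsilon> / 4"
      proof -
        show "\<eta> > 0" using \<epsilon> C by (simp add: \<eta>_def)
        have "C * \<eta> = C / (C + 1) * (\<epsilon> / 4)" by (simp add: \<eta>_def)
        also have "\<dots> \<le> 1 * (\<epsilon> / 4)" using C \<epsilon> by (intro mult_right_mono) auto
        finally show "C * \<eta> \<le> \<epsilon> / 4" by simp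
      qed
      have "\<forall>\<^sub>F k in sequentially. 1 - \<eta> < (\<integral>x. 1 * cutoff (real k) x \<partial>\<nu>)"
        by (rule order_tendstoD(1)[OF tight]) (use \<eta> in simp)
      then obtain k where k: "1 - \<eta> < (\<integral>x. 1 * cutoff (real k) x \<partial>\<nu>)" by (auto simp: eventually_sequentially)
      have "\<forall>\<^sub>F n in sequentially. 1 - \<eta> < (\<integral>x. 1 * cutoff (real k) x \<partial>\<mu> n)"
        by (rule order_tendstoD(1)[OF one k])
      moreover have "\<forall>\<^sub>F n in sequentially. dist (\<integral>x. f x * cutoff (real k) x \<partial>\<mu> n) (\<integral>x. f x * cutoff (real k) x \<partial>\<nu>) < \<epsilon> / 4"
        by (rule tendstoD[OF cut[OF f]]) (use \<epsilon> in simp)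
      ultimately have "\<forall>\<^sub>F n in sequentially. norm ((\<integral>x. f x \<partial>\<mu> n) - (\<integral>x. f x \<partial>\<nu>)) < \<epsilon>"
      proof eventually_elim
        case (elim n)
        have "C * (1 - (\<integral>x. 1 * cutoff (real k) x \<partial>\<mu> n)) \<le> C * \<eta>" "C * (1 - (\<integral>x. 1 * cutoff (real k) x \<partial>\<nu>)) \<le> C * \<eta>"
          using elim(1) k C by (auto intro!: mult_left_mono)
        then have "\<bar>(\<integral>x. f x \<partial>\<mu> n) - (\<integral>x. f x * cutoff (real k) x \<partial>\<mu> n)\<bar> \<le> \<epsilon> / 4" "\<bar>(\<integral>x. f x \<partial>\<nu>) - (\<integral>x. f x * cutoff (real k) x \<partial>\<nu>)\<bar> \<le> \<epsilon> / 4"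
          using tail[OF \<mu>, of n "real k"] tail[OF \<nu>, of "real k"] \<eta>(2) by linarith+
        then have "\<bar>(\<integral>x. f x \<partial>\<mu> n) - (\<integral>x. f x \<partial>\<nu>)\<bar> < \<epsilon>"
        proof -
          have "\<bar>a - c\<bar> < e" if "\<bar>a - b\<bar> \<le> e / 4" "\<bar>c - d\<bar> \<le> e / 4" "\<bar>b - d\<bar> < e / 4" "0 < e" for a b c d e :: real
            using that by linarith
          from this[OF _ _ elim(2)[unfolded dist_real_def] \<epsilon>] show "\<bar>(\<integral>x. f x \<partial>\<mu> n) - (\<integral>x. f x \<partial>\<nu>)\<bar> < \<epsilon>"
            if "\<bar>(\<integral>x. f x \<partial>\<mu> n) - (\<integral>x. f x * cutoff (real k) x \<partial>\<mu> n)\<bar> \<le> \<epsilon> / 4" "\<bar>(\<integral>x. f x \<partial>\<nu>) - (\<integral>x. f x * cutoff (real k) x \<partial>\<nu>)\<bar> \<le> \<epsilon> / 4"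
            using that by blast
        qed
        then show ?case by simp
      qed
      then show "\<exists>n0. \<forall>n\<ge>n0. norm ((\<integral>x. f x \<partial>\<mu> n) - (\<integral>x. f x \<partial>\<nu>)) < \<epsilon>" by (simp add: eventually_sequentially)
    qed
  qed
qed

section \<open>The isotropic normal law\<close>

lemma multivariate_normal_isotropic:
  assumes \<sigma>: "\<sigma> > 0"
  shows "multivariate_normal 0 (\<sigma>^2 *\<^sub>R mat 1 :: real ^ 'm::finite ^ 'm) = density lborel (\<lambda>x. ennreal (gaussian \<sigma> x))"
proof -
  have inv: "matrix_inv (\<sigma>^2 *\<^sub>R mat 1 :: real ^ 'm ^ 'm) = (1 / \<sigma>^2) *\<^sub>R mat 1"
  proof -
    let ?A = "\<sigma>^2 *\<^sub>R mat 1 :: real ^ 'm ^ 'm" and ?B = "(1 / \<sigma>^2) *\<^sub>R mat 1 :: real ^ 'm ^ 'm"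
    have AB: "?A ** ?B = mat 1" "?B ** ?A = mat 1"
      using \<sigma> by (simp_all add: scalar_matrix_assoc[symmetric])
    then have "?A ** matrix_inv ?A = mat 1" unfolding matrix_inv_def
      by (intro someI[where P="\<lambda>A'. ?A ** A' = mat 1 \<and> A' ** ?A = mat 1", THEN conjunct1] conjI)
    then have "?B ** (?A ** matrix_inv ?A) = ?B" by simp
    then show ?thesis unfolding matrix_mul_assoc AB(2) by simp
  qed
  have det: "det (\<sigma>^2 *\<^sub>R mat 1 :: real ^ 'm ^ 'm) = (\<sigma>^2) ^ CARD('m)"
  proof -
    have "det (\<sigma>^2 *\<^sub>R mat 1 :: real ^ 'm ^ 'm) = (\<Prod>i\<in>UNIV. (\<sigma>^2 *\<^sub>R mat 1 :: real ^ 'm ^ 'm) $ i $ i)"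
      by (rule det_diagonal) (simp add: mat_def)
    then show ?thesis by (simp add: mat_def)
  qed
  have "exp (- ((x - 0) \<bullet> (matrix_inv (\<sigma>^2 *\<^sub>R mat 1 :: real ^ 'm ^ 'm) *v (x - 0))) / 2)
       / sqrt ((2 * pi) ^ CARD('m) * det (\<sigma>^2 *\<^sub>R mat 1 :: real ^ 'm ^ 'm)) = gaussian \<sigma> x" for x :: "real ^ 'm"
  proof -
    have "sqrt ((2 * pi) ^ CARD('m) * (\<sigma>^2) ^ CARD('m)) = sqrt (2 * pi * \<sigma>^2) ^ CARD('m)"
      by (simp only: power_mult_distrib[symmetric] real_sqrt_power)
    moreover have "x \<bullet> (((1 / \<sigma>^2) *\<^sub>R mat 1 :: real ^ 'm ^ 'm) *v x) = (norm x)^2 / \<sigma>^2"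
      by (simp add: scaleR_matrix_vector_assoc[symmetric] power2_norm_eq_inner)
    ultimately show ?thesis unfolding inv det gaussian_eq[OF \<sigma>] by (simp add: power_one_over)
  qed
  then show ?thesis unfolding multivariate_normal_def by simp
qed

lemma isotropic_normal:
  assumes \<sigma>: "\<sigma> > 0"
  defines "\<nu> \<equiv> multivariate_normal 0 (\<sigma>^2 *\<^sub>R mat 1 :: real ^ 'm::finite ^ 'm)"
  shows "prob_space \<nu>" "sets \<nu> = sets borel"
    "(\<integral>x. iexp (t \<bullet> x) \<partial>\<nu>) = complex_of_real (exp (- (\<sigma>^2 * (norm t)^2) / 2))"
proof -
  have n: "\<nu> = density lborel (\<lambda>x. ennreal (gaussian \<sigma> x))" unfolding \<nu>_def by (rule multivariate_normal_isotropic[OF \<sigma>])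
  show "sets \<nu> = sets borel" by (simp add: n)
  show "prob_space \<nu>"
  proof
    have "emeasure \<nu> (space \<nu>) = (\<integral>\<^sup>+x. ennreal (gaussian \<sigma> x) \<partial>(lborel :: (real ^ 'm) measure))"
      by (simp add: n emeasure_density)
    also have "\<dots> = ennreal (\<integral>x. gaussian \<sigma> x \<partial>(lborel :: (real ^ 'm) measure))"
      by (rule nn_integral_eq_integral[OF gaussian_integrable[OF \<sigma>]]) (simp add: gaussian_nonneg)
    finally show "emeasure \<nu> (space \<nu>) = 1" by (simp add: gaussian_integral[OF \<sigma>])
  qed
  have "(\<integral>x. iexp (t \<bullet> x) \<partial>\<nu>) = (\<integral>x. gaussian \<sigma> x *\<^sub>R iexp (t \<bullet> x) \<partial>lborel)"
    unfolding n by (rule integral_density) (auto simp: gaussian_nonneg)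
  also have "\<dots> = (\<integral>x. complex_of_real (gaussian \<sigma> x) * iexp (t \<bullet> x) \<partial>lborel)" by (simp add: scaleR_conv_of_real)
  finally show "(\<integral>x. iexp (t \<bullet> x) \<partial>\<nu>) = complex_of_real (exp (- (\<sigma>^2 * (norm t)^2) / 2))"
    by (simp only: gaussian_char(2)[OF \<sigma>])
qed

section \<open>LinUCB runs\<close>

lemma vimage_sets_subset: "(\<And>A. P A ==> f -` A \<inter> S \<in> B) ==> {f -` A \<inter> S | A. P A} \<subseteq> B"
  by blast

lemma vimage_setsI: "P A ==> f -` A \<inter> S \<in> {f -` A \<inter> S | A. P A}"
  by blast

lemma vimage_sets_Pow: "{f -` A \<inter> S | A. P A} \<subseteq> Pow S"
  by blast

lemma history_generators:
  "(\<Union>s\<in>{1..t}. {a s -` A \<inter> space M | A. A \<in> sets borel} \<union> {r s -` B \<inter> space M | B. B \<in> sets borel}) \<subseteq> Pow (space M)"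
  by (intro UN_least Un_least vimage_sets_Pow)

lemma space_history: "space (history M a r t) = space M"
  unfolding history_def by (rule space_measure_of[OF history_generators])

lemma sets_history: "sets (history M a r t) = sigma_sets (space M)
     (\<Union>s\<in>{1..t}. {a s -` A \<inter> space M | A. A \<in> sets borel} \<union> {r s -` B \<inter> space M | B. B \<in> sets borel})"
  unfolding history_def by (rule sets_measure_of[OF history_generators])

lemma pre_noise_generators: "sets (history M a r t) \<union> {a s -` A \<inter> space M | A. A \<in> sets borel} \<subseteq> Pow (space M)"
  by (rule Un_least[OF sets.space_closed[of "history M a r t", unfolded space_history] vimage_sets_Pow])

lemma space_pre_noise: "space (pre_noise M a r t) = space M"
  unfolding pre_noise_def by (rule space_measure_of[OF pre_noise_generators])

lemma sets_pre_noise: "sets (pre_noise M a r t) = sigma_sets (space M)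
     (sets (history M a r (t - 1)) \<union> {a t -` A \<inter> space M | A. A \<in> sets borel})"
  unfolding pre_noise_def by (rule sets_measure_of[OF pre_noise_generators])

lemma history_subset_pre_noise: "sets (history M a r (t - 1)) \<subseteq> sets (pre_noise M a r t)"
  unfolding sets_pre_noise by (intro subsetI sigma_sets.Basic UnI1)

lemma action_history:
  "s \<in> {1..t} ==> A \<in> sets borel ==> a s -` A \<inter> space M \<in> sets (history M a r t)"
  unfolding sets_history by (rule sigma_sets.Basic, rule UN_I, assumption, rule UnI1, rule vimage_setsI)

lemma reward_history:
  "s \<in> {1..t} ==> A \<in> sets borel ==> r s -` A \<inter> space M \<in> sets (history M a r t)"
  unfolding sets_history by (rule sigma_sets.Basic, rule UN_I, assumption, rule UnI2, rule vimage_setsI)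

lemma history_mono: "s \<le> t ==> sets (history M a r s) \<subseteq> sets (history M a r t)"
  unfolding sets_history by (rule sigma_sets_mono', rule UN_mono) (simp_all only: atLeastatMost_subset_iff order_refl simp_thms)

lemma pre_noise_mono:
  assumes "1 \<le> s" "s \<le> t"
  shows "sets (pre_noise M a r s) \<subseteq> sets (pre_noise M a r t)"
proof (cases "s = t")
  case False
  then have st: "s \<in> {1..t - 1}" "s - 1 \<le> t - 1" using assms by auto
  have "sets (history M a r (s - 1)) \<union> {a s -` A \<inter> space M | A. A \<in> sets borel} \<subseteq> sets (history M a r (t - 1))"
    by (rule Un_least[OF history_mono[OF st(2)] vimage_sets_subset[OF action_history[OF st(1)]]])
  also have "\<dots> \<subseteq> sets (pre_noise M a r t)" by (rule history_subset_pre_noise)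
  finally show ?thesis
    unfolding sets_pre_noise[of M a r s] by (rule sets.sigma_sets_subset[of _ "pre_noise M a r t", unfolded space_pre_noise])
qed simp

lemma pre_noise_action:
  fixes a :: "nat \<Rightarrow> 'w \<Rightarrow> real ^ 'n::finite"
  assumes "1 \<le> s" "s \<le> t"
  shows "a s \<in> borel_measurable (pre_noise M a r t)"
proof (rule measurableI)
  fix A :: "(real ^ 'n) set" assume A: "A \<in> sets borel"
  have "a s -` A \<inter> space M \<in> sets (pre_noise M a r s)"
    unfolding sets_pre_noise by (rule sigma_sets.Basic, rule UnI2, rule vimage_setsI[where P="\<lambda>A. A \<in> sets borel", OF A])
  from subsetD[OF pre_noise_mono[OF assms] this]
  show "a s -` A \<inter> space (pre_noise M a r t) \<in> sets (pre_noise M a r t)" unfolding space_pre_noise .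
qed simp

lemma pre_noise_reward:
  fixes r :: "nat \<Rightarrow> 'w \<Rightarrow> real"
  assumes "1 \<le> s" "s < t"
  shows "r s \<in> borel_measurable (pre_noise M a r t)"
proof (rule measurableI)
  fix A :: "real set" assume A: "A \<in> sets borel"
  have "s \<in> {1..t - 1}" using assms by auto
  from subsetD[OF history_subset_pre_noise reward_history[OF this A]]
  show "r s -` A \<inter> space (pre_noise M a r t) \<in> sets (pre_noise M a r t)" unfolding space_pre_noise .
qed simp

context linucb_run
begin

lemma reward_measurable: "t \<in> {1..T} ==> r t \<in> borel_measurable M"
proof -
  assume t: "t \<in> {1..T}"
  have [measurable]: "a t \<in> borel_measurable M" "\<epsilon> t \<in> borel_measurable M" using action_measurable noise_measurable t by auto
  have "(\<lambda>w. a t w \<bullet> \<theta> + \<epsilon> t w) \<in> borel_measurable M" by measurable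
  then show ?thesis by (subst measurable_cong[OF reward[OF t]])
qed

lemma subalgebra_pre_noise:
  assumes t: "t \<in> {1..T}"
  shows "subalgebra M (pre_noise M a r t)"
proof -
  have h: "sets (history M a r (t - 1)) \<subseteq> sets M"
    unfolding sets_history
  proof (rule sets.sigma_sets_subset, rule UN_least)
    fix s assume "s \<in> {1..t - 1}"
    then have s: "s \<in> {1..T}" using t by auto
    show "{a s -` A \<inter> space M | A. A \<in> sets borel} \<union> {r s -` B \<inter> space M | B. B \<in> sets borel} \<subseteq> sets M"
      by (intro Un_least vimage_sets_subset measurable_sets[OF action_measurable[OF s]] measurable_sets[OF reward_measurable[OF s]])
  qed
  have "sets (pre_noise M a r t) \<subseteq> sets M"
    unfolding sets_pre_noise
    by (intro sets.sigma_sets_subset Un_least h vimage_sets_subset measurable_sets[OF action_measurable[OF t]])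
  then show ?thesis by (simp add: subalgebra_def space_pre_noise)
qed

lemma noise_adapted:
  assumes "s \<in> {1..T}" "s < t"
  shows "\<epsilon> s \<in> borel_measurable (pre_noise M a r t)"
proof -
  have [measurable]: "a s \<in> borel_measurable (pre_noise M a r t)" "r s \<in> borel_measurable (pre_noise M a r t)"
    using assms by (auto intro!: pre_noise_action pre_noise_reward)
  have "(\<lambda>w. r s w - a s w \<bullet> \<theta>) \<in> borel_measurable (pre_noise M a r t)" by measurable
  moreover have "\<epsilon> s w = r s w - a s w \<bullet> \<theta>" if "w \<in> space (pre_noise M a r t)" for w
    using reward[OF assms(1)] that by (simp add: space_pre_noise)
  ultimately show ?thesis by (subst measurable_cong) auto
qed

lemma noise_second_moment:
  assumes t: "t \<in> {1..T}"
  shows "AE w in M. real_cond_exp M (pre_noise M a r t) (\<lambda>w. (\<epsilon> t w)\<^sup>2) w = \<sigma>^2"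
proof -
  interpret finite_measure_subalgebra M "pre_noise M a r t" by unfold_locales (rule subalgebra_pre_noise[OF t])
  have [measurable]: "\<epsilon> t \<in> borel_measurable M" by (rule noise_measurable[OF t])
  let ?E = "real_cond_exp M (pre_noise M a r t)"
  have "AE w in M. ?E (\<lambda>w. (\<epsilon> t w - ?E (\<epsilon> t) w)\<^sup>2) w = ?E (\<lambda>w. (\<epsilon> t w)\<^sup>2) w"
  proof (rule real_cond_exp_cong)
    show "AE w in M. (\<epsilon> t w - ?E (\<epsilon> t) w)\<^sup>2 = (\<epsilon> t w)^2"
      using noise_mean[OF t] by eventually_elim simp
  qed measurable
  then show ?thesis using noise_variance[OF t] unfolding cond_variance_def by eventually_elim simp
qed

lemma noise: "subgaussian_noise M (pre_noise M a r) \<sigma> T \<epsilon>"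
proof
  show "s \<in> {1..T} ==> t \<in> {1..T} ==> s \<le> t ==> sets (pre_noise M a r s) \<subseteq> sets (pre_noise M a r t)" for s t
    by (rule pre_noise_mono) auto
qed (rule subalgebra_pre_noise noise_adapted noise_measurable integrable_exp_noise noise_mean noise_second_moment noise_subgaussian; assumption)+

lemma norm_action: "s \<in> {1..T} ==> w \<in> space M ==> norm (a s w) \<le> 1"
  using action[of s w] by (auto simp: is_arg_max_def)

text \<open>Outside the rounds and the sample space the actions are unconstrained, hence the guard.\<close>

definition projected_action :: "real ^ 'n \<Rightarrow> nat \<Rightarrow> 'w \<Rightarrow> real" where
  "projected_action \<xi> s w = (if s \<in> {1..T} \<and> w \<in> space M then \<xi> \<bullet> a s w else 0)"

lemma projected_action_bound: "\<bar>projected_action \<xi> s w\<bar> \<le> norm \<xi>"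
proof (cases "s \<in> {1..T} \<and> w \<in> space M")
  case True
  have "\<bar>\<xi> \<bullet> a s w\<bar> \<le> norm \<xi> * norm (a s w)" by (rule Cauchy_Schwarz_ineq2)
  also have "\<dots> \<le> norm \<xi> * 1" using True norm_action by (intro mult_left_mono) auto
  finally show ?thesis using True by (simp add: projected_action_def)
qed (auto simp: projected_action_def)

lemma projected_action_predictable: "subgaussian_noise.predictable (pre_noise M a r) T (projected_action \<xi>)"
proof -
  interpret noise: subgaussian_noise M "pre_noise M a r" \<sigma> T \<epsilon> by (rule noise)
  show ?thesis
    unfolding noise.predictable_def
  proof
    fix t assume t: "t \<in> {1..T}"
    then have [measurable]: "a t \<in> borel_measurable (pre_noise M a r t)" by (intro pre_noise_action) auto
    have "(\<lambda>w. \<xi> \<bullet> a t w) \<in> borel_measurable (pre_noise M a r t)" by measurable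
    moreover have "projected_action \<xi> t w = \<xi> \<bullet> a t w" if "w \<in> space (pre_noise M a r t)" for w
      using that t by (simp add: projected_action_def space_pre_noise)
    ultimately show "projected_action \<xi> t \<in> borel_measurable (pre_noise M a r t)" by (subst measurable_cong) auto
  qed
qed

abbreviation "S w \<equiv> noise_sum (\<lambda>s. a s w) (\<lambda>s. \<epsilon> s w)"
abbreviation "martingale \<xi> \<equiv> subgaussian_noise.msum \<epsilon> (projected_action \<xi>)"
abbreviation "variation \<xi> \<equiv> subgaussian_noise.qvar (projected_action \<xi>)"

lemma martingale_eq: "t \<le> T ==> w \<in> space M ==> martingale \<xi> t w = \<xi> \<bullet> S w t"
proof -
  interpret noise: subgaussian_noise M "pre_noise M a r" \<sigma> T \<epsilon> by (rule noise)
  assume "t \<le> T" "w \<in> space M"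
  then show ?thesis by (simp add: noise.msum_def noise_sum_def inner_sum_right projected_action_def mult.commute)
qed

lemma variation_eq: "t \<le> T ==> w \<in> space M ==> variation \<xi> t w = (\<Sum>s=1..t. (\<xi> \<bullet> a s w)\<^sup>2)"
proof -
  interpret noise: subgaussian_noise M "pre_noise M a r" \<sigma> T \<epsilon> by (rule noise)
  assume "t \<le> T" "w \<in> space M"
  then show ?thesis by (simp add: noise.qvar_def projected_action_def)
qed

text \<open>Two kinds of control. The level \<open>B\<close> holds at all rounds, pays for peeling
  with the factor \<open>Suc m\<close>, and may grow with the horizon. At the terminal round
  tightness suffices, so \<open>K\<close> can stay fixed and its failure probability is merely
  small. Orthogonal to \<open>\<theta>\<close> the terminal bound depends on the variation, and a
  bound on that remains a premise.\<close>

lemma high_probability_event: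
  assumes unit: "norm \<theta> = 1" and \<sigma>: "\<sigma> > 0" and T: "T \<ge> 1" and K: "K > 0" and B: "B > 0" and L: "L > 0"
    and m: "real T + 1 < 2 ^ Suc m"
  obtains N where "N \<in> sets M"
    "prob N \<le> 2 * (real CARD('n) + 1) * real (Suc m) * exp (- (B / (4 * \<sigma>^2)))
      + (2 * exp (- (K / (2 * \<sigma>^2))) + 2 * real CARD('n) * exp (- (K / (4 * real CARD('n) * \<sigma>^2))))"
    "\<And>w t. w \<in> space M - N ==> t \<le> T ==>
      (\<theta> \<bullet> S w t)^2 \<le> B * (1 + (\<Sum>s=1..t. (\<theta> \<bullet> a s w)\<^sup>2))"
    "\<And>w t i. w \<in> space M - N ==> t \<le> T ==>
      (tangent \<theta> i \<bullet> S w t)^2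
        \<le> B * (1 + (\<Sum>s=1..t. (tangent \<theta> i \<bullet> a s w)\<^sup>2))"
    "\<And>w. w \<in> space M - N ==> (\<theta> \<bullet> S w T)^2 \<le> K * real T"
    "\<And>w i. w \<in> space M - N ==> (\<Sum>s=1..T. (tangent \<theta> i \<bullet> a s w)\<^sup>2) \<le> 2 * L ==>
      (tangent \<theta> i \<bullet> S w T)^2 \<le> K * L / real CARD('n)"
proof -
  interpret noise: subgaussian_noise M "pre_noise M a r" \<sigma> T \<epsilon> by (rule noise)
  define n where "n = real CARD('n)"
  have n: "n \<ge> 1" by (simp add: n_def Suc_leI)
  define D where "D i = axis i 1 - \<theta> $ i *\<^sub>R \<theta>" for i
  have D1: "norm (D i) \<le> 1" for i
  proof -
    have "(norm (D i))^2 = 1 - (\<theta> $ i)^2"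
      using unit unfolding power2_norm_eq_inner
      by (simp add: D_def norm_eq_1 inner_diff_left inner_diff_right inner_axis inner_axis' power2_eq_square)
    also have "\<dots> \<le> 1^2" by simp
    finally show ?thesis by (rule power2_le_imp_le) simp
  qed
  note pred = projected_action_predictable
  have b1: "\<bar>projected_action \<xi> s w\<bar> \<le> 1" if "norm \<xi> \<le> 1" for \<xi> s w
    using projected_action_bound[of \<xi> s w] that by linarith
  define A where "A \<xi> = {w \<in> space M. \<exists>t\<le>T. B * (1 + variation \<xi> t w) < (martingale \<xi> t w)^2}" for \<xi>
  define C where "C \<xi> x R = {w \<in> space M. \<exists>t\<le>T. x \<le> \<bar>martingale \<xi> t w\<bar> \<and> variation \<xi> t w \<le> R}" for \<xi> x R
  have AM: "A \<xi> \<in> sets M" for \<xi> unfolding A_def by (rule noise.quadratic_event_measurable[OF pred])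
  have CM: "C \<xi> x R \<in> sets M" for \<xi> x R unfolding C_def
    by (rule noise.tail_event_measurable[OF pred, of "\<lambda>y. x \<le> \<bar>y\<bar>"]) measurable
  define p where "p = 2 * real (Suc m) * exp (- (B / (4 * \<sigma>^2)))"
  have PA: "prob (A \<xi>) \<le> p" if "norm \<xi> \<le> 1" for \<xi>
    unfolding A_def p_def by (rule noise.law_of_iterated_logarithm_tail[OF pred b1[OF that] B \<sigma> m])
  have PC: "prob (C \<xi> (sqrt x) R) \<le> 2 * exp (- (x / (2 * \<sigma>^2 * R)))" if "norm \<xi> \<le> 1" "x > 0" "R > 0" for \<xi> x R
    using noise.maximal_tail[OF pred b1[OF that(1)] _ that(3) \<sigma>, of "sqrt x"] that(2) unfolding C_def by simp
  define c where "c i = C (D i) (sqrt (K * L / n)) (2 * L)" for i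
  define N where "N = (A \<theta> \<union> (\<Union>i. A (D i))) \<union> (C \<theta> (sqrt (K * real T)) (real T) \<union> (\<Union>i. c i))"
  have m1: "(\<Union>i. A (D i)) \<in> sets M" "(\<Union>i. c i) \<in> sets M" unfolding c_def using AM CM by auto
  have NM: "N \<in> sets M" unfolding N_def by (intro sets.Un m1 AM CM)
  have u1: "prob (\<Union>i. A (D i)) \<le> n * p"
  proof -
    have "prob (\<Union>i\<in>UNIV. A (D i)) \<le> (\<Sum>i\<in>UNIV. prob (A (D i)))"
      by (rule finite_measure_subadditive_finite) (use AM in auto)
    also have "\<dots> \<le> (\<Sum>i\<in>(UNIV :: 'n set). p)" by (intro sum_mono PA D1)
    finally show ?thesis by (simp add: n_def)
  qed
  have u2: "prob (\<Union>i. c i) \<le> n * (2 * exp (- (K / (4 * n * \<sigma>^2))))"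
  proof -
    have "prob (c i) \<le> 2 * exp (- (K / (4 * n * \<sigma>^2)))" for i
    proof -
      have "prob (c i) \<le> 2 * exp (- (K * L / n / (2 * \<sigma>^2 * (2 * L))))"
        unfolding c_def by (rule PC[OF D1]) (use K L n in auto)
      also have "K * L / n / (2 * \<sigma>^2 * (2 * L)) = K / (4 * n * \<sigma>^2)" using L by simp
      finally show ?thesis .
    qed
    then have "(\<Sum>i\<in>UNIV. prob (c i)) \<le> (\<Sum>i\<in>(UNIV :: 'n set). 2 * exp (- (K / (4 * n * \<sigma>^2))))" by (intro sum_mono)
    moreover have "prob (\<Union>i\<in>UNIV. c i) \<le> (\<Sum>i\<in>UNIV. prob (c i))"
      by (rule finite_measure_subadditive_finite) (use CM in \<open>auto simp: c_def\<close>)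
    ultimately show ?thesis by (simp add: n_def)
  qed
  have u3: "prob (C \<theta> (sqrt (K * real T)) (real T)) \<le> 2 * exp (- (K / (2 * \<sigma>^2)))"
  proof -
    have "prob (C \<theta> (sqrt (K * real T)) (real T)) \<le> 2 * exp (- (K * real T / (2 * \<sigma>^2 * real T)))"
      by (rule PC) (use K T unit in auto)
    also have "K * real T / (2 * \<sigma>^2 * real T) = K / (2 * \<sigma>^2)" using T by simp
    finally show ?thesis .
  qed
  have "prob N \<le> (prob (A \<theta>) + prob (\<Union>i. A (D i))) + (prob (C \<theta> (sqrt (K * real T)) (real T)) + prob (\<Union>i. c i))"
    unfolding N_def by (intro order_trans[OF measure_Un_le] add_mono measure_Un_le sets.Un m1 AM CM)
  also have "\<dots> \<le> (p + n * p) + (2 * exp (- (K / (2 * \<sigma>^2))) + n * (2 * exp (- (K / (4 * n * \<sigma>^2)))))"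
    using PA[of \<theta>] unit by (intro add_mono u1 u2 u3) auto
  also have "p + n * p = 2 * (n + 1) * real (Suc m) * exp (- (B / (4 * \<sigma>^2)))" by (simp add: p_def algebra_simps)
  also have "n * (2 * exp (- (K / (4 * n * \<sigma>^2)))) = 2 * n * exp (- (K / (4 * n * \<sigma>^2)))" by simp
  finally have PN: "prob N \<le> 2 * (n + 1) * real (Suc m) * exp (- (B / (4 * \<sigma>^2)))
      + (2 * exp (- (K / (2 * \<sigma>^2))) + 2 * n * exp (- (K / (4 * n * \<sigma>^2))))" .
  have goodA: "(\<xi> \<bullet> S w t)^2 \<le> B * (1 + (\<Sum>s=1..t. (\<xi> \<bullet> a s w)\<^sup>2))"
    if "w \<in> space M" "w \<notin> A \<xi>" "t \<le> T" for \<xi> w t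
  proof -
    have "\<not> B * (1 + variation \<xi> t w) < (martingale \<xi> t w)^2" using that unfolding A_def by blast
    then show ?thesis unfolding martingale_eq[OF that(3,1)] variation_eq[OF that(3,1)] by (simp only: not_less)
  qed
  have goodC: "(\<xi> \<bullet> S w T)^2 \<le> x"
    if "w \<in> space M" "w \<notin> C \<xi> (sqrt x) R" "(\<Sum>s=1..T. (\<xi> \<bullet> a s w)\<^sup>2) \<le> R" "0 \<le> x" for \<xi> w x R
  proof -
    have "variation \<xi> T w \<le> R" using that(3) by (simp only: variation_eq[OF order_refl that(1)])
    then have "\<not> sqrt x \<le> \<bar>martingale \<xi> T w\<bar>" using that(1,2) unfolding C_def by blast
    then have "\<bar>martingale \<xi> T w\<bar>\<^sup>2 \<le> (sqrt x)^2" by (intro power_mono) auto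
    then show ?thesis unfolding martingale_eq[OF order_refl that(1)] using that(4) by simp
  qed
  have sumT: "(\<Sum>s=1..T. (\<theta> \<bullet> a s w)\<^sup>2) \<le> real T" if "w \<in> space M" for w
  proof -
    have "(\<theta> \<bullet> a s w)^2 \<le> 1" if s: "s \<in> {1..T}" for s
      using projected_action_bound[of \<theta> s w] unit s \<open>w \<in> space M\<close> by (simp add: projected_action_def abs_square_le_1)
    then have "(\<Sum>s=1..T. (\<theta> \<bullet> a s w)\<^sup>2) \<le> (\<Sum>s=1..T. 1)" by (rule sum_mono)
    then show ?thesis by simp
  qed
  show thesis
  proof (rule that[OF NM PN[unfolded n_def]])
    fix w assume w: "w \<in> space M - N"
    show "(\<theta> \<bullet> S w T)^2 \<le> K * real T"
      by (rule goodC[OF _ _ sumT]) (use w K in \<open>auto simp: N_def\<close>)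
    fix t assume t: "t \<le> T"
    show "(\<theta> \<bullet> S w t)^2 \<le> B * (1 + (\<Sum>s=1..t. (\<theta> \<bullet> a s w)\<^sup>2))"
      by (rule goodA[OF _ _ t]) (use w in \<open>auto simp: N_def\<close>)
  next
    fix w t i assume w: "w \<in> space M - N" and t: "t \<le> T"
    show "(tangent \<theta> i \<bullet> S w t)^2
        \<le> B * (1 + (\<Sum>s=1..t. (tangent \<theta> i \<bullet> a s w)\<^sup>2))"
      unfolding D_def[symmetric] by (rule goodA[OF _ _ t]) (use w in \<open>auto simp: N_def\<close>)
  next
    fix w i assume w: "w \<in> space M - N" and s: "(\<Sum>s=1..T. (tangent \<theta> i \<bullet> a s w)\<^sup>2) \<le> 2 * L"
    have "w \<notin> C (D i) (sqrt (K * L / n)) (2 * L)" using w by (auto simp: N_def c_def)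
    then show "(tangent \<theta> i \<bullet> S w T)^2 \<le> K * L / real CARD('n)"
      unfolding n_def[symmetric] D_def[symmetric]
      by (intro goodC[of w "D i" _ "2 * L"]) (use w s K L n in \<open>auto simp: D_def\<close>)
  qed
qed

lemma characteristic_bound:
  assumes N: "N \<in> sets M" and L: "L > 0" "norm \<zeta> \<le> sqrt L" and \<delta>: "0 < \<delta>" "\<delta> \<le> 1 / 2" "1 \<le> \<delta> * L"
    and quad: "\<And>w. w \<in> space M - N ==> \<bar>\<zeta> \<bullet> (design_matrix (\<lambda>s. a s w) T *v \<zeta>) - L * (\<zeta> \<bullet> \<zeta>)\<bar> \<le> \<delta> * L * (\<zeta> \<bullet> \<zeta>)"
    and est: "\<And>w. w \<in> space M - N ==>
      \<bar>sqrt L * (\<zeta> \<bullet> \<theta>hat T w) - (\<zeta> \<bullet> S w T) / sqrt L\<bar> \<le> \<delta> * norm \<zeta>"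
  shows "cmod ((\<integral>w. iexp (sqrt L * (\<zeta> \<bullet> \<theta>hat T w)) \<partial>M) - exp (- (\<sigma>^2 * (norm \<zeta>)^2) / 2))
    \<le> (norm \<zeta> + 2 * \<sigma>^2 * (norm \<zeta>)^2 * exp (\<sigma>^2 * (norm \<zeta>)^2)) * \<delta>
      + (4 + exp (\<sigma>^2 * (norm \<zeta>)^2)) * prob N
      + 2 * (norm \<zeta>)^2 * exp (\<sigma>^2 * (norm \<zeta>)^2) * subgaussian_noise.clt_const \<sigma> * norm \<zeta> / sqrt L"
proof -
  interpret noise: subgaussian_noise M "pre_noise M a r" \<sigma> T \<epsilon> by (rule noise)
  define b where "b = norm \<zeta>"
  have bb: "\<zeta> \<bullet> \<zeta> = b^2" by (simp add: b_def power2_norm_eq_inner)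
  define E0 where "E0 = exp (\<sigma>^2 * b^2)"
  have E0: "E0 > 0" by (simp add: E0_def)
  define m where "m w = martingale \<zeta> T w / sqrt L" for w
  define h where "h w = sqrt L * (\<zeta> \<bullet> \<theta>hat T w)" for w
  have mM[measurable]: "m \<in> borel_measurable M"
    unfolding m_def using noise.msum_measurable[OF projected_action_predictable order_refl] by measurable
  have hM[measurable]: "h \<in> borel_measurable M"
    unfolding h_def using estimator_measurable[of T] by measurable
  have im: "integrable M (\<lambda>w. iexp (m w))" by (rule integrable_const_bound[of _ 1]) auto
  have ih: "integrable M (\<lambda>w. iexp (h w))" by (rule integrable_const_bound[of _ 1]) auto
  have iN: "integrable M (\<lambda>w. indicator N w :: real)" by (rule integrable_const_bound[of _ 1]) (use N in auto)
  have 1: "cmod ((\<integral>w. iexp (h w) \<partial>M) - (\<integral>w. iexp (m w) \<partial>M)) \<le> \<delta> * b + 2 * prob N"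
  proof -
    have "(\<integral>w. iexp (h w) \<partial>M) - (\<integral>w. iexp (m w) \<partial>M) = (\<integral>w. iexp (h w) - iexp (m w) \<partial>M)"
      using im ih by (subst Bochner_Integration.integral_diff) auto
    also have "cmod \<dots> \<le> (\<integral>w. \<delta> * b + 2 * indicator N w \<partial>M)"
    proof (rule order_trans[OF integral_norm_bound integral_mono])
      show "integrable M (\<lambda>w. cmod (iexp (h w) - iexp (m w)))" using im ih by auto
      show "integrable M (\<lambda>w. \<delta> * b + 2 * indicator N w :: real)" using iN by auto
      fix w assume w: "w \<in> space M"
      show "cmod (iexp (h w) - iexp (m w)) \<le> \<delta> * b + 2 * indicator N w"
      proof (cases "w \<in> N")
        case True
        have "cmod (iexp (h w) - iexp (m w)) \<le> 1 + 1"
          by (rule order_trans[OF norm_triangle_ineq4]) simp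
        moreover have "0 \<le> \<delta> * b" using \<delta> by (simp add: b_def)
        ultimately show ?thesis using True by simp
      next
        case False
        have "iexp (h w) - iexp (m w) = iexp (m w) * (iexp (h w - m w) - 1)"
          by (simp add: right_diff_distrib flip: exp_add)
        then have "cmod (iexp (h w) - iexp (m w)) = cmod (iexp (h w - m w) - 1)" by (simp only: norm_mult) simp
        also have "\<dots> \<le> \<bar>h w - m w\<bar>" using iexp_approx1[of "h w - m w" 0] by simp
        also have "\<dots> \<le> \<delta> * b"
          using est[of w] w False unfolding h_def m_def b_def martingale_eq[OF order_refl w] by blast
        finally show ?thesis using False by simp
      qed
    qed
    also have "\<dots> = \<delta> * b + 2 * prob N"
      using iN N by (subst Bochner_Integration.integral_add) (auto simp: prob_space)
    finally show ?thesis .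
  qed
  have 2: "cmod ((\<integral>w. iexp (m w) \<partial>M) - exp (- (\<sigma>^2 * b^2) / 2))
    \<le> 2 * b^2 * E0 * noise.clt_const * (b / sqrt L) + \<sigma>^2 * b^2 * E0 * (2 * \<delta>) + (2 + E0) * prob N"
  proof -
    let ?Q = "{w \<in> space M. 2 * \<delta> * L * b^2 < \<bar>variation \<zeta> T w - L * b^2\<bar>}"
    \<comment> \<open>The design matrix contains the identity, so its form exceeds the variation by
      \<open>b^2\<close>. The condition \<open>1 \<le> \<delta> * L\<close> absorbs this, which
      turns \<open>\<delta>\<close> into \<open>2 * \<delta>\<close>.\<close>
    have "?Q \<subseteq> N"
    proof (rule subsetI, rule ccontr)
      fix w assume a: "w \<in> ?Q" "w \<notin> N"
      then have w: "w \<in> space M" by blast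
      have q: "\<zeta> \<bullet> (design_matrix (\<lambda>s. a s w) T *v \<zeta>) = b^2 + variation \<zeta> T w"
        unfolding design_matrix_quad variation_eq[OF order_refl w] by (simp add: bb)
      have "\<bar>b^2 + variation \<zeta> T w - L * b^2\<bar> \<le> \<delta> * L * b^2" using quad[of w] a w unfolding q bb by blast
      moreover have "b^2 \<le> \<delta> * L * b^2" using mult_right_mono[OF \<delta>(3), of "b^2"] by simp
      moreover have "2 * \<delta> * L * b^2 = \<delta> * L * b^2 + \<delta> * L * b^2" by simp
      moreover have "2 * \<delta> * L * b^2 < \<bar>variation \<zeta> T w - L * b^2\<bar>" using a by blast
      ultimately show False using zero_le_power2[of b] by linarith
    qed
    then have Q: "prob ?Q \<le> prob N" by (rule finite_measure_mono[OF _ N])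
    have "cmod ((\<integral>w. iexp (m w) \<partial>M) - exp (- (\<sigma>^2 * b^2) / 2))
      \<le> 2 * b^2 * E0 * noise.clt_const * (b / sqrt L) + \<sigma>^2 * b^2 * E0 * (2 * \<delta>) + (2 + E0) * prob ?Q"
      unfolding m_def E0_def
      by (rule noise.characteristic_limit[OF projected_action_predictable])
         (use projected_action_bound[of \<zeta>] L \<delta> in \<open>auto simp: b_def\<close>)
    also have "(2 + E0) * prob ?Q \<le> (2 + E0) * prob N" using Q E0 by (intro mult_left_mono) auto
    finally show ?thesis by simp
  qed
  have "cmod ((\<integral>w. iexp (h w) \<partial>M) - exp (- (\<sigma>^2 * b^2) / 2))
    \<le> cmod ((\<integral>w. iexp (h w) \<partial>M) - (\<integral>w. iexp (m w) \<partial>M)) + cmod ((\<integral>w. iexp (m w) \<partial>M) - exp (- (\<sigma>^2 * b^2) / 2))"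
    using norm_triangle_ineq[of "(\<integral>w. iexp (h w) \<partial>M) - (\<integral>w. iexp (m w) \<partial>M)" "(\<integral>w. iexp (m w) \<partial>M) - exp (- (\<sigma>^2 * b^2) / 2)"] by simp
  also have "\<dots> \<le> (\<delta> * b + 2 * prob N) + (2 * b^2 * E0 * noise.clt_const * (b / sqrt L) + \<sigma>^2 * b^2 * E0 * (2 * \<delta>) + (2 + E0) * prob N)"
    using 1 2 by (rule add_mono)
  also have "\<dots> = (b + 2 * \<sigma>^2 * b^2 * E0) * \<delta> + (4 + E0) * prob N + 2 * b^2 * E0 * noise.clt_const * b / sqrt L"
    by (simp add: algebra_simps)
  finally show ?thesis unfolding h_def E0_def b_def .
qed

lemma noisy_trajectory_if_noise_controlled:
  assumes "norm \<theta> = 1" "CARD('n) \<ge> 2" "\<beta> \<ge> 1" "B \<ge> 1" and w: "w \<in> space M"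
    and "\<And>t. t \<le> T ==> (\<theta> \<bullet> S w t)^2 \<le> B * (1 + (\<Sum>s=1..t. (\<theta> \<bullet> a s w)\<^sup>2))"
    and "\<And>t i. t \<le> T ==> (tangent \<theta> i \<bullet> S w t)^2
        \<le> B * (1 + (\<Sum>s=1..t. (tangent \<theta> i \<bullet> a s w)\<^sup>2))"
  shows "noisy_trajectory \<theta> \<beta> T (\<lambda>s. a s w) (\<lambda>t. \<theta>hat t w) (\<lambda>s. r s w) (\<lambda>s. \<epsilon> s w) B"
proof
  show "norm (\<theta>hat t w) = 1" if "t \<le> T" for t
    using estimator[of t w] that w by (simp add: is_unit_projection_def)
  show "is_arg_max (ucb_index \<beta> (design_matrix (\<lambda>s. a s w) t) (\<theta>hat t w)) (\<lambda>x. x \<in> cball 0 1) (a (Suc t) w)" if "t < T" for t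
    using action[of "Suc t" w] that w by simp
  show "is_unit_projection (ridge_estimator (\<lambda>s. a s w) (\<lambda>s. r s w) t) (\<theta>hat t w)" if "t \<le> T" for t
    using estimator[of t w] that w by simp
  show "r t w = a t w \<bullet> \<theta> + \<epsilon> t w" if "t \<in> {1..T}" for t by (rule reward[OF that w])
qed (use assms in auto)

end

text \<open>With \<open>q\<close> the diverging ratio, \<open>\<beta>\<close> is at least
  \<open>q * (\<sigma> * sqrt (n + l) + 1)\<close> for \<open>l = ln (ln T)\<close>, and the square
  of the bracket is at least \<open>1 + \<sigma>^2 * l\<close>. So \<open>\<beta>^2\<close> exceeds
  every multiple of the iterated-logarithm level, while growth at most polylogarithmic keeps
  \<open>\<beta>\<close> below every multiple of \<open>sqrt T\<close>.\<close>

lemma schedule_limits: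
  fixes \<beta> :: "nat \<Rightarrow> real"
  assumes n: "n \<ge> (1::real)" and \<sigma>: "\<sigma> > 0" and pos: "\<forall>T\<ge>1. \<beta> T > 0"
    and large: "filterlim (\<lambda>T. \<beta> T / (n ^ 2 * (\<sigma> * sqrt (n + ln (ln (real T))) + 1))) at_top sequentially"
    and polylog: "\<forall>\<^sub>F T in sequentially. \<beta> T \<le> C * ln (real T) ^ k"
  shows "filterlim \<beta> at_top sequentially"
    and "x > 0 ==> \<forall>\<^sub>F T in sequentially. 1 + 8 * \<sigma>^2 * ln (ln (real T)) \<le> x * (\<beta> T)^2"
    and "x > 0 ==> \<forall>\<^sub>F T in sequentially. \<beta> T \<le> x * sqrt (real T)"
    and "filterlim (\<lambda>T. sqrt (2 * (\<beta> T)^2 * real T / (n + 1))) at_top sequentially"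
proof -
  define q where "q T = \<beta> T / (n ^ 2 * (\<sigma> * sqrt (n + ln (ln (real T))) + 1))" for T
  have lnln: "\<forall>\<^sub>F T in sequentially. 0 \<le> ln (ln (real T))" by real_asymp
  have q_le: "q T * (\<sigma> * sqrt (n + ln (ln (real T))) + 1) \<le> \<beta> T" "q T \<le> \<beta> T"
    if T: "0 \<le> ln (ln (real T))" "T \<ge> 1" for T
  proof -
    define w where "w = \<sigma> * sqrt (n + ln (ln (real T))) + 1"
    have w: "1 \<le> w" using \<sigma> n T by (simp add: w_def)
    have n2: "1 \<le> n ^ 2" using n by (simp add: one_le_power)
    have \<beta>: "\<beta> T = q T * (n ^ 2 * w)" using w n by (simp add: q_def w_def)
    have q: "0 \<le> q T" using pos[rule_format, OF T(2)] w n by (simp add: q_def w_def)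
    have "q T * (1 * w) \<le> q T * (n ^ 2 * w)" using q w n2 by (intro mult_left_mono mult_right_mono) auto
    then show 1: "q T * (\<sigma> * sqrt (n + ln (ln (real T))) + 1) \<le> \<beta> T" unfolding \<beta> w_def by simp
    have "q T * 1 \<le> q T * w" using q w by (intro mult_left_mono) auto
    then show "q T \<le> \<beta> T" using 1 by (simp add: w_def)
  qed
  have q_lim: "filterlim q at_top sequentially" using large by (simp add: q_def[abs_def])
  show \<beta>_lim: "filterlim \<beta> at_top sequentially"
  proof (rule filterlim_at_top_mono[OF q_lim])
    show "\<forall>\<^sub>F T in sequentially. q T \<le> \<beta> T"
      using lnln eventually_ge_at_top[of 1] by eventually_elim (rule q_le(2))
  qed
  show "\<forall>\<^sub>F T in sequentially. 1 + 8 * \<sigma>^2 * ln (ln (real T)) \<le> x * (\<beta> T)^2" if x: "x > 0"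
  proof -
    have "\<forall>\<^sub>F T in sequentially. max 1 (8 / x) \<le> q T" using q_lim by (simp only: filterlim_at_top)
    then show ?thesis using lnln eventually_ge_at_top[of 1]
    proof eventually_elim
      case (elim T)
      define l where "l = ln (ln (real T))"
      have l: "0 \<le> l" using elim by (simp add: l_def)
      have q1: "1 \<le> q T" "8 / x \<le> q T" using elim by auto
      have "1 + \<sigma>^2 * l \<le> (\<sigma> * sqrt (n + l) + 1)^2"
      proof -
        have "(\<sigma> * sqrt (n + l) + 1)^2 = \<sigma>^2 * (n + l) + 2 * (\<sigma> * sqrt (n + l)) + 1"
          using n l by (simp add: power2_sum power_mult_distrib)
        moreover have "\<sigma>^2 * l \<le> \<sigma>^2 * (n + l)" using n by (intro mult_left_mono) auto
        moreover have "0 \<le> \<sigma> * sqrt (n + l)" using \<sigma> n l by simp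
        ultimately show ?thesis by linarith
      qed
      then have "8 / x * (1 + \<sigma>^2 * l) \<le> (q T)^2 * (\<sigma> * sqrt (n + l) + 1)^2"
      proof (intro mult_mono)
        have "q T * 1 \<le> q T * q T" using q1 by (intro mult_left_mono) auto
        then show "8 / x \<le> (q T)^2" using q1 unfolding power2_eq_square by linarith
      qed (use l in auto)
      also have "\<dots> = (q T * (\<sigma> * sqrt (n + l) + 1))^2" by (simp only: power_mult_distrib)
      also have "\<dots> \<le> (\<beta> T)^2"
        using q_le(1)[of T] elim q1 \<sigma> n l by (intro power_mono mult_nonneg_nonneg add_nonneg_nonneg) (auto simp: l_def)
      finally have "x * (8 / x * (1 + \<sigma>^2 * l)) \<le> x * (\<beta> T)^2" using x by (intro mult_left_mono) auto
      then have "8 * (1 + \<sigma>^2 * l) \<le> x * (\<beta> T)^2" using x by simp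
      then show ?case unfolding l_def[symmetric] by (simp add: algebra_simps)
    qed
  qed
  show "\<forall>\<^sub>F T in sequentially. \<beta> T \<le> x * sqrt (real T)" if x: "x > 0"
  proof -
    have h: "filterlim (\<lambda>T. ln (real T) / 2) at_top sequentially" by real_asymp
    have "((\<lambda>y. y ^ k / exp y) \<longlongrightarrow> (0::real)) at_top" by (rule tendsto_power_div_exp_0)
    from filterlim_compose[OF this h]
    have "(\<lambda>T. \<bar>C\<bar> * 2 ^ k * ((ln (real T) / 2) ^ k / exp (ln (real T) / 2))) \<longlonglongrightarrow> \<bar>C\<bar> * 2 ^ k * 0"
      by (rule tendsto_mult[OF tendsto_const])
    then have "\<forall>\<^sub>F T in sequentially. \<bar>C\<bar> * 2 ^ k * ((ln (real T) / 2) ^ k / exp (ln (real T) / 2)) < x"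
      by (rule order_tendstoD(2)) (use x in simp)
    then show ?thesis using polylog eventually_ge_at_top[of 1]
    proof eventually_elim
      case (elim T)
      have T: "real T \<ge> 1" using elim by simp
      have s: "exp (ln (real T) / 2) = sqrt (real T)" using T by (simp add: ln_sqrt[symmetric])
      have "\<bar>C\<bar> * 2 ^ k * ((ln (real T) / 2) ^ k / exp (ln (real T) / 2)) = \<bar>C\<bar> * ln (real T) ^ k / sqrt (real T)"
        unfolding s by (simp add: power_divide)
      then have "\<bar>C\<bar> * ln (real T) ^ k / sqrt (real T) < x" using elim(1) by simp
      then have "\<bar>C\<bar> * ln (real T) ^ k < x * sqrt (real T)" using T by (simp add: pos_divide_less_eq)
      moreover have "C * ln (real T) ^ k \<le> \<bar>C\<bar> * ln (real T) ^ k" using T by (intro mult_right_mono) auto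
      ultimately show ?case using elim(2) by linarith
    qed
  qed
  show "filterlim (\<lambda>T. sqrt (2 * (\<beta> T)^2 * real T / (n + 1))) at_top sequentially"
  proof (rule filterlim_at_top_mono)
    show "filterlim (\<lambda>T. sqrt (2 / (n + 1)) * sqrt (real T)) at_top sequentially"
      by (rule filterlim_tendsto_pos_mult_at_top[OF tendsto_const])
         (use n in simp, real_asymp)
    have "\<forall>\<^sub>F T in sequentially. 1 \<le> \<beta> T" using \<beta>_lim by (simp only: filterlim_at_top)
    then show "\<forall>\<^sub>F T in sequentially. sqrt (2 / (n + 1)) * sqrt (real T) \<le> sqrt (2 * (\<beta> T)^2 * real T / (n + 1))"
    proof eventually_elim
      case (elim T)
      have "1 * (real T * (2 / (n + 1))) \<le> (\<beta> T)^2 * (real T * (2 / (n + 1)))"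
        using elim n by (intro mult_right_mono) (auto simp: one_le_power)
      then show ?case unfolding real_sqrt_mult[symmetric] by (intro real_sqrt_le_mono) (simp add: mult_ac)
    qed
  qed
qed

text \<open>The error budget of \<open>linucb_run.characteristic_bound\<close> is met by first fixing
  \<open>\<delta>\<close>, then the level \<open>K\<close> of the tightness events, and only then \<open>T\<close>.\<close>

lemma estimator_characteristic_tendsto:
  fixes \<theta> \<zeta> :: "real ^ 'n::finite"
    and \<sigma> :: real
    and \<beta> :: "nat \<Rightarrow> real"
    and M :: "nat \<Rightarrow> 'w measure"
    and a \<theta>hat :: "nat \<Rightarrow> nat \<Rightarrow> 'w \<Rightarrow> real ^ 'n"
    and r \<epsilon> :: "nat \<Rightarrow> nat \<Rightarrow> 'w \<Rightarrow> real"
  defines "L \<equiv> \<lambda>T. sqrt (2 * (\<beta> T)^2 * real T / (real CARD('n) + 1))"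
  assumes dim: "CARD('n) \<ge> 2"
    and unit: "norm \<theta> = 1"
    and \<sigma>: "\<sigma> > 0"
    and beta_pos: "\<And>T. T \<ge> 1 ==> \<beta> T > 0"
    and run: "\<And>T. T \<ge> 1 ==>
      linucb_run (M T) \<theta> \<sigma> (\<beta> T) T (a T) (r T) (\<epsilon> T) (\<theta>hat T)"
    and beta_large: "filterlim
      (\<lambda>T. \<beta> T / (real CARD('n) ^ 2 * (\<sigma> * sqrt (real CARD('n) + ln (ln (real T))) + 1)))
      at_top sequentially"
    and beta_polylog: "\<exists>C. \<exists>k::nat. \<forall>\<^sub>F T in sequentially. \<beta> T \<le> C * ln (real T) ^ k"
    and \<zeta>: "\<zeta> \<bullet> \<theta> = 0"
  shows "(\<lambda>T. \<integral>w. iexp (sqrt (L T) * (\<zeta> \<bullet> \<theta>hat T T w)) \<partial>M T) \<longlonglongrightarrow> exp (- (\<sigma>^2 * (norm \<zeta>)^2) / 2)"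
proof (rule tendstoI)
  fix e :: real assume e: "e > 0"
  define n where "n = real CARD('n)"
  have n: "n \<ge> 2" "n > 0" using dim by (simp_all add: n_def)
  obtain C k where polylog: "\<forall>\<^sub>F T in sequentially. \<beta> T \<le> C * ln (real T) ^ k" using beta_polylog by blast
  have n1: "1 \<le> n" using n by simp
  have pos: "\<forall>T\<ge>1. \<beta> T > 0" using beta_pos by blast
  note lim = schedule_limits[OF n1 \<sigma> pos beta_large[folded n_def] polylog]
  define b where "b = norm \<zeta>"
  define E0 where "E0 = exp (\<sigma>^2 * b^2)"
  have b: "b \<ge> 0" and E0: "E0 > 0" by (simp_all add: b_def E0_def)
  define c1 where "c1 = b + 2 * \<sigma>^2 * b^2 * E0"
  define c2 where "c2 = 4 + E0"
  define c3 where "c3 = 2 * b^2 * E0 * subgaussian_noise.clt_const \<sigma> * b"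
  have c1: "c1 \<ge> 0" and c2: "c2 > 0" using b E0 by (simp_all add: c1_def c2_def add_pos_pos)
  define \<delta> where "\<delta> = min (1 / 2) (e / (4 * (c1 + 1)))"
  have \<delta>: "0 < \<delta>" "\<delta> \<le> 1 / 2" "c1 * \<delta> \<le> e / 4"
  proof -
    show "0 < \<delta>" using e c1 by (simp add: \<delta>_def)
    show "\<delta> \<le> 1 / 2" unfolding \<delta>_def by (rule min.cobounded1)
    have "\<delta> \<le> e / (4 * (c1 + 1))" unfolding \<delta>_def by (rule min.cobounded2)
    then have "c1 * \<delta> \<le> c1 * (e / (4 * (c1 + 1)))" using c1 by (rule mult_left_mono)
    also have "\<dots> = c1 / (c1 + 1) * (e / 4)" by simp
    also have "\<dots> \<le> 1 * (e / 4)" using c1 e by (intro mult_right_mono) auto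
    finally show "c1 * \<delta> \<le> e / 4" by simp
  qed
  \<comment> \<open>\<open>K\<close> makes both tail exponents at least \<open>y\<close>, and
    \<open>exp (- y) \<le> 1 / y\<close> then meets the share \<open>e / 8\<close> of the error
    budget.\<close>
  define y where "y = c2 * (2 + 2 * n) * 8 / e"
  have y: "y > 0" using c2 n e by (simp add: y_def)
  define K where "K = 4 * n * \<sigma>^2 * y"
  have K: "K > 0" using n \<sigma> y by (simp add: K_def)
  define tail where "tail = 2 * exp (- (K / (2 * \<sigma>^2))) + 2 * n * exp (- (K / (4 * n * \<sigma>^2)))"
  have tail: "c2 * tail \<le> e / 8"
  proof -
    have 1: "K / (4 * n * \<sigma>^2) = y" "K / (2 * \<sigma>^2) = 2 * n * y" using n \<sigma> by (simp_all add: K_def)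
    have "1 * y \<le> 2 * n * y" using n y by (intro mult_right_mono) auto
    then have "2 * exp (- (2 * n * y)) \<le> 2 * exp (- y)" by simp
    then have "tail \<le> (2 + 2 * n) * exp (- y)" unfolding tail_def 1 by (simp add: distrib_right)
    also have "\<dots> \<le> (2 + 2 * n) * (1 / y)"
    proof (rule mult_left_mono)
      have "y \<le> exp y" using exp_ge_add_one_self[of y] by linarith
      then show "exp (- y) \<le> 1 / y" using y by (simp add: exp_minus field_simps)
    qed (use n in simp)
    finally have "c2 * tail \<le> c2 * ((2 + 2 * n) * (1 / y))" using c2 by (rule mult_left_mono[OF _ less_imp_le])
    also have "\<dots> = e / 8" using c2 n e by (simp add: y_def)
    finally show ?thesis .
  qed
  obtain x where x: "x > 0" and close: "\<forall>(\<theta> :: real^'n) \<beta> T a u r e B. noisy_trajectory \<theta> \<beta> T a u r e B \<longrightarrow>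
      1 / \<beta> \<le> x \<longrightarrow> \<beta> \<le> x * sqrt (real T) \<longrightarrow> B \<le> x * \<beta>^2 \<longrightarrow>
      (let L = sqrt (2 * \<beta>^2 * real T / (real CARD('n) + 1)); V = design_matrix a T; S = noise_sum a e T in
        (\<forall>\<zeta>. \<zeta> \<bullet> \<theta> = 0 \<longrightarrow> \<bar>\<zeta> \<bullet> (V *v \<zeta>) - L * (\<zeta> \<bullet> \<zeta>)\<bar> \<le> \<delta> * L * (\<zeta> \<bullet> \<zeta>)) \<and>
        ((\<theta> \<bullet> S)^2 \<le> K * real T \<longrightarrow> S \<bullet> S - (S \<bullet> \<theta>)^2 \<le> K * L \<longrightarrow>
          (\<forall>\<zeta>. \<zeta> \<bullet> \<theta> = 0 \<longrightarrow> \<bar>sqrt L * (\<zeta> \<bullet> u T) - (\<zeta> \<bullet> S) / sqrt L\<bar> \<le> \<delta> * norm \<zeta>)))"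
    using noisy_trajectory_limit[OF dim \<delta>(1) less_imp_le[OF K]] by (elim exE conjE) (rule that)
  define m where "m T = nat \<lfloor>log 2 (real T + 1)\<rfloor>" for T
  \<comment> \<open>The factor 8 gives each peeling block a failure probability of order
    \<open>1 / (ln T)^2\<close>, against about \<open>log 2 T\<close> blocks. The summand 1 ensures
    \<open>B T \<ge> 1\<close>.\<close>
  define B where "B T = 1 + 8 * \<sigma>^2 * ln (ln (real T))" for T
  define p where "p T = 2 * (n + 1) * real (Suc (m T)) * exp (- (B T / (4 * \<sigma>^2)))" for T
  have m: "real T + 1 < 2 ^ Suc (m T)" for T
  proof -
    have "log 2 (real T + 1) \<ge> 0" by simp
    then have "log 2 (real T + 1) < real (Suc (m T))" unfolding m_def by linarith
    then have "2 powr log 2 (real T + 1) < 2 powr real (Suc (m T))" by (intro powr_less_mono) auto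
    also have "2 powr real (Suc (m T)) = 2 ^ Suc (m T)" by (rule powr_realpow) simp
    finally show ?thesis by simp
  qed
  have p_small: "\<forall>\<^sub>F T in sequentially. c2 * p T < e / 8"
  proof -
    have "(\<lambda>T. c2 * (2 * (n + 1) * ((log 2 (real T + 1) + 1) / (ln (real T))^2))) \<longlonglongrightarrow> c2 * (2 * (n + 1) * 0)"
      by (intro tendsto_mult[OF tendsto_const]) real_asymp
    then have "\<forall>\<^sub>F T in sequentially. c2 * (2 * (n + 1) * ((log 2 (real T + 1) + 1) / (ln (real T))^2)) < e / 8"
      by (rule order_tendstoD(2)) (use e in simp)
    moreover have "\<forall>\<^sub>F T in sequentially. 1 < ln (real T)" by real_asymp
    ultimately show ?thesis
    proof eventually_elim
      case (elim T)
      have "exp (- (B T / (4 * \<sigma>^2))) \<le> 1 / (ln (real T))^2"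
      proof -
        have "B T / (4 * \<sigma>^2) = 1 / (4 * \<sigma>^2) + 2 * ln (ln (real T))" using \<sigma> by (simp add: B_def add_divide_distrib)
        then have "- (B T / (4 * \<sigma>^2)) \<le> - (2 * ln (ln (real T)))" using \<sigma> by simp
        then have "exp (- (B T / (4 * \<sigma>^2))) \<le> exp (- (2 * ln (ln (real T))))" by simp
        also have "\<dots> = 1 / (ln (real T))^2"
        proof -
          have "exp (2 * ln (ln (real T))) = (exp (ln (ln (real T))))^2" by (rule exp_double)
          then show ?thesis using elim(2) by (simp add: exp_minus inverse_eq_divide)
        qed
        finally show ?thesis .
      qed
      moreover have "real (Suc (m T)) \<le> log 2 (real T + 1) + 1" unfolding m_def by simp
      ultimately have "real (Suc (m T)) * exp (- (B T / (4 * \<sigma>^2))) \<le> (log 2 (real T + 1) + 1) * (1 / (ln (real T))^2)"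
        by (intro mult_mono) auto
      then have "c2 * (2 * (n + 1) * (real (Suc (m T)) * exp (- (B T / (4 * \<sigma>^2))))) \<le> c2 * (2 * (n + 1) * ((log 2 (real T + 1) + 1) * (1 / (ln (real T))^2)))"
        using c2 n by (intro mult_left_mono) auto
      then have "c2 * p T \<le> c2 * (2 * (n + 1) * ((log 2 (real T + 1) + 1) / (ln (real T))^2))"
        by (simp only: p_def mult.assoc times_divide_eq_right mult_1_right)
      then show ?case using elim(1) by linarith
    qed
  qed
  have L_lim: "filterlim L at_top sequentially" unfolding L_def n_def[symmetric] by (rule lim(4))
  have sL: "filterlim (\<lambda>T. sqrt (L T)) at_top sequentially"
    by (rule filterlim_compose[OF sqrt_at_top L_lim])
  have ev1: "\<forall>\<^sub>F T in sequentially. 1 / \<delta> \<le> L T" "\<forall>\<^sub>F T in sequentially. max (b + 1) (c3 * 8 / e + 1) \<le> sqrt (L T)"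
    "\<forall>\<^sub>F T in sequentially. max 1 (1 / x) \<le> \<beta> T"
    using L_lim sL lim(1) by (simp_all only: filterlim_at_top)
  have ev2: "\<forall>\<^sub>F T in sequentially. 0 \<le> ln (ln (real T))" by real_asymp
  show "\<forall>\<^sub>F T in sequentially. dist (\<integral>w. iexp (sqrt (L T) * (\<zeta> \<bullet> \<theta>hat T T w)) \<partial>M T) (exp (- (\<sigma>^2 * (norm \<zeta>)^2) / 2)) < e"
    using p_small ev1 ev2 lim(2)[OF x] lim(3)[OF x] eventually_ge_at_top[of 1]
  proof eventually_elim
    case (elim T)
    have T: "T \<ge> 1" using elim by blast
    interpret linucb_run "M T" \<theta> \<sigma> "\<beta> T" T "a T" "r T" "\<epsilon> T" "\<theta>hat T" by (rule run[OF T])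
    have sb: "b + 1 \<le> sqrt (L T)" "c3 * 8 / e + 1 \<le> sqrt (L T)" using elim(3) by auto
    have Lpos: "L T > 0" using elim(2) \<delta>(1) by (meson divide_pos_pos less_le_trans zero_less_one)
    have B1: "B T \<ge> 1" using elim(5) by (simp add: B_def)
    have \<beta>1: "1 \<le> \<beta> T" "1 / \<beta> T \<le> x"
    proof -
      show \<beta>1: "1 \<le> \<beta> T" using elim(4) by simp
      have "1 / x \<le> \<beta> T" using elim(4) by simp
      then show "1 / \<beta> T \<le> x" using x \<beta>1 by (simp add: pos_divide_le_eq mult.commute)
    qed
    have B0: "B T > 0" using B1 by simp
    show ?case
    proof (rule high_probability_event[OF unit \<sigma> T K B0 Lpos m[of T]])
    fix N assume N: "N \<in> sets (M T)"
      and pN: "prob N \<le> 2 * (real CARD('n) + 1) * real (Suc (m T)) * exp (- (B T / (4 * \<sigma>^2)))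
        + (2 * exp (- (K / (2 * \<sigma>^2))) + 2 * real CARD('n) * exp (- (K / (4 * real CARD('n) * \<sigma>^2))))"
      and n1: "\<And>w t. w \<in> space (M T) - N ==> t \<le> T ==>
        (\<theta> \<bullet> noise_sum (\<lambda>s. a T s w) (\<lambda>s. \<epsilon> T s w) t)^2 \<le> B T * (1 + (\<Sum>s=1..t. (\<theta> \<bullet> a T s w)\<^sup>2))"
      and n2: "\<And>w t i. w \<in> space (M T) - N ==> t \<le> T ==>
        (tangent \<theta> i \<bullet> noise_sum (\<lambda>s. a T s w) (\<lambda>s. \<epsilon> T s w) t)^2
          \<le> B T * (1 + (\<Sum>s=1..t. (tangent \<theta> i \<bullet> a T s w)\<^sup>2))"
      and n3: "\<And>w. w \<in> space (M T) - N ==> (\<theta> \<bullet> noise_sum (\<lambda>s. a T s w) (\<lambda>s. \<epsilon> T s w) T)^2 \<le> K * real T"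
      and n4: "\<And>w i. w \<in> space (M T) - N ==> (\<Sum>s=1..T. (tangent \<theta> i \<bullet> a T s w)\<^sup>2) \<le> 2 * L T ==>
        (tangent \<theta> i \<bullet> noise_sum (\<lambda>s. a T s w) (\<lambda>s. \<epsilon> T s w) T)^2 \<le> K * L T / real CARD('n)"
    have pN: "prob N \<le> p T + tail" using pN unfolding p_def tail_def n_def .
    have good: "\<bar>\<zeta>' \<bullet> (design_matrix (\<lambda>s. a T s w) T *v \<zeta>') - L T * (\<zeta>' \<bullet> \<zeta>')\<bar> \<le> \<delta> * L T * (\<zeta>' \<bullet> \<zeta>')"
      "\<bar>sqrt (L T) * (\<zeta>' \<bullet> \<theta>hat T T w) - (\<zeta>' \<bullet> noise_sum (\<lambda>s. a T s w) (\<lambda>s. \<epsilon> T s w) T) / sqrt (L T)\<bar> \<le> \<delta> * norm \<zeta>'"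
      if w: "w \<in> space (M T) - N" and \<zeta>': "\<zeta>' \<bullet> \<theta> = 0" for w \<zeta>'
    proof -
      have nt: "noisy_trajectory \<theta> (\<beta> T) T (\<lambda>s. a T s w) (\<lambda>t. \<theta>hat T t w) (\<lambda>s. r T s w) (\<lambda>s. \<epsilon> T s w) (B T)"
        by (rule noisy_trajectory_if_noise_controlled[OF unit dim \<beta>1(1) B1 _ n1[OF w] n2[OF w]]) (use w in blast)
      have LT: "sqrt (2 * (\<beta> T)^2 * real T / (real CARD('n) + 1)) = L T" by (simp only: L_def)
      note cl = close[rule_format, OF nt \<beta>1(2) elim(7) elim(6)[folded B_def], unfolded Let_def LT]
      have q: "\<bar>z \<bullet> (design_matrix (\<lambda>s. a T s w) T *v z) - L T * (z \<bullet> z)\<bar> \<le> \<delta> * L T * (z \<bullet> z)" if "z \<bullet> \<theta> = 0" for z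
        by (rule cl[THEN conjunct1, THEN spec, THEN mp, OF that])
      then show "\<bar>\<zeta>' \<bullet> (design_matrix (\<lambda>s. a T s w) T *v \<zeta>') - L T * (\<zeta>' \<bullet> \<zeta>')\<bar> \<le> \<delta> * L T * (\<zeta>' \<bullet> \<zeta>')" using \<zeta>' .
      let ?S = "noise_sum (\<lambda>s. a T s w) (\<lambda>s. \<epsilon> T s w) T"
      have "(tangent \<theta> i \<bullet> ?S)^2 \<le> K * L T / real CARD('n)" for i
      proof (rule n4[OF w])
        let ?z = "axis i 1 - \<theta> $ i *\<^sub>R \<theta>"
        have \<theta>\<theta>: "\<theta> \<bullet> \<theta> = 1" using unit by (simp add: norm_eq_1)
        have z\<theta>: "?z \<bullet> \<theta> = 0" by (simp add: inner_diff_left inner_axis' \<theta>\<theta>)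
        have zz: "?z \<bullet> ?z \<le> 1"
          by (simp add: inner_diff_left inner_diff_right inner_axis inner_axis' \<theta>\<theta>)
        have "?z \<bullet> (design_matrix (\<lambda>s. a T s w) T *v ?z) \<le> (1 + \<delta>) * L T * (?z \<bullet> ?z)"
          using q[OF z\<theta>] by (simp add: abs_le_iff distrib_right)
        also have "\<dots> \<le> 2 * L T * 1" using \<delta> Lpos zz by (intro mult_mono) auto
        finally show "(\<Sum>s=1..T. (?z \<bullet> a T s w)\<^sup>2) \<le> 2 * L T"
          unfolding design_matrix_quad using inner_ge_zero[of ?z] by linarith
      qed
      then have "(\<Sum>i\<in>UNIV. (tangent \<theta> i \<bullet> ?S)\<^sup>2) \<le> (\<Sum>i\<in>(UNIV :: 'n set). K * L T / real CARD('n))" by (rule sum_mono)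
      then have SK: "?S \<bullet> ?S - (?S \<bullet> \<theta>)^2 \<le> K * L T" using n by (simp add: sum_projected_axes_sq[OF unit] n_def)
      show "\<bar>sqrt (L T) * (\<zeta>' \<bullet> \<theta>hat T T w) - (\<zeta>' \<bullet> ?S) / sqrt (L T)\<bar> \<le> \<delta> * norm \<zeta>'"
        by (rule cl[THEN conjunct2, THEN mp, OF n3[OF w], THEN mp, OF SK, THEN spec, THEN mp, OF \<zeta>'])
    qed
    have \<delta>L: "1 \<le> \<delta> * L T" using elim(2) \<delta>(1) by (simp add: pos_divide_le_eq mult.commute)
    have bL: "norm \<zeta> \<le> sqrt (L T)" using sb by (simp add: b_def)
    have "cmod ((\<integral>w. iexp (sqrt (L T) * (\<zeta> \<bullet> \<theta>hat T T w)) \<partial>M T) - exp (- (\<sigma>^2 * (norm \<zeta>)^2) / 2))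
      \<le> c1 * \<delta> + c2 * prob N + c3 / sqrt (L T)"
      unfolding c1_def c2_def c3_def E0_def b_def
      by (rule characteristic_bound[OF N Lpos bL \<delta>(1,2) \<delta>L good(1)[OF _ \<zeta>] good(2)[OF _ \<zeta>]])
    also have "\<dots> \<le> e / 4 + (c2 * p T + c2 * tail) + e / 8"
    proof (intro add_mono)
      show "c2 * prob N \<le> c2 * p T + c2 * tail" using mult_left_mono[OF pN, of c2] c2 by (simp add: distrib_left)
      have "c3 * 8 / e \<le> sqrt (L T)" using sb by simp
      then have "c3 \<le> e / 8 * sqrt (L T)" using e by (simp add: pos_divide_le_eq mult.commute)
      then show "c3 / sqrt (L T) \<le> e / 8" using Lpos by (simp add: pos_divide_le_eq)
    qed (rule \<delta>(3))
    also have "\<dots> < e" using elim(1) tail e by linarith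
    finally show ?case by (simp add: dist_norm)
    qed
  qed
qed

theorem theorem1:
  fixes \<theta> :: "real ^ 'n::finite"
    and U :: "real ^ 'm::finite ^ 'n"
    and \<sigma> :: real
    and \<beta> :: "nat \<Rightarrow> real"
    and M :: "nat \<Rightarrow> 'w measure"
    and a \<theta>hat :: "nat \<Rightarrow> nat \<Rightarrow> 'w \<Rightarrow> real ^ 'n"
    and r \<epsilon> :: "nat \<Rightarrow> nat \<Rightarrow> 'w \<Rightarrow> real"
  assumes "CARD('n) \<ge> 2"
    and "CARD('m) = CARD('n) - 1"
    and "norm \<theta> = 1"
    and "\<sigma> > 0"
    and U_orthonormal: "transpose U ** U = mat 1"
    and U_orthogonal: "transpose U *v \<theta> = 0"
    and beta_pos: "\<And>T. T \<ge> 1 \<Longrightarrow> \<beta> T > 0"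
    and run: "\<And>T. T \<ge> 1 \<Longrightarrow>
      linucb_run (M T) \<theta> \<sigma> (\<beta> T) T (a T) (r T) (\<epsilon> T) (\<theta>hat T)"
    and beta_large: "filterlim
      (\<lambda>T. \<beta> T / (real CARD('n) ^ 2 * (\<sigma> * sqrt (real CARD('n) + ln (ln (real T))) + 1)))
      at_top sequentially"
    and beta_polylog: "\<exists>C. \<exists>k::nat. \<forall>\<^sub>F T in sequentially. \<beta> T \<le> C * ln (real T) ^ k"
  shows "converges_in_distribution M
      (\<lambda>T \<omega>. (2 * (\<beta> T)\<^sup>2 * real T / (real CARD('n) + 1)) powr (1 / 4)
         *\<^sub>R (transpose U *v (\<theta>hat T T \<omega> - \<theta>)))
      (multivariate_normal 0 (\<sigma>\<^sup>2 *\<^sub>R mat 1 :: real ^ 'm ^ 'm))"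
proof -
  define L where "L T = sqrt (2 * (\<beta> T)^2 * real T / (real CARD('n) + 1))" for T
  define X where "X T \<omega> = sqrt (L T) *\<^sub>R (transpose U *v (\<theta>hat T T \<omega> - \<theta>))" for T \<omega>
  let ?\<nu> = "multivariate_normal 0 (\<sigma>^2 *\<^sub>R mat 1 :: real ^ 'm ^ 'm)"
  note \<nu> = isotropic_normal[OF \<open>\<sigma> > 0\<close>, where 'm='m]
  have scale: "(2 * (\<beta> T)^2 * real T / (real CARD('n) + 1)) powr (1 / 4) = sqrt (L T)" for T
  proof -
    define y where "y = 2 * (\<beta> T)^2 * real T / (real CARD('n) + 1)"
    have "0 \<le> y" by (simp add: y_def)
    then have "sqrt (sqrt y) = (y powr (1 / 2)) powr (1 / 2)" by (simp add: powr_half_sqrt)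
    also have "\<dots> = y powr (1 / 4)" by (simp add: powr_powr)
    finally show ?thesis unfolding L_def y_def by simp
  qed
  have inner_U: "\<xi> \<bullet> (transpose U *v w) = (U *v \<xi>) \<bullet> w" for \<xi> w
    by (metis dot_lmul_matrix vector_transpose_matrix)
  have norm_U: "norm (U *v \<xi>) = norm \<xi>" for \<xi>
  proof -
    have "(U *v \<xi>) \<bullet> (U *v \<xi>) = \<xi> \<bullet> (transpose U *v (U *v \<xi>))" by (simp only: inner_U)
    also have "\<dots> = \<xi> \<bullet> \<xi>" by (simp add: matrix_vector_mul_assoc U_orthonormal)
    finally show ?thesis by (simp add: norm_eq_sqrt_inner)
  qed
  have U\<theta>: "(U *v \<xi>) \<bullet> \<theta> = 0" for \<xi>
    by (simp only: inner_U[symmetric] U_orthogonal inner_zero_right)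
  \<comment> \<open>One direction at a time: the coordinate of \<open>X T\<close> along
    \<open>\<xi>\<close> is that of the estimator along \<open>U *v \<xi>\<close>, which has the
    same norm as \<open>\<xi>\<close> and is orthogonal to \<open>\<theta>\<close>, so the centring
    drops out.\<close>
  have char_X: "(\<lambda>T. \<integral>\<omega>. iexp (\<xi> \<bullet> X T \<omega>) \<partial>M T) \<longlonglongrightarrow> (\<integral>x. iexp (\<xi> \<bullet> x) \<partial>?\<nu>)" for \<xi>
  proof -
    have e: "\<xi> \<bullet> X T \<omega> = sqrt (L T) * ((U *v \<xi>) \<bullet> \<theta>hat T T \<omega>)" for T \<omega>
      by (simp only: X_def inner_scaleR_right inner_U inner_diff_right U\<theta> diff_0_right)
    show ?thesis
      unfolding e \<nu>(3) L_def norm_U[symmetric, of \<xi>]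
      by (rule estimator_characteristic_tendsto[OF assms(1,3,4)], erule beta_pos, erule run,
          rule beta_large, rule beta_polylog, rule U\<theta>)
  qed
  have XM: "X T \<in> borel_measurable (M T)" if "T \<ge> 1" for T
  proof -
    interpret linucb_run "M T" \<theta> \<sigma> "\<beta> T" T "a T" "r T" "\<epsilon> T" "\<theta>hat T" by (rule run[OF that])
    have "continuous_on UNIV (\<lambda>w. sqrt (L T) *\<^sub>R (transpose U *v (w - \<theta>)))"
      by (intro continuous_intros continuous_on_compose2[OF matrix_vector_mult_linear_continuous_on[of UNIV]]) auto
    then have "(\<lambda>w. sqrt (L T) *\<^sub>R (transpose U *v (w - \<theta>))) \<in> borel_measurable borel"
      by (rule borel_measurable_continuous_onI)
    from measurable_compose[OF estimator_measurable[of T] this] show ?thesis unfolding X_def[abs_def] by simp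
  qed
  \<comment> \<open>There is no run at \<open>T = 0\<close>, and hence no probability space there to
    work with; the sequence is shifted by one and shifted back at the end.\<close>
  have wc: "weakly_converges (\<lambda>k. distr (M (Suc k)) borel (X (Suc k))) ?\<nu>"
  proof (rule weakly_converges_if_char_tendsto)
    fix k
    interpret linucb_run "M (Suc k)" \<theta> \<sigma> "\<beta> (Suc k)" "Suc k" "a (Suc k)" "r (Suc k)" "\<epsilon> (Suc k)" "\<theta>hat (Suc k)"
      by (rule run) simp
    show "prob_space (distr (M (Suc k)) borel (X (Suc k)))" by (rule prob_space_distr) (rule XM, simp)
  next
    fix \<xi> :: "real ^ 'm"
    have "(\<integral>x. iexp (\<xi> \<bullet> x) \<partial>distr (M (Suc k)) borel (X (Suc k))) = (\<integral>\<omega>. iexp (\<xi> \<bullet> X (Suc k) \<omega>) \<partial>M (Suc k))" for k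
      by (rule integral_distr) (auto intro!: XM)
    then show "(\<lambda>k. \<integral>x. iexp (\<xi> \<bullet> x) \<partial>distr (M (Suc k)) borel (X (Suc k))) \<longlonglongrightarrow> (\<integral>x. iexp (\<xi> \<bullet> x) \<partial>?\<nu>)"
      using LIMSEQ_Suc[OF char_X[of \<xi>]] by simp
  qed (use \<nu> in auto)
  have "weakly_converges (\<lambda>T. distr (M T) borel (X T)) ?\<nu>"
    unfolding weakly_converges_def
  proof (intro allI impI)
    fix f :: "real ^ 'm \<Rightarrow> real" assume f: "continuous_on UNIV f \<and> bounded (range f)"
    show "(\<lambda>T. \<integral>x. f x \<partial>distr (M T) borel (X T)) \<longlonglongrightarrow> (\<integral>x. f x \<partial>?\<nu>)"
      by (rule LIMSEQ_imp_Suc[OF wc[unfolded weakly_converges_def, THEN spec, THEN mp, OF f]])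
  qed
  then show ?thesis unfolding converges_in_distribution_def scale X_def[abs_def] .
qed

end
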